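(* Let $k$ be a field and let $E$ be a finite quiver. (1) Let $M$ be a left $L(E)$-module. Then $M$ is a finitely generated Blanchfield $P(E)$-module if and only if $M$ is a finitely presented $L(E)$-module of finite length without nonzero projective ($L(E)$-)submodules. (2) Let $M$ be a finitely generated Blanchfield $P(E)$-module. Then $M$ contains a lattice. Moreover, a $P(\overline{E})$-submodule $A$ of $M$ is a lattice if and only if $A$ is finite-dimensional over $k$ and the natural map $L(E)\otimes_{P(\overline{E})}A\to M$ is an isomorphism. Furthermore, any lattice in $M$ does not contain nonzero projective $P(\overline{E})$-submodules. (3) Every finitely generated Blanchfield $P(E)$-module contains a smallest lattice.
   Context: Modules are left modules unless stated otherwise. $E=(E^0,E^1,r,s)$ is a finite quiver with $E^0=\{1,\dots,d\}$ and source and range maps $s,r$. The path algebra $P(E)$ over $k$ has basis the set of all paths (sequences of arrows $e_1\cdots e_n$ with $r(e_t)=s(e_{t+1})$, and trivial paths $p_i$, $i\in E^0$), with product given by concatenation (zero if not composable). The inverse quiver $\overline{E}$ has the same vertices and, for each $e\in E^1$, an arrow $\overline{e}$ with $s(\overline e)=r(e)$, $r(\overline e)=s(e)$. The Leavitt path algebra $L(E)=L_k(E)$ is the $k$-algebra generated by $\{p_v: v\in E^0\}\cup\{e,\overline e: e\in E^1\}$ subject to: $p_vp_{v'}=\delta_{v,v'}p_v$ (with $\sum_v p_v=1$); $p_{s(e)}e=ep_{r(e)}=e$; $p_{r(e)}\overline e=\overline e p_{s(e)}=\overline e$; $\overline e e'=\delta_{e,e'}p_{r(e)}$; and $p_v=\sum_{s(e)=v}e\overline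 e$ for every $v\in E^0$ that emits arrows. $P(E)$ and $P(\overline E)$ are regarded as subalgebras of $L(E)$. A left $P(E)$-module $M$ is a Blanchfield module if $\mathrm{Tor}_q^{P(E)}(k^d,M)=0$ for all $q$, where $k^d$ is a right $P(E)$-module through the augmentation $\epsilon\colon P(E)\to k^d$ (killing all arrows and sending $p_i$ to the $i$-th standard idempotent). Equivalently, the map $\bigoplus_{e\in E^1}p_{r(e)}M\to M$, $(m_e)_e\mapsto\sum_e em_e$, is an isomorphism; in this way the Blanchfield modules are exactly the left $L(E)$-modules $M$ with $p_iM=0$ for every sink $i$ (a vertex emitting no arrows), so every Blanchfield module is also a left $L(E)$-module and a left $P(\overline E)$-module. A lattice in a finitely generated Blanchfield $P(E)$-module $M$ is a $P(\overline E)$-submodule $A\subseteq M$ such that $A$ is finite-dimensional over $k$ and $M=P(E)A$. The natural map $L(E)\otimes_{P(\overline E)}A\to M$ is $x\otimes a\mapsto xa$. *)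

theory Defs
  imports
    "Graph_Theory.Arc_Walk"
    "HOL-Algebra.QuotRing"
    "HOL-Algebra.Module"
    "HOL-Algebra.Free_Abelian_Groups"
begin

section \<open>Modules over non-commutative rings\<close>

text \<open>
  The locale \<^locale>\<open>module\<close> of HOL-Algebra requires a commutative ring of scalars.  The records of
  type \<^typ>\<open>('r, 'm) module\<close> and the predicate \<^const>\<open>submodule\<close> do not, and are reused.
  The fields \<open>mult\<close> and \<open>one\<close> of a module record play no role.
\<close>

locale left_module = R?: ring R + M?: abelian_group M
  for R :: "('r, 'a) ring_scheme" (structure) and M :: "('r, 'm, 'b) module_scheme" (structure) +
  assumes smult_closed: "\<lbrakk>a \<in> carrier R; x \<in> carrier M\<rbrakk> \<Longrightarrow> a \<odot>\<^bsub>M\<^esub> x \<in> carrier M"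
    and smult_l_distr: "\<lbrakk>a \<in> carrier R; b \<in> carrier R; x \<in> carrier M\<rbrakk>
          \<Longrightarrow> (a \<oplus>\<^bsub>R\<^esub> b) \<odot>\<^bsub>M\<^esub> x = a \<odot>\<^bsub>M\<^esub> x \<oplus>\<^bsub>M\<^esub> b \<odot>\<^bsub>M\<^esub> x"
    and smult_r_distr: "\<lbrakk>a \<in> carrier R; x \<in> carrier M; y \<in> carrier M\<rbrakk>
          \<Longrightarrow> a \<odot>\<^bsub>M\<^esub> (x \<oplus>\<^bsub>M\<^esub> y) = a \<odot>\<^bsub>M\<^esub> x \<oplus>\<^bsub>M\<^esub> a \<odot>\<^bsub>M\<^esub> y"
    and smult_assoc: "\<lbrakk>a \<in> carrier R; b \<in> carrier R; x \<in> carrier M\<rbrakk>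
          \<Longrightarrow> (a \<otimes>\<^bsub>R\<^esub> b) \<odot>\<^bsub>M\<^esub> x = a \<odot>\<^bsub>M\<^esub> (b \<odot>\<^bsub>M\<^esub> x)"
    and smult_one: "x \<in> carrier M \<Longrightarrow> \<one>\<^bsub>R\<^esub> \<odot>\<^bsub>M\<^esub> x = x"

definition mk_module ::
  "'m set \<Rightarrow> 'm \<Rightarrow> ('m \<Rightarrow> 'm \<Rightarrow> 'm) \<Rightarrow> ('r \<Rightarrow> 'm \<Rightarrow> 'm) \<Rightarrow> ('r, 'm) module" where
  "mk_module C z pl sm =
     \<lparr>carrier = C, monoid.mult = undefined, monoid.one = undefined, ring.zero = z, ring.add = pl, module.smult = sm\<rparr>"

text \<open>Right \<open>R\<close>-modules are left modules over the opposite ring: \<open>a \<odot>\<^bsub>Y\<^esub> x\<close> then stands for \<open>x a\<close>.\<close>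

definition op_ring :: "('r, 'a) ring_scheme \<Rightarrow> ('r, 'a) ring_scheme" where
  "op_ring R = R\<lparr>monoid.mult := (\<lambda>x y. y \<otimes>\<^bsub>R\<^esub> x)\<rparr>"

definition restrict_scalars :: "('s \<Rightarrow> 'r) \<Rightarrow> ('r, 'm) module \<Rightarrow> ('s, 'm) module" where
  "restrict_scalars h M =
     mk_module (carrier M) \<zero>\<^bsub>M\<^esub> (\<lambda>x y. x \<oplus>\<^bsub>M\<^esub> y) (\<lambda>a x. h a \<odot>\<^bsub>M\<^esub> x)"

definition module_hom ::
  "('r, 'a) ring_scheme \<Rightarrow> ('r, 'm) module \<Rightarrow> ('r, 'n) module \<Rightarrow> ('m \<Rightarrow> 'n) set" where
  "module_hom R M N = {f \<in> hom (add_monoid M) (add_monoid N).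
     \<forall>a\<in>carrier R. \<forall>x\<in>carrier M. f (a \<odot>\<^bsub>M\<^esub> x) = a \<odot>\<^bsub>N\<^esub> f x}"

definition submodule_generated ::
  "('r, 'a) ring_scheme \<Rightarrow> ('r, 'm) module \<Rightarrow> 'm set \<Rightarrow> 'm set" where
  "submodule_generated R M S = \<Inter>{N. submodule N R M \<and> S \<subseteq> N}"

definition finitely_generated :: "('r, 'a) ring_scheme \<Rightarrow> ('r, 'm) module \<Rightarrow> bool" where
  "finitely_generated R M \<longleftrightarrow>
     (\<exists>S. finite S \<and> S \<subseteq> carrier M \<and> submodule_generated R M S = carrier M)"

definition free_module :: "('r, 'a) ring_scheme \<Rightarrow> 'i set \<Rightarrow> ('r, 'i \<Rightarrow> 'r) module" where
  "free_module R I = mk_module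
     {f. (\<forall>i\<in>I. f i \<in> carrier R) \<and> (\<forall>i. i \<notin> I \<longrightarrow> f i = \<zero>\<^bsub>R\<^esub>) \<and> finite {i. f i \<noteq> \<zero>\<^bsub>R\<^esub>}}
     (\<lambda>i. \<zero>\<^bsub>R\<^esub>) (\<lambda>f g i. f i \<oplus>\<^bsub>R\<^esub> g i) (\<lambda>a f i. a \<otimes>\<^bsub>R\<^esub> f i)"

definition finitely_presented :: "('r, 'a) ring_scheme \<Rightarrow> ('r, 'm) module \<Rightarrow> bool" where
  "finitely_presented R M \<longleftrightarrow>
     (\<exists>(n::nat) \<phi>. \<phi> \<in> module_hom R (free_module R {..<n}) M
        \<and> \<phi> ` carrier (free_module R {..<n}) = carrier M
        \<and> finitely_generated R
            ((free_module R {..<n})\<lparr>carrier := a_kernel (free_module R {..<n}) M \<phi>\<rparr>))"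

text \<open>A composition series: successive terms are distinct with no submodule strictly between.\<close>

definition finite_length :: "('r, 'a) ring_scheme \<Rightarrow> ('r, 'm) module \<Rightarrow> bool" where
  "finite_length R M \<longleftrightarrow>
     (\<exists>(n::nat) F. F 0 = {\<zero>\<^bsub>M\<^esub>} \<and> F n = carrier M \<and> (\<forall>i\<le>n. submodule (F i) R M)
        \<and> (\<forall>i<n. F i \<subset> F (Suc i)
             \<and> \<not> (\<exists>N. submodule N R M \<and> F i \<subset> N \<and> N \<subset> F (Suc i))))"

text \<open>
  Projective modules: direct summands (retracts) of free modules.  A retract of a free module is a
  retract of the free module on its own elements, so a basis indexed by elements of the type of
  \<open>M\<close> is no restriction.
\<close>

definition projective :: "('r, 'a) ring_scheme \<Rightarrow> ('r, 'm) module \<Rightarrow> bool" where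
  "projective R M \<longleftrightarrow>
     (\<exists>(I::'m set) f g. f \<in> module_hom R M (free_module R I)
        \<and> g \<in> module_hom R (free_module R I) M \<and> (\<forall>x\<in>carrier M. g (f x) = x))"

section \<open>Tensor products\<close>

text \<open>\<open>Y\<close> is a right \<open>R\<close>-module, that is, a left module over \<^term>\<open>op_ring R\<close>.\<close>

definition tensor_relations ::
  "('r, 'a) ring_scheme \<Rightarrow> ('r, 'x) module \<Rightarrow> ('r, 'm) module \<Rightarrow> (('x \<times> 'm) \<Rightarrow>\<^sub>0 int) set" where
  "tensor_relations R Y M =
     {frag_of (x \<oplus>\<^bsub>Y\<^esub> x', m) - frag_of (x, m) - frag_of (x', m) | x x' m.
        x \<in> carrier Y \<and> x' \<in> carrier Y \<and> m \<in> carrier M} \<union>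
     {frag_of (x, m \<oplus>\<^bsub>M\<^esub> m') - frag_of (x, m) - frag_of (x, m') | x m m'.
        x \<in> carrier Y \<and> m \<in> carrier M \<and> m' \<in> carrier M} \<union>
     {frag_of (a \<odot>\<^bsub>Y\<^esub> x, m) - frag_of (x, a \<odot>\<^bsub>M\<^esub> m) | a x m.
        a \<in> carrier R \<and> x \<in> carrier Y \<and> m \<in> carrier M}"

definition tensor_null ::
  "('r, 'a) ring_scheme \<Rightarrow> ('r, 'x) module \<Rightarrow> ('r, 'm) module \<Rightarrow> (('x \<times> 'm) \<Rightarrow>\<^sub>0 int) set" where
  "tensor_null R Y M =
     generate (free_Abelian_group (carrier Y \<times> carrier M)) (tensor_relations R Y M)"

definition tensor ::
  "('r, 'a) ring_scheme \<Rightarrow> ('r, 'x) module \<Rightarrow> ('r, 'm) module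
     \<Rightarrow> (('x \<times> 'm) \<Rightarrow>\<^sub>0 int) set monoid" where
  "tensor R Y M = free_Abelian_group (carrier Y \<times> carrier M) Mod tensor_null R Y M"

definition pure_tensor ::
  "('r, 'a) ring_scheme \<Rightarrow> ('r, 'x) module \<Rightarrow> ('r, 'm) module \<Rightarrow> 'x \<Rightarrow> 'm
     \<Rightarrow> (('x \<times> 'm) \<Rightarrow>\<^sub>0 int) set" where
  "pure_tensor R Y M x m =
     tensor_null R Y M #>\<^bsub>free_Abelian_group (carrier Y \<times> carrier M)\<^esub> frag_of (x, m)"

text \<open>
  For an abelian group \<open>G\<close> (in multiplicative notation) and an \<open>R\<close>-balanced map \<open>b\<close>, the
  homomorphism from the tensor product to \<open>G\<close> with \<open>x \<otimes> m \<mapsto> b x m\<close>; it is constant on cosets.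
\<close>

definition tensor_lift ::
  "('g, 'c) monoid_scheme \<Rightarrow> ('x \<Rightarrow> 'm \<Rightarrow> 'g) \<Rightarrow> (('x \<times> 'm) \<Rightarrow>\<^sub>0 int) set \<Rightarrow> 'g" where
  "tensor_lift G b C =
     the_elem ((\<lambda>c. finprod G (\<lambda>p. b (fst p) (snd p) [^]\<^bsub>G\<^esub> Poly_Mapping.lookup c p)
                      (Poly_Mapping.keys c)) ` C)"

section \<open>Tor\<close>

definition free_resolution ::
  "('r, 'a) ring_scheme \<Rightarrow> ('r, 'n) module \<Rightarrow> (nat \<Rightarrow> 'i set)
     \<Rightarrow> (nat \<Rightarrow> ('i \<Rightarrow> 'r) \<Rightarrow> ('i \<Rightarrow> 'r)) \<Rightarrow> (('i \<Rightarrow> 'r) \<Rightarrow> 'n) \<Rightarrow> bool" where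
  "free_resolution R N I d \<epsilon> \<longleftrightarrow>
     \<epsilon> \<in> module_hom R (free_module R (I 0)) N
     \<and> \<epsilon> ` carrier (free_module R (I 0)) = carrier N
     \<and> (\<forall>n. d n \<in> module_hom R (free_module R (I (Suc n))) (free_module R (I n)))
     \<and> d 0 ` carrier (free_module R (I (Suc 0))) = a_kernel (free_module R (I 0)) N \<epsilon>
     \<and> (\<forall>n. d (Suc n) ` carrier (free_module R (I (Suc (Suc n))))
            = a_kernel (free_module R (I (Suc n))) (free_module R (I n)) (d n))"

text \<open>
  For a right module \<open>N\<close> and a left module \<open>M\<close>, \<open>Tor R N M q\<close> is the \<open>q\<close>-th homology of
  \<open>F \<otimes> M\<close>, where \<open>F\<close> is a chosen free resolution of \<open>N\<close>; different choices give isomorphic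
  groups.  Every module \<open>N\<close> over a ring has a free resolution whose bases are indexed by subsets of
  the infinite type \<^typ>\<open>('n \<times> 'r) list\<close>, because the finitely supported families of ring elements
  over such a basis form a set whose cardinality does not exceed that of this type.
\<close>

definition chosen_resolution ::
  "('r, 'a) ring_scheme \<Rightarrow> ('r, 'n) module \<Rightarrow>
     (nat \<Rightarrow> ('n \<times> 'r) list set) \<times> (nat \<Rightarrow> (('n \<times> 'r) list \<Rightarrow> 'r) \<Rightarrow> (('n \<times> 'r) list \<Rightarrow> 'r))" where
  "chosen_resolution R N = (SOME (I, d). \<exists>\<epsilon>. free_resolution R N I d \<epsilon>)"

definition Tor ::
  "('r, 'a) ring_scheme \<Rightarrow> ('r, 'n) module \<Rightarrow> ('r, 'm) module \<Rightarrow> nat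
     \<Rightarrow> (((('n \<times> 'r) list \<Rightarrow> 'r) \<times> 'm) \<Rightarrow>\<^sub>0 int) set set monoid" where
  "Tor R N M q =
     (let (I, d) = chosen_resolution (op_ring R) N;
          F = (\<lambda>n. free_module (op_ring R) (I n));
          T = (\<lambda>n. tensor R (F n) M);
          D = (\<lambda>n. tensor_lift (T n) (\<lambda>x m. pure_tensor R (F n) M (d n x) m));
          Z = (if q = 0 then carrier (T 0) else kernel (T q) (T (q - 1)) (D (q - 1)))
      in (T q)\<lparr>carrier := Z\<rparr> Mod (D q ` carrier (T (Suc q))))"

section \<open>Path algebras\<close>

text \<open>
  The algebra with basis \<open>B\<close>, where the product of basis elements \<open>p\<close> and \<open>q\<close> is the basis
  element \<open>w\<close> if \<open>m p q = Some w\<close> and zero if \<open>m p q = None\<close>, and the unit is the sum of the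
  finite set \<open>U\<close> of basis elements.
\<close>

definition basis_algebra ::
  "'b set \<Rightarrow> 'b set \<Rightarrow> ('b \<Rightarrow> 'b \<Rightarrow> 'b option) \<Rightarrow> ('b \<Rightarrow>\<^sub>0 'k::field) ring" where
  "basis_algebra B U m =
     \<lparr>carrier = {x. Poly_Mapping.keys x \<subseteq> B},
      monoid.mult = (\<lambda>x y. \<Sum>p\<in>Poly_Mapping.keys x. \<Sum>q\<in>Poly_Mapping.keys y.
                (case m p q of None \<Rightarrow> 0
                 | Some w \<Rightarrow> Poly_Mapping.single w (Poly_Mapping.lookup x p * Poly_Mapping.lookup y q))),
      monoid.one = (\<Sum>u\<in>U. Poly_Mapping.single u 1),
      ring.zero = 0,
      ring.add = (+)\<rparr>"

definition linear_extension :: "('b \<Rightarrow> 'c) \<Rightarrow> ('b \<Rightarrow>\<^sub>0 'k::field) \<Rightarrow> ('c \<Rightarrow>\<^sub>0 'k)" where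
  "linear_extension f x =
     (\<Sum>p\<in>Poly_Mapping.keys x. Poly_Mapping.single (f p) (Poly_Mapping.lookup x p))"

text \<open>
  A quiver is a \<^typ>\<open>('v, 'e) pre_digraph\<close>; source and range are \<^const>\<open>tail\<close> and
  \<^const>\<open>head\<close>.  A path is a triple of source vertex, list of arrows and range vertex, so that
  the trivial path at \<open>i\<close> is \<open>(i, [], i)\<close>.
\<close>

type_synonym ('v, 'e) path = "'v \<times> 'e list \<times> 'v"

definition paths :: "('v, 'e) pre_digraph \<Rightarrow> ('v, 'e) path set" where
  "paths E = {(u, p, v). pre_digraph.awalk E u p v}"

definition path_concat :: "('v, 'e) path \<Rightarrow> ('v, 'e) path \<Rightarrow> ('v, 'e) path option" where
  "path_concat = (\<lambda>(u, p, v) (u', q, w). if v = u' then Some (u, p @ q, w) else None)"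

definition path_algebra :: "('v, 'e) pre_digraph \<Rightarrow> (('v, 'e) path \<Rightarrow>\<^sub>0 'k::field) ring" where
  "path_algebra E = basis_algebra (paths E) ((\<lambda>v. (v, [], v)) ` verts E) path_concat"

text \<open>In the inverse quiver the arrow \<open>e\<close> stands for the reversed arrow of \<open>e\<close>.\<close>

definition inverse_quiver :: "('v, 'e) pre_digraph \<Rightarrow> ('v, 'e) pre_digraph" where
  "inverse_quiver E = \<lparr>verts = verts E, arcs = arcs E, tail = head E, head = tail E\<rparr>"

text \<open>
  The right \<open>P(E)\<close>-module \<open>k\<^sup>d\<close> (with \<open>d\<close> the number of vertices): on a vector \<open>c\<close> an element
  \<open>x\<close> acts through its augmentation, whose \<open>v\<close>-th component is the coefficient of the trivial
  path at \<open>v\<close>.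
\<close>

definition augmentation_module ::
  "('v, 'e) pre_digraph \<Rightarrow> (('v, 'e) path \<Rightarrow>\<^sub>0 'k::field, 'v \<Rightarrow> 'k) module" where
  "augmentation_module E = mk_module {c. \<forall>v. v \<notin> verts E \<longrightarrow> c v = 0}
     (\<lambda>v. 0) (\<lambda>c c' v. c v + c' v) (\<lambda>x c v. c v * Poly_Mapping.lookup x (v, [], v))"

section \<open>Leavitt path algebras\<close>

datatype ('v, 'e) leavitt_gen = Vtx 'v | Arr 'e | Ghost 'e

definition leavitt_gens :: "('v, 'e) pre_digraph \<Rightarrow> ('v, 'e) leavitt_gen set" where
  "leavitt_gens E = Vtx ` verts E \<union> Arr ` arcs E \<union> Ghost ` arcs E"

definition free_algebra :: "'x set \<Rightarrow> ('x list \<Rightarrow>\<^sub>0 'k::field) ring" where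
  "free_algebra Y = basis_algebra (lists Y) {[]} (\<lambda>u v. Some (u @ v))"

abbreviation word :: "'x list \<Rightarrow> ('x list \<Rightarrow>\<^sub>0 'k::field)" where
  "word w \<equiv> Poly_Mapping.single w 1"

definition leavitt_relations ::
  "('v, 'e) pre_digraph \<Rightarrow> (('v, 'e) leavitt_gen list \<Rightarrow>\<^sub>0 'k::field) set" where
  "leavitt_relations E =
     {word [Vtx v, Vtx v'] - (if v = v' then word [Vtx v] else 0) | v v'.
        v \<in> verts E \<and> v' \<in> verts E} \<union>
     {(\<Sum>v\<in>verts E. word [Vtx v]) - word []} \<union>
     {word [Vtx (tail E e), Arr e] - word [Arr e] | e. e \<in> arcs E} \<union>
     {word [Arr e, Vtx (head E e)] - word [Arr e] | e. e \<in> arcs E} \<union>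
     {word [Vtx (head E e), Ghost e] - word [Ghost e] | e. e \<in> arcs E} \<union>
     {word [Ghost e, Vtx (tail E e)] - word [Ghost e] | e. e \<in> arcs E} \<union>
     {word [Ghost e, Arr e'] - (if e = e' then word [Vtx (head E e)] else 0) | e e'.
        e \<in> arcs E \<and> e' \<in> arcs E} \<union>
     {word [Vtx v] - (\<Sum>e\<in>{e \<in> arcs E. tail E e = v}. word [Arr e, Ghost e]) | v.
        v \<in> verts E \<and> (\<exists>e\<in>arcs E. tail E e = v)}"

definition leavitt_ideal ::
  "('v, 'e) pre_digraph \<Rightarrow> (('v, 'e) leavitt_gen list \<Rightarrow>\<^sub>0 'k::field) set" where
  "leavitt_ideal E = genideal (free_algebra (leavitt_gens E)) (leavitt_relations E)"

type_synonym ('v, 'e, 'k) leavitt_elem = "(('v, 'e) leavitt_gen list \<Rightarrow>\<^sub>0 'k) set"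

definition leavitt_algebra ::
  "('v, 'e) pre_digraph \<Rightarrow> ('v, 'e, 'k::field) leavitt_elem ring" where
  "leavitt_algebra E = free_algebra (leavitt_gens E) Quot leavitt_ideal E"

definition leavitt_class ::
  "('v, 'e) pre_digraph \<Rightarrow> (('v, 'e) leavitt_gen list \<Rightarrow>\<^sub>0 'k::field)
     \<Rightarrow> ('v, 'e, 'k) leavitt_elem" where
  "leavitt_class E x = leavitt_ideal E +>\<^bsub>free_algebra (leavitt_gens E)\<^esub> x"

text \<open>The embeddings of \<open>P(E)\<close>, of the path algebra of the inverse quiver, and of \<open>k\<close>.\<close>

definition real_embed ::
  "('v, 'e) pre_digraph \<Rightarrow> (('v, 'e) path \<Rightarrow>\<^sub>0 'k::field) \<Rightarrow> ('v, 'e, 'k) leavitt_elem" where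
  "real_embed E x = leavitt_class E (linear_extension (\<lambda>(u, p, v). Vtx u # map Arr p) x)"

definition ghost_embed ::
  "('v, 'e) pre_digraph \<Rightarrow> (('v, 'e) path \<Rightarrow>\<^sub>0 'k::field) \<Rightarrow> ('v, 'e, 'k) leavitt_elem" where
  "ghost_embed E x = leavitt_class E (linear_extension (\<lambda>(u, p, v). Vtx u # map Ghost p) x)"

definition scalar_embed ::
  "('v, 'e) pre_digraph \<Rightarrow> 'k::field \<Rightarrow> ('v, 'e, 'k) leavitt_elem" where
  "scalar_embed E c = leavitt_class E (Poly_Mapping.single [] c)"

text \<open>\<open>L(E)\<close> as a right module over the path algebra of the inverse quiver\<close>

definition leavitt_right_module ::
  "('v, 'e) pre_digraph \<Rightarrow> (('v, 'e) path \<Rightarrow>\<^sub>0 'k::field, ('v, 'e, 'k) leavitt_elem) module" where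
  "leavitt_right_module E =
     mk_module (carrier (leavitt_algebra E)) \<zero>\<^bsub>leavitt_algebra E\<^esub>
       (\<lambda>x y. x \<oplus>\<^bsub>leavitt_algebra E\<^esub> y) (\<lambda>a x. x \<otimes>\<^bsub>leavitt_algebra E\<^esub> ghost_embed E a)"

section \<open>Blanchfield modules and lattices\<close>

definition blanchfield ::
  "('v, 'e) pre_digraph \<Rightarrow> (('v, 'e) path \<Rightarrow>\<^sub>0 'k::field, 'm) module \<Rightarrow> bool" where
  "blanchfield E M \<longleftrightarrow> left_module (path_algebra E) M
     \<and> (\<forall>q. trivial_group (Tor (path_algebra E) (augmentation_module E) M q))"

definition fg_blanchfield ::
  "('v, 'e) pre_digraph \<Rightarrow> (('v, 'e) path \<Rightarrow>\<^sub>0 'k::field, 'm) module \<Rightarrow> bool" where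
  "fg_blanchfield E M \<longleftrightarrow> blanchfield E M \<and> finitely_generated (path_algebra E) M"

text \<open>
  The \<open>L(E)\<close>-module structure on a Blanchfield module \<open>M\<close>: the (on carriers unique) one that
  extends the given \<open>P(E)\<close>-module structure.
\<close>

definition leavitt_module ::
  "('v, 'e) pre_digraph \<Rightarrow> (('v, 'e) path \<Rightarrow>\<^sub>0 'k::field, 'm) module
     \<Rightarrow> (('v, 'e, 'k) leavitt_elem, 'm) module" where
  "leavitt_module E M =
     (let LM = mk_module (carrier M) \<zero>\<^bsub>M\<^esub> (\<lambda>x y. x \<oplus>\<^bsub>M\<^esub> y)
      in LM (SOME s. left_module (leavitt_algebra E) (LM s)
               \<and> (\<forall>a\<in>carrier (path_algebra E). \<forall>x\<in>carrier M.
                     s (real_embed E a) x = a \<odot>\<^bsub>M\<^esub> x)))"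

text \<open>\<open>M\<close> regarded as a module over the path algebra of the inverse quiver\<close>

definition ghost_module ::
  "('v, 'e) pre_digraph \<Rightarrow> (('v, 'e) path \<Rightarrow>\<^sub>0 'k::field, 'm) module
     \<Rightarrow> (('v, 'e) path \<Rightarrow>\<^sub>0 'k, 'm) module" where
  "ghost_module E M = restrict_scalars (ghost_embed E) (leavitt_module E M)"

abbreviation ghost_submodule ::
  "('v, 'e) pre_digraph \<Rightarrow> (('v, 'e) path \<Rightarrow>\<^sub>0 'k::field, 'm) module \<Rightarrow> 'm set \<Rightarrow> bool" where
  "ghost_submodule E M A \<equiv>
     submodule A (path_algebra (inverse_quiver E) :: (('v, 'e) path \<Rightarrow>\<^sub>0 'k) ring) (ghost_module E M)"

definition ring_of_field :: "'k::field ring" where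
  "ring_of_field =
     \<lparr>carrier = UNIV, monoid.mult = (\<lambda>x y. x * y), monoid.one = 1, ring.zero = 0, ring.add = (+)\<rparr>"

definition finite_dimensional ::
  "('v, 'e) pre_digraph \<Rightarrow> (('v, 'e) path \<Rightarrow>\<^sub>0 'k::field, 'm) module \<Rightarrow> 'm set \<Rightarrow> bool" where
  "finite_dimensional E M A \<longleftrightarrow>
     finitely_generated (ring_of_field :: 'k ring)
       (restrict_scalars (scalar_embed E) ((leavitt_module E M)\<lparr>carrier := A\<rparr>))"

definition lattice_in ::
  "('v, 'e) pre_digraph \<Rightarrow> (('v, 'e) path \<Rightarrow>\<^sub>0 'k::field, 'm) module \<Rightarrow> 'm set \<Rightarrow> bool" where
  "lattice_in E M A \<longleftrightarrow> ghost_submodule E M A \<and> finite_dimensional E M A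
     \<and> submodule_generated (path_algebra E) M A = carrier M"

text \<open>
  The map \<open>x \<otimes> a \<mapsto> x a\<close> from the tensor product of \<open>L(E)\<close> and \<open>A\<close> to \<open>M\<close>.  It is automatically
  \<open>L(E)\<close>-linear, so it is an isomorphism of modules iff it is one of additive groups.
\<close>

definition natural_map ::
  "('v, 'e) pre_digraph \<Rightarrow> (('v, 'e) path \<Rightarrow>\<^sub>0 'k::field, 'm) module
     \<Rightarrow> ((('v, 'e, 'k) leavitt_elem \<times> 'm) \<Rightarrow>\<^sub>0 int) set \<Rightarrow> 'm" where
  "natural_map E M =
     tensor_lift (add_monoid M) (\<lambda>x a. x \<odot>\<^bsub>leavitt_module E M\<^esub> a)"

definition natural_map_is_iso ::
  "('v, 'e) pre_digraph \<Rightarrow> (('v, 'e) path \<Rightarrow>\<^sub>0 'k::field, 'm) module \<Rightarrow> 'm set \<Rightarrow> bool" where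
  "natural_map_is_iso E M A \<longleftrightarrow>
     natural_map E M \<in> iso
       (tensor (path_algebra (inverse_quiver E)) (leavitt_right_module E)
          ((ghost_module E M)\<lparr>carrier := A\<rparr>))
       (add_monoid M)"

end

theory Submission
 imports Defs "HOL-Library.Countable_Set"
begin

text \<open>
 An element killed by the sinks is recovered from its images under the ghost arrows, since
 \<open>p_v\<close> is the sum of the \<open>e e*\<close> over the arrows \<open>e\<close> leaving \<open>v\<close>; and long ghost paths move every
 element of the module generated by a \<open>P(E*)\<close>-submodule \<open>C\<close> into \<open>C\<close>.  So a ghost-stable subspace is
 controlled by its intersection with \<open>C\<close>.  For finite-dimensional \<open>C\<close> this gives finite length, finite
 presentation, injectivity of \<open>L(E) \<otimes> A \<rightarrow> M\<close>, and the stability of lattices under intersection,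
 whence a smallest one.  A free \<open>L(E)\<close>-module is filtered by the length of ghost paths into
 finite-dimensional pieces, and no nonzero ghost-stable subspace killed by the sinks lies in a piece, so
 a module with a lattice contains no projective one.  Conversely, let \<open>M\<close> be finitely presented
 with relations of length at most \<open>D + 1\<close>: either the image of the \<open>D\<close>-th piece is a lattice, or some
 element of length \<open>D + 1\<close> is independent of the relations modulo shorter ones, and comparing leading
 terms shows that a vertex multiple of it generates a projective submodule.
\<close>

text \<open>Submodules are studied through operators for vertices, arrows and ghost arrows on a
  vector space; elements of the quotient algebra L(E) occur only where modules are built or
  compared. In these terms an L(E)-module is Blanchfield iff it is killed by the sinks, and finitely
  generated over P(E) iff it has a lattice, so every claim becomes one about lattices in sink-free
  modules. The first equivalence must be extracted from Tor of an arbitrarily chosen free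
  resolution. The short resolution of the augmentation module consists of projectives cut out by
  vertices, which need not be free; an infinite periodic free resolution replaces it, and the
  comparison theorem makes the choice harmless. Length of ghost paths makes sense in L(E) only
  because the ghost path algebra embeds into it, which is shown on an explicit module where distinct
  ghost paths act independently. Relations are bounded by D + 1 and not D because stability of the
  D-th piece under one ghost arrow is a statement about length D + 1. Vertices are only idempotents,
  so leading terms yield copies of L(E)p, projective but possibly not free.\<close>

type_synonym ('v,'e,'k) path_elem = "('v,'e) path \<Rightarrow>\<^sub>0 'k"
type_synonym ('v,'e,'k) word_elem = "('v,'e) leavitt_gen list \<Rightarrow>\<^sub>0 'k"
type_synonym ('v,'e,'k) leavitt_ring = "('v,'e,'k) leavitt_elem ring"
type_synonym ('x,'m) tensor_elem = "(('x * 'm) \<Rightarrow>\<^sub>0 int) set"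

notation (input) iff (infixr "<->" 25)

abbreviation (input) "car == carrier"
abbreviation (input) "keys == Poly_Mapping.keys"
abbreviation (input) "lookup == Poly_Mapping.lookup"
abbreviation (input) "single == Poly_Mapping.single"

text \<open>Indexed operations are written \<open>x \<oplus>_{M} y\<close>.\<close>

syntax (input) "_index" :: "logic => index"  ("'_{_}")

section \<open>Vector spaces over the scalar field\<close>

lemma submodule_iff:
 "submodule N R M <-> subgroup N (add_monoid M) & (ALL a:car R. ALL x:N. a \<odot>_{M} x : N)"
 by(auto simp: submodule_def submodule_axioms_def)

section \<open>Additive subgroups\<close>

context abelian_group
begin

lemma subgrpI: assumes "N <= car G" "\<zero> : N" "!!x y. x : N ==> y : N ==> x \<oplus> y : N"
  and "!!x. x : N ==> \<ominus> x : N" shows "subgroup N (add_monoid G)"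
 using assms by(intro subgroup.intro) (auto simp: a_inv_def)

lemma subgrpD: assumes "subgroup N (add_monoid G)"
 shows "N <= car G" "\<zero> : N" "x : N ==> y : N ==> x \<oplus> y : N" "x : N ==> \<ominus> x : N"
  "x : N ==> x : car G"
proof -
 show "N <= car G" using subgroup.subset[OF assms] by simp
 show "\<zero> : N" using subgroup.one_closed[OF assms] by simp
 show "x : N ==> y : N ==> x \<oplus> y : N" using subgroup.m_closed[OF assms] by simp
 show "x : N ==> \<ominus> x : N" using subgroup.m_inv_closed[OF assms] by(simp add: a_inv_def)
 show "x : N ==> x : car G" using subgroup.subset[OF assms] by auto
qed

lemma subgroup_minus_closed: assumes "subgroup N (add_monoid G)" "x : N" "y : N"
 shows "x \<ominus> y : N" using subgrpD[OF assms(1)] assms(2,3) by(simp add: a_minus_def)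

lemma sub_finsum: assumes N: "subgroup N (add_monoid G)" and f: "!!i. i : I ==> f i : N"
 shows "finsum G f I : N" using f
proof (induction I rule: infinite_finite_induct)
 case (insert i I)
 have "f : I \<rightarrow> car G" "f i : car G" using insert.prems subgrpD(1)[OF N] by auto
 thus ?case using insert subgrpD(3)[OF N] by simp
qed (use subgrpD(2)[OF N] in auto)

lemma subgroup_Inter: assumes "!!N. N : S ==> subgroup N (add_monoid G)" "S ~= {}"
 shows "subgroup (\<Inter>S) (add_monoid G)"
proof (rule subgrpI)
 show "\<Inter>S <= car G" using assms subgrpD(1) by blast
qed (use assms subgrpD in auto)

lemma subgroup_zero: "subgroup {\<zero>} (add_monoid G)" by(rule subgrpI) auto

lemma subgroup_cancel: assumes "subgroup N (add_monoid G)" "x \<oplus> y : N" "x : N" "y : car G"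
 shows "y : N"
proof -
 have "\<ominus> x \<oplus> (x \<oplus> y) : N" using assms subgrpD[OF assms(1)] by blast
 moreover have "\<ominus> x \<oplus> (x \<oplus> y) = y"
  using assms subgrpD(5)[OF assms(1)] by(simp add: r_neg1)
 ultimately show ?thesis by simp
qed

end

text \<open>The scalars act through a bare operator \<open>sc\<close>, because in the applications
  the record \<open>M\<close> already carries the action of an algebra; the k-structure is then the
  action of the embedded scalars.\<close>

locale kspace = abelian_group M for M :: "('m,'z) ring_scheme" (structure) +
 fixes sc :: "'k::field => 'm => 'm" assumes sc_closed [simp]: "x : car M ==> sc c x : car M"
  and sc_add: "x : car M ==> y : car M ==> sc c (x \<oplus> y) = sc c x \<oplus> sc c y"
  and sc_plus: "x : car M ==> sc (c + d) x = sc c x \<oplus> sc d x"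
  and sc_times: "x : car M ==> sc (c * d) x = sc c (sc d x)"
  and sc_one [simp]: "x : car M ==> sc 1 x = x"
begin

lemma sc_zero_left [simp]: assumes "x : car M" shows "sc 0 x = \<zero>"
proof -
 have "sc 0 x \<oplus> sc 0 x = sc 0 x" using sc_plus[OF assms, of 0 0] by simp
 thus ?thesis using assms add.r_cancel_one by auto
qed

lemma sc_uminus_one: assumes "x : car M" shows "sc (-1) x = \<ominus> x"
proof -
 have "sc (-1) x \<oplus> x = \<zero>" using sc_plus[OF assms, of "-1" 1] assms by simp
 thus ?thesis using assms by(simp add: minus_equality)
qed

lemma sc_zero_right [simp]: "sc c \<zero> = \<zero>"
proof -
 have "sc c \<zero> = sc c (sc 0 \<zero>)" by simp
 also have "... = sc (c * 0) \<zero>" by(rule sc_times[symmetric]) simp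
 finally show ?thesis by simp
qed

definition ksub :: "'m set => bool" where
 "ksub N <-> subgroup N (add_monoid M) & (ALL c. ALL x:N. sc c x : N)"

definition kspan :: "'m set => 'm set" where
 "kspan S = \<Inter>{N. ksub N & S <= N}"

text \<open>A finite spanning set stands in for a dimension. Where a number is wanted,
  \<open>dimension_exists\<close> supplies one that strictly increases along proper inclusions
  inside a fixed finite-dimensional subspace.\<close>

definition fd :: "'m set => bool" where
 "fd A <-> (EX S. finite S & S <= car M & A = kspan S)"

lemma ksubI: assumes "N <= car M" "\<zero> : N" "!!x y. x : N ==> y : N ==> x \<oplus> y : N"
  and "!!c x. x : N ==> sc c x : N" shows "ksub N"
proof -
 have "\<ominus> x : N" if "x : N" for x using assms(1,4) sc_uminus_one[of x] that by(metis subsetD)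
 thus ?thesis unfolding ksub_def using assms by(intro conjI subgrpI) auto
qed

lemma ksubD: assumes "ksub N"
 shows "N <= car M" "\<zero> : N" "x : N ==> y : N ==> x \<oplus> y : N" "x : N ==> \<ominus> x : N"
  "x : N ==> x : car M" "x : N ==> sc c x : N" "x : N ==> y : N ==> x \<ominus> y : N"
proof -
 have N: "subgroup N (add_monoid M)" using assms by(simp add: ksub_def)
 note D = subgrpD[OF N]
 show "N <= car M" "\<zero> : N" by(fact D(1), fact D(2))
 show "x : N ==> y : N ==> x \<oplus> y : N" by(rule D(3))
 show "x : N ==> \<ominus> x : N" by(rule D(4))
 show "x : N ==> x : car M" by(rule D(5))
 show "x : N ==> sc c x : N" using assms by(simp add: ksub_def)
 show "x : N ==> y : N ==> x \<ominus> y : N" by(rule subgroup_minus_closed[OF N])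
qed

lemma ksub_subgroup: "ksub N ==> subgroup N (add_monoid M)" by(simp add: ksub_def)

lemma ksub_carrier: "ksub (car M)" by(rule ksubI) auto

lemma ksub_zero: "ksub {\<zero>}" by(rule ksubI) auto

lemma ksub_Inter: assumes "!!N. N : S ==> ksub N" "S ~= {}" shows "ksub (\<Inter>S)"
 using assms subgroup_Inter[of S] unfolding ksub_def by blast

lemma ksub_Int: "ksub N ==> ksub N' ==> ksub (N Int N')" using ksub_Inter[of "{N, N'}"] by auto

lemma ksub_kspan: "S <= car M ==> ksub (kspan S)"
 unfolding kspan_def using ksub_carrier by(intro ksub_Inter) auto

lemma kspan_superset: "S <= kspan S" unfolding kspan_def by auto

lemma kspan_minimal: "ksub N ==> S <= N ==> kspan S <= N" unfolding kspan_def by auto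

lemma kspan_mono: "S <= T ==> kspan S <= kspan T" unfolding kspan_def by auto

lemma fd_ksub: "fd A ==> ksub A" unfolding fd_def using ksub_kspan by auto

lemma fd_kspan: "finite S ==> S <= car M ==> fd (kspan S)" unfolding fd_def by auto

definition ksum :: "'m set => 'm set => 'm set" where
 "ksum A B = {a \<oplus> b | a b. a : A & b : B}"

lemma ksub_ksum: assumes "ksub A" "ksub B" shows "ksub (ksum A B)"
proof (rule ksubI)
 note A = ksubD[OF assms(1)] and B = ksubD[OF assms(2)]
 show "ksum A B <= car M" unfolding ksum_def using A(5) B(5) by auto
 show "\<zero> : ksum A B" unfolding ksum_def using A(2) B(2) by force
 show "x \<oplus> y : ksum A B" if xy: "x : ksum A B" "y : ksum A B" for x y
 proof -
  obtain a b a' b' where *: "x = a \<oplus> b" "y = a' \<oplus> b'" "a : A" "a' : A" "b : B" "b' : B"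
   using xy unfolding ksum_def by blast
  hence "x \<oplus> y = (a \<oplus> a') \<oplus> (b \<oplus> b')" using A(5) B(5) by(simp add: a_ac)
  thus ?thesis unfolding ksum_def using * A(3) B(3) by blast
 qed
 show "sc c x : ksum A B" if x: "x : ksum A B" for c x
 proof -
  obtain a b where *: "x = a \<oplus> b" "a : A" "b : B" using x unfolding ksum_def by blast
  hence "sc c x = sc c a \<oplus> sc c b" using A(5) B(5) by(simp add: sc_add)
  thus ?thesis unfolding ksum_def using * A(6) B(6) by blast
 qed
qed

lemma ksum_left: assumes "ksub A" "ksub B" shows "A <= ksum A B"
proof
 fix a assume "a : A"
 hence "a = a \<oplus> \<zero>" using ksubD(5)[OF assms(1)] by simp
 thus "a : ksum A B" unfolding ksum_def using \<open>a : A\<close> ksubD(2)[OF assms(2)] by blast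
qed

lemma ksum_right: assumes "ksub A" "ksub B" shows "B <= ksum A B"
proof
 fix a assume "a : B"
 hence "a = \<zero> \<oplus> a" using ksubD(5)[OF assms(2)] by simp
 thus "a : ksum A B" unfolding ksum_def using \<open>a : B\<close> ksubD(2)[OF assms(1)] by blast
qed

lemma ksum_least: "ksub N ==> A <= N ==> B <= N ==> ksum A B <= N"
 unfolding ksum_def using ksubD(3)[of N] by blast

lemma fd_ksum: assumes "fd A" "fd B" shows "fd (ksum A B)"
proof -
 obtain S T where S: "finite S" "S <= car M" "A = kspan S"
  and T: "finite T" "T <= car M" "B = kspan T" using assms unfolding fd_def by auto
 have "ksum A B = kspan (S Un T)"
 proof
  show "ksum A B <= kspan (S Un T)" by(rule ksum_least) (use S T ksub_kspan kspan_mono in auto)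
  show "kspan (S Un T) <= ksum A B"
  proof (rule kspan_minimal)
   show "ksub (ksum A B)" using assms fd_ksub ksub_ksum by blast
   show "S Un T <= ksum A B"
    using ksum_left[of A B] ksum_right[of A B] assms fd_ksub kspan_superset S T by blast
  qed
 qed
 thus ?thesis unfolding fd_def using S T by(intro exI[of _ "S Un T"]) auto
qed

lemma fd_zero: "fd {\<zero>}"
proof -
 have "kspan {} = {\<zero>}"
  using kspan_minimal[OF ksub_zero, of "{}"] ksubD(2)[OF ksub_kspan[of "{}"]] by auto
 thus ?thesis unfolding fd_def by(intro exI[of _ "{}"]) auto
qed

lemma fd_indexed_sum: assumes "finite I" "!!i. i : I ==> fd (A i)"
 shows "EX B. fd B & (ALL i:I. A i <= B) & (ALL N. ksub N & (ALL i:I. A i <= N) --> B <= N)"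
 using assms
proof (induction I rule: finite_induct)
 case empty
 thus ?case using fd_zero ksubD(2) by(intro exI[of _ "{\<zero>}"]) auto
next
 case (insert i I)
 then obtain B where B: "fd B" "ALL i:I. A i <= B" "ALL N. ksub N & (ALL i:I. A i <= N) --> B <= N"
  by auto
 have i: "fd (A i)" using insert by simp
 have AB: "ksub (A i)" "ksub B" using i B(1) fd_ksub by auto
 have "A j <= ksum (A i) B" if "j : insert i I" for j
  using that B(2) ksum_left[OF AB] ksum_right[OF AB] by auto
 moreover have "ksum (A i) B <= N" if "ksub N" "ALL j:insert i I. A j <= N" for N
  using that B(3) by(intro ksum_least) auto
 ultimately show ?case using fd_ksum[OF i B(1)] by blast
qed

lemma kspan_insert: assumes "S <= car M" "a : car M"
 shows "kspan (insert a S) = {sc c a \<oplus> s | c s. s : kspan S}" (is "_ = ?R")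
proof
 have S: "ksub (kspan S)" using assms ksub_kspan by auto
 note SD = ksubD[OF S]
 have R: "ksub ?R"
 proof (rule ksubI)
  show "?R <= car M" using SD(5) assms by auto
  have "\<zero> = sc 0 a \<oplus> \<zero>" using assms by simp
  thus "\<zero> : ?R" using SD(2) by blast
  show "x \<oplus> y : ?R" if xy: "x : ?R" "y : ?R" for x y
  proof -
   obtain c s d t where *: "x = sc c a \<oplus> s" "y = sc d a \<oplus> t" "s : kspan S" "t : kspan S"
    using xy by blast
   hence "x \<oplus> y = sc (c + d) a \<oplus> (s \<oplus> t)"
    using SD(5) assms by(simp add: sc_plus a_ac)
   thus ?thesis using * SD(3) by blast
  qed
  show "sc c x : ?R" if x: "x : ?R" for c x
  proof -
   obtain d s where *: "x = sc d a \<oplus> s" "s : kspan S" using x by blast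
   hence "sc c x = sc (c * d) a \<oplus> sc c s" using SD(5) assms by(simp add: sc_add sc_times)
   thus ?thesis using * SD(6) by blast
  qed
 qed
 have "insert a S <= ?R"
 proof
  fix x assume "x : insert a S"
  moreover have "a = sc 1 a \<oplus> \<zero>" using assms by simp
  moreover have "x = sc 0 a \<oplus> x" if "x : S" using that assms by auto
  ultimately show "x : ?R" using SD(2) kspan_superset[of S] by blast
 qed
 thus "kspan (insert a S) <= ?R" using kspan_minimal R by blast
 have "ksub (kspan (insert a S))" using assms ksub_kspan by auto
 thus "?R <= kspan (insert a S)"
  using kspan_mono[of S "insert a S"] kspan_superset[of "insert a S"] ksubD(3,6)[of "kspan (insert a S)"]
  by blast
qed

text \<open>Adjoining one vector a to a spanning set S raises the rank of a subspace by at most one.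
  So the rank of N is that of its intersection with the span of S, plus 1 if N leaves this span. The
  same case distinction yields a finite spanning set of N: one vector outside the span of S together
  with finitely many that span the intersection.\<close>

lemma dimension_exists: assumes "fd A"
 shows "EX dm :: 'm set => nat. ALL N N'. ksub N & ksub N' & N < N' & N' <= A --> dm N < dm N'"
  and "ksub N ==> N <= A ==> fd N"
proof -
 have *: "(EX dm :: 'm set => nat. ALL N N'. ksub N & ksub N' & N < N' & N' <= kspan S --> dm N < dm N')
  & (ALL N. ksub N & N <= kspan S --> fd N)" if "finite S" "S <= car M" for S using that
 proof (induction S rule: finite_induct)
  case empty
  have e: "kspan {} = {\<zero>}"
   using kspan_minimal[OF ksub_zero, of "{}"] ksubD(2)[OF ksub_kspan[of "{}"]] by auto
  have N0: "N = {\<zero>}" if "ksub N" "N <= kspan {}" for N using that e ksubD(2) by blast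
  have "~ (ksub N & ksub N' & N < N' & N' <= kspan {})" for N N' using N0[of N] N0[of N'] by blast
  moreover have "fd N" if "ksub N" "N <= kspan {}" for N using N0[OF that] fd_zero by simp
  ultimately show ?case by blast
 next
  case (insert a S)
  let ?A0 = "kspan S"
  have aS: "S <= car M" "a : car M" using insert.prems by auto
  have A0: "ksub ?A0" using aS ksub_kspan by auto
  obtain dm :: "'m set => nat" where
   dm: "!!N N'. ksub N ==> ksub N' ==> N < N' ==> N' <= ?A0 ==> dm N < dm N'"
   and fdA0: "!!N. ksub N ==> N <= ?A0 ==> fd N"
   using insert.IH[OF aS(1)] by(elim conjE exE) (rule that, auto)
  \<comment> \<open>Outside the span of S the coefficient of a in n is nonzero; the quotient of the
    two coefficients of a is the multiple of n to subtract from x.\<close>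
  have red: "EX c. x \<ominus> sc c n : ?A0"
   if n: "n : kspan (insert a S)" "n ~: ?A0" and x: "x : kspan (insert a S)" for n x
  proof -
   obtain c s where cs: "n = sc c a \<oplus> s" "s : ?A0" using n kspan_insert[OF aS] by blast
   obtain d t where dt: "x = sc d a \<oplus> t" "t : ?A0" using x kspan_insert[OF aS] by blast
   have st: "s : car M" "t : car M" using cs dt ksubD(5)[OF A0] by auto
   have "c ~= 0" using n(2) cs st aS by auto
   let ?e = "d / c"
   have "x \<ominus> sc ?e n = t \<oplus> sc (- ?e) s"
   proof -
    have "\<ominus> sc ?e n = sc (- ?e) n"
     using sc_uminus_one[of "sc ?e n"] cs(1) st aS by(simp flip: sc_times)
    also have "... = sc (- d) a \<oplus> sc (- ?e) s"
     using cs(1) st aS \<open>c ~= 0\<close> by(simp add: sc_add flip: sc_times)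
    finally have "x \<ominus> sc ?e n = (sc d a \<oplus> t) \<oplus> (sc (- d) a \<oplus> sc (- ?e) s)"
     using dt by(simp add: a_minus_def)
    also have "... = (sc d a \<oplus> sc (- d) a) \<oplus> (t \<oplus> sc (- ?e) s)"
     using st aS by(simp add: a_ac)
    also have "sc d a \<oplus> sc (- d) a = \<zero>" using aS sc_plus[of a d "-d"] by simp
    finally show ?thesis using st by simp
   qed
   thus ?thesis using ksubD[OF A0] cs dt by metis
  qed
  have rec: "x : K" if "ksub K" "n : K" "x \<ominus> sc c n : K" "x : car M" for K n x c
  proof -
   have n: "sc c n : K" "sc c n : car M" using ksubD(5,6)[OF that(1)] that(2) by auto
   have "(x \<ominus> sc c n) \<oplus> sc c n = x" using n that(4) by(simp add: a_minus_def a_assoc l_neg)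
   thus ?thesis using ksubD(3)[OF that(1) that(3) n(1)] by simp
  qed
  let ?d = "%N. dm (N Int ?A0) + (if N <= ?A0 then 0 else 1)"
  have mono: "?d N < ?d N'" if N: "ksub N" "ksub N'" "N < N'" "N' <= kspan (insert a S)" for N N'
  proof (cases "N Int ?A0 = N' Int ?A0")
   case False
   hence "dm (N Int ?A0) < dm (N' Int ?A0)" by(intro dm ksub_Int N(1,2) A0) (use N(3) False in auto)
   thus ?thesis using N(3) by auto
  next
   case True
   \<comment> \<open>If the intersections agree and N left the span of S, a multiple of some n in N
     would move any x of N' into the common intersection, so x would lie in N, against the strict
     inclusion.\<close>
   have "N <= ?A0"
   proof (rule ccontr)
    assume "~ N <= ?A0"
    then obtain n where n: "n : N" "n ~: ?A0" by auto
    have "x : N" if x: "x : N'" for x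
    proof -
     obtain c where c: "x \<ominus> sc c n : ?A0" using red[of n x] n x N by blast
     moreover have "x \<ominus> sc c n : N'" using ksubD(6,7)[OF N(2)] x n N(3) by blast
     ultimately have "x \<ominus> sc c n : N" using True by blast
     thus ?thesis using rec[OF N(1) n(1)] ksubD(5)[OF N(2)] x by blast
    qed
    thus False using N(3) by auto
   qed
   moreover have "~ N' <= ?A0" using calculation True N(3) by auto
   ultimately show ?thesis using True by simp
  qed
  have fin: "fd N" if N: "ksub N" "N <= kspan (insert a S)" for N
  proof (cases "N <= ?A0")
   case True
   thus ?thesis using fdA0 N by blast
  next
   case False
   then obtain n where n: "n : N" "n ~: ?A0" by auto
   obtain T where T: "finite T" "T <= car M" "N Int ?A0 = kspan T"
    using fdA0[of "N Int ?A0"] N A0 ksub_Int unfolding fd_def by auto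
   have nT: "insert n T <= car M" using T n N ksubD(5) by blast
   have "N = kspan (insert n T)"
   proof
    show "kspan (insert n T) <= N"
     by(rule kspan_minimal[OF N(1)]) (use n T(3) kspan_superset[of T] in blast)
    show "N <= kspan (insert n T)"
    proof
     fix x assume x: "x : N"
     obtain c where c: "x \<ominus> sc c n : ?A0" using red[of n x] n x N by blast
     moreover have "x \<ominus> sc c n : N" using ksubD(6,7)[OF N(1)] x n by blast
     ultimately have "x \<ominus> sc c n : kspan (insert n T)"
      using T(3) kspan_mono[of T "insert n T"] by blast
     thus "x : kspan (insert n T)"
      using rec[OF ksub_kspan[OF nT]] kspan_superset[of "insert n T"] ksubD(5)[OF N(1)] x by blast
    qed
   qed
   thus ?thesis unfolding fd_def using T nT by(intro exI[of _ "insert n T"]) auto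
  qed
  show ?case
   by(intro conjI exI[of _ ?d] allI impI) (elim conjE, erule (3) mono, elim conjE, erule (1) fin)
 qed
 obtain S where S: "finite S" "S <= car M" "A = kspan S" using assms unfolding fd_def by auto
 show "EX dm :: 'm set => nat. ALL N N'. ksub N & ksub N' & N < N' & N' <= A --> dm N < dm N'"
  and "ksub N ==> N <= A ==> fd N" using *[OF S(1,2)] unfolding S(3)[symmetric] by auto
qed

lemma obtain_dimension: assumes "fd A"
 obtains dm :: "'m set => nat" where
  "!!N N'. ksub N ==> ksub N' ==> N < N' ==> N' <= A ==> dm N < dm N'"
proof -
 from dimension_exists(1)[OF assms] obtain dm :: "'m set => nat" where
  *: "ALL N N'. ksub N & ksub N' & N < N' & N' <= A --> dm N < dm N'" by(elim exE)
 show thesis by(rule that[of dm]) (simp add: *)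
qed

end

lemma kspan_image: assumes "kspace M sc" "kspace M' sc'" and f: "!!x. x : car M ==> f x : car M'"
   "!!x y. x : car M ==> y : car M ==> f (x \<oplus>_{M} y) = f x \<oplus>_{M'} f y"
   "!!c x. x : car M ==> f (sc c x) = sc' c (f x)" and S: "S <= car M"
 shows "f ` kspace.kspan M sc S = kspace.kspan M' sc' (f ` S)"
proof -
 interpret A: kspace M sc by fact
 interpret B: kspace M' sc' by fact
 have f0: "f \<zero>_{M} = \<zero>_{M'}"
  using f(3)[of "\<zero>_{M}" 0] f(1)[of "\<zero>_{M}"] by simp
 have S': "f ` S <= car M'" using S f(1) by auto
 show ?thesis
 proof
  have "A.ksub {x : car M. f x : B.kspan (f ` S)}"
   by(rule A.ksubI) (use B.ksubD[OF B.ksub_kspan[OF S']] f f0 in auto)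
  hence "A.kspan S <= {x : car M. f x : B.kspan (f ` S)}"
   by(rule A.kspan_minimal) (use S B.kspan_superset[of "f ` S"] in auto)
  thus "f ` A.kspan S <= B.kspan (f ` S)" by auto
  note D = A.ksubD[OF A.ksub_kspan[OF S]]
  have "B.ksub (f ` A.kspan S)"
  proof (rule B.ksubI)
   show "f ` A.kspan S <= car M'" using D(5) f(1) by auto
   show "\<zero>_{M'} : f ` A.kspan S" using D(2) f0 by(metis imageI)
   show "x \<oplus>_{M'} y : f ` A.kspan S" if "x : f ` A.kspan S" "y : f ` A.kspan S" for x y
    using that D(3,5) f(2) by(auto simp flip: f(2))
   show "sc' c x : f ` A.kspan S" if "x : f ` A.kspan S" for c x
    using that D(5,6) by(auto simp flip: f(3))
  qed
  thus "B.kspan (f ` S) <= f ` A.kspan S" by(rule B.kspan_minimal) (use A.kspan_superset in auto)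
 qed
qed

lemma fd_image: assumes "kspace M sc" "kspace M' sc'" and f: "!!x. x : car M ==> f x : car M'"
   "!!x y. x : car M ==> y : car M ==> f (x \<oplus>_{M} y) = f x \<oplus>_{M'} f y"
   "!!c x. x : car M ==> f (sc c x) = sc' c (f x)" and A: "kspace.fd M sc A"
 shows "kspace.fd M' sc' (f ` A)"
proof -
 interpret A: kspace M sc by fact
 interpret B: kspace M' sc' by fact
 obtain S where S: "finite S" "S <= car M" "A = A.kspan S" using A unfolding A.fd_def by blast
 have eq: "f ` A = B.kspan (f ` S)"
  unfolding S(3) by(rule kspan_image[of M sc M' sc' f S]) (fact assms f S(2))+
 have "B.fd (B.kspan (f ` S))" by(rule B.fd_kspan) (use S(1,2) f(1) in auto)
 thus ?thesis by(simp only: eq)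
qed

section \<open>Modules over Leavitt path algebras in terms of operators\<close>

text \<open>The axioms are the relations of the presentation of L(E), read as identities between
  operators. By \<open>leavitt_ops_of_module\<close> and \<open>leavitt_module_of_ops\<close> this
  is the same as an L(E)-module, so lattices, filtrations and submodules can be treated without the
  quotient algebra.\<close>

locale leavitt_ops = kspace M sc + fin_digraph E
 for M :: "('m,'z) ring_scheme" (structure) and sc :: "'k::field => 'm => 'm"
  and E :: "('v,'e) pre_digraph" +
 fixes vt :: "'v => 'm => 'm" and ar gh :: "'e => 'm => 'm"
 assumes vt_closed [simp]: "v : verts E ==> x : car M ==> vt v x : car M"
  and ar_closed [simp]: "e : arcs E ==> x : car M ==> ar e x : car M"
  and gh_closed [simp]: "e : arcs E ==> x : car M ==> gh e x : car M"
  and vt_add: "v : verts E ==> x : car M ==> y : car M ==> vt v (x \<oplus> y) = vt v x \<oplus> vt v y"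
  and ar_add: "e : arcs E ==> x : car M ==> y : car M ==> ar e (x \<oplus> y) = ar e x \<oplus> ar e y"
  and gh_add: "e : arcs E ==> x : car M ==> y : car M ==> gh e (x \<oplus> y) = gh e x \<oplus> gh e y"
  and vt_sc: "v : verts E ==> x : car M ==> vt v (sc c x) = sc c (vt v x)"
  and ar_sc: "e : arcs E ==> x : car M ==> ar e (sc c x) = sc c (ar e x)"
  and gh_sc: "e : arcs E ==> x : car M ==> gh e (sc c x) = sc c (gh e x)"
  and vt_vt: "v : verts E ==> v' : verts E ==> x : car M
     ==> vt v (vt v' x) = (if v = v' then vt v x else \<zero>)"
  and vt_sum: "x : car M ==> (\<Oplus>v\<in>verts E. vt v x) = x"
  and vt_ar0: "e : arcs E ==> x : car M ==> vt (tail E e) (ar e x) = ar e x"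
  and ar_vt0: "e : arcs E ==> x : car M ==> ar e (vt (head E e) x) = ar e x"
  and vt_gh0: "e : arcs E ==> x : car M ==> vt (head E e) (gh e x) = gh e x"
  and gh_vt0: "e : arcs E ==> x : car M ==> gh e (vt (tail E e) x) = gh e x"
  and gh_ar: "e : arcs E ==> e' : arcs E ==> x : car M
     ==> gh e (ar e' x) = (if e = e' then vt (head E e) x else \<zero>)"
  and vt_out: "v : verts E ==> EX e:arcs E. tail E e = v ==> x : car M
     ==> vt v x = (\<Oplus>e\<in>{e : arcs E. tail E e = v}. ar e (gh e x))"
begin

abbreviation "gh_sum y == (\<Oplus>e\<in>arcs E. gh e (y e))"

definition sink :: "'v => bool" where
 "sink w <-> w : verts E & ~ (EX e:arcs E. tail E e = w)"

lemma op_zero: assumes "v : verts E" "e : arcs E"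
 shows "vt v \<zero> = \<zero>" "ar e \<zero> = \<zero>" "gh e \<zero> = \<zero>"
proof -
 have "vt v (sc 0 \<zero>) = sc 0 (vt v \<zero>)" "ar e (sc 0 \<zero>) = sc 0 (ar e \<zero>)" "gh e (sc 0 \<zero>) = sc 0 (gh e \<zero>)"
  using assms by(simp_all add: vt_sc ar_sc gh_sc del: sc_zero_left sc_zero_right)
 thus "vt v \<zero> = \<zero>" "ar e \<zero> = \<zero>" "gh e \<zero> = \<zero>" using assms by simp_all
qed

lemma vt_zero [simp]: "v : verts E ==> vt v \<zero> = \<zero>" using vt_sc[of v \<zero> 0] by simp

lemma ar_zero [simp]: "e : arcs E ==> ar e \<zero> = \<zero>"
 using op_zero(2)[of "tail E e"] by simp

lemma gh_zero [simp]: "e : arcs E ==> gh e \<zero> = \<zero>"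
 using op_zero(3)[of "tail E e"] by simp

lemma vt_ar: "v : verts E ==> e : arcs E ==> x : car M
  ==> vt v (ar e x) = (if v = tail E e then ar e x else \<zero>)"
 using vt_vt[of v "tail E e" "ar e x"] vt_ar0[of e x] by auto

lemma vt_gh: "v : verts E ==> e : arcs E ==> x : car M
  ==> vt v (gh e x) = (if v = head E e then gh e x else \<zero>)"
 using vt_vt[of v "head E e" "gh e x"] vt_gh0[of e x] by auto

lemma gh_vt: "v : verts E ==> e : arcs E ==> x : car M
  ==> gh e (vt v x) = (if v = tail E e then gh e x else \<zero>)"
 using gh_vt0[of e "vt v x"] vt_vt[of "tail E e" v x] gh_vt0[of e x] by auto

text \<open>The letters stand for ghost, real and full: these are the submodules over the path
  algebra of the inverse quiver, over P(E) and over L(E), as \<open>submodule_iff_gsub\<close>,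
  \<open>submodule_iff_rsub\<close> and \<open>submodule_iff_fsub\<close> confirm.\<close>

definition gsub :: "'m set => bool" where
 "gsub N <-> ksub N & (ALL v:verts E. ALL x:N. vt v x : N) & (ALL e:arcs E. ALL x:N. gh e x : N)"

definition rsub :: "'m set => bool" where
 "rsub N <-> ksub N & (ALL v:verts E. ALL x:N. vt v x : N) & (ALL e:arcs E. ALL x:N. ar e x : N)"

definition fsub :: "'m set => bool" where
 "fsub N <-> rsub N & gsub N"

definition rspan :: "'m set => 'm set" where
 "rspan S = \<Inter>{N. rsub N & S <= N}"

definition fspan :: "'m set => 'm set" where
 "fspan S = \<Inter>{N. fsub N & S <= N}"

lemma gsub_ksub: "gsub N ==> ksub N" by(simp add: gsub_def)
lemma rsub_ksub: "rsub N ==> ksub N" by(simp add: rsub_def)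
lemma fsub_ksub: "fsub N ==> ksub N" by(simp add: rsub_def fsub_def)

lemma gsubD: assumes "gsub N" "x : N" shows "v : verts E ==> vt v x : N" "e : arcs E ==> gh e x : N"
 using assms by(auto simp: gsub_def)

lemma gsub_carrier: "gsub (car M)" and rsub_carrier: "rsub (car M)"
 by(auto simp: gsub_def rsub_def ksub_carrier)

lemma fsub_carrier: "fsub (car M)" by(simp add: fsub_def gsub_carrier rsub_carrier)

lemma fsub_zero: "fsub {\<zero>}" by(auto simp: fsub_def gsub_def rsub_def ksub_zero)

lemma gsub_Int: "gsub A ==> gsub B ==> gsub (A Int B)" by(auto simp: gsub_def ksub_Int)

lemma rsub_rspan: "S <= car M ==> rsub (rspan S)" unfolding rspan_def rsub_def using rsub_carrier
 by(intro conjI ksub_Inter) (auto simp: rsub_def)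

lemma fsub_fspan: "S <= car M ==> fsub (fspan S)"
 unfolding fspan_def fsub_def rsub_def gsub_def using fsub_carrier
 by(intro conjI ksub_Inter) (auto simp: rsub_def gsub_def fsub_def)

lemma rspan_superset: "S <= rspan S" unfolding rspan_def by auto
lemma fspan_superset: "S <= fspan S" unfolding fspan_def by auto
lemma rspan_minimal: "rsub N ==> S <= N ==> rspan S <= N" unfolding rspan_def by auto
lemma fspan_minimal: "fsub N ==> S <= N ==> fspan S <= N" unfolding fspan_def by auto

text \<open>x is the sum of its vertex components, and the component at a vertex that emits arrows
  is the sum of the terms \<open>ar e (gh e x)\<close> over these arrows. The sinks are the only
  vertices where this says nothing, whence their separate hypothesis.\<close>

lemma reconstruct: assumes K: "subgroup K (add_monoid M)" and x: "x : car M"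
  and s: "!!w. sink w ==> vt w x : K" and a: "!!e. e : arcs E ==> ar e (gh e x) : K" shows "x : K"
proof -
 have "vt v x : K" if v: "v : verts E" for v
 proof (cases "EX e:arcs E. tail E e = v")
  case True
  show ?thesis unfolding vt_out[OF v True x] by(rule sub_finsum[OF K]) (use a in auto)
 qed (use s v sink_def in auto)
 hence "(\<Oplus>v\<in>verts E. vt v x) : K" by(rule sub_finsum[OF K])
 thus ?thesis using vt_sum[OF x] by simp
qed

text \<open>Every ghost word of length n carries an element of \<open>good C n\<close> into
  \<open>C\<close>. Sink components are required to lie in \<open>C\<close> at each stage because
  every ghost arrow kills them, so that later stages could not see them.\<close>

primrec good :: "'m set => nat => 'm set" where
 "good C 0 = C"
| "good C (Suc n) = {x : car M. (ALL e:arcs E. gh e x : good C n) & (ALL w. sink w --> vt w x : C)}"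

context
 fixes C assumes C: "gsub C"
begin

text \<open>Stability of a stage under ghost arrows means that an image in the preceding stage also
  lies in the stage itself; hence growth of the chain is carried through the same induction.\<close>

lemma good_gsub: "gsub (good C n) & good C n <= good C (Suc n)"
proof (induction n)
 case 0
 thus ?case using C gsubD[OF C] ksubD(1)[OF gsub_ksub[OF C]] by(auto simp: sink_def)
next
 case (Suc n)
 hence n: "gsub (good C n)" and sub: "good C n <= good C (Suc n)" by auto
 note nD = ksubD[OF gsub_ksub[OF n]] and CD = ksubD[OF gsub_ksub[OF C]]
 have "ksub (good C (Suc n))"
  by(rule ksubI) (use nD CD in "auto simp: gh_add gh_sc vt_add vt_sc sink_def")
 moreover have "vt v x : good C (Suc n)" if "v : verts E" "x : good C (Suc n)" for v x
  using that nD(2) CD(2) by(auto simp: gh_vt vt_vt sink_def)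
 moreover have "gh e x : good C (Suc n)" if "e : arcs E" "x : good C (Suc n)" for e x
  using that sub by auto
 ultimately show ?case using sub by(auto simp: gsub_def)
qed

lemma good_mono: "m <= n ==> good C m <= good C n"
 by(rule lift_Suc_mono_le[of "good C"]) (use good_gsub in auto)

text \<open>A ghost arrow applied to \<open>ar e x\<close> gives a vertex component of x or zero, so
  a real arrow costs exactly one stage.\<close>

lemma good_ar: "e : arcs E ==> x : good C n ==> ar e x : good C (Suc n)"
 using ksubD(2,5)[OF gsub_ksub[of "good C n"]] good_gsub[of n] gsubD(1)[of "good C n"]
  ksubD(2)[OF gsub_ksub[OF C]] by(auto simp: gh_ar vt_ar sink_def)

lemma fsub_good: "fsub (\<Union>n. good C n)" (is "fsub ?G")
proof -
 have k: "ksub (good C n)" for n using good_gsub[of n] gsub_ksub by auto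
 note D = ksubD[OF k]
 have "ksub ?G"
 proof (rule ksubI)
  show "?G <= car M" using D(1) by blast
  show "\<zero> : ?G" using D(2) by blast
  show "sc c x : ?G" if "x : ?G" for c x using that D(6) by blast
  show "x \<oplus> y : ?G" if xy: "x : ?G" "y : ?G" for x y
  proof -
   obtain m n where "x : good C m" "y : good C n" using xy by auto
   hence "x : good C (max m n)" "y : good C (max m n)"
    using good_mono[of m "max m n"] good_mono[of n "max m n"] by auto
   thus ?thesis using D(3) by blast
  qed
 qed
 moreover have "ALL e:arcs E. ALL x:?G. ar e x : ?G" using good_ar by blast
 moreover have "ALL e:arcs E. ALL x:?G. gh e x : ?G" "ALL v:verts E. ALL x:?G. vt v x : ?G"
  using gsubD[OF conjunct1[OF good_gsub]] by fast+
 ultimately show ?thesis unfolding fsub_def rsub_def gsub_def by simp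
qed

text \<open>
 Iterating the ghost arrows moves any element of the module into \<open>C\<close>, and an element is recovered
 from its images under the ghost arrows by the real arrows.
\<close>

lemma ghost_descent: assumes gen: "N <= fspan C"
  and N: "N <= car M" "!!v x. v : verts E ==> x : N ==> vt v x : N"
   "!!e x. e : arcs E ==> x : N ==> gh e x : N"
  and K: "subgroup K (add_monoid M)" "!!e x. e : arcs E ==> x : K ==> ar e x : K"
  and NC: "N Int C <= K" shows "N <= K"
proof
 fix x assume x: "x : N"
 \<comment> \<open>The stages start at \<open>C\<close> and their union is a full submodule, so it
   contains everything that \<open>C\<close> generates; x therefore reaches \<open>C\<close> after
   finitely many ghost arrows.\<close>
 have "C <= (\<Union>n. good C n)" by(metis UN_upper UNIV_I good.simps(1))
 hence "x : (\<Union>n. good C n)"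
  using fspan_minimal[OF fsub_good, of C] gen N(1) x by(meson subsetD)
 then obtain n where "x : good C n" by auto
 thus "x : K" using x
 proof (induction n arbitrary: x)
  case 0
  thus ?case using NC by auto
 next
  case (Suc n)
  show ?case
  proof (rule reconstruct[OF K(1)])
   show "x : car M" using Suc.prems N by auto
   show "vt w x : K" if "sink w" for w using that Suc.prems N(2) NC by(auto simp: sink_def)
   show "ar e (gh e x) : K" if "e : arcs E" for e using that Suc N(3) K(2) by auto
  qed
 qed
qed

end

section \<open>Lattices: intersections, the smallest lattice, composition series, existence\<close>

definition lattice :: "'m set => bool" where
 "lattice A <-> gsub A & fd A & rspan A = car M"

lemma rspan_le_fspan: "rspan A <= fspan A" unfolding rspan_def fspan_def fsub_def by auto

lemma lattice_generates: "lattice A ==> car M <= fspan A"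
 using rspan_le_fspan unfolding lattice_def by auto

text \<open>Descent with the whole module as \<open>N\<close> and the P(E)-span of \<open>A\<close>
  as \<open>K\<close>: ghost arrows bring every element down into \<open>A\<close>, and real arrows
  alone bring it back.\<close>

lemma rspan_eq_carrier_if_fspan: assumes "gsub A" "car M <= fspan A" shows "rspan A = car M"
proof
 have A: "A <= car M" using assms ksubD(1) gsub_ksub by blast
 show "rspan A <= car M" using rspan_minimal rsub_carrier A by blast
 show "car M <= rspan A" by(rule ghost_descent[OF assms(1,2)])
   (use rsub_rspan[OF A] rspan_superset in "auto simp: rsub_def ksub_def")
qed

text \<open>Descent applied to B inside the module generated by A shows that what B shares with A
  already generates B over P(E). It therefore generates the whole module, which B generates.\<close>

lemma lattice_Int: assumes "lattice A" "lattice B" shows "lattice (A Int B)"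
proof -
 have g: "gsub A" "gsub B" "fd A" "rspan B = car M" using assms by(auto simp: lattice_def)
 have BM: "B <= car M" using g ksubD(1) gsub_ksub by blast
 hence AB: "A Int B <= car M" by auto
 have "B <= rspan (A Int B)"
  by(rule ghost_descent[OF g(1) order_trans[OF BM lattice_generates[OF assms(1)]] BM])
   (use g BM rsub_rspan[OF AB] rspan_superset[of "A Int B"] in "auto simp: rsub_def ksub_def gsub_def")
 hence "rspan B <= rspan (A Int B)" using rspan_minimal rsub_rspan[OF AB] by blast
 hence "rspan (A Int B) = car M" using g(4) rspan_minimal[OF rsub_carrier AB] by auto
 moreover have "fd (A Int B)"
  using dimension_exists(2)[OF g(3), of "A Int B"] g gsub_ksub ksub_Int by auto
 ultimately show ?thesis using g gsub_Int by(auto simp: lattice_def)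
qed

text \<open>A lattice of least rank among those inside a fixed one cannot shrink when it is
  intersected with any lattice, because the intersection is again a lattice; so it lies in all of
  them.\<close>

lemma smallest_lattice: assumes "lattice A0" shows "EX A. lattice A & (ALL B. lattice B --> A <= B)"
proof -
 have "fd A0" using assms by(simp add: lattice_def)
 then obtain dm :: "'m set => nat" where
  dm: "!!N N'. ksub N ==> ksub N' ==> N < N' ==> N' <= A0 ==> dm N < dm N'"
  by(rule obtain_dimension) blast
 obtain A where A: "lattice A" "A <= A0" "!!B. lattice B ==> B <= A0 ==> dm A <= dm B"
  using ex_has_least_nat[of "%A. lattice A & A <= A0" A0 dm] assms by auto
 have "A <= B" if B: "lattice B" for B
 proof (rule ccontr)
  assume "~ A <= B"
  hence "A Int B < A" by auto
  moreover have AB: "lattice (A Int B)" using lattice_Int A(1) B by auto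
  ultimately have "dm (A Int B) < dm A" using A(1,2) by(intro dm) (auto simp: lattice_def gsub_ksub)
  moreover have "dm A <= dm (A Int B)" by(rule A(3)[OF AB]) (use A(2) in auto)
  ultimately show False by simp
 qed
 thus ?thesis using A(1) by auto
qed

text \<open>A submodule can be recovered from its trace on a lattice. This is how finiteness passes
  from vector spaces to submodules of a module that may be infinite-dimensional.\<close>

lemma fsub_determined: assumes "lattice A" "fsub N" "fsub N'" "N' Int A <= N" shows "N' <= N"
proof -
 have NM: "N' <= car M" using assms fsub_ksub ksubD(1) by blast
 have "gsub A" using assms by(simp add: lattice_def)
 thus ?thesis by(rule ghost_descent[OF _ order_trans[OF NM lattice_generates[OF assms(1)]] NM])
   (use assms in "auto simp: fsub_def rsub_def gsub_def ksub_def")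
qed

text \<open>The rank of the trace on the lattice strictly increases along inclusions of submodules.
  The series is built downwards, each time passing to a maximal proper submodule, which is why the
  statement is about an arbitrary submodule N.\<close>

lemma composition_series: assumes "lattice A" "fsub N"
 shows "EX (n::nat) F. F 0 = {\<zero>} & F n = N & (ALL i<=n. fsub (F i))
  & (ALL i<n. F i < F (Suc i) & ~ (EX N. fsub N & F i < N & N < F (Suc i)))"
proof -
 have "fd A" using assms by(simp add: lattice_def)
 then obtain dm :: "'m set => nat" where
  dm: "!!N N'. ksub N ==> ksub N' ==> N < N' ==> N' <= A ==> dm N < dm N'"
  by(rule obtain_dimension) blast
 have dless: "dm (N Int A) < dm (N' Int A)" if N: "fsub N" "fsub N'" "N < N'" for N N'
 proof (rule dm)
  show "ksub (N Int A)" "ksub (N' Int A)"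
   using N assms(1) fsub_ksub gsub_ksub ksub_Int unfolding lattice_def by blast+
  show "N Int A < N' Int A" using fsub_determined[OF assms(1) N(1,2)] N(3) by blast
 qed auto
 show ?thesis using assms(2)
 proof (induction "dm (N Int A)" arbitrary: N rule: less_induct)
  case less
  have z: "\<zero> : N" using less.prems fsub_ksub ksubD(2) by blast
  show ?case
  proof (cases "N = {\<zero>}")
   case True
   thus ?thesis using fsub_zero by(intro exI[of _ 0] exI[of _ "%_. N"]) auto
  next
   case False
   have bound: "ALL N'. fsub N' & N' < N --> dm (N' Int A) < dm (N Int A)"
    using dless less.prems by blast
   have "fsub {\<zero>} & {\<zero>} < N" using z False fsub_zero by auto
   \<comment> \<open>A proper submodule whose trace has the greatest rank is maximal, since anything
     strictly between would have a trace of larger rank.\<close>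
   from ex_has_greatest_nat[OF this bound] obtain N' where "fsub N' & N' < N"
    and mx: "ALL N''. fsub N'' & N'' < N --> dm (N'' Int A) <= dm (N' Int A)"
    by(elim exE conjE) (rule that, auto)
   hence N': "fsub N'" "N' < N" by auto
   have "dm (N' Int A) < dm (N Int A)" by(rule dless) (use N' less.prems in auto)
   from less.hyps[OF this N'(1)] obtain n F where F: "F 0 = {\<zero>}" "F n = N'" "ALL i<=n. fsub (F i)"
    "ALL i<n. F i < F (Suc i) & ~ (EX N. fsub N & F i < N & N < F (Suc i))" by blast
   have no: "~ (EX K. fsub K & N' < K & K < N)" using dless[OF N'(1)] mx by(meson leD)
   let ?F = "F(Suc n := N)"
   have "?F i < ?F (Suc i) & ~ (EX N. fsub N & ?F i < N & N < ?F (Suc i))" if "i < Suc n" for i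
   proof (cases "i = n")
    case True
    thus ?thesis using F(2) N'(2) no by simp
   next
    case False
    thus ?thesis using that F(4) by auto
   qed
   moreover have "ALL i<=Suc n. fsub (?F i)" using F(3) less.prems by auto
   ultimately show ?thesis using F(1) by(intro exI[of _ "Suc n"] exI[of _ ?F]) auto
  qed
 qed
qed

lemma linear_kspan_subset: assumes f: "!!x. x : car M ==> f x : car M"
   "!!x y. x : car M ==> y : car M ==> f (x \<oplus> y) = f x \<oplus> f y"
   "!!c x. x : car M ==> f (sc c x) = sc c (f x)"
  and N: "ksub N" and S: "S <= car M" "!!x. x : S ==> f x : N" and x: "x : kspan S" shows "f x : N"
proof -
 have f0: "f \<zero> = \<zero>" using f(3)[of \<zero> 0] f(1)[of \<zero>] by simp
 have "ksub {x : car M. f x : N}" by(rule ksubI) (use ksubD[OF N] f f0 in auto)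
 hence "kspan S <= {x : car M. f x : N}" by(rule kspan_minimal) (use S in auto)
 thus ?thesis using x by auto
qed

lemma vt_kspan: "v : verts E ==> ksub N ==> S <= car M ==> (!!x. x : S ==> vt v x : N)
  ==> x : kspan S ==> vt v x : N" by(rule linear_kspan_subset[of "vt v"]) (auto simp: vt_add vt_sc)

lemma ar_kspan: "e : arcs E ==> ksub N ==> S <= car M ==> (!!x. x : S ==> ar e x : N)
  ==> x : kspan S ==> ar e x : N" by(rule linear_kspan_subset[of "ar e"]) (auto simp: ar_add ar_sc)

lemma gh_kspan: "e : arcs E ==> ksub N ==> S <= car M ==> (!!x. x : S ==> gh e x : N)
  ==> x : kspan S ==> gh e x : N" by(rule linear_kspan_subset[of "gh e"]) (auto simp: gh_add gh_sc)

text \<open>Filter the module by the length of real words applied to finitely many vectors. A ghost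
  arrow cancels the first letter of a word, so it can raise the filtration degree only on the
  finitely many starting vectors. A degree K that bounds these finitely many values therefore gives
  a ghost-stable piece.\<close>

lemma lattice_exists: assumes S: "finite S" "S <= car M" "rspan S = car M" shows "EX A. lattice A"
proof -
 \<comment> \<open>The start consists of vertex components of the generators, so that every vertex
   fixes or kills a starting vector; on longer words the leading arrow ensures the same.\<close>
 define T where "T = rec_nat ((%(v, x). vt v x) ` (verts E \<times> S))
  (%_ X. X Un (%(e, x). ar e x) ` (arcs E \<times> X))"
 have T0: "T 0 = (%(v, x). vt v x) ` (verts E \<times> S)"
  and TS: "T (Suc n) = T n Un (%(e, x). ar e x) ` (arcs E \<times> T n)" for n
  unfolding T_def by simp_all
 have Tf: "finite (T n) & T n <= car M" for n by(induction n) (use S in "auto simp: T0 TS")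
 have Tc: "T n <= car M" for n using Tf by simp
 define A where "A n = kspan (T n)" for n
 have A: "ksub (A n)" "fd (A n)" "T n <= A n" for n
  unfolding A_def using Tf[of n] ksub_kspan kspan_superset fd_def by auto
 note AD = ksubD[OF A(1)]
 have mono: "A m <= A n" if "m <= n" for m n
  by(rule lift_Suc_mono_le[of A, OF _ that]) (unfold A_def TS, rule kspan_mono, rule Un_upper1)
 have vtT: "vt v x : A n" if "x : T n" "v : verts E" for v x n using that
 proof (induction n arbitrary: x)
  case 0
  then obtain v' y where y: "x = vt v' y" "v' : verts E" "y : S" by(auto simp: T0)
  have "y : car M" using y S(2) by auto
  hence "vt v x = (if v = v' then x else \<zero>)" using y 0 by(simp add: vt_vt)
  thus ?case using A(3)[of 0] AD(2)[of 0] 0(1) by auto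
 next
  case (Suc n)
  show ?case
  proof (cases "x : T n")
   case True
   thus ?thesis using Suc mono[of n "Suc n"] by auto
  next
   case False
   then obtain e y where y: "x = ar e y" "e : arcs E" "y : T n" using Suc.prems by(auto simp: TS)
   have "y : car M" using y Tc by blast
   hence "vt v x = (if v = tail E e then x else \<zero>)" using y Suc.prems by(simp add: vt_ar)
   thus ?thesis using A(3)[of "Suc n"] AD(2)[of "Suc n"] Suc.prems by auto
  qed
 qed
 have vtA: "vt v x : A n" if "x : A n" "v : verts E" for v x n
  using vt_kspan[OF that(2) A(1)[of n] Tc[of n]] vtT that unfolding A_def by blast
 have arA: "ar e x : A (Suc n)" if "x : A n" "e : arcs E" for e x n
 proof (rule ar_kspan[OF that(2) A(1) Tc[of n]])
  show "ar e y : A (Suc n)" if "y : T n" for y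
   using that \<open>e : arcs E\<close> A(3)[of "Suc n"] by(auto simp: TS)
 qed (use that A_def in auto)
 have "ksub (\<Union>n. A n)"
 proof (rule ksubI)
  show "(\<Union>n. A n) <= car M" using AD(1) by blast
  show "\<zero> : (\<Union>n. A n)" using AD(2) by blast
  show "sc c x : (\<Union>n. A n)" if "x : (\<Union>n. A n)" for c x using that AD(6) by blast
  show "x \<oplus> y : (\<Union>n. A n)" if xy: "x : (\<Union>n. A n)" "y : (\<Union>n. A n)" for x y
  proof -
   obtain m n where "x : A m" "y : A n" using xy by auto
   hence "x : A (max m n)" "y : A (max m n)" using mono[of m "max m n"] mono[of n "max m n"] by auto
   thus ?thesis using AD(3) by blast
  qed
 qed
 moreover have "ALL e:arcs E. ALL x:(\<Union>n. A n). ar e x : (\<Union>n. A n)" using arA by blast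
 moreover have "ALL v:verts E. ALL x:(\<Union>n. A n). vt v x : (\<Union>n. A n)" using vtA by blast
 ultimately have rA: "rsub (\<Union>n. A n)" unfolding rsub_def by simp
 have SN: "S <= N" if N: "ksub N" "T 0 <= N" for N
 proof
  fix x assume x: "x : S"
  have "(\<Oplus>v\<in>verts E. vt v x) : N"
   by(rule sub_finsum) (use N x in "auto simp: T0 ksub_def")
  thus "x : N" using vt_sum x S(2) by auto
 qed
 have "S <= (\<Union>n. A n)" by(rule SN) (use rA A(3) in "auto simp: rsub_def")
 hence all: "car M <= (\<Union>n. A n)" using rspan_minimal[OF rA, of S] unfolding S(3) by simp
 have "EX n. gh e x : A n" if "e : arcs E" "x : T 0" for e x
 proof -
  have "gh e x : car M" using that Tc[of 0] by auto
  thus ?thesis using all by auto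
 qed
 then obtain h where h: "!!e x. e : arcs E ==> x : T 0 ==> gh e x : A (h e x)" by metis
 define K where "K = Max ((%(e, x). h e x) ` (arcs E \<times> T 0))"
 have hK: "h e x <= K" if "e : arcs E" "x : T 0" for e x
  unfolding K_def by(rule Max_ge) (use that Tf[of 0] in auto)
 \<comment> \<open>On a word that begins with an arrow, the ghost arrow returns a vertex component
   of the shorter word or zero; only the starting vectors can need the bound K.\<close>
 have ghT: "gh e x : A (max K n)" if "e : arcs E" "x : T n" for e x n using that
 proof (induction n arbitrary: x)
  case 0
  thus ?case using h hK[of e x] mono[of "h e x" "max K 0"] by auto
 next
  case (Suc n)
  show ?case
  proof (cases "x : T n")
   case True
   have "gh e x : A (max K n)" using True Suc by blast
   moreover have "A (max K n) <= A (max K (Suc n))" by(rule mono) simp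
   ultimately show ?thesis by blast
  next
   case False
   then obtain e' y where y: "x = ar e' y" "e' : arcs E" "y : T n" using Suc.prems by(auto simp: TS)
   have "y : car M" using y Tc by blast
   hence "gh e x = (if e = e' then vt (head E e) y else \<zero>)" using y Suc.prems by(simp add: gh_ar)
   moreover have "vt (head E e) y : A n" using vtT y Suc.prems by auto
   moreover have "A n <= A (max K (Suc n))" by(rule mono) simp
   ultimately show ?thesis using AD(2)[of "max K (Suc n)"] by auto
  qed
 qed
 have ghA: "gh e x : A K" if "e : arcs E" "x : A K" for e x
  using gh_kspan[OF that(1) A(1)[of K] Tc[of K]] ghT[OF that(1), of _ K] that unfolding A_def by auto
 have g: "gsub (A K)" unfolding gsub_def using A(1) vtA ghA by blast
 have "rspan (A K) = car M"
 proof
  have AM: "A K <= car M" using AD by blast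
  show "rspan (A K) <= car M" using rspan_minimal[OF rsub_carrier AM] .
  have "T 0 <= rspan (A K)" using A(3)[of 0] mono[of 0 K] rspan_superset by blast
  hence "S <= rspan (A K)" using SN rsub_ksub[OF rsub_rspan[OF AM]] by blast
  thus "car M <= rspan (A K)" using rspan_minimal[OF rsub_rspan[OF AM]] S(3) by blast
 qed
 thus ?thesis using g A(2) unfolding lattice_def by blast
qed

end

section \<open>Algebras with a multiplicative basis\<close>

lemma poly_mapping_monomials: "x = (\<Sum>p\<in>keys x. single p (lookup x p))"
 by(rule poly_mapping_eqI)
  (simp add: lookup_sum lookup_single when_def in_keys_iff sum.delta' split: if_splits)

lemma span_induct [consumes 1, case_names zero single add]:
 assumes "keys x <= B" "P 0" "!!p c. p : B ==> P (single p c)"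
  and add: "!!x y. keys x <= B ==> keys y <= B ==> P x ==> P y ==> P (x + y)"
 shows "P (x :: 'b \<Rightarrow>\<^sub>0 'k::comm_monoid_add)"
proof -
 let ?s = "%F. \<Sum>p\<in>F. single p (lookup x p)"
 have "keys (?s F) <= B & P (?s F)" if "finite F" "F <= keys x" for F using that
 proof (induction F rule: finite_induct)
  case (insert p F)
  have "keys (single p (lookup x p)) <= B" using insert.prems assms(1) by auto
  thus ?case using insert assms(1,3) keys_add[of "single p (lookup x p)" "?s F"]
   by(auto intro!: add)
 qed (simp add: assms(2))
 from this[of "keys x"] show ?thesis using poly_mapping_monomials[of x] by simp
qed

definition bterm :: "('b => 'b => 'b option) => 'b => 'b => 'k => 'k => ('b \<Rightarrow>\<^sub>0 'k::field)" where
 "bterm m p q a b = (case m p q of None => 0 | Some w => single w (a * b))"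

definition bmul :: "('b => 'b => 'b option) => ('b \<Rightarrow>\<^sub>0 'k::field) => ('b \<Rightarrow>\<^sub>0 'k) => ('b \<Rightarrow>\<^sub>0 'k)" where
 "bmul m x y = (\<Sum>p\<in>keys x. \<Sum>q\<in>keys y.
   bterm m p q (lookup x p) (lookup y q))"

lemma basis_algebra_simps:
 "car (basis_algebra B U m) = {x. keys x <= B}"
 "x \<otimes>_{basis_algebra B U m} y = bmul m x y"
 "\<one>_{basis_algebra B U m} = (\<Sum>u\<in>U. single u 1)"
 "\<zero>_{basis_algebra B U m} = 0"
 "x \<oplus>_{basis_algebra B U m} y = x + y" by(simp_all add: basis_algebra_def bmul_def bterm_def)

lemma bterm_zero [simp]: "bterm m p q 0 b = 0" "bterm m p q a 0 = 0"
 by(simp_all add: bterm_def split: option.split)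

lemma bmul_superset: assumes "finite X" "keys x <= X" "finite Y" "keys y <= Y"
 shows "bmul m x y = (\<Sum>p\<in>X. \<Sum>q\<in>Y. bterm m p q (lookup x p) (lookup y q))"
proof -
 have "bmul m x y = (\<Sum>p\<in>keys x. \<Sum>q\<in>Y. bterm m p q (lookup x p) (lookup y q))"
  unfolding bmul_def
  by(intro sum.cong refl sum.mono_neutral_left) (use assms in "auto simp: in_keys_iff")
 also have "... = (\<Sum>p\<in>X. \<Sum>q\<in>Y. bterm m p q (lookup x p) (lookup y q))"
  by(intro sum.mono_neutral_left) (use assms in "auto simp: in_keys_iff")
 finally show ?thesis .
qed

lemma bterm_add: "bterm m p q (a + a') b = bterm m p q a b + bterm m p q a' b"
  "bterm m p q a (b + b') = bterm m p q a b + bterm m p q a b'"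
 by(simp_all add: bterm_def single_add distrib_left distrib_right split: option.split)

lemma bmul_add_left: "bmul m (x + x') y = bmul m x y + bmul m x' y"
proof -
 let ?X = "keys x Un keys x'"
 note s = bmul_superset[of ?X _ "keys y" y m]
 show ?thesis using s[of "x + x'"] s[of x] s[of x'] keys_add[of x x']
  by(simp add: lookup_add bterm_add sum.distrib)
qed

lemma bmul_add_right: "bmul m x (y + y') = bmul m x y + bmul m x y'"
proof -
 let ?Y = "keys y Un keys y'"
 note s = bmul_superset[of "keys x" x ?Y _ m]
 show ?thesis using s[of "y + y'"] s[of y] s[of y'] keys_add[of y y']
  by(simp add: lookup_add bterm_add sum.distrib)
qed

lemma bmul_zero [simp]: "bmul m 0 y = 0" "bmul m x 0 = 0" by(simp_all add: bmul_def)

lemma bmul_single: "bmul m (single p a) (single q b) = bterm m p q a b"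
 by(subst bmul_superset[of "{p}" _ "{q}"]) auto

lemma bmul_sum_left: "bmul m (\<Sum>i\<in>I. f i) y = (\<Sum>i\<in>I. bmul m (f i) y)"
 by(induction I rule: infinite_finite_induct) (auto simp: bmul_add_left)

lemma bmul_sum_right: "bmul m x (\<Sum>i\<in>I. f i) = (\<Sum>i\<in>I. bmul m x (f i))"
 by(induction I rule: infinite_finite_induct) (auto simp: bmul_add_right)

text \<open>Composition is partial, as for paths. The last two conditions make the sum over
  \<open>U\<close> a two-sided identity, because exactly one of its summands composes with a given
  basis element on each side; for words \<open>U\<close> is just the empty word.\<close>

locale basis_alg =
 fixes B U :: "'b set" and m :: "'b => 'b => 'b option" assumes units: "finite U" "U <= B"
  and closed: "p : B ==> q : B ==> m p q = Some w ==> w : B"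
  and assoc: "p : B ==> q : B ==> r : B ==>
   (case m p q of None => None | Some w => m w r) = (case m q r of None => None | Some w => m p w)"
  and left_unit: "p : B ==> EX u0:U. m u0 p = Some p & (ALL u:U. u ~= u0 --> m u p = None)"
  and right_unit: "p : B ==> EX u0:U. m p u0 = Some p & (ALL u:U. u ~= u0 --> m p u = None)"
begin

lemma keys_bterm: "p : B ==> q : B ==> keys (bterm m p q a b) <= B"
 using closed[of p q] by(cases "m p q") (simp_all add: bterm_def)

lemma keys_bmul: assumes "keys x <= B" "keys y <= B" shows "keys (bmul m x y) <= B"
 unfolding bmul_def using assms
 by(intro order_trans[OF keys_sum] UN_least order_trans[OF keys_sum] keys_bterm) auto

lemma bterm_assoc: assumes "p : B" "q : B" "r : B"
 shows "bmul m (bterm m p q a b) (single r c) = bmul m (single p a) (bterm m q r b c)"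
 using assoc[OF assms] by(auto simp: bterm_def bmul_single mult.assoc split: option.splits)

lemma bmul_assoc: assumes "keys x <= B" "keys y <= B" "keys z <= B"
 shows "bmul m (bmul m x y) z = bmul m x (bmul m y z)" using assms(1)
proof (induction x rule: span_induct)
 case (single p a)
 show ?case using assms(2)
 proof (induction y rule: span_induct)
  case (single q b)
  show ?case using assms(3)
  proof (induction z rule: span_induct)
   case (single r c)
   thus ?case using \<open>p : B\<close> \<open>q : B\<close> by(simp add: bmul_single bterm_assoc)
  qed (simp_all add: bmul_add_right)
 qed (simp_all add: bmul_add_left bmul_add_right)
qed (simp_all add: bmul_add_left)

lemma bmul_one: assumes "keys x <= B"
 shows "bmul m (\<Sum>u\<in>U. single u 1) x = x" "bmul m x (\<Sum>u\<in>U. single u 1) = x"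
proof -
 show "bmul m (\<Sum>u\<in>U. single u 1) x = x" using assms
 proof (induction x rule: span_induct)
  case (single p c)
  obtain u0 where u0: "u0 : U" "m u0 p = Some p" "!!u. u : U ==> u ~= u0 ==> m u p = None"
   using left_unit[OF single] by blast
  have "bmul m (\<Sum>u\<in>U. single u 1) (single p c) = (\<Sum>u\<in>U. bterm m u p 1 c)"
   by(simp add: bmul_sum_left bmul_single)
  also have "... = (\<Sum>u\<in>U. if u = u0 then single p c else 0)"
   by(rule sum.cong) (use u0 in "auto simp: bterm_def")
  finally show ?case using u0(1) units(1) by simp
 qed (simp_all add: bmul_add_right)
 show "bmul m x (\<Sum>u\<in>U. single u 1) = x" using assms
 proof (induction x rule: span_induct)
  case (single p c)
  obtain u0 where u0: "u0 : U" "m p u0 = Some p" "!!u. u : U ==> u ~= u0 ==> m p u = None"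
   using right_unit[OF single] by blast
  have "bmul m (single p c) (\<Sum>u\<in>U. single u 1) = (\<Sum>u\<in>U. bterm m p u c 1)"
   by(simp add: bmul_sum_right bmul_single)
  also have "... = (\<Sum>u\<in>U. if u = u0 then single p c else 0)"
   by(rule sum.cong) (use u0 in "auto simp: bterm_def")
  finally show ?case using u0(1) units(1) by simp
 qed (simp_all add: bmul_add_left)
qed

lemma keys_one: "keys (\<Sum>u\<in>U. single u (1::'k::field)) <= B"
 using units by(intro order_trans[OF keys_sum] UN_least) auto

lemma ring_basis_algebra: "ring (basis_algebra B U m :: ('b \<Rightarrow>\<^sub>0 'k::field) ring)"
proof (rule ringI)
 let ?A = "basis_algebra B U m :: ('b \<Rightarrow>\<^sub>0 'k::field) ring"
 have ka: "keys (x + y) <= B" if "keys x <= B" "keys y <= B"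
  for x y :: "'b \<Rightarrow>\<^sub>0 'k" using that keys_add[of x y] by auto
 show "abelian_group ?A"
 proof (rule abelian_groupI)
  show "EX y:car ?A. y \<oplus>_{?A} x = \<zero>_{?A}" if "x : car ?A" for x
   using that by(intro bexI[of _ "- x"]) (auto simp: basis_algebra_simps)
 qed (auto simp: basis_algebra_simps ka add.assoc add.commute)
 show "Group.monoid ?A"
  by(rule monoidI) (auto simp: basis_algebra_simps keys_bmul bmul_assoc bmul_one keys_one)
qed (auto simp: basis_algebra_simps bmul_add_left bmul_add_right)

lemma basis_algebra_hom:
 fixes phi :: "('b \<Rightarrow>\<^sub>0 'k::field) => 'r" and S :: "('r,'s) ring_scheme"
 assumes S: "ring S" and cl: "!!x. keys x <= B ==> phi x : car S"
  and add: "!!x y. keys x <= B ==> keys y <= B ==> phi (x + y) = phi x \<oplus>_{S} phi y"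
  and mult: "!!p q a b. p : B ==> q : B ==>
    phi (bterm m p q a b) = phi (single p a) \<otimes>_{S} phi (single q b)"
  and one: "phi (\<Sum>u\<in>U. single u 1) = \<one>_{S}"
 shows "phi : ring_hom (basis_algebra B U m) S"
proof (rule ring_hom_memI)
 interpret S: ring S by fact
 have z: "phi 0 = \<zero>_{S}"
 proof -
  have "phi 0 \<oplus>_{S} phi 0 = phi 0" using add[of 0 0] by simp
  thus ?thesis using cl[of 0] S.add.r_cancel_one by auto
 qed
 fix x y :: "'b \<Rightarrow>\<^sub>0 'k" assume "x : car (basis_algebra B U m)" "y : car (basis_algebra B U m)"
 hence xy: "keys x <= B" "keys y <= B" by(auto simp: basis_algebra_simps)
 have "phi (bmul m x y) = phi x \<otimes>_{S} phi y" using xy(1)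
 proof (induction x rule: span_induct)
  case (single p a)
  have kp: "keys (single p a) <= B" using single by auto
  show ?case using xy(2)
  proof (induction y rule: span_induct)
   case zero
   thus ?case using cl[OF kp] z by simp
  next
   case (single q b)
   thus ?case using \<open>p : B\<close> by(simp add: bmul_single mult)
  next
   case (add x' y')
   thus ?case using cl kp keys_bmul[OF kp] assms(3) by(simp add: bmul_add_right S.r_distr)
  qed
 next
  case (add x' y')
  thus ?case using cl xy(2) keys_bmul[OF add.hyps(1) xy(2)] keys_bmul[OF add.hyps(2) xy(2)] assms(3)
  by(simp add: bmul_add_left S.l_distr)
 qed (use z cl xy in simp)
 thus "phi (x \<otimes>_{basis_algebra B U m} y) = phi x \<otimes>_{S} phi y" by(simp add: basis_algebra_simps)
qed (use cl add one in "auto simp: basis_algebra_simps")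

end

section \<open>Modules over algebras with a multiplicative basis\<close>

lemma mk_module_simps [simp]:
 "car (mk_module C z pl sm) = C" "\<zero>_{mk_module C z pl sm} = z"
 "x \<oplus>_{mk_module C z pl sm} y = pl x y" "a \<odot>_{mk_module C z pl sm} x = sm a x"
 by(simp_all add: mk_module_def)

lemma abelian_group_mk_module: assumes "abelian_group M"
 shows "abelian_group (mk_module (car M) \<zero>_{M} (%x y. x \<oplus>_{M} y) s)"
proof -
 interpret abelian_group M by fact
 show ?thesis
 proof (rule abelian_groupI)
  show "EX y:car (mk_module (car M) \<zero>_{M} (%x y. x \<oplus>_{M} y) s).
    y \<oplus>_{mk_module (car M) \<zero>_{M} (%x y. x \<oplus>_{M} y) s} x
    = \<zero>_{mk_module (car M) \<zero>_{M} (%x y. x \<oplus>_{M} y) s}"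
   if "x : car (mk_module (car M) \<zero>_{M} (%x y. x \<oplus>_{M} y) s)" for x
   using that by(intro bexI[of _ "\<ominus>_{M} x"]) (auto simp: l_neg)
 qed (auto simp: a_ac)
qed

text \<open>Operators for the basis elements extend to a module over the algebra once undefined
  products act as zero. It is used to turn operators for the generators of L(E) into a module over
  the free algebra on them.\<close>

locale basis_action = basis_alg B U m + kspace M sc
 for B U :: "'b set" and m and M :: "('m,'z) ring_scheme" (structure) and sc :: "'k::field => 'm => 'm" +
 fixes opr :: "'b => 'm => 'm" assumes opr_closed [simp]: "p : B ==> x : car M ==> opr p x : car M"
  and opr_add: "p : B ==> x : car M ==> y : car M ==> opr p (x \<oplus> y) = opr p x \<oplus> opr p y"
  and opr_sc: "p : B ==> x : car M ==> opr p (sc c x) = sc c (opr p x)"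
  and opr_mult: "p : B ==> q : B ==> x : car M ==>
   opr p (opr q x) = (case m p q of None => \<zero> | Some w => opr w x)"
  and opr_one: "x : car M ==> (\<Oplus>u\<in>U. opr u x) = x"
begin

definition act :: "('b \<Rightarrow>\<^sub>0 'k) => 'm => 'm" where
 "act a x = (\<Oplus>p\<in>keys a. sc (lookup a p) (opr p x))"

lemma act_superset: assumes "finite X" "keys a <= X" "X <= B" "x : car M"
 shows "act a x = (\<Oplus>p\<in>X. sc (lookup a p) (opr p x))" unfolding act_def
 by(rule add.finprod_mono_neutral_cong_left) (use assms in "auto simp: in_keys_iff")

lemma act_closed: "keys a <= B ==> x : car M ==> act a x : car M"
 unfolding act_def by(rule finsum_closed) auto

lemma act_plus: assumes "keys a <= B" "keys b <= B" "x : car M"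
 shows "act (a + b) x = act a x \<oplus> act b x"
proof -
 let ?X = "keys a Un keys b"
 have B: "?X <= B" "finite ?X" using assms by auto
 have f: "(%p. sc (lookup c p) (opr p x)) : ?X \<rightarrow> car M" for c :: "'b \<Rightarrow>\<^sub>0 'k"
  using B assms by auto
 have "act (a + b) x = (\<Oplus>p\<in>?X. sc (lookup (a + b) p) (opr p x))"
  by(rule act_superset) (use B assms keys_add[of a b] in auto)
 also have "... = (\<Oplus>p\<in>?X. sc (lookup a p) (opr p x) \<oplus> sc (lookup b p) (opr p x))"
  by(rule add.finprod_cong') (use B assms f in "auto simp: lookup_add sc_plus")
 also have "... = act a x \<oplus> act b x"
  using act_superset[of ?X a x] act_superset[of ?X b x] B assms finsum_addf[OF f f] by simp
 finally show ?thesis .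
qed

lemma act_zero [simp]: "act 0 x = \<zero>" unfolding act_def by simp

lemma act_single: "p : B ==> x : car M ==> act (single p c) x = sc c (opr p x)"
 using act_superset[of "{p}" "single p c" x] by simp

lemma act_linear: assumes "keys a <= B" "x : car M" "y : car M"
 shows "act a (x \<oplus> y) = act a x \<oplus> act a y" "act a (sc c x) = sc c (act a x)"
proof -
 show "act a (x \<oplus> y) = act a x \<oplus> act a y" using assms(1)
 proof (induction a rule: span_induct)
  case (add a b)
  thus ?case using assms by(simp add: act_plus act_closed a_ac)
 qed (use assms in "simp_all add: act_single opr_add sc_add")
 show "act a (sc c x) = sc c (act a x)" using assms(1)
 proof (induction a rule: span_induct)
  case (single p d)
  have "sc d (sc c (opr p x)) = sc c (sc d (opr p x))"
   using single assms by(simp add: mult.commute flip: sc_times)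
  thus ?case using single assms by(simp add: act_single opr_sc)
 qed (use assms in "simp_all add: act_plus act_closed sc_add")
qed

lemma act_mult: assumes "keys a <= B" "keys b <= B" "x : car M"
 shows "act (bmul m a b) x = act a (act b x)" using assms(1)
proof (induction a rule: span_induct)
 case (single p c)
 have kp: "keys (single p c) <= B" using single by auto
 show ?case using assms(2)
 proof (induction b rule: span_induct)
  case zero
  thus ?case using single by(simp add: act_single opr_sc[of p \<zero> 0, simplified])
 next
  case (single q d)
  have "act (bterm m p q c d) x = sc (c * d) (opr p (opr q x))"
   using opr_mult[OF \<open>p : B\<close> \<open>q : B\<close> assms(3)] closed[OF \<open>p : B\<close> \<open>q : B\<close>] assms(3)
   by(cases "m p q") (simp_all add: bterm_def act_single)
  thus ?case
   using \<open>p : B\<close> \<open>q : B\<close> assms(3) by(simp add: bmul_single act_single opr_sc sc_times)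
 next
  case (add a' b')
  thus ?case using keys_bmul[OF kp] kp assms(3)
   by(simp add: bmul_add_right act_plus act_linear act_closed)
 qed
next
 case (add a' b')
 thus ?case using keys_bmul[OF add.hyps(1) assms(2)] keys_bmul[OF add.hyps(2) assms(2)] assms(2,3)
  by(simp add: bmul_add_left act_plus act_closed)
qed simp

lemma act_one: assumes "x : car M" shows "act (\<Sum>u\<in>U. single u 1) x = x"
proof -
 have "act (\<Sum>u\<in>U. single u 1) x
   = (\<Oplus>p\<in>U. sc (lookup (\<Sum>u\<in>U. single u (1::'k)) p) (opr p x))"
  by(rule act_superset) (use units assms keys_sum[of "%u. single u (1::'k)" U] in auto)
 also have "... = (\<Oplus>p\<in>U. opr p x)" by(rule add.finprod_cong')
   (use units assms in "auto simp: lookup_sum lookup_single when_def")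
 finally show ?thesis using opr_one[OF assms] by simp
qed

lemma left_module_act:
 "left_module (basis_algebra B U m) (mk_module (car M) \<zero> (%x y. x \<oplus> y) act)"
proof -
 let ?N = "mk_module (car M) \<zero> (%x y. x \<oplus> y) act :: ('b \<Rightarrow>\<^sub>0 'k,'m) module"
 have "abelian_group ?N" by(rule abelian_group_mk_module) (rule abelian_group_axioms)
 thus ?thesis using ring_basis_algebra[where 'k = 'k]
  unfolding left_module_def left_module_axioms_def
  by(auto simp: basis_algebra_simps act_closed act_plus act_linear act_mult act_one)
qed

end

section \<open>Path algebras and Leavitt path algebras\<close>

lemma basis_alg_lists: "basis_alg (lists Y) {[]} (%u v. Some (u @ v))" by unfold_locales auto

lemma (in wf_digraph) paths_iff: "(u, p, v) : paths G <-> awalk u p v" by(simp add: paths_def)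

lemma (in fin_digraph) basis_alg_paths:
 "basis_alg (paths G) ((%v. (v, [], v)) ` verts G) path_concat"
proof
 show "EX u0:(%v. (v, [], v)) ` verts G. path_concat u0 p = Some p
   & (ALL u:(%v. (v, [], v)) ` verts G. u ~= u0 --> path_concat u p = None)"
  if p: "p : paths G" for p
 proof -
  obtain u a v where a: "p = (u, a, v)" by(cases p)
  hence "u : verts G" using p by(auto simp: paths_iff)
  thus ?thesis using a by(intro bexI[of _ "(u, [], u)"]) (auto simp: path_concat_def)
 qed
 show "EX u0:(%v. (v, [], v)) ` verts G. path_concat p u0 = Some p
   & (ALL u:(%v. (v, [], v)) ` verts G. u ~= u0 --> path_concat p u = None)"
  if p: "p : paths G" for p
 proof -
  obtain u a v where a: "p = (u, a, v)" by(cases p)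
  hence "v : verts G" using p by(auto simp: paths_iff)
  thus ?thesis using a by(intro bexI[of _ "(v, [], v)"]) (auto simp: path_concat_def)
 qed
 show "w : paths G" if "p : paths G" "q : paths G" "path_concat p q = Some w" for p q w
  using that by(cases p; cases q) (auto simp: path_concat_def paths_iff split: if_splits)
 show "(case path_concat p q of None => None | Some w => path_concat w r)
   = (case path_concat q r of None => None | Some w => path_concat p w)" for p q r :: "('a,'b) path"
  by(cases p; cases q; cases r) (auto simp: path_concat_def)
qed (auto simp: paths_iff awalk_Nil_iff)

lemma linear_extension_superset: assumes "finite X" "keys x <= X"
 shows "linear_extension f x = (\<Sum>p\<in>X. single (f p) (lookup x p))"
 unfolding linear_extension_def
 by(rule sum.mono_neutral_left) (use assms in "auto simp: in_keys_iff")

lemma linear_extension_add: "linear_extension f (x + y) = linear_extension f x + linear_extension f y"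
proof -
 let ?X = "keys x Un keys y"
 show ?thesis using linear_extension_superset[of ?X "x + y" f] linear_extension_superset[of ?X x f]
   linear_extension_superset[of ?X y f] keys_add[of x y]
  by(simp add: lookup_add single_add sum.distrib)
qed

lemma linear_extension_single [simp]:
 "linear_extension f (single p c) = single (f p) c"
 using linear_extension_superset[of "{p}" "single p c" f] by simp

lemma linear_extension_zero [simp]: "linear_extension f 0 = 0" by(simp add: linear_extension_def)

lemma keys_linear_extension: "keys (linear_extension f x) <= f ` keys x"
 unfolding linear_extension_def by(rule order_trans[OF keys_sum]) (auto split: if_splits)

section \<open>The Leavitt path algebra as a quotient of the free algebra\<close>

abbreviation lgen :: "('v,'e) pre_digraph => ('v,'e) leavitt_gen => ('v,'e,'k::field) leavitt_elem" where
 "lgen E g == leavitt_class E (word [g])"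

context fin_digraph
begin

abbreviation FA :: "('a,'b,'k::field) word_elem ring" where
 "FA == free_algebra (leavitt_gens G)"

abbreviation LA :: "('a,'b,'k::field) leavitt_ring" where
 "LA == leavitt_algebra G"

abbreviation "semb == scalar_embed G"
abbreviation "lcl == leavitt_class G"
abbreviation "lg == lgen G"

lemma FA_simps:
 "car FA = {x. keys x <= lists (leavitt_gens G)}"
 "x \<otimes>_{FA} y = bmul (%u v. Some (u @ v)) x y"
 "\<one>_{FA} = word []" "\<zero>_{FA} = 0" "x \<oplus>_{FA} y = x + y"
 by(simp_all add: free_algebra_def basis_algebra_simps)

lemma ring_FA: "ring (FA :: ('a,'b,'k::field) word_elem ring)"
 unfolding free_algebra_def by(rule basis_alg.ring_basis_algebra[OF basis_alg_lists])

lemma FA_minus: assumes "x : car (FA :: ('a,'b,'k::field) word_elem ring)"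
 shows "\<ominus>_{FA} x = - x"
proof -
 interpret ring "FA :: ('a,'b,'k) word_elem ring" by(rule ring_FA)
 show ?thesis by(rule minus_equality) (use assms in "simp_all add: FA_simps")
qed

lemma gens [simp]: "v : verts G ==> Vtx v : leavitt_gens G"
 "e : arcs G ==> Arr e : leavitt_gens G" "e : arcs G ==> Ghost e : leavitt_gens G"
 by(auto simp: leavitt_gens_def)

lemma word_in_FA: "set w <= leavitt_gens G ==> single w c : car FA" by(auto simp: FA_simps)

lemma FA_diff: "x : car FA ==> y : car FA ==> x - y : car (FA :: ('a,'b,'k::field) word_elem ring)"
 unfolding FA_simps using keys_diff[of x y] by blast

lemma FA_sum: "(!!i. i : I ==> f i : car FA) ==> (\<Sum>i\<in>I. f i) : car (FA :: ('a,'b,'k::field) word_elem ring)"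
 unfolding FA_simps using keys_sum[of f I] by blast

lemma zero_in_FA: "0 : car FA" by(simp add: FA_simps)

lemma leavitt_relations_subset:
 "leavitt_relations G <= car (FA :: ('a,'b,'k::field) word_elem ring)"
 unfolding leavitt_relations_def by(auto intro!: FA_diff FA_sum word_in_FA zero_in_FA)

lemma ideal_leavitt: "ideal (leavitt_ideal G) (FA :: ('a,'b,'k::field) word_elem ring)"
 unfolding leavitt_ideal_def by(rule ring.genideal_ideal[OF ring_FA leavitt_relations_subset])

lemma ring_LA: "ring (LA :: ('a,'b,'k::field) leavitt_ring)"
 unfolding leavitt_algebra_def by(rule ideal.quotient_is_ring[OF ideal_leavitt])

lemma leavitt_class_hom:
 "lcl : ring_hom FA (LA :: ('a,'b,'k::field) leavitt_ring)"
 unfolding leavitt_algebra_def leavitt_class_def[abs_def]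
 by(rule ideal.rcos_ring_hom[OF ideal_leavitt])

lemma leavitt_class_surj:
 "car (LA :: ('a,'b,'k::field) leavitt_ring) = lcl ` car FA"
 unfolding leavitt_algebra_def FactRing_def leavitt_class_def[abs_def]
 by(auto simp: A_RCOSETS_def' )

lemma leavitt_class_eq_iff: assumes "x : car FA" "y : car (FA :: ('a,'b,'k::field) word_elem ring)"
 shows "lcl x = lcl y <-> x - y : leavitt_ideal G"
proof -
 interpret ideal "leavitt_ideal G" "FA :: ('a,'b,'k) word_elem ring" by(rule ideal_leavitt)
 have "x \<ominus>_{FA} y = x - y" using assms FA_minus by(simp add: a_minus_def FA_simps)
 thus ?thesis unfolding leavitt_class_def using quotient_eq_iff_same_a_r_cos[OF ideal_leavitt assms] by simp
qed

lemma leavitt_class_add: assumes "x : car FA" "y : car FA"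
 shows "lcl (x + y) = lcl x \<oplus>_{LA} lcl (y :: ('a,'b,'k::field) word_elem)"
 using ring_hom_add[OF leavitt_class_hom assms] by(simp add: FA_simps)

lemma leavitt_class_mult: assumes "x : car FA" "y : car FA"
 shows "lcl (bmul (%u v. Some (u @ v)) x y)
  = lcl x \<otimes>_{LA} lcl (y :: ('a,'b,'k::field) word_elem)"
 using ring_hom_mult[OF leavitt_class_hom assms] by(simp add: FA_simps)

lemma leavitt_class_one: "lcl (word []) = \<one>_{LA :: ('a,'b,'k::field) leavitt_ring}"
 using ring_hom_one[OF leavitt_class_hom] by(simp add: FA_simps)

lemma leavitt_class_zero: "lcl 0 = \<zero>_{LA :: ('a,'b,'k::field) leavitt_ring}"
 using ring_hom_zero[OF leavitt_class_hom ring_FA ring_LA] by(simp add: FA_simps)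

lemma leavitt_class_closed: "x : car FA ==> lcl x : car (LA :: ('a,'b,'k::field) leavitt_ring)"
 using leavitt_class_surj by auto

lemma leavitt_class_append: assumes "set w <= leavitt_gens G" "set w' <= leavitt_gens G"
 shows "lcl (single (w @ w') (c * d)) =
  lcl (single w c) \<otimes>_{LA} lcl (single w' (d :: 'k::field))"
 using leavitt_class_mult[OF word_in_FA word_in_FA, OF assms, of c d] by(simp add: bmul_single bterm_def)

lemma leavitt_class_relation:
 assumes "x - y : leavitt_relations G" "x : car FA" "y : car (FA :: ('a,'b,'k::field) word_elem ring)"
 shows "lcl x = lcl y" using ring.genideal_self[OF ring_FA leavitt_relations_subset] assms
 unfolding leavitt_class_eq_iff[OF assms(2,3)] leavitt_ideal_def by auto

lemma leavitt_class_sum: assumes "finite I" "!!i. i : I ==> f i : car FA"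
 shows "lcl (\<Sum>i\<in>I. f i) = (\<Oplus>_{LA :: ('a,'b,'k::field) leavitt_ring}i\<in>I. lcl (f i))"
 using assms
proof (induction I rule: finite_induct)
 case empty
 interpret L: ring "LA :: ('a,'b,'k) leavitt_ring" by(rule ring_LA)
 show ?case by(simp add: leavitt_class_zero)
next
 case (insert i I)
 interpret L: ring "LA :: ('a,'b,'k) leavitt_ring" by(rule ring_LA)
 have "(\<Sum>i\<in>I. f i) : car FA" by(rule FA_sum) (use insert.prems in simp)
 moreover have "(%i. lcl (f i)) : I \<rightarrow> car LA"
  using insert.prems leavitt_class_closed by auto
 ultimately show ?case
  using insert by(simp add: leavitt_class_add L.finsum_insert leavitt_class_closed)
qed

lemma scalar_embed_closed [simp]: "semb c : car (LA :: ('a,'b,'k::field) leavitt_ring)"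
 unfolding scalar_embed_def by(intro leavitt_class_closed word_in_FA) simp

lemma lgen_closed [simp]: "g : leavitt_gens G ==> lg g : car (LA :: ('a,'b,'k::field) leavitt_ring)"
 by(intro leavitt_class_closed word_in_FA) simp

lemma scalar_embed_ring:
 "semb (c + d) = semb c \<oplus>_{LA} semb (d :: 'k::field)"
 "semb (c * d) = semb c \<otimes>_{LA} semb d"
 "semb 1 = \<one>_{LA :: ('a,'b,'k) leavitt_ring}"
 "semb 0 = \<zero>_{LA :: ('a,'b,'k) leavitt_ring}"
 using leavitt_class_append[of "[]" "[]" c d] leavitt_class_add[OF word_in_FA word_in_FA, of "[]" "[]" c d]
 by(simp_all add: scalar_embed_def leavitt_class_one leavitt_class_zero single_add)

lemma leavitt_class_single: assumes "set w <= leavitt_gens G"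
 shows "lcl (single w c) = semb c \<otimes>_{LA} lcl (word w :: ('a,'b,'k::field) word_elem)"
  "lcl (single w c) = lcl (word w) \<otimes>_{LA} semb (c :: 'k)"
 using leavitt_class_append[of "[]" w c "1::'k"] leavitt_class_append[of w "[]" "1::'k" c] assms
 by(simp_all add: scalar_embed_def)

lemma word_Cons: assumes "g : leavitt_gens G" "set w <= leavitt_gens G"
 shows "lcl (word (g # w)) = lg g \<otimes>_{LA} lcl (word w :: ('a,'b,'k::field) word_elem)"
 using leavitt_class_append[of "[g]" w "1::'k" "1::'k"] assms by simp

text \<open>Each class is a linear combination of words. Scalars form a base case of their own
  because vertices, arrows and ghost arrows generate L(E) as a k-algebra and not as a ring.\<close>

lemma leavitt_induct [consumes 1, case_names scalar gen add mult]:
 assumes x: "x : car (LA :: ('a,'b,'k::field) leavitt_ring)"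
  and sca: "!!c. P (semb c)" and gen: "!!g. g : leavitt_gens G ==> P (lg g)"
  and add: "!!x y. x : car LA ==> y : car LA ==> P x ==> P y ==> P (x \<oplus>_{LA} y)"
  and mult: "!!x y. x : car LA ==> y : car LA ==> P x ==> P y ==> P (x \<otimes>_{LA} y)"
 shows "P x"
proof -
 obtain a where a: "keys a <= lists (leavitt_gens G)" "x = lcl a"
  using x unfolding leavitt_class_surj FA_simps by blast
 have w: "P (lcl (word w))" if "set w <= leavitt_gens G" for w using that
 proof (induction w)
  case Nil
  thus ?case using sca[of 1] by(simp add: scalar_embed_def)
 next
  case (Cons g w)
  hence gw: "g : leavitt_gens G" "set w <= leavitt_gens G" by auto
  have "P (lg g \<otimes>_{LA} lcl (word w))"
   by(rule mult[OF lgen_closed leavitt_class_closed[OF word_in_FA] gen Cons.IH]) (fact gw)+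
  thus ?case by(subst word_Cons[OF gw])
 qed
 have "P (lcl a)" using a(1)
 proof (induction a rule: span_induct)
  case zero
  thus ?case using sca[of 0] by(simp add: scalar_embed_def)
 next
  case (single p c)
  hence p: "set p <= leavitt_gens G" by auto
  hence "P (semb c \<otimes>_{LA} lcl (word p))"
   by(intro mult[OF scalar_embed_closed leavitt_class_closed[OF word_in_FA] sca w]) auto
  thus ?case unfolding leavitt_class_single(1)[OF p, of c] .
 next
  case (add x y)
  thus ?case using assms(4)[of "lcl x" "lcl y"]
   by(simp add: leavitt_class_add leavitt_class_closed FA_simps)
 qed
 thus ?thesis using a by simp
qed

lemma scalar_central: assumes "x : car (LA :: ('a,'b,'k::field) leavitt_ring)"
 shows "semb c \<otimes>_{LA} x = x \<otimes>_{LA} semb c" using assms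
proof (induction x rule: leavitt_induct)
 interpret L: ring "LA :: ('a,'b,'k) leavitt_ring" by(rule ring_LA)
 case (scalar d)
 thus ?case by(metis mult.commute scalar_embed_ring(2))
next
 case (gen g)
 thus ?case using leavitt_class_single[of "[g]" c] by simp
next
 interpret L: ring "LA :: ('a,'b,'k) leavitt_ring" by(rule ring_LA)
 case (add x y)
 thus ?case by(simp add: L.l_distr L.r_distr)
next
 interpret L: ring "LA :: ('a,'b,'k) leavitt_ring" by(rule ring_LA)
 case (mult x y)
 thus ?case by(metis L.m_assoc scalar_embed_closed)
qed

end

section \<open>Modules over Leavitt path algebras and path algebras\<close>

lemma (in abelian_group) eq_if_minus_eq_zero:
 assumes "x : car G" "y : car G" "x \<ominus> y = \<zero>" shows "x = y"
proof -
 have "x = (x \<ominus> y) \<oplus> y" using assms(1,2) by(simp add: a_minus_def a_assoc l_neg)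
 thus ?thesis using assms by simp
qed

context left_module
begin

lemma smult_l_null [simp]: assumes "x : car M" shows "\<zero>_{R} \<odot>_{M} x = \<zero>_{M}"
proof -
 have "\<zero>_{R} \<odot>_{M} x \<oplus>_{M} \<zero>_{R} \<odot>_{M} x = \<zero>_{R} \<odot>_{M} x"
  using smult_l_distr[of "\<zero>_{R}" "\<zero>_{R}" x] assms by simp
 thus ?thesis using smult_closed[of "\<zero>_{R}" x] assms M.add.r_cancel_one by auto
qed

lemma smult_r_null [simp]: assumes "a : car R" shows "a \<odot>_{M} \<zero>_{M} = \<zero>_{M}"
proof -
 have "a \<odot>_{M} \<zero>_{M} \<oplus>_{M} a \<odot>_{M} \<zero>_{M} = a \<odot>_{M} \<zero>_{M}"
  using smult_r_distr[of a "\<zero>_{M}" "\<zero>_{M}"] assms by simp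
 thus ?thesis using smult_closed[of a "\<zero>_{M}"] assms M.add.r_cancel_one by auto
qed

lemma smult_l_minus: assumes "a : car R" "x : car M"
 shows "(\<ominus>_{R} a) \<odot>_{M} x = \<ominus>_{M} (a \<odot>_{M} x)"
proof -
 have "(\<ominus>_{R} a) \<odot>_{M} x \<oplus>_{M} a \<odot>_{M} x = \<zero>_{M}"
  using smult_l_distr[of "\<ominus>_{R} a" a x] assms by(simp add: R.l_neg)
 thus ?thesis using assms smult_closed by(simp add: M.minus_equality)
qed

lemma smult_finsum_l: assumes "x : car M" "!!i. i : I ==> a i : car R"
 shows "(\<Oplus>_{R}i\<in>I. a i) \<odot>_{M} x = (\<Oplus>_{M}i\<in>I. a i \<odot>_{M} x)"
 using assms(2)
proof (induction I rule: infinite_finite_induct)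
 case (insert i I)
 have "a : I \<rightarrow> car R" "(%i. a i \<odot>_{M} x) : I \<rightarrow> car M"
  using insert.prems assms(1) smult_closed by auto
 thus ?case using insert assms(1) by(simp add: smult_l_distr smult_closed)
qed (use assms in simp_all)

lemma smult_finsum_r: assumes "a : car R" "!!i. i : I ==> x i : car M"
 shows "a \<odot>_{M} (\<Oplus>_{M}i\<in>I. x i) = (\<Oplus>_{M}i\<in>I. a \<odot>_{M} x i)"
 using assms(2)
proof (induction I rule: infinite_finite_induct)
 case (insert i I)
 have "x : I \<rightarrow> car M" "(%i. a \<odot>_{M} x i) : I \<rightarrow> car M"
  using insert.prems assms(1) smult_closed by auto
 thus ?case using insert assms(1) by(simp add: smult_r_distr smult_closed)
qed (use assms in simp_all)

lemma annihilator_ideal: "ideal {a : car R. ALL x:car M. a \<odot>_{M} x = \<zero>_{M}} R"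
proof (rule idealI)
 show "ring R" by(rule R.ring_axioms)
 show "subgroup {a : car R. ALL x:car M. a \<odot>_{M} x = \<zero>_{M}} (add_monoid R)"
  by(rule R.subgrpI) (auto simp: smult_l_distr smult_l_minus)
qed (auto simp: smult_assoc smult_closed)

text \<open>A coset acts as a chosen representative; two representatives differ by an element of
  \<open>I\<close>, which kills the module, so the choice does not show.\<close>

lemma quotient_module:
 assumes I: "ideal I R" and ann: "!!a x. a : I ==> x : car M ==> a \<odot>_{M} x = \<zero>_{M}"
 shows "EX s. left_module (R Quot I) (mk_module (car M) \<zero>_{M} (%x y. x \<oplus>_{M} y) s)
  & (ALL a:car R. ALL x:car M. s (I +>_{R} a) x = a \<odot>_{M} x)"
proof -
 interpret I: ideal I R by fact
 define s where "s C x = (SOME a. a : car R & C = I +>_{R} a) \<odot>_{M} x" for C and x :: 'm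
 have s: "s (I +>_{R} a) x = a \<odot>_{M} x" if a: "a : car R" and x: "x : car M" for a x
 proof -
  let ?b = "SOME b. b : car R & I +>_{R} a = I +>_{R} b"
  have b: "?b : car R & I +>_{R} a = I +>_{R} ?b" by(rule someI[of _ a]) (simp add: a)
  hence "a \<ominus>_{R} ?b : I" using R.quotient_eq_iff_same_a_r_cos[OF I a] by blast
  hence "(a \<ominus>_{R} ?b) \<odot>_{M} x = \<zero>_{M}" using ann x by blast
  hence "a \<odot>_{M} x \<ominus>_{M} ?b \<odot>_{M} x = \<zero>_{M}"
   using a b x by(simp add: a_minus_def smult_l_distr smult_l_minus)
  hence "a \<odot>_{M} x = ?b \<odot>_{M} x" using M.eq_if_minus_eq_zero smult_closed a b x by blast
  thus ?thesis unfolding s_def by simp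
 qed
 have rep: "EX a:car R. C = I +>_{R} a" if "C : car (R Quot I)" for C
  using that by(auto simp: FactRing_simps)
 let ?N = "mk_module (car M) \<zero>_{M} (%x y. x \<oplus>_{M} y) s"
 have "left_module (R Quot I) ?N" unfolding left_module_def left_module_axioms_def
 proof (intro conjI allI impI)
  show "ring (R Quot I)" by(rule I.quotient_is_ring)
  show "abelian_group ?N" by(rule abelian_group_mk_module) (rule M.abelian_group_axioms)
  show "a \<odot>_{?N} x : car ?N" if ax: "a : car (R Quot I)" "x : car ?N" for a x
   using rep[OF ax(1)] ax(2) by(auto simp: s smult_closed)
  show "(a \<oplus>_{R Quot I} b) \<odot>_{?N} x = a \<odot>_{?N} x \<oplus>_{?N} b \<odot>_{?N} x"
   if ax: "a : car (R Quot I)" "b : car (R Quot I)" "x : car ?N" for a b x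
   using rep[OF ax(1)] rep[OF ax(2)] ax(3) by(auto simp: s FactRing_def I.a_rcos_sum smult_l_distr)
  show "a \<odot>_{?N} (x \<oplus>_{?N} y) = a \<odot>_{?N} x \<oplus>_{?N} a \<odot>_{?N} y"
   if ax: "a : car (R Quot I)" "x : car ?N" "y : car ?N" for a x y
   using rep[OF ax(1)] ax(2,3) by(auto simp: s smult_r_distr)
  show "(a \<otimes>_{R Quot I} b) \<odot>_{?N} x = a \<odot>_{?N} (b \<odot>_{?N} x)"
   if ax: "a : car (R Quot I)" "b : car (R Quot I)" "x : car ?N" for a b x
   using rep[OF ax(1)] rep[OF ax(2)] ax(3)
   by(auto simp: s FactRing_def I.rcoset_mult_add smult_assoc smult_closed)
  show "\<one>_{R Quot I} \<odot>_{?N} x = x" if "x : car ?N" for x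
   using that by(simp add: FactRing_def s smult_one)
 qed
 thus ?thesis using s by blast
qed

end

section \<open>Restriction of scalars, and Leavitt modules versus operators\<close>

lemma restrict_scalars_simps [simp]:
 "car (restrict_scalars h M) = car M" "\<zero>_{restrict_scalars h M} = \<zero>_{M}"
 "x \<oplus>_{restrict_scalars h M} y = x \<oplus>_{M} y" "a \<odot>_{restrict_scalars h M} x = h a \<odot>_{M} x"
 by(simp_all add: restrict_scalars_def)

lemma restrict_scalars_module:
 fixes M :: "('r,'m) module" assumes "left_module R M" "ring S" "h : ring_hom S R"
 shows "left_module S (restrict_scalars h M)"
proof -
 interpret left_module R M by fact
 interpret S: ring S by fact
 have "abelian_group (restrict_scalars h M)"
  unfolding restrict_scalars_def by(rule abelian_group_mk_module) (rule M.abelian_group_axioms)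
 thus ?thesis unfolding left_module_def left_module_axioms_def
  using assms(2) ring_hom_closed[OF assms(3)]
  by(simp add: smult_closed smult_l_distr smult_r_distr smult_assoc smult_one
    ring_hom_add[OF assms(3)] ring_hom_mult[OF assms(3)] ring_hom_one[OF assms(3)])
qed

context fin_digraph
begin

lemma lgen_mult: assumes "g : leavitt_gens G" "h : leavitt_gens G"
 shows "lg g \<otimes>_{LA} lg h = lcl (word [g, h] :: ('a,'b,'k::field) word_elem)"
 by(rule word_Cons[of g "[h]", symmetric, where 'k = 'k]) (use assms in auto)

lemma leavitt_relationsI:
 "v : verts G ==> v' : verts G ==> word [Vtx v, Vtx v'] - (if v = v' then word [Vtx v] else 0) : leavitt_relations G"
 "(\<Sum>v\<in>verts G. word [Vtx v]) - word [] : leavitt_relations G"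
 "e : arcs G ==> word [Vtx (tail G e), Arr e] - word [Arr e] : leavitt_relations G"
 "e : arcs G ==> word [Arr e, Vtx (head G e)] - word [Arr e] : leavitt_relations G"
 "e : arcs G ==> word [Vtx (head G e), Ghost e] - word [Ghost e] : leavitt_relations G"
 "e : arcs G ==> word [Ghost e, Vtx (tail G e)] - word [Ghost e] : leavitt_relations G"
 "e : arcs G ==> e' : arcs G ==> word [Ghost e, Arr e'] - (if e = e' then word [Vtx (head G e)] else 0) : leavitt_relations G"
 "v : verts G ==> EX e:arcs G. tail G e = v ==>
  word [Vtx v] - (\<Sum>e\<in>{e : arcs G. tail G e = v}. word [Arr e, Ghost e]) : leavitt_relations G"
 unfolding leavitt_relations_def Un_iff mem_Collect_eq by blast+

lemma leavitt_relation_simps: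
 "v : verts G ==> v' : verts G ==> lg (Vtx v) \<otimes>_{LA} lg (Vtx v')
  = (if v = v' then lg (Vtx v) else \<zero>_{LA :: ('a,'b,'k::field) leavitt_ring})"
 "e : arcs G ==> lg (Vtx (tail G e)) \<otimes>_{LA} lg (Arr e) = (lg (Arr e) :: ('a,'b,'k) leavitt_elem)"
 "e : arcs G ==> lg (Arr e) \<otimes>_{LA} lg (Vtx (head G e)) = (lg (Arr e) :: ('a,'b,'k) leavitt_elem)"
 "e : arcs G ==> lg (Vtx (head G e)) \<otimes>_{LA} lg (Ghost e) = (lg (Ghost e) :: ('a,'b,'k) leavitt_elem)"
 "e : arcs G ==> lg (Ghost e) \<otimes>_{LA} lg (Vtx (tail G e)) = (lg (Ghost e) :: ('a,'b,'k) leavitt_elem)"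
 "e : arcs G ==> e' : arcs G ==> lg (Ghost e) \<otimes>_{LA} lg (Arr e')
  = (if e = e' then lg (Vtx (head G e)) else \<zero>_{LA :: ('a,'b,'k) leavitt_ring})"
 "(\<Oplus>_{LA}v\<in>verts G. lg (Vtx v)) = \<one>_{LA :: ('a,'b,'k) leavitt_ring}"
 "v : verts G ==> EX e:arcs G. tail G e = v ==>
  (\<Oplus>_{LA}e\<in>{e : arcs G. tail G e = v}. lg (Arr e) \<otimes>_{LA} lg (Ghost e)) = (lg (Vtx v) :: ('a,'b,'k) leavitt_elem)"
proof -
 note rel = leavitt_class_relation[where 'k = 'k]
 show "lg (Vtx v) \<otimes>_{LA} lg (Vtx v')
  = (if v = v' then lg (Vtx v) else \<zero>_{LA :: ('a,'b,'k::field) leavitt_ring})"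
  if "v : verts G" "v' : verts G"
 proof -
  have "lcl (word [Vtx v, Vtx v']) = lcl (if v = v' then word [Vtx v] else (0 :: _ \<Rightarrow>\<^sub>0 'k))"
   by(rule rel[OF leavitt_relationsI(1)]) (use that in "auto intro!: word_in_FA zero_in_FA")
  thus ?thesis using that by(simp add: lgen_mult leavitt_class_zero split: if_splits)
 qed
 show "lg (Vtx (tail G e)) \<otimes>_{LA} lg (Arr e) = (lg (Arr e) :: ('a,'b,'k) leavitt_elem)" if "e : arcs G"
  by(subst lgen_mult) (use that in simp, use that in simp,
    rule rel[OF leavitt_relationsI(3)], use that in "auto intro!: word_in_FA")
 show "lg (Arr e) \<otimes>_{LA} lg (Vtx (head G e)) = (lg (Arr e) :: ('a,'b,'k) leavitt_elem)" if "e : arcs G"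
  by(subst lgen_mult) (use that in simp, use that in simp,
    rule rel[OF leavitt_relationsI(4)], use that in "auto intro!: word_in_FA")
 show "lg (Vtx (head G e)) \<otimes>_{LA} lg (Ghost e) = (lg (Ghost e) :: ('a,'b,'k) leavitt_elem)" if "e : arcs G"
  by(subst lgen_mult) (use that in simp, use that in simp,
    rule rel[OF leavitt_relationsI(5)], use that in "auto intro!: word_in_FA")
 show "lg (Ghost e) \<otimes>_{LA} lg (Vtx (tail G e)) = (lg (Ghost e) :: ('a,'b,'k) leavitt_elem)" if "e : arcs G"
  by(subst lgen_mult) (use that in simp, use that in simp,
    rule rel[OF leavitt_relationsI(6)], use that in "auto intro!: word_in_FA")
 show "lg (Ghost e) \<otimes>_{LA} lg (Arr e')
  = (if e = e' then lg (Vtx (head G e)) else \<zero>_{LA :: ('a,'b,'k) leavitt_ring})"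
  if "e : arcs G" "e' : arcs G"
 proof -
  have "lcl (word [Ghost e, Arr e']) = lcl (if e = e' then word [Vtx (head G e)] else (0 :: _ \<Rightarrow>\<^sub>0 'k))"
   by(rule rel[OF leavitt_relationsI(7)]) (use that in "auto intro!: word_in_FA zero_in_FA")
  thus ?thesis using that by(simp add: lgen_mult leavitt_class_zero split: if_splits)
 qed
 have "lcl (\<Sum>v\<in>verts G. word [Vtx v]) = lcl (word [] :: _ \<Rightarrow>\<^sub>0 'k)"
  by(rule rel[OF leavitt_relationsI(2)]) (auto intro!: word_in_FA FA_sum)
 thus "(\<Oplus>_{LA}v\<in>verts G. lg (Vtx v)) = \<one>_{LA :: ('a,'b,'k) leavitt_ring}"
  by(simp add: leavitt_class_sum word_in_FA leavitt_class_one)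
 show "(\<Oplus>_{LA}e\<in>{e : arcs G. tail G e = v}. lg (Arr e) \<otimes>_{LA} lg (Ghost e)) = (lg (Vtx v) :: ('a,'b,'k) leavitt_elem)"
  if v: "v : verts G" "EX e:arcs G. tail G e = v"
 proof -
  have "lg (Vtx v) = lcl (\<Sum>e\<in>{e : arcs G. tail G e = v}. word [Arr e, Ghost e] :: _ \<Rightarrow>\<^sub>0 'k)"
   by(rule rel[OF leavitt_relationsI(8)]) (use v in "auto intro!: word_in_FA FA_sum")
  also have "... = (\<Oplus>_{LA :: ('a,'b,'k) leavitt_ring}e\<in>{e : arcs G. tail G e = v}. lcl (word [Arr e, Ghost e]))"
   by(rule leavitt_class_sum) (auto intro!: word_in_FA)
  also have "... = (\<Oplus>_{LA}e\<in>{e : arcs G. tail G e = v}. lg (Arr e) \<otimes>_{LA} lg (Ghost e))"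
  proof -
   interpret L: ring "LA :: ('a,'b,'k) leavitt_ring" by(rule ring_LA)
   show ?thesis by(rule L.add.finprod_cong') (auto simp: lgen_mult intro!: leavitt_class_closed word_in_FA)
  qed
  finally show ?thesis ..
 qed
qed

lemma leavitt_ops_of_module: assumes "left_module (LA :: ('a,'b,'k::field) leavitt_ring) M"
 shows "leavitt_ops M (%c x. semb (c :: 'k) \<odot>_{M} x) G (%v x. lg (Vtx v) \<odot>_{M} x)
  (%e x. lg (Arr e) \<odot>_{M} x) (%e x. lg (Ghost e) \<odot>_{M} x)"
proof -
 interpret left_module "LA :: ('a,'b,'k) leavitt_ring" M by fact
 note rs = leavitt_relation_simps[where 'k = 'k]
 have k: "kspace M (%c x. semb (c :: 'k) \<odot>_{M} x)" by unfold_locales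
   (auto simp: smult_closed smult_r_distr smult_l_distr smult_assoc smult_one scalar_embed_ring)
 have comm: "lg g \<odot>_{M} (semb c \<odot>_{M} x) = semb c \<odot>_{M} (lg g \<odot>_{M} x)"
  if "g : leavitt_gens G" "x : car M" for g x and c :: 'k
  using that scalar_central[of "lg g" c] by(simp flip: smult_assoc)
 have mult: "lg g \<odot>_{M} (lg h \<odot>_{M} x) = (lg g \<otimes>_{LA} lg h) \<odot>_{M} x"
  if "g : leavitt_gens G" "h : leavitt_gens G" "x : car M" for g h x
  using that by(simp add: smult_assoc)
 have s1: "(\<Oplus>_{M}v\<in>verts G. lg (Vtx v) \<odot>_{M} x) = x" if "x : car M" for x
  using that smult_finsum_l[of x "verts G" "%v. lg (Vtx v)"] rs(7) by(simp add: smult_one)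
 have s2: "lg (Vtx v) \<odot>_{M} x =
   (\<Oplus>_{M}e\<in>{e : arcs G. tail G e = v}. lg (Arr e) \<odot>_{M} (lg (Ghost e) \<odot>_{M} x))"
  if v: "v : verts G" "EX e:arcs G. tail G e = v" and x: "x : car M" for v x
 proof -
  have "lg (Vtx v) \<odot>_{M} x = (\<Oplus>_{M}e\<in>{e : arcs G. tail G e = v}. (lg (Arr e) \<otimes>_{LA} lg (Ghost e)) \<odot>_{M} x)"
   unfolding rs(8)[OF v, symmetric] by(rule smult_finsum_l) (use x in auto)
  also have "... = (\<Oplus>_{M}e\<in>{e : arcs G. tail G e = v}. lg (Arr e) \<odot>_{M} (lg (Ghost e) \<odot>_{M} x))"
   by(rule M.add.finprod_cong') (use x in "auto simp: smult_assoc smult_closed")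
  finally show ?thesis .
 qed
 show ?thesis unfolding leavitt_ops_def leavitt_ops_axioms_def
  by(intro conjI allI impI k fin_digraph_axioms)
   (simp_all add: smult_closed smult_r_distr comm mult rs s1 s2)
qed

text \<open>Words in the generators act by composing operators, which makes M a module over the free
  algebra. Its annihilator is an ideal containing every defining relation, hence contains the ideal
  they generate, and the action descends to the quotient.\<close>

lemma leavitt_module_of_ops:
 fixes M :: "('m,'z) ring_scheme" and sc :: "'k::field => 'm => 'm"
 assumes "leavitt_ops M sc G vt ar gh" shows "EX s. left_module (LA :: ('a,'b,'k) leavitt_ring)
    (mk_module (car M) \<zero>_{M} (%x y. x \<oplus>_{M} y) s)
  & (ALL x:car M. (ALL c. s (semb c) x = sc c x)
    & (ALL v:verts G. s (lg (Vtx v)) x = vt v x)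
    & (ALL e:arcs G. s (lg (Arr e)) x = ar e x & s (lg (Ghost e)) x = gh e x))"
proof -
 interpret O: leavitt_ops M sc G vt ar gh by fact
 define go where "go = (%g. case g of Vtx v => vt v | Arr e => ar e | Ghost e => gh e)"
 have go: "go (Vtx v) = vt v" "go (Arr e) = ar e" "go (Ghost e) = gh e" for v e
  by(simp_all add: go_def)
 have g1: "go g x : car M" "go g (x \<oplus>_{M} y) = go g x \<oplus>_{M} go g y" "go g (sc c x) = sc c (go g x)"
  if "g : leavitt_gens G" "x : car M" "y : car M" for g x y c using that
  by(auto simp: leavitt_gens_def go O.vt_add O.ar_add O.gh_add O.vt_sc O.ar_sc O.gh_sc)
 have w0: "foldr go w x : car M" if "w : lists (leavitt_gens G)" "x : car M" for w x
  using that by(induction w) (simp_all add: g1)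
 have w1: "foldr go w x : car M"
  "foldr go w (x \<oplus>_{M} y) = foldr go w x \<oplus>_{M} foldr go w y" "foldr go w (sc c x) = sc c (foldr go w x)"
  if "w : lists (leavitt_gens G)" "x : car M" "y : car M" for w x y c
  using that by(induction w) (simp_all add: g1 w0 del: in_lists_conv_set)
 interpret B: basis_alg "lists (leavitt_gens G)" "{[]}" "%u v. Some (u @ v)" by(rule basis_alg_lists)
 interpret A: basis_action "lists (leavitt_gens G)" "{[]}" "%u v. Some (u @ v)" M sc "foldr go"
  by unfold_locales (simp_all add: w1 del: in_lists_conv_set)
 let ?N = "mk_module (car M) \<zero>_{M} (%x y. x \<oplus>_{M} y) A.act :: (('a,'b,'k) word_elem,'m) module"
 interpret N: left_module "FA :: ('a,'b,'k) word_elem ring" ?N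
  using A.left_module_act by(simp add: free_algebra_def)
 define Ann where "Ann = {a : car FA. ALL x:car ?N. a \<odot>_{?N} x = \<zero>_{?N}}"
 have sgl: "A.act (word w) x = foldr go w x" if "w : lists (leavitt_gens G)" "x : car M" for w x
  using that w1(1) by(simp add: A.act_single del: in_lists_conv_set)
 \<comment> \<open>Every defining relation is a difference; it lies in the annihilator as soon as
   both sides act equally, which for each family is one axiom on the operators.\<close>
 have diff: "a - b : Ann" if ab: "a : car FA" "b : car FA" "!!x. x : car M ==> A.act a x = A.act b x" for a b
 proof -
  have d: "a - b : car FA" using ab FA_diff by blast
  have "A.act (a - b) x = \<zero>_{M}" if x: "x : car M" for x
  proof -
   have "A.act (a - b) x \<oplus>_{M} A.act b x = A.act (a - b + b) x"
    using A.act_plus[of "a - b" b x] d ab x by(simp add: FA_simps)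
   hence "A.act (a - b) x \<oplus>_{M} A.act b x = A.act b x" using ab x by simp
   thus ?thesis using A.act_closed[of "a - b" x] A.act_closed[of b x] d ab x O.add.r_cancel_one
    by(simp add: FA_simps)
  qed
  thus ?thesis using d by(simp add: Ann_def)
 qed
 have sums: "A.act (\<Sum>i\<in>I. word (f i)) x = (\<Oplus>_{M}i\<in>I. foldr go (f i) x)"
  if "finite I" "!!i. i : I ==> f i : lists (leavitt_gens G)" "x : car M" for I :: "'i set" and f x
  using that
 proof (induction I rule: finite_induct)
  case (insert i I)
  have k: "keys (\<Sum>i\<in>I. word (f i) :: _ \<Rightarrow>\<^sub>0 'k) <= lists (leavitt_gens G)"
   by(rule order_trans[OF keys_sum], rule UN_least) (use insert.prems(1) in simp)
  have fi: "f j : lists (leavitt_gens G)" if "j : insert i I" for j using insert.prems(1) that .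
  have "(%i. foldr go (f i) x) : I \<rightarrow> car M" by(rule Pi_I) (rule w0[OF fi insert.prems(2)], simp)
  moreover have "foldr go (f i) x : car M" "f i : lists (leavitt_gens G)"
   using w0[OF fi insert.prems(2), of i] fi[of i] by simp_all
  moreover have "A.act (word (f i) + (\<Sum>i\<in>I. word (f i))) x = A.act (word (f i)) x \<oplus>_{M} A.act (\<Sum>i\<in>I. word (f i)) x"
  proof (rule A.act_plus[OF _ k])
   show "keys (word (f i) :: _ \<Rightarrow>\<^sub>0 'k) <= lists (leavitt_gens G)" using insert.prems(1)[of i] by simp
  qed (rule insert.prems(2))
  moreover have "A.act (\<Sum>i\<in>I. word (f i)) x = (\<Oplus>_{M}i\<in>I. foldr go (f i) x)"
   using insert by simp
  ultimately show ?case using insert.hyps by(simp add: sgl insert.prems(2) del: in_lists_conv_set)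
 qed simp
 have rel: "leavitt_relations G <= Ann"
 proof -
  have l: "[Vtx v] : lists (leavitt_gens G)" if "v : verts G" for v using that by simp
  show ?thesis unfolding leavitt_relations_def
  proof (intro Un_least subsetI)
   fix r :: "('a,'b,'k) word_elem"
   assume "r : {word [Vtx v, Vtx v'] - (if v = v' then word [Vtx v] else 0) |v v'. v : verts G & v' : verts G}"
   then obtain v v' where r: "r = word [Vtx v, Vtx v'] - (if v = v' then word [Vtx v] else 0)" "v : verts G" "v' : verts G" by blast
   show "r : Ann" unfolding r(1)
    by(rule diff) (use r in "auto intro!: word_in_FA zero_in_FA simp: sgl go O.vt_vt")
  next
   fix r :: "('a,'b,'k) word_elem"
   assume "r : {(\<Sum>v\<in>verts G. word [Vtx v]) - word []}"
   hence r: "r = (\<Sum>v\<in>verts G. word [Vtx v]) - word []" by simp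
   show "r : Ann" unfolding r
   proof (rule diff)
    fix x assume x: "x : car M"
    show "A.act (\<Sum>v\<in>verts G. word [Vtx v]) x = A.act (word []) x"
     using sums[of "verts G" "%v. [Vtx v]" x] x by(simp add: sgl go O.vt_sum)
   qed (auto intro!: word_in_FA FA_sum)
  next
   fix r :: "('a,'b,'k) word_elem"
   assume "r : {word [Vtx (tail G e), Arr e] - word [Arr e] |e. e : arcs G}"
   then obtain e where r: "r = word [Vtx (tail G e), Arr e] - word [Arr e]" "e : arcs G" by blast
   show "r : Ann" unfolding r(1)
    by(rule diff) (use r(2) in "auto intro!: word_in_FA simp: sgl go O.vt_ar0")
  next
   fix r :: "('a,'b,'k) word_elem"
   assume "r : {word [Arr e, Vtx (head G e)] - word [Arr e] |e. e : arcs G}"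
   then obtain e where r: "r = word [Arr e, Vtx (head G e)] - word [Arr e]" "e : arcs G" by blast
   show "r : Ann" unfolding r(1)
    by(rule diff) (use r(2) in "auto intro!: word_in_FA simp: sgl go O.ar_vt0")
  next
   fix r :: "('a,'b,'k) word_elem"
   assume "r : {word [Vtx (head G e), Ghost e] - word [Ghost e] |e. e : arcs G}"
   then obtain e where r: "r = word [Vtx (head G e), Ghost e] - word [Ghost e]" "e : arcs G" by blast
   show "r : Ann" unfolding r(1)
    by(rule diff) (use r(2) in "auto intro!: word_in_FA simp: sgl go O.vt_gh0")
  next
   fix r :: "('a,'b,'k) word_elem"
   assume "r : {word [Ghost e, Vtx (tail G e)] - word [Ghost e] |e. e : arcs G}"
   then obtain e where r: "r = word [Ghost e, Vtx (tail G e)] - word [Ghost e]" "e : arcs G" by blast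
   show "r : Ann" unfolding r(1)
    by(rule diff) (use r(2) in "auto intro!: word_in_FA simp: sgl go O.gh_vt0")
  next
   fix r :: "('a,'b,'k) word_elem"
   assume "r : {word [Ghost e, Arr e'] - (if e = e' then word [Vtx (head G e)] else 0) |e e'. e : arcs G & e' : arcs G}"
   then obtain e e' where r: "r = word [Ghost e, Arr e'] - (if e = e' then word [Vtx (head G e)] else 0)" "e : arcs G" "e' : arcs G" by blast
   show "r : Ann" unfolding r(1)
    by(rule diff) (use r in "auto intro!: word_in_FA zero_in_FA simp: sgl go O.gh_ar")
  next
   fix r :: "('a,'b,'k) word_elem"
   assume "r : {word [Vtx v] - (\<Sum>e\<in>{e : arcs G. tail G e = v}. word [Arr e, Ghost e]) |v.
     v : verts G & (EX e:arcs G. tail G e = v)}"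
   then obtain v where r: "r = word [Vtx v] - (\<Sum>e\<in>{e : arcs G. tail G e = v}. word [Arr e, Ghost e])"
    "v : verts G" "EX e:arcs G. tail G e = v" by blast
   show "r : Ann" unfolding r(1)
   proof (rule diff)
    fix x assume x: "x : car M"
    show "A.act (word [Vtx v]) x = A.act (\<Sum>e\<in>{e : arcs G. tail G e = v}. word [Arr e, Ghost e]) x"
     using sums[of "{e : arcs G. tail G e = v}" "%e. [Arr e, Ghost e]" x] r(2) x
     by(simp add: sgl go O.vt_out[OF r(2,3) x])
   qed (use r(2) in "auto intro!: word_in_FA FA_sum")
  qed
 qed
 have "leavitt_ideal G <= Ann"
  unfolding leavitt_ideal_def by(rule ring.genideal_minimal[OF ring_FA N.annihilator_ideal rel[unfolded Ann_def], folded Ann_def])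
 hence ann: "a \<odot>_{?N} x = \<zero>_{?N}" if "a : leavitt_ideal G" "x : car ?N" for a x
  using that unfolding Ann_def by blast
 obtain s where s: "left_module LA (mk_module (car M) \<zero>_{M} (%x y. x \<oplus>_{M} y) s)"
  "!!a x. a : car FA ==> x : car M ==> s (lcl a) x = A.act a x"
  using N.quotient_module[OF ideal_leavitt ann] by(auto simp: leavitt_algebra_def leavitt_class_def)
 have "s (semb c) x = sc c x" if "x : car M" for c x
  using that s(2)[OF word_in_FA[of "[]" c]] by(simp add: scalar_embed_def A.act_single)
 moreover have "s (lg g) x = go g x" if "x : car M" "g : leavitt_gens G" for g x
  using that s(2)[OF word_in_FA[of "[g]" 1]] by(simp add: sgl)
 ultimately show ?thesis using s(1) go by(intro exI[of _ s]) (simp add: leavitt_gens_def)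
qed

end

section \<open>Generators of path algebras and the embeddings into the Leavitt path algebra\<close>

definition path_scalar :: "('v,'e) pre_digraph => 'k => ('v,'e,'k::field) path_elem" where
 "path_scalar E c = (\<Sum>v\<in>verts E. single (v, [], v) c)"

definition path_vtx :: "'v => ('v,'e,'k::field) path_elem" where
 "path_vtx v = single (v, [], v) 1"

definition path_arr :: "('v,'e) pre_digraph => 'e => ('v,'e,'k::field) path_elem" where
 "path_arr E e = single (tail E e, [e], head E e) 1"

context fin_digraph
begin

abbreviation "Gi == inverse_quiver G"
abbreviation "PG == path_algebra Gi"
abbreviation "gemb == ghost_embed G"

abbreviation PA :: "('a,'b,'k::field) path_elem ring" where
 "PA == path_algebra G"

lemma PA_simps:
 "car PA = {x. keys x <= paths G}"
 "x \<otimes>_{PA} y = bmul path_concat x y"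
 "\<one>_{PA} = path_scalar G 1" "\<zero>_{PA} = 0" "x \<oplus>_{PA} y = x + y"
proof -
 show "\<one>_{PA} = path_scalar G 1" unfolding path_scalar_def path_algebra_def basis_algebra_simps
  by(subst sum.reindex) (auto simp: inj_on_def)
qed (simp_all add: path_algebra_def basis_algebra_simps)

lemma ring_PA: "ring (PA :: ('a,'b,'k::field) path_elem ring)"
 unfolding path_algebra_def by(rule basis_alg.ring_basis_algebra[OF basis_alg_paths])

lemma path_gens_closed [simp]:
 "path_scalar G c : car PA" "v : verts G ==> path_vtx v : car PA" "e : arcs G ==> path_arr G e : car PA"
proof -
 show "path_scalar G c : car PA" unfolding PA_simps path_scalar_def
  by(rule CollectI, rule order_trans[OF keys_sum], rule UN_least) (auto simp: paths_iff awalk_Nil_iff)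
 show "v : verts G ==> path_vtx v : car PA" by(auto simp: PA_simps path_vtx_def paths_iff awalk_Nil_iff)
 show "e : arcs G ==> path_arr G e : car PA"
  by(auto simp: PA_simps path_arr_def paths_iff awalk_Cons_iff awalk_Nil_iff)
qed

lemma path_scalar_single: assumes "(u, p, v) : paths G"
 shows "bmul path_concat (path_scalar G c) (single (u, p, v) d) = single (u, p, v) (c * d)"
proof -
 have "u : verts G" using assms by(auto simp: paths_iff)
 have "bmul path_concat (path_scalar G c) (single (u, p, v) d)
   = (\<Sum>w\<in>verts G. bterm path_concat (w, [], w) (u, p, v) c d)"
  unfolding path_scalar_def by(simp add: bmul_sum_left bmul_single)
 also have "... = (\<Sum>w\<in>verts G. if w = u then single (u, p, v) (c * d) else 0)"
  by(rule sum.cong) (auto simp: bterm_def path_concat_def)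
 finally show ?thesis using \<open>u : verts G\<close> by simp
qed

lemma path_vtx_single:
 "bmul path_concat (path_vtx w) (single (u, p, v) d)
  = (if w = u then single (u, p, v) d else 0)"
 by(simp add: path_vtx_def bmul_single bterm_def path_concat_def)

lemma path_arr_single:
 "bmul path_concat (path_arr G e) (single (u, p, v) d)
  = (if head G e = u then single (tail G e, e # p, v) d else 0)"
 by(simp add: path_arr_def bmul_single bterm_def path_concat_def)

lemma path_induct [consumes 1, case_names scalar vtx arr add mult]:
 fixes P :: "('a,'b,'k::field) path_elem => bool" assumes x: "x : car PA"
  and sca: "!!c. P (path_scalar G c)" and vtx: "!!v. v : verts G ==> P (path_vtx v)"
  and arr: "!!e. e : arcs G ==> P (path_arr G e)"
  and add: "!!x y. x : car PA ==> y : car PA ==> P x ==> P y ==> P (x \<oplus>_{PA} y)"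
  and mult: "!!x y. x : car PA ==> y : car PA ==> P x ==> P y ==> P (x \<otimes>_{PA} y)"
 shows "P x"
proof -
 have w: "P (single (u, p, v) 1)" if "awalk u p v" for u p v using that
 proof (induction p arbitrary: u)
  case Nil
  thus ?case using vtx by(auto simp: awalk_Nil_iff path_vtx_def)
 next
  case (Cons e p)
  hence e: "e : arcs G" "u = tail G e" "awalk (head G e) p v" by(auto simp: awalk_Cons_iff)
  have "P (path_arr G e \<otimes>_{PA} single (head G e, p, v) 1)"
   by(rule mult) (use e Cons.IH arr in "auto simp: PA_simps(1) path_arr_def paths_iff awalk_Cons_iff awalk_Nil_iff")
  thus ?case using e(2) by(simp add: PA_simps path_arr_single)
 qed
 have "keys x <= paths G" using x by(simp add: PA_simps)
 thus ?thesis
 proof (induction x rule: span_induct)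
  case zero
  have "path_scalar G 0 = (0 :: ('a,'b,'k) path_elem)" by(simp add: path_scalar_def)
  thus ?case using sca[of 0] by simp
 next
  case (single p c)
  obtain u q v where p: "p = (u, q, v)" by(cases p)
  have "P (path_scalar G c \<otimes>_{PA} single p 1)"
   by(rule mult[OF path_gens_closed(1) _ sca]) (use single p w in "auto simp: PA_simps(1) paths_iff")
  thus ?case using single p by(simp add: PA_simps path_scalar_single)
 next
  case (add x y)
  thus ?case using assms(5)[of x y] by(simp add: PA_simps)
 qed
qed

text \<open>Stated for an arbitrary additive \<open>phi\<close> with prescribed values on paths, so
  that one computation serves \<open>real_embed\<close> on E and \<open>ghost_embed\<close> on the
  inverse quiver. What has to be checked is that images of paths multiply like paths.\<close>

lemma path_hom:
 fixes S :: "('r,'s) ring_scheme" and phi :: "('a,'b,'k::field) path_elem => 'r" assumes S: "ring S"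
  and sc: "!!c. sc c : car S" "!!c d. sc (c * d) = sc c \<otimes>_{S} sc d" "sc 1 = \<one>_{S}"
   "!!c x. x : car S ==> sc c \<otimes>_{S} x = x \<otimes>_{S} sc c"
  and V: "!!v. v : verts G ==> V v : car S"
   "!!v v'. v : verts G ==> v' : verts G ==> V v \<otimes>_{S} V v' = (if v = v' then V v else \<zero>_{S})"
   "(\<Oplus>_{S}v\<in>verts G. V v) = \<one>_{S}" and A: "!!e. e : arcs G ==> A e : car S"
   "!!e. e : arcs G ==> V (tail G e) \<otimes>_{S} A e = A e" "!!e. e : arcs G ==> A e \<otimes>_{S} V (head G e) = A e"
  and add: "!!x y. keys x <= paths G ==> keys y <= paths G
    ==> phi (x + y) = phi x \<oplus>_{S} phi y"
  and sgl: "!!u p v c. awalk u p v ==> phi (single (u, p, v) c)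
    = sc c \<otimes>_{S} (V u \<otimes>_{S} foldr (%e y. A e \<otimes>_{S} y) p \<one>_{S})"
  and zero: "phi 0 = \<zero>_{S}" shows "phi : ring_hom PA S" "phi (path_scalar G c) = sc c"
  "v : verts G ==> phi (path_vtx v) = V v" "e : arcs G ==> phi (path_arr G e) = A e"
proof -
 interpret S: ring S by fact
 \<comment> \<open>The image of a path carries its starting vertex in front, so that a trivial path
   goes to its vertex and not to the identity.\<close>
 define bt where "bt u p = V u \<otimes>_{S} foldr (%e y. A e \<otimes>_{S} y) p \<one>_{S}" for u p
 have fcl: "foldr (%e y. A e \<otimes>_{S} y) p y : car S" if "set p <= arcs G" "y : car S" for p y
  using that by(induction p) (auto simp: A)
 have btcl: "bt u p : car S" if "awalk u p v" for u p v
  using that fcl[of p "\<one>_{S}"] V(1) by(auto simp: bt_def awalk_def)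
 have btNil: "bt u [] = V u" if "u : verts G" for u using that V by(simp add: bt_def)
 have btCons: "bt u (e # p) = A e \<otimes>_{S} bt (head G e) p" if "awalk u (e # p) v" for u e p v
 proof -
  have e: "e : arcs G" "u = tail G e" "set p <= arcs G" using that by(auto simp: awalk_def)
  have f: "foldr (%e y. A e \<otimes>_{S} y) p \<one>_{S} : car S" using fcl e by simp
  have "bt u (e # p) = (V u \<otimes>_{S} A e) \<otimes>_{S} foldr (%e y. A e \<otimes>_{S} y) p \<one>_{S}"
   using e f V A by(simp add: bt_def S.m_assoc[symmetric] del: S.m_assoc)
  also have "... = (A e \<otimes>_{S} V (head G e)) \<otimes>_{S} foldr (%e y. A e \<otimes>_{S} y) p \<one>_{S}" using e A by simp
  also have "... = A e \<otimes>_{S} bt (head G e) p"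
   unfolding bt_def by(rule S.m_assoc) (use e f V A in auto)
  finally show ?thesis .
 qed
 have btV: "V w \<otimes>_{S} bt u p = (if w = u then bt u p else \<zero>_{S})" if "awalk u p v" "w : verts G" for w u p v
 proof -
  have "u : verts G" "foldr (%e y. A e \<otimes>_{S} y) p \<one>_{S} : car S"
   using that fcl by(auto simp: awalk_def)
  thus ?thesis using that V by(simp add: bt_def flip: S.m_assoc)
 qed
 have btm: "bt u p \<otimes>_{S} bt u' q = (if v = u' then bt u (p @ q) else \<zero>_{S})"
  if "awalk u p v" "awalk u' q w" for u p v u' q w using that(1)
 proof (induction p arbitrary: u)
  case Nil
  hence "u : verts G" "u = v" by(auto simp: awalk_Nil_iff)
  thus ?case using btV[OF that(2), of u] btNil by simp
 next
  case (Cons e p)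
  hence e: "e : arcs G" "u = tail G e" "awalk (head G e) p v" by(auto simp: awalk_Cons_iff)
  have "bt u (e # p) \<otimes>_{S} bt u' q = A e \<otimes>_{S} (bt (head G e) p \<otimes>_{S} bt u' q)"
   using btCons[OF Cons.prems] btcl[OF e(3)] btcl[OF that(2)] A e by(simp add: S.m_assoc)
  moreover have "bt u (e # p @ q) = A e \<otimes>_{S} bt (head G e) (p @ q)" if "v = u'"
   using btCons[of u e "p @ q" w] awalk_appendI[OF Cons.prems] \<open>awalk u' q w\<close> that by simp
  ultimately show ?case using Cons.IH[OF e(3)] A e by auto
 qed
 have sgl': "phi (single (u, p, v) c) = sc c \<otimes>_{S} bt u p" if "awalk u p v" for u p v c
  using sgl[OF that] by(simp add: bt_def)
 have cl: "phi x : car S" if "keys x <= paths G" for x using that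
 proof (induction x rule: span_induct)
  case (single p c)
  obtain u q v where p: "p = (u, q, v)" by(cases p)
  hence "awalk u q v" using single by(simp add: paths_iff)
  thus ?case using p sgl'[of u q v c] btcl[of u q v] sc(1) by simp
 qed (auto simp: add zero)
 have one': "phi (path_scalar G c) = sc c" for c
 proof -
  have s: "phi (\<Sum>v\<in>I. single (v, [], v) c) = sc c \<otimes>_{S} (\<Oplus>_{S}v\<in>I. V v)"
   if "finite I" "I <= verts G" for I using that
  proof (induction I rule: finite_induct)
   case (insert v I)
   have v: "v : verts G" "I <= verts G" using insert.prems by auto
   have Vc: "V : I \<rightarrow> car S" "V v : car S" using v V(1) by auto
   have "phi (single (v, [], v) c) = sc c \<otimes>_{S} V v"
    using sgl'[of v "[]" v c] v btNil[of v] by(simp add: awalk_Nil_iff)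
   moreover have "phi (\<Sum>v\<in>I. single (v, [], v) c) = sc c \<otimes>_{S} (\<Oplus>_{S}v\<in>I. V v)"
    using insert.IH v by blast
   moreover have "keys (\<Sum>v\<in>I. single (v, [], v) c) <= paths G"
    by(rule order_trans[OF keys_sum], rule UN_least) (use v in "auto simp: paths_iff awalk_Nil_iff")
   moreover have "keys (single (v, [], v) c) <= paths G"
    using v by(simp add: paths_iff awalk_Nil_iff)
   ultimately show ?case using insert.hyps Vc sc(1)[of c] by(simp add: add S.r_distr)
  qed (use zero sc(1)[of c] in simp)
  show ?thesis unfolding path_scalar_def using s[of "verts G"] V(3) sc(1) by simp
 qed
 thus "phi (path_scalar G c) = sc c" .
 show "v : verts G ==> phi (path_vtx v) = V v"
  using sgl'[of v "[]" v 1] btNil V(1) sc(3) by(simp add: path_vtx_def awalk_Nil_iff)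
 show "e : arcs G ==> phi (path_arr G e) = A e"
  using sgl'[of "tail G e" "[e]" "head G e" 1] btCons[of "tail G e" e "[]" "head G e"] btNil[of "head G e"] A V(1) sc(3)
  by(simp add: path_arr_def awalk_Nil_iff awalk_Cons_iff)
 show "phi : ring_hom PA S" unfolding path_algebra_def
 proof (rule basis_alg.basis_algebra_hom[OF basis_alg_paths S])
  show "phi (\<Sum>u\<in>(%v. (v, [], v)) ` verts G. single u 1) = \<one>_{S}"
  proof -
   have "(\<Sum>u\<in>(%v. (v, [], v)) ` verts G. single u (1::'k)) = path_scalar G 1"
    unfolding path_scalar_def by(subst sum.reindex) (auto simp: inj_on_def)
   thus ?thesis using one'[of 1] sc(3) by simp
  qed
  fix p q :: "'a \<times> 'b list \<times> 'a" and a b :: 'k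
  assume pq: "p : paths G" "q : paths G"
  obtain u x v where p: "p = (u, x, v)" by(cases p)
  obtain u' y w where q: "q = (u', y, w)" by(cases q)
  have aw: "awalk u x v" "awalk u' y w" using pq p q by(auto simp: paths_iff)
  have "phi (single p a) \<otimes>_{S} phi (single q b)
    = (sc a \<otimes>_{S} bt u x) \<otimes>_{S} (sc b \<otimes>_{S} bt u' y)"
   using aw p q by(simp add: sgl')
  also have "... = sc a \<otimes>_{S} ((bt u x \<otimes>_{S} sc b) \<otimes>_{S} bt u' y)"
   using btcl[OF aw(1)] btcl[OF aw(2)] sc(1) by(simp add: S.m_assoc)
  also have "... = sc a \<otimes>_{S} ((sc b \<otimes>_{S} bt u x) \<otimes>_{S} bt u' y)"
   using btcl[OF aw(1)] sc(4) by simp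
  also have "... = sc (a * b) \<otimes>_{S} (bt u x \<otimes>_{S} bt u' y)"
   using btcl[OF aw(1)] btcl[OF aw(2)] sc(1,2) by(simp add: S.m_assoc)
  also have "... = phi (bterm path_concat p q a b)"
   using btm[OF aw] sc(1) zero sgl'[OF awalk_appendI[OF aw(1)], of y w] aw(2)
   by(auto simp: bterm_def path_concat_def p q)
  finally show "phi (bterm path_concat p q a b) = phi (single p a) \<otimes>_{S} phi (single q b)" ..
 qed (use cl add in auto)
qed

lemma inverse_fin: "fin_digraph Gi" by unfold_locales (auto simp: inverse_quiver_def)

lemma inverse_simps [simp]:
 "verts Gi = verts G" "arcs Gi = arcs G"
 "tail Gi = head G" "head Gi = tail G" by(simp_all add: inverse_quiver_def)

lemma leavitt_class_word: assumes "set w <= leavitt_gens G"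
 shows "lcl (word w) = foldr (%g y. lg g \<otimes>_{LA} y) w \<one>_{LA :: ('a,'b,'k::field) leavitt_ring}"
 using assms
proof (induction w)
 case (Cons g w)
 hence gw: "g : leavitt_gens G" "set w <= leavitt_gens G" by auto
 show ?case unfolding word_Cons[OF gw] Cons.IH[OF gw(2)] by simp
qed (simp add: leavitt_class_one)

lemma linear_extension_hom_helper:
 fixes f :: "'c => ('a,'b) leavitt_gen list" assumes f: "!!p. p : B ==> set (f p) <= leavitt_gens G"
 shows "keys x <= B ==> keys y <= B ==>
   lcl (linear_extension f (x + y)) =
   lcl (linear_extension f x) \<oplus>_{LA :: ('a,'b,'k::field) leavitt_ring} lcl (linear_extension f y)"
  "p : B ==> lcl (linear_extension f (single p c)) =
   semb c \<otimes>_{LA :: ('a,'b,'k::field) leavitt_ring} foldr (%g y. lg g \<otimes>_{LA} y) (f p) \<one>_{LA}"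
proof -
 have k: "linear_extension f z : car FA" if "keys z <= B" for z :: "'c \<Rightarrow>\<^sub>0 'k"
 proof -
  have "f ` keys z <= lists (leavitt_gens G)" using that f by auto
  thus ?thesis unfolding FA_simps using keys_linear_extension[of f z] by blast
 qed
 show "lcl (linear_extension f (x + y)) = lcl (linear_extension f x) \<oplus>_{LA} lcl (linear_extension f y)"
  if "keys x <= B" "keys y <= B"
  unfolding linear_extension_add by(rule leavitt_class_add) (use k that in auto)
 show "lcl (linear_extension f (single p c)) =
   semb c \<otimes>_{LA} foldr (%g y. lg g \<otimes>_{LA} y) (f p) \<one>_{LA}" if "p : B"
  using leavitt_class_single(1)[OF f[OF that], of c] leavitt_class_word[OF f[OF that], where 'k = 'k] by simp
qed

lemma real_embed_hom: shows "real_embed G : ring_hom PA (LA :: ('a,'b,'k::field) leavitt_ring)"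
  "real_embed G (path_scalar G c) = semb (c :: 'k)"
  "v : verts G ==> real_embed G (path_vtx v) = (lg (Vtx v) :: ('a,'b,'k) leavitt_elem)"
  "e : arcs G ==> real_embed G (path_arr G e) = (lg (Arr e) :: ('a,'b,'k) leavitt_elem)"
proof -
 let ?f = "%(u, p, v). Vtx u # map Arr p"
 have f: "set (?f p) <= leavitt_gens G" if "p : paths G" for p
  using that by(cases p) (auto simp: paths_iff awalk_def)
 note h = linear_extension_hom_helper[of "paths G" ?f, OF f]
 note rs = leavitt_relation_simps[where 'k = 'k]
 have add: "real_embed G (x + y) = real_embed G x \<oplus>_{LA} (real_embed G y :: ('a,'b,'k) leavitt_elem)"
  if "keys x <= paths G" "keys y <= paths G" for x y
  unfolding real_embed_def by(rule h(1)) (use that in auto)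
 have sgl: "real_embed G (single (u, p, v) c) = semb (c :: 'k) \<otimes>_{LA}
   (lg (Vtx u) \<otimes>_{LA} foldr (%e y. lg (Arr e) \<otimes>_{LA} y) p \<one>_{LA})" if "awalk u p v" for u p v c
  unfolding real_embed_def using h(2)[of "(u, p, v)" c] that by(simp add: paths_iff foldr_map comp_def)
 have zero: "real_embed G 0 = \<zero>_{LA :: ('a,'b,'k) leavitt_ring}"
  by(simp add: real_embed_def leavitt_class_zero)
 note ph = path_hom[where S = "LA :: ('a,'b,'k) leavitt_ring" and sc = "semb"
   and V = "%v. lg (Vtx v)" and A = "%e. lg (Arr e)" and phi = "real_embed G",
   OF ring_LA scalar_embed_closed scalar_embed_ring(2,3) scalar_central
    lgen_closed[OF gens(1)] rs(1) rs(7) lgen_closed[OF gens(2)] rs(2,3) add sgl zero]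
 show "real_embed G : ring_hom PA (LA :: ('a,'b,'k::field) leavitt_ring)" by(rule ph(1))
 show "real_embed G (path_scalar G c) = semb (c :: 'k)" by(rule ph(2))
 show "v : verts G ==> real_embed G (path_vtx v) = (lg (Vtx v) :: ('a,'b,'k) leavitt_elem)" by(rule ph(3))
 show "e : arcs G ==> real_embed G (path_arr G e) = (lg (Arr e) :: ('a,'b,'k) leavitt_elem)" by(rule ph(4))
qed

lemma ghost_embed_hom: shows "gemb : ring_hom PG (LA :: ('a,'b,'k::field) leavitt_ring)"
  "gemb (path_scalar Gi c) = semb (c :: 'k)"
  "v : verts G ==> gemb (path_vtx v) = (lg (Vtx v) :: ('a,'b,'k) leavitt_elem)"
  "e : arcs G ==> gemb (path_arr Gi e) = (lg (Ghost e) :: ('a,'b,'k) leavitt_elem)"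
proof -
 interpret I: fin_digraph Gi by(rule inverse_fin)
 let ?f = "%(u, p, v). Vtx u # map Ghost p"
 have f: "set (?f p) <= leavitt_gens G" if "p : paths Gi" for p
  using that by(cases p) (auto simp: I.paths_iff I.awalk_def)
 note h = linear_extension_hom_helper[of "paths Gi" ?f, OF f]
 note rs = leavitt_relation_simps[where 'k = 'k]
 have add: "gemb (x + y) = gemb x \<oplus>_{LA} (gemb y :: ('a,'b,'k) leavitt_elem)"
  if "keys x <= paths Gi" "keys y <= paths Gi" for x y
  unfolding ghost_embed_def by(rule h(1)) (use that in auto)
 have sgl: "gemb (single (u, p, v) c) = semb (c :: 'k) \<otimes>_{LA}
   (lg (Vtx u) \<otimes>_{LA} foldr (%e y. lg (Ghost e) \<otimes>_{LA} y) p \<one>_{LA})" if "I.awalk u p v" for u p v c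
  unfolding ghost_embed_def using h(2)[of "(u, p, v)" c] that by(simp add: I.paths_iff foldr_map comp_def)
 have zero: "gemb 0 = \<zero>_{LA :: ('a,'b,'k) leavitt_ring}"
  by(simp add: ghost_embed_def leavitt_class_zero)
 note ph = I.path_hom[where S = "LA :: ('a,'b,'k) leavitt_ring" and sc = "semb"
   and V = "%v. lg (Vtx v)" and A = "%e. lg (Ghost e)" and phi = "gemb",
   unfolded inverse_simps,
   OF ring_LA scalar_embed_closed scalar_embed_ring(2,3) scalar_central
    lgen_closed[OF gens(1)] rs(1) rs(7) lgen_closed[OF gens(3)] rs(4,5) add sgl zero]
 show "gemb : ring_hom PG (LA :: ('a,'b,'k::field) leavitt_ring)" by(rule ph(1))
 show "gemb (path_scalar Gi c) = semb (c :: 'k)" by(rule ph(2))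
 show "v : verts G ==> gemb (path_vtx v) = (lg (Vtx v) :: ('a,'b,'k) leavitt_elem)" by(rule ph(3))
 show "e : arcs G ==> gemb (path_arr Gi e) = (lg (Ghost e) :: ('a,'b,'k) leavitt_elem)" by(rule ph(4))
qed

end

section \<open>Submodules over the three algebras as stable subspaces\<close>

lemma subgroup_add_monoid_cong:
 assumes "car M' = car M" "!!x y. x \<oplus>_{M'} y = x \<oplus>_{M} y" "\<zero>_{M'} = \<zero>_{M}"
 shows "subgroup N (add_monoid M') <-> subgroup N (add_monoid M)"
 unfolding subgroup_def m_inv_def using assms by simp

locale lpa_module = fin_digraph E + left_module "leavitt_algebra E" M
 for E :: "('v,'e) pre_digraph" and M :: "(('v,'e,'k::field) leavitt_elem, 'm) module"
begin

abbreviation vtM :: "'v => 'm => 'm" where "vtM v x == lg (Vtx v) \<odot>_{M} x"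
abbreviation arM :: "'e => 'm => 'm" where "arM e x == lg (Arr e) \<odot>_{M} x"
abbreviation ghM :: "'e => 'm => 'm" where "ghM e x == lg (Ghost e) \<odot>_{M} x"
abbreviation scM :: "'k => 'm => 'm" where "scM c x == semb c \<odot>_{M} x"

sublocale ops: leavitt_ops M scM E vtM arM ghM
 by(rule leavitt_ops_of_module) (rule left_module_axioms)

lemma submodule_via_hom:
 assumes same: "car M' = car M" "!!x y. x \<oplus>_{M'} y = x \<oplus>_{M} y" "\<zero>_{M'} = \<zero>_{M}"
   "!!a x. a : car S ==> x : car M ==> a \<odot>_{M'} x = h a \<odot>_{M} x"
 shows "submodule N S M' <-> subgroup N (add_monoid M) & (ALL a:car S. ALL x:N. h a \<odot>_{M} x : N)"
proof -
 have "subgroup N (add_monoid M') <-> subgroup N (add_monoid M)"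
  by(rule subgroup_add_monoid_cong) (fact same)+
 thus ?thesis unfolding submodule_iff using same(4) M.subgrpD(5)[of N] by auto
qed

lemma submodule_iff_fsub: "submodule N (LA) M <-> ops.fsub N"
proof
 assume "submodule N (LA) M"
 thus "ops.fsub N"
  unfolding submodule_iff ops.fsub_def ops.rsub_def ops.gsub_def ops.ksub_def by simp
next
 assume N: "ops.fsub N"
 hence sg: "subgroup N (add_monoid M)" unfolding ops.fsub_def ops.rsub_def ops.ksub_def by simp
 have "a \<odot>_{M} x : N" if "a : car (LA)" "x : N" for a x using that
 proof (induction a arbitrary: x rule: leavitt_induct)
  case (scalar c)
  thus ?case using N unfolding ops.fsub_def ops.rsub_def ops.ksub_def by simp
 next
  case (gen g)
  thus ?case using N unfolding ops.fsub_def ops.rsub_def ops.gsub_def leavitt_gens_def by auto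
 next
  case (add a b)
  thus ?case using M.subgrpD(3,5)[OF sg] by(simp add: smult_l_distr)
 next
  case (mult a b)
  thus ?case using M.subgrpD(5)[OF sg] by(simp add: smult_assoc)
 qed
 thus "submodule N (LA) M" unfolding submodule_iff using sg by simp
qed

text \<open>The record \<open>M'\<close> only has to agree with the restriction of scalars on the
  carrier. This covers both a literal restriction of an L(E)-module and a given Blanchfield module,
  whose L(E)-structure is chosen afterwards.\<close>

lemma submodule_iff_rsub:
 assumes same: "car M' = car M" "!!x y. x \<oplus>_{M'} y = x \<oplus>_{M} y" "\<zero>_{M'} = \<zero>_{M}"
   "!!a x. a : car (PA :: ('v,'e,'k) path_elem ring) ==> x : car M ==> a \<odot>_{M'} x = real_embed E a \<odot>_{M} x"
 shows "submodule N (PA :: ('v,'e,'k) path_elem ring) M' <-> ops.rsub N"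
proof -
 note rh = real_embed_hom[where 'k = 'k]
 have closed: "real_embed E a : car (LA :: ('v,'e,'k) leavitt_ring)"
  if "a : car (PA)" for a using ring_hom_closed[OF rh(1) that] .
 have "(ALL a:car (PA). ALL x:N. real_embed E a \<odot>_{M} x : N) <->
   (ALL c. ALL x:N. scM c x : N) & (ALL v:verts E. ALL x:N. vtM v x : N) & (ALL e:arcs E. ALL x:N. arM e x : N)"
  (is "?L <-> ?R") if sg: "subgroup N (add_monoid M)"
 proof
  assume L: ?L
  show ?R using L[rule_format, OF path_gens_closed(1)] L[rule_format, OF path_gens_closed(2)]
    L[rule_format, OF path_gens_closed(3)] rh(2,3,4) by auto
 next
  assume R: ?R
  have "real_embed E a \<odot>_{M} x : N" if "a : car (PA)" "x : N" for a :: "('v,'e,'k) path_elem" and x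
   using that
  proof (induction a arbitrary: x rule: path_induct)
   case (add a b)
   thus ?case using M.subgrpD(3,5)[OF sg] closed by(simp add: ring_hom_add[OF rh(1)] smult_l_distr)
  next
   case (mult a b)
   thus ?case using M.subgrpD(5)[OF sg] closed by(simp add: ring_hom_mult[OF rh(1)] smult_assoc)
  qed (use R rh(2,3,4) in auto)
  thus ?L by blast
 qed
 moreover have "submodule N (PA :: ('v,'e,'k) path_elem ring) M' <-> subgroup N (add_monoid M)
   & (ALL a:car (PA). ALL x:N. real_embed E a \<odot>_{M} x : N)"
  by(rule submodule_via_hom) (fact same)+
 ultimately show ?thesis unfolding ops.rsub_def ops.ksub_def by blast
qed

lemma submodule_iff_gsub:
 assumes same: "car M' = car M" "!!x y. x \<oplus>_{M'} y = x \<oplus>_{M} y" "\<zero>_{M'} = \<zero>_{M}"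
   "!!a x. a : car (PG :: ('v,'e,'k) path_elem ring) ==> x : car M
    ==> a \<odot>_{M'} x = gemb a \<odot>_{M} x"
 shows "submodule N (PG :: ('v,'e,'k) path_elem ring) M' <-> ops.gsub N"
proof -
 interpret I: fin_digraph Gi by(rule inverse_fin)
 note rh = ghost_embed_hom[where 'k = 'k]
 note gc = I.path_gens_closed[unfolded inverse_simps]
 have closed: "gemb a : car (LA :: ('v,'e,'k) leavitt_ring)"
  if "a : car PG" for a using ring_hom_closed[OF rh(1) that] .
 have "(ALL a:car PG. ALL x:N. gemb a \<odot>_{M} x : N) <->
   (ALL c. ALL x:N. scM c x : N) & (ALL v:verts E. ALL x:N. vtM v x : N) & (ALL e:arcs E. ALL x:N. ghM e x : N)"
  (is "?L <-> ?R") if sg: "subgroup N (add_monoid M)"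
 proof
  assume L: ?L
  show ?R using L[rule_format, OF gc(1)] L[rule_format, OF gc(2)]
    L[rule_format, OF gc(3)] rh(2,3,4) by auto
 next
  assume R: ?R
  have "gemb a \<odot>_{M} x : N" if "a : car PG" "x : N" for a :: "('v,'e,'k) path_elem" and x
   using that
  proof (induction a arbitrary: x rule: I.path_induct)
   case (add a b)
   thus ?case using M.subgrpD(3,5)[OF sg] closed by(simp add: ring_hom_add[OF rh(1)] smult_l_distr)
  next
   case (mult a b)
   thus ?case using M.subgrpD(5)[OF sg] closed by(simp add: ring_hom_mult[OF rh(1)] smult_assoc)
  qed (use R rh(2,3,4) in auto)
  thus ?L by blast
 qed
 moreover have "submodule N (PG :: ('v,'e,'k) path_elem ring) M' <-> subgroup N (add_monoid M)
   & (ALL a:car PG. ALL x:N. gemb a \<odot>_{M} x : N)" by(rule submodule_via_hom) (fact same)+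
 ultimately show ?thesis unfolding ops.gsub_def ops.ksub_def by blast
qed

end

section \<open>The path algebra of the inverse quiver inside the Leavitt path algebra\<close>

definition partial_extension :: "('b => 'c option) => ('b \<Rightarrow>\<^sub>0 'k::field) => ('c \<Rightarrow>\<^sub>0 'k)" where
 "partial_extension f x = (\<Sum>p\<in>keys x.
  case f p of None => 0 | Some q => single q (lookup x p))"

lemma partial_extension_superset: assumes "finite X" "keys x <= X"
 shows "partial_extension f x = (\<Sum>p\<in>X. case f p of None => 0 | Some q => single q (lookup x p))"
 unfolding partial_extension_def
 by(rule sum.mono_neutral_left) (use assms in "auto simp: in_keys_iff split: option.split")

lemma partial_extension_add: "partial_extension f (x + y) = partial_extension f x + partial_extension f y"
proof -
 let ?X = "keys x Un keys y"
 have s: "partial_extension f z = (\<Sum>p\<in>?X. case f p of None => 0 | Some q => single q (lookup z p))"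
  if "keys z <= ?X" for z by(rule partial_extension_superset) (use that in auto)
 have "partial_extension f (x + y) = (\<Sum>p\<in>?X. case f p of None => 0 | Some q => single q (lookup (x + y) p))"
  by(rule s[OF keys_add])
 also have "... = (\<Sum>p\<in>?X. (case f p of None => 0 | Some q => single q (lookup x p))
   + (case f p of None => 0 | Some q => single q (lookup y p)))"
  by(intro sum.cong refl) (simp add: lookup_add single_add split: option.split)
 also have "... = partial_extension f x + partial_extension f y" by(simp add: sum.distrib s)
 finally show ?thesis .
qed

lemma partial_extension_single [simp]:
 "partial_extension f (single p c) = (case f p of None => 0 | Some q => single q c)"
 by(subst partial_extension_superset[of "{p}"]) (auto split: option.split)

lemma partial_extension_zero [simp]: "partial_extension f 0 = 0" by(simp add: partial_extension_def)

lemma keys_partial_extension: assumes "!!p q. p : A ==> f p = Some q ==> q : B" "keys x <= A"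
 shows "keys (partial_extension f x) <= B" unfolding partial_extension_def
 by(rule order_trans[OF keys_sum], rule UN_least) (use assms in "auto split: option.splits if_splits")

context fin_digraph
begin

text \<open>The left coefficient at the arrow e: a leading e is removed and paths that do not start
  with e go to zero. Together with the trivial part these coefficients determine an element, see
  \<open>path_decompose\<close>.\<close>

definition pderiv :: "'b => ('a,'b,'k::field) path_elem => ('a,'b,'k) path_elem" where
 "pderiv e = partial_extension (%(u, p, v). case p of [] => None
  | e' # q => if e' = e then Some (head G e, q, v) else None)"

definition ptriv :: "('a,'b,'k::field) path_elem => ('a,'b,'k) path_elem" where
 "ptriv = partial_extension (%(u, p, v). case p of [] => Some (u, [], v) | e' # q => None)"

definition paths_le :: "nat => ('a,'b) path set" where
 "paths_le d = {(u, p, v). awalk u p v & length p <= d}"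

lemma paths_le_subset: "paths_le d <= paths G" "m <= n ==> paths_le m <= paths_le n"
 by(auto simp: paths_le_def paths_iff)

lemma finite_paths_le: "finite (paths_le d)"
proof (rule finite_subset)
 show "paths_le d <= verts G \<times> {p. set p <= arcs G & length p <= d} \<times> verts G"
  by(auto simp: paths_le_def awalk_def intro: awalk_last_in_verts[unfolded awalk_def])
 show "finite (verts G \<times> {p. set p <= arcs G & length p <= d} \<times> verts G)"
  using finite_lists_length_le[of "arcs G" d] by simp
qed

lemma keys_pderiv_le: assumes "keys x <= paths_le (Suc d)" shows "keys (pderiv e x) <= paths_le d"
 unfolding pderiv_def by(rule keys_partial_extension[OF _ assms])
  (auto simp: paths_le_def awalk_Cons_iff split: list.splits if_splits)

lemma pderiv_le_0: assumes "keys x <= paths_le 0" shows "pderiv e x = 0" using assms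
 by(induction x rule: span_induct)
  (auto simp: pderiv_def partial_extension_add paths_le_def split: list.split)

lemma keys_pderiv: assumes "keys x <= paths G" shows "keys (pderiv e x) <= paths G"
 unfolding pderiv_def by(rule keys_partial_extension[OF _ assms])
  (auto simp: paths_iff awalk_Cons_iff split: list.splits if_splits)

lemma keys_ptriv: assumes "keys x <= paths G" shows "keys (ptriv x) <= paths_le 0"
 unfolding ptriv_def by(rule keys_partial_extension[OF _ assms])
  (auto simp: paths_le_def paths_iff awalk_Nil_iff split: list.splits if_splits)

lemma vtx_pderiv: "bmul path_concat (path_vtx (head G e)) (pderiv e x) = pderiv e x"
proof -
 have "keys x <= UNIV" by simp
 thus ?thesis
 proof (induction x rule: span_induct)
  case (single p c)
  thus ?case by(cases p) (auto simp: pderiv_def path_vtx_single split: list.split)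
 qed (auto simp: pderiv_def partial_extension_add bmul_add_right)
qed

text \<open>Only the part of y that starts at the head of the arrow survives multiplication by the
  arrow; this is the origin of the vertex on the right.\<close>

lemma pderiv_arr_mult: assumes "keys y <= paths G"
 shows "pderiv e (bmul path_concat (path_arr G e') y) = (if e = e' then bmul path_concat (path_vtx (head G e)) y else 0)"
 using assms
proof (induction y rule: span_induct)
 case (single p c)
 thus ?case by(cases p) (auto simp: pderiv_def path_vtx_single path_arr_single)
next
 case zero
 thus ?case by(simp add: pderiv_def)
next
 case (add x y)
 thus ?case unfolding pderiv_def by(simp add: partial_extension_add bmul_add_right)
qed

lemma pderiv_add: "pderiv e (x + y) = pderiv e x + pderiv e y"
 by(simp add: pderiv_def partial_extension_add)

lemma pderiv_zero [simp]: "pderiv e 0 = 0" by(simp add: pderiv_def)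

lemma pderiv_sum: "pderiv e (\<Sum>i\<in>I. f i) = (\<Sum>i\<in>I. pderiv e (f i))"
 by(induction I rule: infinite_finite_induct) (auto simp: pderiv_add)

lemma path_decompose: assumes "keys x <= paths G"
 shows "x = ptriv x + (\<Sum>e\<in>arcs G. bmul path_concat (path_arr G e) (pderiv e x))"
 using assms
proof (induction x rule: span_induct)
 case (single p c)
 obtain u q v where p: "p = (u, q, v)" by(cases p)
 hence aw: "awalk u q v" using single by(simp add: paths_iff)
 show ?case
 proof (cases q)
  case Nil
  thus ?thesis using p by(simp add: ptriv_def pderiv_def)
 next
  case (Cons e q')
  hence e: "e : arcs G" "u = tail G e" using aw by(auto simp: awalk_Cons_iff)
  have "(\<Sum>e'\<in>arcs G. bmul path_concat (path_arr G e') (pderiv e' (single p c)))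
    = (\<Sum>e'\<in>arcs G. if e' = e then single p c else 0)"
   by(rule sum.cong) (auto simp: pderiv_def p Cons path_arr_single e)
  thus ?thesis using p Cons e by(simp add: ptriv_def)
 qed
next
 case zero
 thus ?case by(simp add: ptriv_def)
next
 case (add x y)
 have "ptriv (x + y) + (\<Sum>e\<in>arcs G. bmul path_concat (path_arr G e) (pderiv e (x + y)))
  = (ptriv x + (\<Sum>e\<in>arcs G. bmul path_concat (path_arr G e) (pderiv e x)))
  + (ptriv y + (\<Sum>e\<in>arcs G. bmul path_concat (path_arr G e) (pderiv e y)))"
  by(simp add: ptriv_def partial_extension_add pderiv_add bmul_add_right sum.distrib)
 thus ?case using add by simp
qed

lemma lookup_ptriv: assumes "keys x <= paths G"
 shows "ptriv x = (\<Sum>v\<in>verts G. single (v, [], v) (lookup x (v, [], v)))" using assms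
proof (induction x rule: span_induct)
 case (single p c)
 obtain u q v where p: "p = (u, q, v)" by(cases p)
 hence aw: "awalk u q v" using single by(simp add: paths_iff)
 show ?case
 proof (cases q)
  case Nil
  hence uv: "u = v" "v : verts G" using aw by(auto simp: awalk_Nil_iff)
  have "(\<Sum>w\<in>verts G. single (w, [] :: 'b list, w) (lookup (single p c) (w, [], w)))
   = (\<Sum>w\<in>verts G. if w = v then single (v, [], v) c else 0)"
   by(rule sum.cong) (auto simp: p Nil uv lookup_single)
  thus ?thesis using uv p Nil by(simp add: ptriv_def)
 next
  case (Cons e q')
  thus ?thesis using p by(simp add: ptriv_def lookup_single)
 qed
qed (auto simp: ptriv_def partial_extension_add lookup_add single_add sum.distrib)

end

text \<open>
 Ghost paths are linearly independent: the Leavitt path algebra acts on functions on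
 \<open>vertex \<times> \<nat> \<times> \<int>\<close>, where the paths of a given length starting at a vertex act with disjoint
 images on the second coordinate and the third coordinate records the length.
\<close>

definition rep_space :: "('v,'e) pre_digraph => ('r,'v \<times> nat \<times> int => 'k::field) module" where
 "rep_space E = mk_module {f. ALL w n z. w ~: verts E --> f (w, n, z) = 0} (%_. 0) (%f g x. f x + g x) (%_. undefined)"

context fin_digraph
begin

text \<open>For a vertex v that emits arrows, the product of its finite nonempty set of arrows with
  the natural numbers is countably infinite. The maps \<open>bt e\<close> with e leaving v then
  split the natural numbers into disjoint copies of themselves, which models the relation expressing
  v as a sum over its outgoing arrows.\<close>

lemma ex_branching: "EX bt :: 'b => nat => nat. ALL v:verts G. (EX e:arcs G. tail G e = v) -->
 bij_betw (%(e, n). bt e n) ({e : arcs G. tail G e = v} \<times> UNIV) UNIV"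
proof -
 have "EX b :: 'b \<times> nat => nat. bij_betw b ({e : arcs G. tail G e = v} \<times> UNIV) UNIV"
  if "EX e:arcs G. tail G e = v" for v
 proof (rule exI[of _ "to_nat_on ({e : arcs G. tail G e = v} \<times> (UNIV :: nat set))"], rule to_nat_on_infinite)
  show "countable ({e : arcs G. tail G e = v} \<times> (UNIV :: nat set))" by(intro countable_SIGMA) (auto simp: countable_finite)
  show "infinite ({e : arcs G. tail G e = v} \<times> (UNIV :: nat set))"
   using that by(auto simp: finite_cartesian_product_iff)
 qed
 hence "ALL v. EX b :: 'b \<times> nat => nat. (EX e:arcs G. tail G e = v) -->
   bij_betw b ({e : arcs G. tail G e = v} \<times> UNIV) UNIV" by blast
 from choice[OF this] obtain b :: "'a => 'b \<times> nat => nat" where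
  b: "ALL v. (EX e:arcs G. tail G e = v) --> bij_betw (b v) ({e : arcs G. tail G e = v} \<times> UNIV) UNIV" by(elim exE)
 have "bij_betw (%(e, n). b (tail G e) (e, n)) ({e : arcs G. tail G e = v} \<times> UNIV) UNIV"
  if "EX e:arcs G. tail G e = v" for v
  by(subst bij_betw_cong[of _ _ "b v"]) (use b[rule_format, OF that] in auto)
 thus ?thesis by(intro exI[of _ "%e n. b (tail G e) (e, n)"]) blast
qed

lemma rep_space_simps:
 "car (rep_space G) = {f. ALL w n z. w ~: verts G --> f (w, n, z) = 0}"
 "\<zero>_{rep_space G} = (%_. 0)" "f \<oplus>_{rep_space G} g = (%x. f x + g x)"
 by(simp_all add: rep_space_def)

lemma abelian_group_rep_space: "abelian_group (rep_space G :: ('r,'a \<times> nat \<times> int => 'k::field) module)"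
proof (rule abelian_groupI)
 let ?V = "rep_space G :: ('r,'a \<times> nat \<times> int => 'k) module"
 show "EX y:car ?V. y \<oplus>_{?V} x = \<zero>_{?V}" if "x : car ?V" for x
  using that by(intro bexI[of _ "%p. - x p"]) (auto simp: rep_space_simps)
qed (auto simp: rep_space_simps algebra_simps)

lemma finsum_rep_space: assumes "finite I" "!!i. i : I ==> f i : car (rep_space G)"
 shows "finsum (rep_space G :: ('r,'a \<times> nat \<times> int => 'k::field) module) f I = (%x. \<Sum>i\<in>I. f i x)"
 using assms
proof (induction I rule: finite_induct)
 case empty
 interpret V: abelian_group "rep_space G :: ('r,'a \<times> nat \<times> int => 'k) module" by(rule abelian_group_rep_space)
 show ?case by(simp add: rep_space_simps)
next
 case (insert i I)
 interpret V: abelian_group "rep_space G :: ('r,'a \<times> nat \<times> int => 'k) module" by(rule abelian_group_rep_space)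
 have "f : I \<rightarrow> car (rep_space G :: ('r,'a \<times> nat \<times> int => 'k) module)"
  "f i : car (rep_space G :: ('r,'a \<times> nat \<times> int => 'k) module)"
  using insert.prems by(auto simp: rep_space_simps)
 hence "finsum (rep_space G :: ('r,'a \<times> nat \<times> int => 'k) module) f (insert i I)
   = f i \<oplus>_{rep_space G :: ('r,'a \<times> nat \<times> int => 'k) module} finsum (rep_space G :: ('r,'a \<times> nat \<times> int => 'k) module) f I"
  using insert.hyps by simp
 thus ?case using insert by(simp add: rep_space_simps)
qed

text \<open>Suppose a path p occurs in q. Apply q to the indicator function of the point where p
  takes its argument, for a suitable evaluation point: end vertex, second and third coordinate
  together single out p among all paths with its starting vertex, so the value is the coefficient of
  p.\<close>

lemma ghost_embed_injective: assumes q: "keys q <= paths Gi"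
  and q0: "gemb q = \<zero>_{LA :: ('a,'b,'k::field) leavitt_ring}"
 shows "q = (0 :: ('a,'b,'k) path_elem)"
proof -
 interpret I: fin_digraph Gi by(rule inverse_fin)
 let ?V = "rep_space G :: (unit, 'a \<times> nat \<times> int => 'k) module"
 interpret V: abelian_group ?V by(rule abelian_group_rep_space)
 obtain bt :: "'b => nat => nat" where bt: "!!v. v : verts G ==> EX e:arcs G. tail G e = v ==>
  bij_betw (%(e, n). bt e n) ({e : arcs G. tail G e = v} \<times> UNIV) UNIV"
  using ex_branching by blast
 have btinj: "e = e' & n = n'" if "e : arcs G" "e' : arcs G" "tail G e = tail G e'" "bt e n = bt e' n'" for e e' n n'
 proof -
  have "inj_on (%(e, n). bt e n) ({a : arcs G. tail G a = tail G e} \<times> UNIV)"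
   using bt[of "tail G e"] that by(auto simp: bij_betw_def)
  from inj_onD[OF this, of "(e, n)" "(e', n')"] that show ?thesis by auto
 qed
 have btsurj: "EX e n. e : arcs G & tail G e = v & m = bt e n" if "v : verts G" "EX e:arcs G. tail G e = v" for v m
 proof -
  have "m : (%(e, n). bt e n) ` ({e : arcs G. tail G e = v} \<times> UNIV)"
   using bt[OF that] by(simp add: bij_betw_def)
  thus ?thesis by auto
 qed
 define sc where "sc c f = (%x. c * f x)" for c :: 'k and f :: "'a \<times> nat \<times> int => 'k"
 define vt where "vt v f = (%(w, n, z). if w = v then f (w, n, z) else 0)" for v and f :: "'a \<times> nat \<times> int => 'k"
 \<comment> \<open>\<open>ar e\<close> inverts \<open>gh e\<close> along the image of
   \<open>bt e\<close> and vanishes off this image. Its shift by -1 undoes the shift by +1 in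
   \<open>gh e\<close>; the third coordinate is an integer so that both shifts are
   invertible.\<close>
 define ar where "ar e f = (%(w, m, z). if w = tail G e & (EX n. m = bt e n) then f (head G e, (THE n. m = bt e n), z - 1) else 0)"
  for e and f :: "'a \<times> nat \<times> int => 'k"
 define gh where "gh e f = (%(w, n, z). if w = head G e then f (tail G e, bt e n, z + 1) else 0)"
  for e and f :: "'a \<times> nat \<times> int => 'k"
 have the: "(THE n'. bt e n = bt e n') = n" if "e : arcs G" for e n
  using btinj[OF that that refl] by blast
 have arb: "ar e f (w, bt e n, z) = (if w = tail G e then f (head G e, n, z - 1) else 0)" if "e : arcs G" for e f w n z
  using the[OF that] by(auto simp: ar_def)
 have arn: "ar e f (w, bt e' n, z) = 0" if "e : arcs G" "e' : arcs G" "e ~= e'" "tail G e = tail G e'" for e e' f w n z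
  using btinj[OF that(2,1)] that by(auto simp: ar_def)
 have gen: "vt v f : car ?V" "ar e f : car ?V" "gh e f : car ?V"
  if "v : verts G" "e : arcs G" "f : car ?V" for v e f
  using that by(auto simp: rep_space_simps vt_def ar_def gh_def)
 have L: "leavitt_ops ?V sc G vt ar gh"
  unfolding leavitt_ops_def leavitt_ops_axioms_def kspace_def kspace_axioms_def
 proof (intro conjI allI impI)
  show "abelian_group ?V" by(rule abelian_group_rep_space)
  show "fin_digraph G" by(rule fin_digraph_axioms)
  fix f assume f: "f : car ?V"
  show "vt v f : car ?V" if "v : verts G" for v using that f by(auto simp: rep_space_simps vt_def)
  show "ar e f : car ?V" "gh e f : car ?V" if "e : arcs G" for e
   using that f by(auto simp: rep_space_simps ar_def gh_def)
  show "finsum ?V (%v. vt v f) (verts G) = f"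
  proof -
   have "finsum ?V (%v. vt v f) (verts G) = (%x. \<Sum>v\<in>verts G. vt v f x)"
    by(rule finsum_rep_space) (use f in "auto simp: rep_space_simps vt_def")
   also have "... = f" using f by(auto simp: vt_def rep_space_simps fun_eq_iff)
   finally show ?thesis .
  qed
  show "gh e (ar e' f) = (if e = e' then vt (head G e) f else \<zero>_{?V})" if e: "e : arcs G" "e' : arcs G" for e e'
  proof (cases "e = e'")
   case True
   thus ?thesis using arb[OF e(1)] by(auto simp: gh_def vt_def fun_eq_iff)
  next
   case False
   have "ar e' f (tail G e, bt e n, z) = 0" for n z
   proof (cases "tail G e = tail G e'")
    case True
    show ?thesis by(rule arn) (use e False True in auto)
   qed (simp add: ar_def)
   thus ?thesis using False by(auto simp: gh_def rep_space_simps fun_eq_iff)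
  qed
  show "vt v f = finsum ?V (%e. ar e (gh e f)) {e : arcs G. tail G e = v}" if v: "v : verts G" "EX e:arcs G. tail G e = v" for v
  proof -
   have "finsum ?V (%e. ar e (gh e f)) {e : arcs G. tail G e = v} = (%x. \<Sum>e\<in>{e : arcs G. tail G e = v}. ar e (gh e f) x)"
    by(rule finsum_rep_space) (use f in "auto simp: rep_space_simps ar_def gh_def")
   also have "... = vt v f"
   proof
    fix x :: "'a \<times> nat \<times> int"
    obtain w m z where x: "x = (w, m, z)" by(cases x)
    obtain e n where e: "e : arcs G" "tail G e = v" "m = bt e n" using btsurj[OF v] by blast
    have "ar e' (gh e' f) x = (if e' = e then vt v f x else 0)" if "e' : arcs G" "tail G e' = v" for e'
     using arb[OF e(1)] arn[OF that(1) e(1)] e that x by(auto simp: vt_def gh_def)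
    hence "(\<Sum>e'\<in>{e : arcs G. tail G e = v}. ar e' (gh e' f) x) = (\<Sum>e'\<in>{e : arcs G. tail G e = v}. if e' = e then vt v f x else 0)"
     by(intro sum.cong) auto
    thus "(\<Sum>e\<in>{e : arcs G. tail G e = v}. ar e (gh e f) x) = vt v f x" using e by simp
   qed
   finally show ?thesis ..
  qed
 qed (auto simp: rep_space_simps sc_def vt_def ar_def gh_def algebra_simps fun_eq_iff)
 obtain s where s: "left_module (LA :: ('a,'b,'k) leavitt_ring) (mk_module (car ?V) \<zero>_{?V} (%x y. x \<oplus>_{?V} y) s)"
  and sV: "!!f c. f : car ?V ==> s (semb c) f = sc c f"
   "!!f v. f : car ?V ==> v : verts G ==> s (lg (Vtx v)) f = vt v f"
   "!!f e. f : car ?V ==> e : arcs G ==> s (lg (Ghost e)) f = gh e f"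
  using leavitt_module_of_ops[OF L] by blast
 let ?M = "mk_module (car ?V) \<zero>_{?V} (%x y. x \<oplus>_{?V} y) s"
 interpret M: left_module "LA :: ('a,'b,'k) leavitt_ring" ?M by(rule s)
 note gE = ghost_embed_hom[where 'k = 'k]
 have cl: "gemb a : car (LA :: ('a,'b,'k) leavitt_ring)" if "keys a <= paths Gi" for a
  using ring_hom_closed[OF gE(1)] that by(simp add: I.PA_simps)
 have smult: "s (x \<otimes>_{LA} y) f = s x (s y f)" "s y f : car ?V" if "x : car LA" "y : car LA" "f : car ?V" for x y f
  using M.smult_assoc[of x y f] M.smult_closed[of y f] that by auto
 have gmul: "gemb (bmul path_concat a b) = gemb a \<otimes>_{LA} (gemb b :: ('a,'b,'k) leavitt_elem)"
  if "keys a <= paths Gi" "keys b <= paths Gi" for a b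
  using ring_hom_mult[OF gE(1), of a b] that by(simp add: I.PA_simps)
 \<comment> \<open>\<open>fold\<close> applies the map of the first arrow first, so the value lies
   in the image of the map of the last arrow.\<close>
 define bb where "bb p m = fold bt p m" for p m
 have act1: "s (gemb (single (u, p, v) 1)) f = (%(w, m, z). if w = u then f (v, bb p m, z + int (length p)) else 0)"
  if "I.awalk u p v" "f : car ?V" for u p v f using that(1)
 proof (induction p arbitrary: u)
  case Nil
  hence uv: "u = v" "v : verts G" by(auto simp: I.awalk_Nil_iff)
  hence "gemb (single (u, [], v) 1) = (lg (Vtx v) :: ('a,'b,'k) leavitt_elem)"
   using gE(3)[of v] by(simp add: path_vtx_def)
  thus ?case using uv that(2) by(auto simp: sV bb_def vt_def fun_eq_iff)
 next
  case (Cons e p)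
  hence e: "e : arcs G" "u = head G e" "I.awalk (tail G e) p v" by(auto simp: I.awalk_Cons_iff)
  have k: "keys (path_arr Gi e :: _ \<Rightarrow>\<^sub>0 'k) <= paths Gi"
   "keys (single (tail G e, p, v) (1::'k)) <= paths Gi"
   using I.path_gens_closed(3)[of e] e by(auto simp: I.PA_simps I.paths_iff)
  have "single (u, e # p, v) (1::'k) = bmul path_concat (path_arr Gi e) (single (tail G e, p, v) 1)"
   using I.path_arr_single[of e "tail G e" p v "1::'k"] e by simp
  hence "s (gemb (single (u, e # p, v) 1)) f
    = s (gemb (path_arr Gi e)) (s (gemb (single (tail G e, p, v) 1)) f)"
   using gmul[OF k] smult(1)[OF cl[OF k(1)] cl[OF k(2)] that(2)] by simp
  also have "... = gh e (s (gemb (single (tail G e, p, v) 1)) f)"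
   using gE(4)[OF e(1)] sV(3)[OF smult(2)[OF cl[OF k(2)] cl[OF k(2)] that(2)] e(1)] by simp
  finally show ?case unfolding Cons.IH[OF e(3)] using e by(auto simp: gh_def bb_def fun_eq_iff algebra_simps)
 qed
 have act: "s (gemb a) f (w, m, z) = (\<Sum>(u, p, v)\<in>keys a. lookup a (u, p, v) * (if w = u then f (v, bb p m, z + int (length p)) else 0))"
  if "keys a <= paths Gi" "f : car ?V" for a f w m z
 proof -
  let ?t = "%a (u, p, v). lookup a (u, p, v) * (if w = u then f (v, bb p m, z + int (length p)) else 0)"
  have sup: "sum (?t a) (keys a) = sum (?t a) X" if "finite X" "keys a <= X" for a X
   by(rule sum.mono_neutral_left) (use that in "auto simp: in_keys_iff")
  show ?thesis using that(1)
  proof (induction a rule: span_induct)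
   case zero
   have "gemb 0 = \<zero>_{LA :: ('a,'b,'k) leavitt_ring}"
    by(simp add: ghost_embed_def leavitt_class_zero)
   thus ?case using M.smult_l_null[of f] that(2) by(simp add: rep_space_simps)
  next
   case (single p c)
   obtain u r v where p: "p = (u, r, v)" by(cases p)
   hence aw: "I.awalk u r v" using single by(simp add: I.paths_iff)
   have k: "keys (path_scalar Gi c) <= paths Gi"
    "keys (single p (1::'k)) <= paths Gi"
    using I.path_gens_closed(1)[of c] single by(auto simp: I.PA_simps)
   have "single p c = bmul path_concat (path_scalar Gi c) (single p 1)"
    using I.path_scalar_single[of u r v c 1] single p by simp
   hence "s (gemb (single p c)) f = sc c (s (gemb (single p 1)) f)"
    using gmul[OF k] smult(1)[OF cl[OF k(1)] cl[OF k(2)] that(2)] gE(2)[of c]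
     sV(1)[OF smult(2)[OF cl[OF k(2)] cl[OF k(2)] that(2)]] by simp
   thus ?case unfolding p act1[OF aw that(2)] by(simp add: sc_def)
  next
   case (add x y)
   let ?X = "keys x Un keys y"
   have "gemb (x + y) = gemb x \<oplus>_{LA} (gemb y :: ('a,'b,'k) leavitt_elem)"
    using ring_hom_add[OF gE(1), of x y] add.hyps by(simp add: I.PA_simps)
   hence "s (gemb (x + y)) f = (%p. s (gemb x) f p + s (gemb y) f p)"
    using M.smult_l_distr[of "gemb x" "gemb y" f] cl add.hyps that(2) by(simp add: rep_space_simps)
   moreover have "sum (?t (x + y)) ?X = sum (?t x) ?X + sum (?t y) ?X"
    unfolding sum.distrib[symmetric] by(rule sum.cong) (auto simp: lookup_add distrib_right)
   ultimately show ?case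
    using add.IH sup[of ?X "x + y"] sup[of ?X x] sup[of ?X y] keys_add[of x y] by simp
  qed
 qed
 \<comment> \<open>Two paths of the inverse quiver that end at v have last arrows which leave v in
   E, and there the maps \<open>bt\<close> have disjoint images. So the paths are compared from the
   end, and the induction removes last arrows.\<close>
 have bbinj: "p = p'" if "I.awalk u p v" "I.awalk u' p' v" "length p = length p'" "bb p m = bb p' m'" for u u' p p' v m m'
  using that
 proof (induction p arbitrary: p' v m m' rule: rev_induct)
  case (snoc e p)
  then obtain e' r where p': "p' = r @ [e']" by(cases p' rule: rev_cases) auto
  have a: "I.awalk u p (head G e)" "e : arcs G" "v = tail G e"
   using snoc.prems(1) by(auto simp: I.awalk_append_iff I.awalk_Cons_iff I.awalk_Nil_iff)
  have b: "I.awalk u' r (head G e')" "e' : arcs G" "v = tail G e'"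
   using snoc.prems(2) by(auto simp: p' I.awalk_append_iff I.awalk_Cons_iff I.awalk_Nil_iff)
  have "bt e (bb p m) = bt e' (bb r m')" using snoc.prems(4) by(simp add: bb_def p')
  moreover have "tail G e = tail G e'" using a(3) b(3) by simp
  ultimately have "e = e' & bb p m = bb r m'" using btinj[OF a(2) b(2)] by blast
  hence e: "e = e'" "bb p m = bb r m'" by auto
  have "p = r"
  proof (rule snoc.IH[OF a(1)])
   show "I.awalk u' r (head G e)" using b(1) e(1) by simp
   show "length p = length r" using snoc.prems(3) p' by simp
   show "bb p m = bb r m'" by(rule e(2))
  qed
  thus ?case using e(1) p' by simp
 qed simp
 show ?thesis
 proof (rule ccontr)
  assume "q ~= 0"
  then obtain k where k: "k : keys q" by(metis keys_eq_empty equals0I)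
  obtain u p v where kp: "k = (u, p, v)" by(cases k)
  hence aw: "I.awalk u p v" using q k by(auto simp: I.paths_iff)
  have vG: "v : verts G" using I.awalk_last_in_verts[OF aw] by simp
  \<comment> \<open>With third coordinate 0 and evaluation at minus the length of p, only paths of
    the same length as p can contribute.\<close>
  define f where "f = (%x. if x = (v, bb p 0, 0::int) then 1 else (0::'k))"
  have f: "f : car ?V" using vG by(auto simp: f_def rep_space_simps)
  have "s (gemb q) f (u, 0, - int (length p)) = 0"
   unfolding q0 using M.smult_l_null[of f] f by(simp add: rep_space_simps)
  moreover have "s (gemb q) f (u, 0, - int (length p))
   = (\<Sum>k'\<in>keys q. if k' = k then lookup q k else 0)" unfolding act[OF q f]
  proof (rule sum.cong[OF refl])
   fix k' assume k': "k' : keys q"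
   obtain u' p' v' where kp': "k' = (u', p', v')" by(cases k')
   hence aw': "I.awalk u' p' v'" using q k' by(auto simp: I.paths_iff)
   have "u = u' ==> v' = v ==> length p' = length p ==> bb p' 0 = bb p 0 ==> p' = p"
    using bbinj[OF aw' , of u p 0 0] aw by auto
   thus "(case k' of (ua, pa, va) => lookup q (ua, pa, va) *
     (if u = ua then f (va, bb pa 0, - int (length p) + int (length pa)) else 0))
     = (if k' = k then lookup q k else 0)" by(auto simp: kp kp' f_def)
  qed
  ultimately show False using k by(simp add: in_keys_iff)
 qed
qed

end

section \<open>Filtrations by the length of ghost paths\<close>

text \<open>\<open>F d\<close> is modelled on elements of ghost length at most d.
  \<open>F_lower\<close> and \<open>F_bottom\<close> say that terms with different leading ghost
  arrows cannot cancel, provided each coefficient is cut down to the tail of its arrow. The pieces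
  need not exhaust the module: their union is a generating ghost-stable subspace, which is the input
  of \<open>ghost_descent\<close>. The axioms are satisfied by L(E) and by finite free modules over
  it.\<close>

locale ghost_filtration = leavitt_ops M sc E vt ar gh
 for M :: "('m,'z) ring_scheme" (structure) and sc :: "'k::field => 'm => 'm"
  and E :: "('v,'e) pre_digraph" and vt ar gh +
 fixes F :: "nat => 'm set" assumes F_fd: "fd (F d)" and F_Suc: "F d <= F (Suc d)"
  and F_vt: "v : verts E ==> x : F d ==> vt v x : F d"
  and F_gh: "e : arcs E ==> x : F d ==> gh e x : F (Suc d)"
  and F_decompose: "x : F (Suc d) ==> EX y z. z : F 0 & (ALL e:arcs E. y e : F d & vt (tail E e) (y e) = y e)
    & x = z \<oplus> gh_sum y"
  and F_lower: "(!!e. e : arcs E ==> y e : F m) ==> (!!e. e : arcs E ==> vt (tail E e) (y e) = y e)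
    ==> (gh_sum y) : F (Suc d) ==> e : arcs E ==> y e : F d"
  and F_bottom: "(!!e. e : arcs E ==> y e : F m) ==> (!!e. e : arcs E ==> vt (tail E e) (y e) = y e)
    ==> (gh_sum y) : F 0 ==> e : arcs E ==> y e = \<zero>" and F_generates: "car M <= fspan (F 0)"
begin

lemma F_ksub: "ksub (F d)" using F_fd fd_ksub by auto

lemmas FD = ksubD[OF F_ksub]

lemma F_mono: "m <= n ==> F m <= F n" by(rule lift_Suc_mono_le[of F]) (rule F_Suc)

lemma single_gh_sum: assumes "e : arcs E" "x : car M"
 shows "(\<Oplus>e'\<in>arcs E. gh e' (if e' = e then x else \<zero>)) = gh e x"
proof -
 have "(\<Oplus>e'\<in>arcs E. gh e' (if e' = e then x else \<zero>)) = (\<Oplus>e'\<in>arcs E. if e = e' then gh e' x else \<zero>)"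
  by(rule add.finprod_cong') (use assms in auto)
 also have "... = gh e x" by(rule add.finprod_singleton) (use assms in auto)
 finally show ?thesis .
qed

lemma F_lower1: assumes "e : arcs E" "x : F m" "vt (tail E e) x = x"
 shows "gh e x : F (Suc d) ==> x : F d" "gh e x : F 0 ==> x = \<zero>"
proof -
 let ?y = "%e'. if e' = e then x else \<zero>"
 have x: "x : car M" using assms FD(5) by blast
 have y: "?y e' : F m" "vt (tail E e') (?y e') = ?y e'" if "e' : arcs E" for e'
  using that assms FD(2) by auto
 show "x : F d" if "gh e x : F (Suc d)"
  using F_lower[of ?y m d e, OF y] single_gh_sum[OF assms(1) x] that assms(1) by simp
 show "x = \<zero>" if "gh e x : F 0"
  using F_bottom[of ?y m e, OF y] single_gh_sum[OF assms(1) x] that assms(1) by simp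
qed

text \<open>If v is no sink, choose an arrow e leaving v. Its ghost sends the component of x at v
  back into W, hence into the bounding piece, and lengthens it by one; so this component has smaller
  length than assumed. The bound on W thus drops step by step to zero, where \<open>F_bottom\<close>
  kills what is left.\<close>

lemma bounded_ghost_closed_zero: assumes W: "W <= F m" "!!v x. v : verts E ==> x : W ==> vt v x : W"
  "!!e x. e : arcs E ==> x : W ==> gh e x : W" "!!w x. sink w ==> x : W ==> vt w x = \<zero>"
 shows "W <= {\<zero>}"
proof -
 have step: "EX e:arcs E. tail E e = v & vt v x : F d & vt (tail E e) (vt v x) = vt v x & gh e (vt v x) : W"
  if h: "W <= F d" "x : W" "v : verts E" "~ sink v" for v x d
 proof -
  obtain e where e: "e : arcs E" "tail E e = v" using h by(auto simp: sink_def)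
  thus ?thesis using h W(2,3) FD(5) by(intro bexI[of _ e]) (auto simp: vt_vt)
 qed
 have all: "x : K" if "x : W" "subgroup K (add_monoid M)" "!!v. v : verts E ==> ~ sink v ==> vt v x : K" for x K
 proof -
  have "(\<Oplus>v\<in>verts E. vt v x) : K"
  proof (rule sub_finsum[OF that(2)])
   show "vt v x : K" if "v : verts E" for v
    using that W(4)[of v x] \<open>x : W\<close> \<open>!!v. v : verts E ==> ~ sink v ==> vt v x : K\<close>
     subgrpD(2)[OF \<open>subgroup K (add_monoid M)\<close>] by(cases "sink v") auto
  qed
  thus ?thesis using vt_sum[of x] W(1) FD(5) that(1) by auto
 qed
 have down: "W <= F d ==> W <= {\<zero>}" for d
 proof (induction d)
  case 0
  show ?case
  proof
   fix x assume x: "x : W"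
   show "x : {\<zero>}"
   proof (rule all[OF x subgroup_zero])
    fix v assume v: "v : verts E" "~ sink v"
    obtain e where e: "e : arcs E" "tail E e = v" "vt v x : F 0" "vt (tail E e) (vt v x) = vt v x" "gh e (vt v x) : W"
     using step[OF 0 x v] by blast
    thus "vt v x : {\<zero>}" using F_lower1(2)[OF e(1,3,4)] 0 by blast
   qed
  qed
 next
  case (Suc d)
  have "W <= F d"
  proof
   fix x assume x: "x : W"
   show "x : F d"
   proof (rule all[OF x ksub_subgroup[OF F_ksub]])
    fix v assume v: "v : verts E" "~ sink v"
    obtain e where e: "e : arcs E" "tail E e = v" "vt v x : F (Suc d)" "vt (tail E e) (vt v x) = vt v x" "gh e (vt v x) : W"
     using step[OF Suc.prems x v] by blast
    thus "vt v x : F d" using F_lower1(1)[OF e(1,3,4)] Suc.prems by blast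
   qed
  qed
  thus ?case by(rule Suc.IH)
 qed
 thus ?thesis using W(1) by blast
qed

end

section \<open>Regular and free modules\<close>

lemma finsum_same:
 fixes M :: "('m,'z) ring_scheme" and M' :: "('m,'y) ring_scheme"
 assumes "car M' = car M" "!!x y. x \<oplus>_{M'} y = x \<oplus>_{M} y" "\<zero>_{M'} = \<zero>_{M}"
 shows "finsum M' f I = finsum M f I"
proof -
 have "(\<oplus>_{M'}) = (\<oplus>_{M})" using assms(2) by(simp add: fun_eq_iff)
 thus ?thesis using assms(1,3) unfolding finsum_def finprod_def by simp
qed

definition reg_module :: "('r,'a) ring_scheme => ('r,'r) module" where
 "reg_module R = mk_module (car R) \<zero>_{R} (%x y. x \<oplus>_{R} y) (%a x. a \<otimes>_{R} x)"

lemma reg_module_simps [simp]: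
 "car (reg_module R) = car R" "\<zero>_{reg_module R} = \<zero>_{R}"
 "x \<oplus>_{reg_module R} y = x \<oplus>_{R} y" "a \<odot>_{reg_module R} x = a \<otimes>_{R} x"
 by(simp_all add: reg_module_def)

lemma left_module_reg: assumes "ring R" shows "left_module R (reg_module R)"
proof -
 interpret ring R by fact
 have "abelian_group (reg_module R)"
  unfolding reg_module_def by(rule abelian_group_mk_module) (rule abelian_group_axioms)
 thus ?thesis unfolding left_module_def left_module_axioms_def using assms
  by(simp add: l_distr r_distr m_assoc)
qed

lemma free_simps:
 "car (free_module R I) = {f. (ALL i:I. f i : car R) & (ALL i. i ~: I --> f i = \<zero>_{R}) & finite {i. f i ~= \<zero>_{R}}}"
 "\<zero>_{free_module R I} = (%i. \<zero>_{R})"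
 "f \<oplus>_{free_module R I} g = (%i. f i \<oplus>_{R} g i)"
 "a \<odot>_{free_module R I} f = (%i. a \<otimes>_{R} f i)" by(simp_all add: free_module_def)

lemma left_module_free: fixes R (structure) assumes "ring R" shows "left_module R (free_module R I)"
proof -
 interpret ring R by fact
 let ?X = "free_module R I"
 have c: "f i : car R" if "f : car ?X" for f i using that by(auto simp: free_simps)
 have "abelian_group ?X"
 proof (rule abelian_groupI)
  show "x \<oplus>_{?X} y : car ?X" if "x : car ?X" "y : car ?X" for x y
  proof -
   have "{i. x i \<oplus> y i ~= \<zero>} <= {i. x i ~= \<zero>} Un {i. y i ~= \<zero>}" using c that by auto
   thus ?thesis using that by(auto simp: free_simps intro: finite_subset)
  qed
  show "EX y:car ?X. y \<oplus>_{?X} x = \<zero>_{?X}" if "x : car ?X" for x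
  proof (rule bexI[of _ "%i. \<ominus> x i"])
   have "{i. \<ominus> x i ~= \<zero>} <= {i. x i ~= \<zero>}" by auto
   thus "(%i. \<ominus> x i) : car ?X" using that by(auto simp: free_simps intro: finite_subset)
   show "(%i. \<ominus> x i) \<oplus>_{?X} x = \<zero>_{?X}" using c[OF that] by(simp add: free_simps l_neg)
  qed
  show "\<zero>_{?X} \<oplus>_{?X} x = x" if "x : car ?X" for x
   using c[OF that] by(simp add: free_simps)
  show "x \<oplus>_{?X} y = y \<oplus>_{?X} x" if "x : car ?X" "y : car ?X" for x y
   using c[OF that(1)] c[OF that(2)] by(simp add: free_simps a_comm)
  show "x \<oplus>_{?X} y \<oplus>_{?X} z = x \<oplus>_{?X} (y \<oplus>_{?X} z)" if "x : car ?X" "y : car ?X" "z : car ?X" for x y z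
   using c[OF that(1)] c[OF that(2)] c[OF that(3)] by(simp add: free_simps a_assoc)
 qed (auto simp: free_simps)
 moreover have "a \<odot>_{?X} x : car ?X" if "a : car R" "x : car ?X" for a x
 proof -
  have "{i. a \<otimes> x i ~= \<zero>} <= {i. x i ~= \<zero>}" using that by auto
  thus ?thesis using that by(auto simp: free_simps intro: finite_subset)
 qed
 moreover have "\<one> \<odot>_{?X} x = x" if "x : car ?X" for x
  using c[OF that] by(simp add: free_simps)
 ultimately show ?thesis unfolding left_module_def left_module_axioms_def using assms c
  by(simp add: free_simps(3,4) l_distr r_distr m_assoc)
qed

lemma finsum_free_module:
 fixes R :: "('r,'a) ring_scheme" (structure) and f :: "'j => 'i => 'r"
 assumes "ring R" "!!j. j : J ==> f j : car (free_module R I)"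
 shows "(\<Oplus>_{free_module R I}j\<in>J. f j) i = (\<Oplus>_{R}j\<in>J. f j i)" using assms(2)
proof (induction J rule: infinite_finite_induct)
 case (insert j J)
 interpret R: ring R by fact
 interpret X: left_module R "free_module R I" by(rule left_module_free) fact
 have "f : J \<rightarrow> car (free_module R I)" using insert.prems by auto
 moreover have "f j i : car R" "(%j. f j i) : J \<rightarrow> car R"
  using insert.prems by(auto simp: free_simps Pi_def; metis R.zero_closed)+
 ultimately show ?case using insert by(simp add: free_simps(3))
next
 case (infinite J)
 interpret R: ring R by fact
 interpret X: left_module R "free_module R I" by(rule left_module_free) fact
 show ?case using infinite by(simp add: free_simps(2))
next
 case empty
 interpret R: ring R by fact
 interpret X: left_module R "free_module R I" by(rule left_module_free) fact
 show ?case by(simp add: free_simps(2))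
qed

section \<open>The ghost filtration of the regular module\<close>

context fin_digraph
begin

lemma path_scalar_le: "keys (path_scalar G c) <= paths_le 0" unfolding path_scalar_def
 by(rule order_trans[OF keys_sum], rule UN_least) (auto simp: paths_le_def awalk_Nil_iff)

lemma path_vtx_le: "v : verts G ==> keys (path_vtx v) <= paths_le 0"
 by(auto simp: path_vtx_def paths_le_def awalk_Nil_iff)

lemma path_arr_le: "e : arcs G ==> keys (path_arr G e) <= paths_le (Suc 0)"
 by(auto simp: path_arr_def paths_le_def awalk_Nil_iff awalk_Cons_iff)

lemma keys_bmul_le:
 fixes x y :: "('a,'b,'k::field) path_elem" assumes "keys x <= paths_le m" "keys y <= paths_le n"
 shows "keys (bmul path_concat x y) <= paths_le (m + n)"
proof -
 have "keys (bterm path_concat p q a b) <= paths_le (m + n)" if "p : paths_le m" "q : paths_le n" for p q and a b :: 'k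
  using that by(cases p; cases q) (auto simp: paths_le_def bterm_def path_concat_def awalk_appendI split: if_splits)
 hence "keys (bterm path_concat p q (lookup x p) (lookup y q)) <= paths_le (m + n)"
  if "p : keys x" "q : keys y" for p q using that assms by blast
 thus ?thesis unfolding bmul_def
  by(intro order_trans[OF keys_sum] UN_least order_trans[OF keys_sum])
qed

definition Cf :: "nat => ('a,'b,'k::field) leavitt_elem set" where
 "Cf d = gemb ` {x. keys x <= fin_digraph.paths_le Gi d}"

lemma lpa_module_reg: "lpa_module G (reg_module (LA :: ('a,'b,'k::field) leavitt_ring))"
 unfolding lpa_module_def using left_module_reg[OF ring_LA] fin_digraph_axioms by blast

lemma ghost_embed_closed: assumes "keys a <= paths Gi"
 shows "gemb a : car (LA :: ('a,'b,'k::field) leavitt_ring)"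
proof -
 interpret I: fin_digraph Gi by(rule inverse_fin)
 show ?thesis using ring_hom_closed[OF ghost_embed_hom(1), of a] assms by(simp add: I.PA_simps)
qed

lemma ghost_embed_bmul: assumes "keys a <= paths Gi" "keys b <= paths Gi"
 shows "gemb (bmul path_concat a b) = gemb a \<otimes>_{LA} (gemb b :: ('a,'b,'k::field) leavitt_elem)"
  "gemb (a + b) = gemb a \<oplus>_{LA} (gemb b :: ('a,'b,'k::field) leavitt_elem)"
proof -
 interpret I: fin_digraph Gi by(rule inverse_fin)
 show "gemb (bmul path_concat a b) = gemb a \<otimes>_{LA} (gemb b :: ('a,'b,'k::field) leavitt_elem)"
  using ring_hom_mult[OF ghost_embed_hom(1), of a b] assms by(simp add: I.PA_simps)
 show "gemb (a + b) = gemb a \<oplus>_{LA} (gemb b :: ('a,'b,'k::field) leavitt_elem)"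
  using ring_hom_add[OF ghost_embed_hom(1), of a b] assms by(simp add: I.PA_simps)
qed

lemma ghost_embed_zero: "gemb 0 = \<zero>_{LA :: ('a,'b,'k::field) leavitt_ring}"
 by(simp add: ghost_embed_def leavitt_class_zero)

lemma ghost_embed_sum: assumes "finite J" "!!j. j : J ==> keys (f j) <= paths Gi"
 shows "gemb (\<Sum>j\<in>J. f j) = (\<Oplus>_{LA :: ('a,'b,'k::field) leavitt_ring}j\<in>J. gemb (f j))"
 using assms
proof (induction J rule: finite_induct)
 case empty
 interpret L: ring "LA :: ('a,'b,'k) leavitt_ring" by(rule ring_LA)
 show ?case by(simp add: ghost_embed_zero)
next
 case (insert j J)
 interpret L: ring "LA :: ('a,'b,'k) leavitt_ring" by(rule ring_LA)
 have k: "keys (\<Sum>j\<in>J. f j) <= paths Gi"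
  by(rule order_trans[OF keys_sum], rule UN_least) (use insert.prems in simp)
 have "(%j. gemb (f j)) : J \<rightarrow> car (LA :: ('a,'b,'k) leavitt_ring)"
  by(intro Pi_I ghost_embed_closed insert.prems) simp
 moreover have "gemb (f j) : car (LA :: ('a,'b,'k) leavitt_ring)"
  by(intro ghost_embed_closed insert.prems) simp
 ultimately show ?case using insert k ghost_embed_bmul(2)[of "f j" "\<Sum>j\<in>J. f j"] by simp
qed

lemma ghost_embed_eqD: assumes "keys a <= paths Gi" "keys b <= paths Gi"
  "gemb a = (gemb b :: ('a,'b,'k::field) leavitt_elem)" shows "a = b"
proof -
 interpret L: ring "LA :: ('a,'b,'k) leavitt_ring" by(rule ring_LA)
 have k: "keys (a - b) <= paths Gi" using assms keys_diff[of a b] by blast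
 have "gemb (a - b) \<oplus>_{LA} gemb b = (gemb a :: ('a,'b,'k) leavitt_elem)"
  using ghost_embed_bmul(2)[OF k assms(2)] by simp
 hence "gemb (a - b) = \<zero>_{LA :: ('a,'b,'k) leavitt_ring}"
  using ghost_embed_closed[OF k] ghost_embed_closed[OF assms(2)] assms(3) by simp
 hence "a - b = 0" by(rule ghost_embed_injective[OF k])
 thus ?thesis by simp
qed

lemma Cf_facts:
 fixes x y :: "('a,'b,'k::field) leavitt_elem" shows "Cf d <= car (LA :: ('a,'b,'k) leavitt_ring)"
  and "x : Cf m ==> y : Cf n ==> x \<otimes>_{LA} y : Cf (m + n)"
  and "x : Cf d ==> y : Cf d ==> x \<oplus>_{LA} y : Cf d"
  and "\<zero>_{LA} : (Cf d :: ('a,'b,'k) leavitt_elem set)"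
  and "semb c : (Cf 0 :: ('a,'b,'k) leavitt_elem set)"
  and "v : verts G ==> lg (Vtx v) : (Cf 0 :: ('a,'b,'k) leavitt_elem set)"
  and "e : arcs G ==> lg (Ghost e) : (Cf (Suc 0) :: ('a,'b,'k) leavitt_elem set)"
  and "m <= n ==> Cf m <= (Cf n :: ('a,'b,'k) leavitt_elem set)"
proof -
 interpret I: fin_digraph Gi by(rule inverse_fin)
 note gE = ghost_embed_hom[where 'k = 'k]
 show "Cf d <= car (LA :: ('a,'b,'k) leavitt_ring)"
  unfolding Cf_def using ghost_embed_closed I.paths_le_subset(1) by blast
 show "x \<otimes>_{LA} y : Cf (m + n)" if xy: "x : Cf m" "y : Cf n"
 proof -
  obtain a b where ab: "x = gemb a" "y = gemb b" "keys a <= I.paths_le m" "keys b <= I.paths_le n"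
   using xy unfolding Cf_def by blast
  hence "x \<otimes>_{LA} y = gemb (bmul path_concat a b)"
   using ghost_embed_bmul(1)[of a b] I.paths_le_subset(1) by blast
  thus ?thesis unfolding Cf_def using I.keys_bmul_le[OF ab(3,4)] by blast
 qed
 show "x \<oplus>_{LA} y : Cf d" if xy: "x : Cf d" "y : Cf d"
 proof -
  obtain a b where ab: "x = gemb a" "y = gemb b" "keys a <= I.paths_le d" "keys b <= I.paths_le d"
   using xy unfolding Cf_def by blast
  hence "x \<oplus>_{LA} y = gemb (a + b)"
   using ghost_embed_bmul(2)[of a b] I.paths_le_subset(1) by blast
  moreover have "keys (a + b) <= I.paths_le d" using ab keys_add[of a b] by blast
  ultimately show ?thesis unfolding Cf_def by blast
 qed
 show "\<zero>_{LA} : (Cf d :: ('a,'b,'k) leavitt_elem set)"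
  unfolding Cf_def using ghost_embed_zero[where 'k = 'k] by(intro image_eqI[of _ _ 0]) auto
 show "semb c : (Cf 0 :: ('a,'b,'k) leavitt_elem set)"
  unfolding Cf_def using gE(2)[of c] I.path_scalar_le[of c] by(intro image_eqI[of _ _ "path_scalar Gi c"]) auto
 show "lg (Vtx v) : (Cf 0 :: ('a,'b,'k) leavitt_elem set)" if "v : verts G"
  unfolding Cf_def using gE(3)[OF that] I.path_vtx_le[of v] that by(intro image_eqI[of _ _ "path_vtx v"]) auto
 show "lg (Ghost e) : (Cf (Suc 0) :: ('a,'b,'k) leavitt_elem set)" if "e : arcs G"
  unfolding Cf_def using gE(4)[OF that] I.path_arr_le[of e] that by(intro image_eqI[of _ _ "path_arr Gi e"]) auto
 show "Cf m <= (Cf n :: ('a,'b,'k) leavitt_elem set)" if "m <= n"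
  unfolding Cf_def using I.paths_le_subset(2)[OF that] by blast
qed

text \<open>Each axiom except generation is a fact about polynomials in ghost paths, moved into L(E)
  along the injective embedding; generation holds because the identity has ghost length
  zero.\<close>

lemma ghost_filtration_reg:
 "ghost_filtration (reg_module (LA :: ('a,'b,'k::field) leavitt_ring)) (lpa_module.scM G (reg_module LA)) G
  (lpa_module.vtM G (reg_module LA)) (lpa_module.arM G (reg_module LA)) (lpa_module.ghM G (reg_module LA)) Cf"
proof -
 interpret I: fin_digraph Gi by(rule inverse_fin)
 interpret L: ring "LA :: ('a,'b,'k) leavitt_ring" by(rule ring_LA)
 interpret R: lpa_module G "reg_module (LA :: ('a,'b,'k) leavitt_ring)" by(rule lpa_module_reg)
 note gE = ghost_embed_hom[where 'k = 'k]
 note CfF = Cf_facts[where 'k = 'k]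
 have kC: "R.ops.ksub (Cf d)" for d by(rule R.ops.ksubI)
   (use CfF(1)[of d] CfF(2)[OF CfF(5), of _ d] CfF(3,4) in "auto")
 have fdC: "R.ops.fd (Cf d)" for d
 proof -
  let ?S = "(%p. gemb (single p 1)) ` I.paths_le d :: ('a,'b,'k) leavitt_elem set"
  have S: "finite ?S" "?S <= car LA" "?S <= Cf d"
  proof -
   show "finite ?S" using I.finite_paths_le by blast
   have "gemb (single p 1) : car (LA :: ('a,'b,'k) leavitt_ring)" if "p : I.paths_le d" for p
    by(rule ghost_embed_closed) (use that I.paths_le_subset(1)[of d] in auto)
   thus "?S <= car LA" by blast
   have "gemb (single p 1) : (Cf d :: ('a,'b,'k) leavitt_elem set)" if "p : I.paths_le d" for p
    unfolding Cf_def by(rule imageI) (use that in simp)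
   thus "?S <= Cf d" by blast
  qed
  have SD: "R.ops.ksub (R.ops.kspan ?S)" by(rule R.ops.ksub_kspan) (use S in simp)
  have "gemb x : R.ops.kspan ?S" if "keys x <= I.paths_le d" for x using that
  proof (induction x rule: span_induct)
   case zero
   show ?case using R.ops.ksubD(2)[OF SD] by(simp add: ghost_embed_zero)
  next
   case (single p c)
   obtain u r v where p: "p = (u, r, v)" by(cases p)
   have pp: "p : paths Gi" using single I.paths_le_subset(1) by blast
   have k: "keys (path_scalar Gi c) <= paths Gi"
    "keys (single p (1::'k)) <= paths Gi"
    using I.path_gens_closed(1)[of c] pp by(auto simp: I.PA_simps)
   have "gemb (single p c) = semb c \<otimes>_{LA} gemb (single p (1::'k))"
    using ghost_embed_bmul(1)[OF k] gE(2)[of c] I.path_scalar_single[of u r v c 1] pp p by simp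
   moreover have "gemb (single p 1) : R.ops.kspan ?S"
    using R.ops.kspan_superset[of ?S] single by blast
   ultimately show ?case using R.ops.ksubD(6)[OF SD] by simp
  next
   case (add x y)
   hence "gemb (x + y) = gemb x \<oplus>_{LA} (gemb y :: ('a,'b,'k) leavitt_elem)"
    using ghost_embed_bmul(2)[of x y] I.paths_le_subset(1)[of d] by blast
   thus ?case using R.ops.ksubD(3)[OF SD add.IH] by simp
  qed
  hence "Cf d <= R.ops.kspan ?S" by(auto simp: Cf_def)
  moreover have "R.ops.kspan ?S <= Cf d" by(rule R.ops.kspan_minimal[OF kC S(3)])
  ultimately have "Cf d = R.ops.kspan ?S" by blast
  thus ?thesis using R.ops.fd_kspan[of ?S] S(1,2) by simp
 qed
 have dec: "EX y z. z : Cf 0 & (ALL e:arcs G. y e : Cf d & lg (Vtx (tail G e)) \<otimes>_{LA} y e = y e)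
    & x = z \<oplus>_{LA} (\<Oplus>_{reg_module LA}e\<in>arcs G. lg (Ghost e) \<otimes>_{LA} y e)"
  if x: "x : Cf (Suc d)" for x :: "('a,'b,'k) leavitt_elem" and d
 proof -
  obtain a where a: "x = gemb a" "keys a <= I.paths_le (Suc d)" using x unfolding Cf_def by blast
  have ap: "keys a <= paths Gi" using a I.paths_le_subset(1) by blast
  have kd: "keys (I.pderiv e a) <= paths Gi" for e by(rule I.keys_pderiv[OF ap])
  have ka: "keys (path_arr Gi e :: _ \<Rightarrow>\<^sub>0 'k) <= paths Gi" if "e : arcs G" for e
   using I.path_gens_closed(3)[of e] that by(simp add: I.PA_simps)
  have kt: "keys (I.ptriv a) <= I.paths_le 0" by(rule I.keys_ptriv[OF ap])
  have km: "keys (bmul path_concat (path_arr Gi e) (I.pderiv e a)) <= paths Gi" if "e : arcs G" for e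
   using basis_alg.keys_bmul[OF I.basis_alg_paths ka[OF that] kd] .
  have "x = gemb (I.ptriv a + (\<Sum>e\<in>arcs G. bmul path_concat (path_arr Gi e) (I.pderiv e a)))"
   using I.path_decompose[OF ap] a by simp
  also have "... = gemb (I.ptriv a) \<oplus>_{LA} gemb (\<Sum>e\<in>arcs G. bmul path_concat (path_arr Gi e) (I.pderiv e a))"
  proof (rule ghost_embed_bmul(2))
   show "keys (I.ptriv a) <= paths Gi" using kt I.paths_le_subset(1) by blast
   show "keys (\<Sum>e\<in>arcs G. bmul path_concat (path_arr Gi e) (I.pderiv e a)) <= paths Gi"
    by(rule order_trans[OF keys_sum], rule UN_least) (use km in simp)
  qed
  also have "gemb (\<Sum>e\<in>arcs G. bmul path_concat (path_arr Gi e) (I.pderiv e a))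
    = (\<Oplus>_{LA}e\<in>arcs G. gemb (bmul path_concat (path_arr Gi e) (I.pderiv e a)))"
   by(rule ghost_embed_sum) (use km in auto)
  also have "... = (\<Oplus>_{LA}e\<in>arcs G. lg (Ghost e) \<otimes>_{LA} gemb (I.pderiv e a))"
   by(rule L.add.finprod_cong')
    (use ghost_embed_bmul(1)[OF ka kd] gE(4) ghost_embed_closed[OF kd] in auto)
  also have "... = (\<Oplus>_{reg_module LA}e\<in>arcs G. lg (Ghost e) \<otimes>_{LA} gemb (I.pderiv e a))"
   by(rule finsum_same[symmetric]) simp_all
  finally have "x = gemb (I.ptriv a) \<oplus>_{LA} (\<Oplus>_{reg_module LA}e\<in>arcs G. lg (Ghost e) \<otimes>_{LA} gemb (I.pderiv e a))" .
  moreover have "gemb (I.ptriv a) : Cf 0" using kt by(auto simp: Cf_def)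
  moreover have "gemb (I.pderiv e a) : Cf d & lg (Vtx (tail G e)) \<otimes>_{LA} gemb (I.pderiv e a) = gemb (I.pderiv e a)"
   if "e : arcs G" for e
  proof
   show "gemb (I.pderiv e a) : Cf d" using I.keys_pderiv_le[OF a(2)] by(auto simp: Cf_def)
   have "keys (path_vtx (tail G e) :: _ \<Rightarrow>\<^sub>0 'k) <= paths Gi"
    using I.path_gens_closed(2)[of "tail G e"] that by(simp add: I.PA_simps)
   from ghost_embed_bmul(1)[OF this kd[of e]] show "lg (Vtx (tail G e)) \<otimes>_{LA} gemb (I.pderiv e a) = gemb (I.pderiv e a)"
    using I.vtx_pderiv[of e a] gE(3)[of "tail G e"] that by simp
  qed
  ultimately show ?thesis by(intro exI[of _ "%e. gemb (I.pderiv e a)"] exI[of _ "gemb (I.ptriv a)"]) blast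
 qed
 \<comment> \<open>By injectivity of the embedding the sum becomes an identity between path-algebra
   elements, and the derivative of b along e returns \<open>y e\<close>. Both \<open>F_lower\<close>
   and \<open>F_bottom\<close> then follow from the degree of b.\<close>
 have low: "EX b. keys b <= I.paths_le n & (ALL e:arcs G. y e = gemb (I.pderiv e b))"
  if y: "!!e. e : arcs G ==> y e : Cf m" "!!e. e : arcs G ==> lg (Vtx (tail G e)) \<otimes>_{LA} y e = y e"
   and s: "(\<Oplus>_{reg_module LA}e\<in>arcs G. lg (Ghost e) \<otimes>_{LA} y e) : Cf n"
  for y :: "'b => ('a,'b,'k) leavitt_elem" and m n
 proof -
  have "ALL e:arcs G. EX a. y e = gemb a & keys a <= paths Gi"
   using y(1) I.paths_le_subset(1) unfolding Cf_def by blast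
  from bchoice[OF this] obtain a where a: "ALL e:arcs G. y e = gemb (a e) & keys (a e) <= paths Gi" by blast
  obtain b where b: "(\<Oplus>_{reg_module LA}e\<in>arcs G. lg (Ghost e) \<otimes>_{LA} y e) = gemb b" "keys b <= I.paths_le n"
   using s unfolding Cf_def by blast
  have ka: "keys (path_arr Gi e :: _ \<Rightarrow>\<^sub>0 'k) <= paths Gi" if "e : arcs G" for e
   using I.path_gens_closed(3)[of e] that by(simp add: I.PA_simps)
  have km: "keys (bmul path_concat (path_arr Gi e) (a e)) <= paths Gi" if "e : arcs G" for e
   using basis_alg.keys_bmul[OF I.basis_alg_paths ka[OF that]] a that by blast
  have "(\<Oplus>_{reg_module LA}e\<in>arcs G. lg (Ghost e) \<otimes>_{LA} y e) = (\<Oplus>_{LA}e\<in>arcs G. lg (Ghost e) \<otimes>_{LA} y e)"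
   by(rule finsum_same) simp_all
  also have "... = (\<Oplus>_{LA}e\<in>arcs G. gemb (bmul path_concat (path_arr Gi e) (a e)))"
   by(rule L.add.finprod_cong')
    (use ghost_embed_bmul(1)[OF ka] gE(4) ghost_embed_closed[OF km] a in auto)
  also have "... = gemb (\<Sum>e\<in>arcs G. bmul path_concat (path_arr Gi e) (a e))"
   by(rule ghost_embed_sum[symmetric]) (use km in auto)
  finally have "gemb b = (gemb (\<Sum>e\<in>arcs G. bmul path_concat (path_arr Gi e) (a e)) :: ('a,'b,'k) leavitt_elem)"
   using b by simp
  hence beq: "b = (\<Sum>e\<in>arcs G. bmul path_concat (path_arr Gi e) (a e))"
  proof (rule ghost_embed_eqD[rotated 2])
   show "keys b <= paths Gi" using b(2) I.paths_le_subset(1) by blast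
   show "keys (\<Sum>e\<in>arcs G. bmul path_concat (path_arr Gi e) (a e)) <= paths Gi"
    by(rule order_trans[OF keys_sum], rule UN_least) (use km in simp)
  qed
  have "y e = gemb (I.pderiv e b)" if e: "e : arcs G" for e
  proof -
   have "I.pderiv e b = (\<Sum>e'\<in>arcs G. if e' = e then bmul path_concat (path_vtx (tail G e)) (a e) else 0)"
    unfolding beq I.pderiv_sum by(rule sum.cong) (use I.pderiv_arr_mult[of "a _" e] a in auto)
   hence "I.pderiv e b = bmul path_concat (path_vtx (tail G e)) (a e)" using e by simp
   moreover have "keys (path_vtx (tail G e) :: _ \<Rightarrow>\<^sub>0 'k) <= paths Gi"
    using I.path_gens_closed(2)[of "tail G e"] e by(simp add: I.PA_simps)
   ultimately have "gemb (I.pderiv e b) = lg (Vtx (tail G e)) \<otimes>_{LA} y e"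
    using ghost_embed_bmul(1)[of "path_vtx (tail G e)" "a e"] gE(3)[of "tail G e"] e a by simp
   thus ?thesis using y(2)[OF e] by simp
  qed
  thus ?thesis using b(2) by blast
 qed
 have gen: "car LA <= R.ops.fspan (Cf 0)"
 proof
  fix x assume x: "x : car (LA :: ('a,'b,'k) leavitt_ring)"
  have "R.ops.fsub (R.ops.fspan (Cf 0))" by(rule R.ops.fsub_fspan) (use CfF(1) in simp)
  hence "submodule (R.ops.fspan (Cf 0)) LA (reg_module LA)" unfolding R.submodule_iff_fsub .
  moreover have "\<one>_{LA} : R.ops.fspan (Cf 0)"
   using R.ops.fspan_superset[of "Cf 0"] CfF(5)[of 1] unfolding scalar_embed_ring(3)[where 'k = 'k] by blast
  ultimately have "x \<odot>_{reg_module LA} \<one>_{LA} : R.ops.fspan (Cf 0)" using x unfolding submodule_iff by blast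
  hence "x \<otimes>_{LA} \<one>_{LA} : R.ops.fspan (Cf 0)" unfolding reg_module_simps .
  thus "x : R.ops.fspan (Cf 0)" using x by simp
 qed
 show ?thesis unfolding ghost_filtration_def ghost_filtration_axioms_def
 proof (intro conjI allI impI)
  show "leavitt_ops (reg_module (LA :: ('a,'b,'k) leavitt_ring)) R.scM G R.vtM R.arM R.ghM" by unfold_locales
  show "Cf d <= (Cf (Suc d) :: ('a,'b,'k) leavitt_elem set)" for d by(rule CfF(8)) simp
  show "R.vtM v x : Cf d" if "v : verts G" "x : Cf d" for v x d using CfF(2)[OF CfF(6)[OF that(1)] that(2)] by simp
  show "R.ghM e x : Cf (Suc d)" if "e : arcs G" "x : Cf d" for e x d using CfF(2)[OF CfF(7)[OF that(1)] that(2)] by simp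
  show "y e : Cf d" if h: "ALL e. e : arcs G --> y e : Cf m" "ALL e. e : arcs G --> R.vtM (tail G e) (y e) = y e"
   "(\<Oplus>_{reg_module LA}e\<in>arcs G. R.ghM e (y e)) : Cf (Suc d)" "e : arcs G" for y :: "'b => ('a,'b,'k) leavitt_elem" and m d e
  proof -
   obtain b where "keys b <= I.paths_le (Suc d)" "ALL e:arcs G. y e = gemb (I.pderiv e b)"
    using low[of y m "Suc d"] h by auto
   thus ?thesis using h(4) I.keys_pderiv_le[of b d e] unfolding Cf_def by blast
  qed
  show "y e = \<zero>_{reg_module LA}" if h: "ALL e. e : arcs G --> y e : Cf m" "ALL e. e : arcs G --> R.vtM (tail G e) (y e) = y e"
   "(\<Oplus>_{reg_module LA}e\<in>arcs G. R.ghM e (y e)) : Cf 0" "e : arcs G" for y :: "'b => ('a,'b,'k) leavitt_elem" and m e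
  proof -
   obtain b where "keys b <= I.paths_le 0" "ALL e:arcs G. y e = gemb (I.pderiv e b)"
    using low[of y m 0] h by auto
   thus ?thesis using h(4) by(simp add: I.pderiv_le_0 ghost_embed_zero)
  qed
  show "R.ops.fd (Cf d)" for d by(rule fdC)
  show "car (reg_module LA) <= R.ops.fspan (Cf 0)" using gen by simp
  show "EX y z. z : Cf 0 & (ALL e:arcs G. y e : Cf d & R.vtM (tail G e) (y e) = y e)
    & x = z \<oplus>_{reg_module LA} (\<Oplus>_{reg_module LA}e\<in>arcs G. R.ghM e (y e))"
   if "x : Cf (Suc d)" for x :: "('a,'b,'k) leavitt_elem" and d
   using dec[OF that] unfolding reg_module_simps .
 qed
qed

end

section \<open>Chains of subspaces, and ghost words applied to a subspace\<close>

lemma finite_subset_chain: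
 fixes F :: "nat => 'a set"
 assumes "finite T" "T <= (\<Union>d. F d)" "!!m n. m <= n ==> F m <= F n" shows "EX m. T <= F m"
 using assms(1,2)
proof (induction T rule: finite_induct)
 case (insert x T)
 then obtain m n where "T <= F m" "x : F n" by auto
 hence "insert x T <= F (max m n)" using assms(3)[of m "max m n"] assms(3)[of n "max m n"] by auto
 thus ?case by blast
qed simp

lemma additive_finsum:
 fixes A :: "('a,'y) ring_scheme" and B :: "('b,'z) ring_scheme"
 assumes "abelian_group A" "abelian_group B" and f: "!!x. x : car A ==> f x : car B"
   "!!x y. x : car A ==> y : car A ==> f (x \<oplus>_{A} y) = f x \<oplus>_{B} f y"
  and g: "!!i. i : I ==> g i : car A"
 shows "f (\<Oplus>_{A}i\<in>I. g i) = (\<Oplus>_{B}i\<in>I. f (g i))"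
proof -
 interpret A: abelian_group A by fact
 interpret B: abelian_group B by fact
 have f0: "f \<zero>_{A} = \<zero>_{B}"
 proof -
  have "f \<zero>_{A} \<oplus>_{B} f \<zero>_{A} = f \<zero>_{A}" using f(2)[of "\<zero>_{A}" "\<zero>_{A}"] by simp
  thus ?thesis using f(1)[of "\<zero>_{A}"] B.add.r_cancel_one by auto
 qed
 show ?thesis using g
 proof (induction I rule: infinite_finite_induct)
  case (insert i I)
  have "g : I \<rightarrow> car A" "g i : car A" "(%i. f (g i)) : I \<rightarrow> car B"
   using insert.prems f(1) by auto
  thus ?case using insert f by simp
 qed (simp_all add: f0)
qed

context leavitt_ops
begin

lemma op_finsum: assumes "!!i. i : I ==> g i : car M"
 shows "v : verts E ==> vt v (\<Oplus>i\<in>I. g i) = (\<Oplus>i\<in>I. vt v (g i))"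
  "e : arcs E ==> gh e (\<Oplus>i\<in>I. g i) = (\<Oplus>i\<in>I. gh e (g i))"
  "sc c (\<Oplus>i\<in>I. g i) = (\<Oplus>i\<in>I. sc c (g i))"
 by(rule additive_finsum[OF abelian_group_axioms abelian_group_axioms], simp_all add: assms vt_add gh_add sc_add)+

lemma gsub_chain_union: assumes "!!d. ksub (F d)" "!!m n. m <= n ==> F m <= F n"
  and "!!v x d. v : verts E ==> x : F d ==> vt v x : F d"
  and "!!e x d. e : arcs E ==> x : F d ==> gh e x : F (Suc d)" shows "gsub (\<Union>d. F d)"
proof -
 note D = ksubD[OF assms(1)]
 have "ksub (\<Union>d. F d)"
 proof (rule ksubI)
  show "(\<Union>d. F d) <= car M" using D(1) by blast
  show "\<zero> : (\<Union>d. F d)" using D(2) by blast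
  show "sc c x : (\<Union>d. F d)" if "x : (\<Union>d. F d)" for c x using that D(6) by blast
  show "x \<oplus> y : (\<Union>d. F d)" if xy: "x : (\<Union>d. F d)" "y : (\<Union>d. F d)" for x y
  proof -
   obtain m n where "x : F m" "y : F n" using xy by auto
   hence "x : F (max m n)" "y : F (max m n)"
    using assms(2)[of m "max m n"] assms(2)[of n "max m n"] by auto
   thus ?thesis using D(3) by blast
  qed
 qed
 moreover have "ALL v:verts E. ALL x:(\<Union>d. F d). vt v x : (\<Union>d. F d)" using assms(3) by blast
 moreover have "ALL e:arcs E. ALL x:(\<Union>d. F d). gh e x : (\<Union>d. F d)" using assms(4) by blast
 ultimately show ?thesis unfolding gsub_def by simp
qed

text \<open>Ghost words of length at most j applied to U. The coefficient of each arrow is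
  normalised to be fixed by the tail of the arrow, so that \<open>F_lower\<close> applies to the
  difference of two such expressions.\<close>

primrec lev :: "'m set => nat => 'm set" where
 "lev U 0 = U"
| "lev U (Suc j) = {x. EX z y. x = z \<oplus> (gh_sum y) & z : lev U j
  & (ALL e:arcs E. y e : lev U j & vt (tail E e) (y e) = y e)}"

lemma lev_ksub: assumes U: "ksub U" "!!v x. v : verts E ==> x : U ==> vt v x : U"
 shows "ksub (lev U j)" "v : verts E ==> x : lev U j ==> vt v x : lev U j"
  "lev U j <= lev U (Suc j)" "e : arcs E ==> x : lev U j ==> gh e x : lev U (Suc j)"
proof -
 have up: "lev U j <= lev U (Suc j) & (ALL e:arcs E. ALL x:lev U j. gh e x : lev U (Suc j))"
  if k: "ksub (lev U j)" and v: "!!v x. v : verts E ==> x : lev U j ==> vt v x : lev U j" for j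
 proof (intro conjI subsetI ballI)
  note D = ksubD[OF k]
  fix x assume x: "x : lev U j"
  have z: "(\<Oplus>e\<in>arcs E. gh e \<zero>) = \<zero>"
   by(subst add.finprod_cong'[of _ _ "%e. \<zero>"]) auto
  have "x = x \<oplus> (gh_sum (%e. (%_. \<zero>) e))" using z D(5)[OF x] by simp
  thus "x : lev U (Suc j)" using x D(2) unfolding lev.simps mem_Collect_eq
   by(intro exI[of _ x] exI[of _ "%_. \<zero>"]) auto
  fix e assume e: "e : arcs E"
  let ?y = "%e'. if e' = e then vt (tail E e) x else \<zero>"
  have c: "x : car M" using D(5)[OF x] .
  have "(\<Oplus>e'\<in>arcs E. gh e' (?y e')) = (\<Oplus>e'\<in>arcs E. if e = e' then gh e' x else \<zero>)"
   by(rule add.finprod_cong') (use e c in "auto simp: gh_vt0")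
  also have "... = gh e x" by(rule add.finprod_singleton) (use e c in auto)
  finally have "gh e x = \<zero> \<oplus> (\<Oplus>e'\<in>arcs E. gh e' (?y e'))" using c e by simp
  thus "gh e x : lev U (Suc j)" using e v x D(2) c unfolding lev.simps mem_Collect_eq
   by(intro exI[of _ "\<zero>"] exI[of _ ?y]) (auto simp: vt_vt)
 qed
 have main: "ksub (lev U j) & (ALL v:verts E. ALL x:lev U j. vt v x : lev U j)" for j
 proof (induction j)
  case 0
  thus ?case using U by simp
 next
  case (Suc j)
  hence k: "ksub (lev U j)" and v: "!!v x. v : verts E ==> x : lev U j ==> vt v x : lev U j" by auto
  note D = ksubD[OF k]
  have "ksub (lev U (Suc j))"
  proof (rule ksubI)
   show "lev U (Suc j) <= car M"
   proof
    fix x assume "x : lev U (Suc j)"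
    then obtain z y where x: "x = z \<oplus> gh_sum y" "z : lev U j" "!!e. e : arcs E ==> y e : lev U j" by auto
    have "(gh_sum y) : car M" by(rule finsum_closed) (use x(3) D(5) in auto)
    thus "x : car M" using x D(5) by simp
   qed
   show "\<zero> : lev U (Suc j)" using up[OF k v] D(2) by blast
   show "x \<oplus> x' : lev U (Suc j)" if xx: "x : lev U (Suc j)" "x' : lev U (Suc j)" for x x'
   proof -
    obtain z y where x: "x = z \<oplus> gh_sum y" "z : lev U j" "!!e. e : arcs E ==> y e : lev U j"
     "!!e. e : arcs E ==> vt (tail E e) (y e) = y e" using xx(1) by auto
    obtain z' y' where x': "x' = z' \<oplus> gh_sum y'" "z' : lev U j" "!!e. e : arcs E ==> y' e : lev U j"
     "!!e. e : arcs E ==> vt (tail E e) (y' e) = y' e" using xx(2) by auto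
    have c: "z : car M" "z' : car M" "!!e. e : arcs E ==> y e : car M" "!!e. e : arcs E ==> y' e : car M"
     using x x' D(5) by auto
    have s: "(gh_sum y) : car M" "(gh_sum y') : car M" by(rule finsum_closed; use c in auto)+
    have "(gh_sum (%e. y e \<oplus> y' e)) = (\<Oplus>e\<in>arcs E. gh e (y e) \<oplus> gh e (y' e))"
     by(rule add.finprod_cong') (use c in "auto simp: gh_add")
    also have "... = (gh_sum y) \<oplus> gh_sum y'" by(rule finsum_addf) (use c in auto)
    finally have "x \<oplus> x' = (z \<oplus> z') \<oplus> (gh_sum (%e. y e \<oplus> y' e))"
     using x(1) x'(1) c s by(simp add: a_ac)
    moreover have "y e \<oplus> y' e : lev U j & vt (tail E e) (y e \<oplus> y' e) = y e \<oplus> y' e" if "e : arcs E" for e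
     using that x x' c D(3) by(simp add: vt_add)
    moreover have "z \<oplus> z' : lev U j" using x x' D(3) by blast
    ultimately show ?thesis unfolding lev.simps mem_Collect_eq
     by(intro exI[of _ "z \<oplus> z'"] exI[of _ "%e. y e \<oplus> y' e"]) blast
   qed
   show "sc c x : lev U (Suc j)" if xx: "x : lev U (Suc j)" for c x
   proof -
    obtain z y where x: "x = z \<oplus> gh_sum y" "z : lev U j" "!!e. e : arcs E ==> y e : lev U j"
     "!!e. e : arcs E ==> vt (tail E e) (y e) = y e" using xx by auto
    have cc: "z : car M" "!!e. e : arcs E ==> y e : car M" using x D(5) by auto
    have s: "(gh_sum y) : car M" by(rule finsum_closed) (use cc in auto)
    have "(gh_sum (%e. sc c (y e))) = (\<Oplus>e\<in>arcs E. sc c (gh e (y e)))"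
     by(rule add.finprod_cong') (use cc in "auto simp: gh_sc")
    also have "... = sc c (gh_sum y)" by(rule op_finsum(3)[symmetric]) (use cc in auto)
    finally have "sc c x = sc c z \<oplus> (gh_sum (%e. sc c (y e)))"
     using x(1) cc s by(simp add: sc_add)
    moreover have "sc c (y e) : lev U j & vt (tail E e) (sc c (y e)) = sc c (y e)" if "e : arcs E" for e
     using that x cc D(6) by(simp add: vt_sc)
    moreover have "sc c z : lev U j" using x D(6) by blast
    ultimately show ?thesis unfolding lev.simps mem_Collect_eq
     by(intro exI[of _ "sc c z"] exI[of _ "%e. sc c (y e)"]) blast
   qed
  qed
  moreover have "vt w x : lev U (Suc j)" if w: "w : verts E" and xx: "x : lev U (Suc j)" for w x
  proof -
   obtain z y where x: "x = z \<oplus> gh_sum y" "z : lev U j" "!!e. e : arcs E ==> y e : lev U j"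
    "!!e. e : arcs E ==> vt (tail E e) (y e) = y e" using xx by auto
   have cc: "z : car M" "!!e. e : arcs E ==> y e : car M" using x D(5) by auto
   have s: "(gh_sum y) : car M" by(rule finsum_closed) (use cc in auto)
   let ?y = "%e. if w = head E e then y e else \<zero>"
   have "(gh_sum (%e. ?y e)) = (\<Oplus>e\<in>arcs E. vt w (gh e (y e)))"
    by(rule add.finprod_cong') (use cc w in "auto simp: vt_gh")
   also have "... = vt w (gh_sum y)" by(rule op_finsum(1)[symmetric]) (use cc w in auto)
   finally have "vt w x = vt w z \<oplus> (gh_sum (%e. ?y e))"
    using x(1) cc s w by(simp add: vt_add)
   moreover have "?y e : lev U j & vt (tail E e) (?y e) = ?y e" if "e : arcs E" for e
    using that x cc D(2) by simp
   moreover have "vt w z : lev U j" using x v w by blast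
   ultimately show ?thesis unfolding lev.simps mem_Collect_eq
    by(intro exI[of _ "vt w z"] exI[of _ ?y]) blast
  qed
  ultimately show ?case by blast
 qed
 show "ksub (lev U j)" using main by blast
 show "v : verts E ==> x : lev U j ==> vt v x : lev U j" using main by blast
 show "lev U j <= lev U (Suc j)" using up[of j] main by blast
 show "e : arcs E ==> x : lev U j ==> gh e x : lev U (Suc j)" using up[of j] main by blast
qed

end

section \<open>Finite-dimensional ghost-stable subspaces and leading terms\<close>

context ghost_filtration
begin

lemma F_union_gsub: "gsub (\<Union>d. F d)"
 by(rule gsub_chain_union[of F]) (simp_all add: F_ksub F_mono F_vt F_gh)

lemma F_union_generates: "car M <= fspan (\<Union>d. F d)"
proof -
 have "fspan (F 0) <= fspan (\<Union>d. F d)" unfolding fspan_def by auto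
 thus ?thesis using F_generates by blast
qed

text \<open>The part of W inside the union of the pieces has a finite spanning set, so it lies in a
  single piece and vanishes by \<open>bounded_ghost_closed_zero\<close>. Descent from the union then
  makes all of W vanish.\<close>

lemma fd_ghost_closed_zero:
 assumes W: "gsub W" "fd W" "!!w x. sink w ==> x : W ==> vt w x = \<zero>" shows "W <= {\<zero>}"
proof -
 let ?W' = "W Int (\<Union>d. F d)"
 have g: "gsub ?W'" using gsub_Int W(1) F_union_gsub by blast
 have "fd ?W'" by(rule dimension_exists(2)[OF W(2) gsub_ksub[OF g]]) blast
 then obtain T where T: "finite T" "?W' = kspan T" unfolding fd_def by blast
 hence Tsub: "T <= (\<Union>d. F d)" using kspan_superset[of T] by blast
 from finite_subset_chain[of T F, OF T(1) Tsub F_mono] obtain m where m: "T <= F m" by blast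
 have "?W' <= F m" unfolding T(2) by(rule kspan_minimal[OF F_ksub m])
 hence z: "?W' <= {\<zero>}"
  by(rule bounded_ghost_closed_zero) (use g W(3) in "auto simp: gsub_def")
 have WM: "W <= car M" using W(1) gsub_ksub ksubD(1) by blast
 show ?thesis by(rule ghost_descent[OF F_union_gsub order_trans[OF WM F_union_generates] WM])
   (use W(1) z subgroup_zero in "auto simp: gsub_def")
qed

context
 fixes Ker D U assumes Ker: "fsub Ker" and U_def: "U = Ker Int F (Suc D)"
begin

lemma U_ksub: "ksub U" "v : verts E ==> x : U ==> vt v x : U"
 unfolding U_def using ksub_Int[OF fsub_ksub[OF Ker] F_ksub] Ker F_vt
 by(auto simp: fsub_def rsub_def)

lemmas lev_facts = lev_ksub[OF U_ksub]
lemmas levD = ksubD[OF lev_facts(1)]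

lemma lev_mono: "i <= j ==> lev U i <= lev U j"
 by(rule lift_Suc_mono_le[of "lev U"]) (rule lev_facts(3))

lemma lev_bound: "lev U j <= F (Suc D + j) Int Ker"
proof (induction j)
 case (Suc j)
 have K: "ksub (F (Suc D + Suc j) Int Ker)" using ksub_Int[OF F_ksub fsub_ksub[OF Ker]] .
 show ?case
 proof
  fix x assume "x : lev U (Suc j)"
  then obtain z y where x: "x = z \<oplus> gh_sum y" "z : lev U j" "!!e. e : arcs E ==> y e : lev U j" by auto
  have "z : F (Suc D + Suc j) Int Ker" using x(2) Suc F_Suc[of "Suc D + j"] by auto
  moreover have "(gh_sum y) : F (Suc D + Suc j) Int Ker"
  proof (rule sub_finsum[OF ksub_subgroup[OF K]])
   fix e assume e: "e : arcs E"
   hence "y e : F (Suc D + j)" "y e : Ker" using x(3) Suc by auto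
   thus "gh e (y e) : F (Suc D + Suc j) Int Ker"
    using F_gh[OF e, of "y e" "Suc D + j"] e Ker by(auto simp: fsub_def gsub_def)
  qed
  ultimately show "x : F (Suc D + Suc j) Int Ker" using x(1) ksubD(3)[OF K] by blast
 qed
qed (auto simp: U_def)

text \<open>Length cannot be lost by cancellation. If x has length one less than its level allows,
  so does the sum over the leading ghost arrows, and \<open>F_lower\<close> shortens every
  coefficient; by induction each coefficient lies one level lower. At the bottom the claim holds
  because U contains all relations of length at most D + 1.\<close>

lemma lev_lower: "x : lev U (Suc j) ==> x : F (Suc D + j) ==> x : lev U j"
proof (induction j arbitrary: x)
 case (0 x)
 thus ?case using lev_bound[of "Suc 0"] by(auto simp: U_def)
next
 case (Suc j x)
 obtain z y where x: "x = z \<oplus> gh_sum y" "z : lev U (Suc j)" "!!e. e : arcs E ==> y e : lev U (Suc j)"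
  "!!e. e : arcs E ==> vt (tail E e) (y e) = y e" using Suc.prems(1) unfolding lev.simps(2)[of U "Suc j"] by blast
 have yF: "y e : F (Suc D + Suc j)" if "e : arcs E" for e using x(3)[OF that] lev_bound[of "Suc j"] by blast
 have zF: "z : F (Suc D + Suc j)" using x(2) lev_bound[of "Suc j"] by blast
 have yM: "y e : car M" if "e : arcs E" for e using FD(5)[OF yF[OF that]] .
 have sc: "(gh_sum y) : car M" by(rule finsum_closed) (use yM in auto)
 have "(gh_sum y) : F (Suc D + Suc j)"
  using subgroup_cancel[OF ksub_subgroup[OF F_ksub] _ zF sc] Suc.prems(2) x(1) by simp
 hence "y e : F (Suc D + j)" if "e : arcs E" for e
  using F_lower[of y "Suc D + Suc j" "Suc D + j" e, OF yF x(4)] that by simp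
 hence "y e : lev U j" if "e : arcs E" for e using Suc.IH x(3) that by blast
 hence g: "gh e (y e) : lev U (Suc j)" if "e : arcs E" for e using lev_facts(4)[of e "y e" j] that by blast
 have "(gh_sum y) : lev U (Suc j)"
  by(rule sub_finsum[OF ksub_subgroup[OF lev_facts(1)]]) (simp_all add: g del: lev.simps)
 thus ?case using x(1,2) levD(3) by blast
qed

lemma lev_lower': "x : lev U (j + k) ==> x : F (Suc D + j) ==> x : lev U j"
proof (induction k)
 case (Suc k)
 have "x : F (Suc D + (j + k))" using Suc.prems(2) F_mono[of "Suc D + j" "Suc D + (j + k)"] by auto
 hence "x : lev U (j + k)" using lev_lower[of x "j + k"] Suc.prems(1) by simp
 thus ?case using Suc by blast
qed simp

text \<open>
 The freeness argument: \<open>u\<close> is independent, modulo shorter elements, of the relations of length at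
 most \<open>D + 1\<close>; then comparing leading terms shows that no nonzero multiple of \<open>u\<close> by a ghost
 polynomial lies in the module generated by these relations.
\<close>

lemma leading_term_independence:
 fixes H :: "nat => 'y set" and th :: "'y => 'm" assumes u: "u : F (Suc D)" "u ~: ksum (F D) U"
  and H0: "!!q. q : H 0 ==> EX c. th q = sc c u & (c = 0 --> q = o0)"
  and Hdec: "!!q m. q : H (Suc m) ==> EX z r. z : H 0 & (ALL e:arcs E. r e : H m & vt (tail E e) (th (r e)) = th (r e))
    & th q = th z \<oplus> (gh_sum (%e. th (r e)))
    & (ALL m'. (ALL e:arcs E. r e : H m') --> q : H (Suc m')) & ((ALL e:arcs E. r e = o0) --> q : H 0)"
  and th: "!!q m. q : H m ==> th q : F (Suc D + m)" and q: "q : H m" "th q : lev U j" shows "q = o0"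
proof -
 \<comment> \<open>\<open>H m\<close> abstracts the multipliers of ghost length at most m, and
   \<open>th\<close> their application to u. If \<open>th q\<close> agrees with an element of
   \<open>lev U m\<close> up to length at most D + m, then q drops in degree, and vanishes when m =
   0.\<close>
 have step: "(m = 0 --> q = o0) & (ALL m'. m = Suc m' --> q : H m')" if "q : H m" "th q : ksum (F (D + m)) (lev U m)" for q m
  using that
 proof (induction m arbitrary: q)
  case (0 q)
  obtain c where c: "th q = sc c u" "c = 0 --> q = o0" using H0[OF 0(1)] by blast
  have "c = 0"
  proof (rule ccontr)
   assume "c ~= 0"
   have "sc (1 / c) (sc c u) : ksum (F D) U"
    using ksubD(6)[OF ksub_ksum[OF F_ksub U_ksub(1)]] 0(2) c(1) by simp
   thus False using \<open>c ~= 0\<close> u FD(5) by(simp flip: sc_times)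
  qed
  thus ?case using c by simp
 next
  case (Suc m q)
  obtain z r where zr: "z : H 0" "!!e. e : arcs E ==> r e : H m" "!!e. e : arcs E ==> vt (tail E e) (th (r e)) = th (r e)"
   "th q = th z \<oplus> (gh_sum (%e. th (r e)))"
   "!!m'. (ALL e:arcs E. r e : H m') ==> q : H (Suc m')" "(ALL e:arcs E. r e = o0) ==> q : H 0"
   using Hdec[OF Suc.prems(1)] by blast
  obtain f y0 where fy: "f : F (D + Suc m)" "y0 : lev U (Suc m)" "th q = f \<oplus> y0"
   using Suc.prems(2) unfolding ksum_def by blast
  obtain z' y where y: "y0 = z' \<oplus> gh_sum y" "z' : lev U m" "!!e. e : arcs E ==> y e : lev U m"
   "!!e. e : arcs E ==> vt (tail E e) (y e) = y e" using fy(2) by auto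
  let ?d = "Suc D + m"
  have zF: "th z : F ?d" using th[OF zr(1)] F_mono[of "Suc D" ?d] by auto
  have z'F: "z' : F ?d" using y(2) lev_bound by blast
  have fF: "f : F ?d" using fy(1) by simp
  have rF: "th (r e) : F ?d" if "e : arcs E" for e using th[OF zr(2)[OF that]] .
  have yF: "y e : F ?d" if "e : arcs E" for e using y(3)[OF that] lev_bound by blast
  have c: "th z : car M" "z' : car M" "f : car M" "!!e. e : arcs E ==> th (r e) : car M" "!!e. e : arcs E ==> y e : car M"
   using zF z'F fF rF yF FD(5) by blast+
  let ?A = "\<Oplus>e\<in>arcs E. gh e (th (r e))" and ?B = "\<Oplus>e\<in>arcs E. gh e (y e)"
  \<comment> \<open>The two expansions are compared arrow by arrow. The differences
    \<open>?w e\<close> have a ghost sum of length at most D + 1 + m, so \<open>F_lower\<close>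
    bounds each difference by D + m, and the induction hypothesis applies to
    \<open>r e\<close>.\<close>
  let ?w = "%e. th (r e) \<ominus> y e"
  have AB: "?A : car M" "?B : car M" by(rule finsum_closed; use c in auto)+
  have wF: "?w e : F ?d" "vt (tail E e) (?w e) = ?w e" "?w e : car M" if e: "e : arcs E" for e
  proof -
   show "?w e : F ?d" using FD(7)[OF rF yF] e by blast
   show "?w e : car M" using c e by simp
   have "vt (tail E e) (\<ominus> y e) = \<ominus> y e"
    using vt_sc[of "tail E e" "y e" "-1"] sc_uminus_one c(5)[OF e] y(4)[OF e] e by simp
   thus "vt (tail E e) (?w e) = ?w e" using c e zr(3)[OF e] by(simp add: a_minus_def vt_add)
  qed
  have "?A = (\<Oplus>e\<in>arcs E. gh e (?w e) \<oplus> gh e (y e))"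
  proof (rule add.finprod_cong')
   fix e assume e: "e : arcs E"
   have "th (r e) = ?w e \<oplus> y e" using c(4,5)[OF e] by(simp add: a_minus_def a_assoc l_neg)
   thus "gh e (th (r e)) = gh e (?w e) \<oplus> gh e (y e)" using gh_add[OF e wF(3)[OF e] c(5)[OF e]] by simp
  qed (use wF(3) c in auto)
  also have "... = (gh_sum (%e. ?w e)) \<oplus> ?B" by(rule finsum_addf) (use wF(3) c in auto)
  finally have A: "?A = (gh_sum (%e. ?w e)) \<oplus> ?B" .
  have Wc: "(gh_sum (%e. ?w e)) : car M" by(rule finsum_closed) (use wF(3) in auto)
  have "th z \<oplus> ((gh_sum (%e. ?w e)) \<oplus> ?B) = f \<oplus> (z' \<oplus> ?B)"
   using zr(4) fy(3) y(1) A by simp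
  hence "(th z \<oplus> (gh_sum (%e. ?w e))) \<oplus> ?B = (f \<oplus> z') \<oplus> ?B"
   using c AB Wc by(simp add: a_assoc)
  hence "th z \<oplus> (gh_sum (%e. ?w e)) = f \<oplus> z'" using c AB Wc by simp
  hence "th z \<oplus> (gh_sum (%e. ?w e)) : F ?d" using FD(3)[OF fF z'F] by simp
  hence "(gh_sum (%e. ?w e)) : F ?d"
   using subgroup_cancel[OF ksub_subgroup[OF F_ksub] _ zF Wc] by blast
  hence "?w e : F (D + m)" if "e : arcs E" for e
   using F_lower[of ?w ?d "D + m" e, OF wF(1,2)] that by simp
  hence "th (r e) : ksum (F (D + m)) (lev U m)" if e: "e : arcs E" for e
  proof -
   have "th (r e) = ?w e \<oplus> y e" using c(4,5)[OF e] by(simp add: a_minus_def a_assoc l_neg)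
   thus ?thesis unfolding ksum_def using \<open>!!e. e : arcs E ==> ?w e : F (D + m)\<close>[OF e] y(3)[OF e] by blast
  qed
  hence IH: "(m = 0 --> r e = o0) & (ALL m'. m = Suc m' --> r e : H m')" if "e : arcs E" for e
   using Suc.IH[of "r e"] zr(2) that by blast
  have "q : H m"
  proof (cases m)
   case 0
   thus ?thesis using IH zr(6) by blast
  next
   case (Suc m')
   thus ?thesis using IH zr(5)[of m'] by blast
  qed
  thus ?case by simp
 qed
 \<comment> \<open>Since \<open>th q\<close> has length at most D + 1 + m, the level j can be
   replaced by m: by growth of the levels if j is smaller, by \<open>lev_lower'\<close> if it is
   larger. Then \<open>step\<close> lowers the degree of q.\<close>
 show ?thesis using q(1)
 proof (induction m)
  case 0
  have "th q : F (Suc D + 0)" using th[OF 0] .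
  hence "th q : lev U 0" using lev_lower'[of "th q" 0 j] q(2) by simp
  hence "th q : ksum (F (D + 0)) (lev U 0)" using ksum_right[OF F_ksub lev_facts(1)] by blast
  thus ?case using step[OF 0] by blast
 next
  case (Suc m)
  have f: "th q : F (Suc D + Suc m)" using th[OF Suc.prems] .
  have "th q : lev U (Suc m)"
  proof (cases "j <= Suc m")
   case True
   thus ?thesis using q(2) lev_mono by blast
  next
   case False
   hence "th q : lev U (Suc m + (j - Suc m))" using q(2) by simp
   thus ?thesis using lev_lower' f by blast
  qed
  hence "th q : ksum (F (D + Suc m)) (lev U (Suc m))" using ksum_right[OF F_ksub lev_facts(1)] by blast
  hence "q : H m" using step[OF Suc.prems] by blast
  thus ?case by(rule Suc.IH)
 qed
qed

end

end

section \<open>The ghost filtration of a finite free module\<close>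

context fin_digraph
begin

lemma lpa_module_free: "lpa_module G (free_module (LA :: ('a,'b,'k::field) leavitt_ring) I)"
 unfolding lpa_module_def using left_module_free[OF ring_LA] fin_digraph_axioms by blast

definition TF :: "'i set => nat => ('i => ('a,'b,'k::field) leavitt_elem) set" where
 "TF I d = {x : car (free_module LA I). ALL i:I. x i : Cf d}"

definition coord :: "'i => ('a,'b,'k::field) leavitt_elem => 'i => ('a,'b,'k) leavitt_elem" where
 "coord i a = (%j. if j = i then a else \<zero>_{LA})"

lemma coord_closed: "i : I ==> a : car LA ==> coord i a : car (free_module (LA :: ('a,'b,'k::field) leavitt_ring) I)"
proof -
 assume "i : I" "a : car (LA :: ('a,'b,'k) leavitt_ring)"
 moreover have "finite {j. coord i a j ~= \<zero>_{LA}}" by(rule finite_subset[of _ "{i}"]) (auto simp: coord_def)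
 moreover have "\<zero>_{LA} : car (LA :: ('a,'b,'k) leavitt_ring)" by(rule ring.ring_simprules(2)[OF ring_LA])
 ultimately show ?thesis by(auto simp: free_simps coord_def)
qed

lemma coord_sum: assumes "finite I" "x : car (free_module (LA :: ('a,'b,'k::field) leavitt_ring) I)"
 shows "x = (\<Oplus>_{free_module LA I}i\<in>I. coord i (x i))"
proof
 interpret L: ring "LA :: ('a,'b,'k) leavitt_ring" by(rule ring_LA)
 fix j
 have xc: "x i : car LA" for i using assms(2) by(cases "i : I") (auto simp: free_simps)
 have "(\<Oplus>_{free_module LA I}i\<in>I. coord i (x i)) j = (\<Oplus>_{LA}i\<in>I. coord i (x i) j)"
  by(rule finsum_free_module[OF ring_LA]) (rule coord_closed[OF _ xc])
 also have "... = (\<Oplus>_{LA}i\<in>I. if j = i then x i else \<zero>_{LA})"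
  by(rule L.add.finprod_cong') (use xc in "auto simp: coord_def")
 also have "... = x j"
 proof (cases "j : I")
  case True
  thus ?thesis by(intro L.add.finprod_singleton) (use xc assms in auto)
 next
  case False
  hence "(\<Oplus>_{LA}i\<in>I. if j = i then x i else \<zero>_{LA}) = (\<Oplus>_{LA}i\<in>I. \<zero>_{LA})"
   by(intro L.add.finprod_cong') auto
  thus ?thesis using False assms(2) by(simp add: free_simps)
 qed
 finally show "x j = (\<Oplus>_{free_module LA I}i\<in>I. coord i (x i)) j" ..
qed

text \<open>The axioms are verified coordinate by coordinate from those of the regular module.
  Finiteness of the basis makes the pieces finite-dimensional and lets a vector be reassembled from
  its coordinates.\<close>

lemma ghost_filtration_free: assumes I: "finite I"
 defines "X == free_module (LA :: ('a,'b,'k::field) leavitt_ring) (I :: 'i set)"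
 shows "ghost_filtration X (lpa_module.scM G X) G (lpa_module.vtM G X) (lpa_module.arM G X) (lpa_module.ghM G X) (TF I)"
proof -
 let ?T = "TF I :: nat => ('i => ('a,'b,'k) leavitt_elem) set"
 interpret L: ring "LA :: ('a,'b,'k) leavitt_ring" by(rule ring_LA)
 interpret R: lpa_module G "reg_module (LA :: ('a,'b,'k) leavitt_ring)" by(rule lpa_module_reg)
 interpret RF: ghost_filtration "reg_module (LA :: ('a,'b,'k) leavitt_ring)" R.scM G R.vtM R.arM R.ghM Cf
  by(rule ghost_filtration_reg)
 interpret X: lpa_module G X unfolding X_def by(rule lpa_module_free)
 have Xc: "x i : car LA" if "x : car X" for x i using that unfolding X_def by(cases "i : I") (auto simp: free_simps)
 have Xs: "(x \<oplus>_{X} y) i = x i \<oplus>_{LA} y i" "(a \<odot>_{X} x) i = a \<otimes>_{LA} x i" "\<zero>_{X} i = \<zero>_{LA}" for x y a i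
  unfolding X_def by(simp_all add: free_simps)
 have Xout: "x i = \<zero>_{LA}" if "x : car X" "i ~: I" for x i using that unfolding X_def by(auto simp: free_simps)
 have XI: "x : car X" if "!!i. i : I ==> x i : car LA" "!!i. i ~: I ==> x i = \<zero>_{LA}" for x
 proof -
  have "finite {i. x i ~= \<zero>_{LA}}" by(rule finite_subset[OF _ I]) (use that(2) in auto)
  thus ?thesis using that unfolding X_def by(simp add: free_simps)
 qed
 have Xeq: "x = y" if "x : car X" "y : car X" "!!i. i : I ==> x i = y i" for x y
  using that Xout by(intro ext) metis
 have Xsum: "(\<Oplus>_{X}j\<in>J. f j) i = (\<Oplus>_{reg_module LA}j\<in>J. f j i)" if "!!j. j : J ==> f j : car X" for f J i
 proof -
  have "(\<Oplus>_{X}j\<in>J. f j) i = (\<Oplus>_{LA}j\<in>J. f j i)"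
   unfolding X_def by(rule finsum_free_module[OF ring_LA]) (use that X_def in auto)
  also have "... = (\<Oplus>_{reg_module LA}j\<in>J. f j i)" by(rule finsum_same[symmetric]) simp_all
  finally show ?thesis .
 qed
 have TFdef: "x : ?T d <-> x : car X & (ALL i:I. x i : Cf d)" for x d by(simp add: TF_def X_def)
 note CfF = Cf_facts[where 'k = 'k]
 have kT: "X.ops.ksub (?T d)" for d
 proof (rule X.ops.ksubI)
  show "?T d <= car X" using TFdef by blast
  show "\<zero>_{X} : ?T d" unfolding TFdef using CfF(4) by(simp add: Xs)
  show "x \<oplus>_{X} y : ?T d" if "x : ?T d" "y : ?T d" for x y
   using that CfF(3) unfolding TFdef by(simp add: Xs)
  show "X.scM c x : ?T d" if "x : ?T d" for c x
   using that CfF(2)[OF CfF(5), of _ d c] X.smult_closed[of "semb c" x] unfolding TFdef by(simp add: Xs)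
 qed
 have fdT: "X.ops.fd (?T d)" for d
 proof -
  have ck: "kspace (reg_module LA) R.scM" "kspace X X.scM"
   using R.ops.kspace_axioms X.ops.kspace_axioms by auto
  have fi: "X.ops.fd (coord i ` Cf d)" if i: "i : I" for i
  proof (rule fd_image[where f = "coord i", OF ck])
   show "coord i x : car X" if "x : car (reg_module LA)" for x
    using coord_closed[OF i, of x] that unfolding X_def by simp
   show "coord i (x \<oplus>_{reg_module LA} y) = coord i x \<oplus>_{X} coord i y" if "x : car (reg_module LA)" "y : car (reg_module LA)" for x y
    by(rule ext) (simp add: Xs coord_def)
   show "coord i (R.scM c x) = X.scM c (coord i x)" if "x : car (reg_module LA)" for c x
    by(rule ext) (simp add: Xs coord_def)
   show "R.ops.fd (Cf d)" by(rule RF.F_fd)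
  qed
  from X.ops.fd_indexed_sum[of I "%i. coord i ` Cf d", OF I fi] obtain B where B: "X.ops.fd B" "ALL i:I. coord i ` Cf d <= B" by blast
  have "?T d <= B"
  proof
   fix x assume x: "x : ?T d"
   hence xX: "x : car X" "!!i. i : I ==> x i : Cf d" unfolding TFdef by auto
   have "(\<Oplus>_{X}i\<in>I. coord i (x i)) : B"
    by(rule X.M.sub_finsum[OF X.ops.ksub_subgroup[OF X.ops.fd_ksub[OF B(1)]]]) (use B(2) xX(2) in blast)
   thus "x : B" using coord_sum[OF I, of x] xX(1) unfolding X_def by simp
  qed
  thus ?thesis using X.ops.dimension_exists(2)[OF B(1) kT] by blast
 qed
 have low: "(ALL e:arcs G. y e i : Cf m) & (ALL e:arcs G. R.vtM (tail G e) (y e i) = y e i)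
   & (\<Oplus>_{reg_module LA}e\<in>arcs G. R.ghM e (y e i)) : Cf n"
  if y: "ALL e. e : arcs G --> y e : ?T m" "ALL e. e : arcs G --> X.vtM (tail G e) (y e) = y e"
   "(\<Oplus>_{X}e\<in>arcs G. X.ghM e (y e)) : ?T n" and i: "i : I" for y m n i
 proof (intro conjI ballI)
  fix e assume e: "e : arcs G"
  hence "y e : ?T m" using y(1) by blast
  thus "y e i : Cf m" using i unfolding TFdef by blast
  show "R.vtM (tail G e) (y e i) = y e i" using y(2)[rule_format, OF e] Xs(2)[of "lg (Vtx (tail G e))" "y e" i] by simp
 next
  have "(\<Oplus>_{X}e\<in>arcs G. X.ghM e (y e)) i = (\<Oplus>_{reg_module LA}e\<in>arcs G. (X.ghM e (y e)) i)"
   by(rule Xsum) (use y(1) TFdef X.smult_closed in auto)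
  also have "... = (\<Oplus>_{reg_module LA}e\<in>arcs G. R.ghM e (y e i))" by(simp add: Xs)
  finally have eq: "(\<Oplus>_{X}e\<in>arcs G. X.ghM e (y e)) i = (\<Oplus>_{reg_module LA}e\<in>arcs G. R.ghM e (y e i))" .
  have "(\<Oplus>_{X}e\<in>arcs G. X.ghM e (y e)) i : Cf n" using y(3) i unfolding TFdef by blast
  thus "(\<Oplus>_{reg_module LA}e\<in>arcs G. R.ghM e (y e i)) : Cf n" unfolding eq .
 qed
 show ?thesis unfolding ghost_filtration_def ghost_filtration_axioms_def
 proof (intro conjI allI impI)
  show "leavitt_ops X X.scM G X.vtM X.arM X.ghM" by(rule X.ops.leavitt_ops_axioms)
  show "X.ops.fd (?T d)" for d by(rule fdT)
  show "?T d <= ?T (Suc d)" for d using CfF(8)[of d "Suc d"] unfolding TF_def by auto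
  show "X.vtM v x : ?T d" if "v : verts G" "x : ?T d" for v x d
   using that CfF(2)[OF CfF(6), of v _ d] X.smult_closed unfolding TFdef by(simp add: Xs)
  show "X.ghM e x : ?T (Suc d)" if "e : arcs G" "x : ?T d" for e x d
   using that CfF(2)[OF CfF(7), of e _ d] X.smult_closed unfolding TFdef by(simp add: Xs)
  show "EX y z. z : ?T 0 & (ALL e:arcs G. y e : ?T d & X.vtM (tail G e) (y e) = y e)
    & x = z \<oplus>_{X} (\<Oplus>_{X}e\<in>arcs G. X.ghM e (y e))" if x: "x : ?T (Suc d)" for x d
  proof -
   have "ALL i:I. EX p. snd p : Cf 0 & (ALL e:arcs G. fst p e : Cf d & R.vtM (tail G e) (fst p e) = fst p e)
    & x i = snd p \<oplus>_{reg_module LA} (\<Oplus>_{reg_module LA}e\<in>arcs G. R.ghM e (fst p e))"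
    using RF.F_decompose x unfolding TFdef by fastforce
   from bchoice[OF this] obtain p where p: "!!i. i : I ==> snd (p i) : Cf 0"
    "!!i e. i : I ==> e : arcs G ==> fst (p i) e : Cf d" "!!i e. i : I ==> e : arcs G ==> R.vtM (tail G e) (fst (p i) e) = fst (p i) e"
    "!!i. i : I ==> x i = snd (p i) \<oplus>_{reg_module LA} (\<Oplus>_{reg_module LA}e\<in>arcs G. R.ghM e (fst (p i) e))" by blast
   define z where "z = (%i. if i : I then snd (p i) else \<zero>_{LA})"
   define y where "y e = (%i. if i : I then fst (p i) e else \<zero>_{LA})" for e
   have zX: "z : car X" by(rule XI) (use p(1) CfF(1) in "auto simp: z_def")
   have yX: "y e : car X" if "e : arcs G" for e by(rule XI) (use p(2) that CfF(1) in "auto simp: y_def")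
   have zT: "z : ?T 0" unfolding TFdef using zX p(1) by(simp add: z_def)
   have yT: "y e : ?T d" if "e : arcs G" for e unfolding TFdef using yX p(2) that by(simp add: y_def)
   have yv: "X.vtM (tail G e) (y e) = y e" if "e : arcs G" for e
    by(rule Xeq) (use yX[OF that] X.smult_closed that p(3) in "auto simp: Xs y_def")
   have gX: "X.ghM e (y e) : car X" if "e : arcs G" for e using yX[OF that] that X.smult_closed by simp
   have sX: "(\<Oplus>_{X}e\<in>arcs G. X.ghM e (y e)) : car X" by(rule X.M.finsum_closed) (use gX in auto)
   have "x = z \<oplus>_{X} (\<Oplus>_{X}e\<in>arcs G. X.ghM e (y e))"
   proof (rule Xeq)
    show "x : car X" using x unfolding TFdef by blast
    show "z \<oplus>_{X} (\<Oplus>_{X}e\<in>arcs G. X.ghM e (y e)) : car X" using zX sX X.M.a_closed by blast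
    fix i assume i: "i : I"
    have "(\<Oplus>_{X}e\<in>arcs G. X.ghM e (y e)) i = (\<Oplus>_{reg_module LA}e\<in>arcs G. (X.ghM e (y e)) i)"
     by(rule Xsum) (rule gX)
    thus "x i = (z \<oplus>_{X} (\<Oplus>_{X}e\<in>arcs G. X.ghM e (y e))) i"
     using p(4)[OF i] i by(simp add: Xs z_def y_def)
   qed
   thus ?thesis using zT yT yv by blast
  qed
  show "y e : ?T d" if y: "ALL e. e : arcs G --> y e : ?T m" "ALL e. e : arcs G --> X.vtM (tail G e) (y e) = y e"
   "(\<Oplus>_{X}e\<in>arcs G. X.ghM e (y e)) : ?T (Suc d)" "e : arcs G" for y m d e
  proof -
   have "y e i : Cf d" if "i : I" for i
    using low[OF y(1-3) that] RF.F_lower[of "%e. y e i" m d e] y(4) by blast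
   thus ?thesis using y(1,4) unfolding TFdef by blast
  qed
  show "y e = \<zero>_{X}" if y: "ALL e. e : arcs G --> y e : ?T m" "ALL e. e : arcs G --> X.vtM (tail G e) (y e) = y e"
   "(\<Oplus>_{X}e\<in>arcs G. X.ghM e (y e)) : ?T 0" "e : arcs G" for y m e
  proof (rule Xeq)
   show "y e : car X" using y(1,4) unfolding TFdef by blast
   show "\<zero>_{X} : car X" by simp
   show "y e i = \<zero>_{X} i" if "i : I" for i
    using low[OF y(1-3) that] RF.F_bottom[of "%e. y e i" m e] y(4) by(simp add: Xs)
  qed
  show "car X <= X.ops.fspan (?T 0)"
  proof
   fix x assume x: "x : car X"
   have fs: "X.ops.fsub (X.ops.fspan (?T 0))" by(rule X.ops.fsub_fspan) (use TFdef in blast)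
   hence sm: "submodule (X.ops.fspan (?T 0)) LA X" unfolding X.submodule_iff_fsub .
   have "coord i (x i) : X.ops.fspan (?T 0)" if i: "i : I" for i
   proof -
    have "\<one>_{LA} : (Cf 0 :: ('a,'b,'k) leavitt_elem set)" using CfF(5)[of 1] scalar_embed_ring(3)[where 'k = 'k] by simp
    hence "coord i \<one>_{LA} : ?T 0"
     unfolding TFdef using coord_closed[OF i, of "\<one>_{LA}"] CfF(4)[of 0] by(auto simp: coord_def X_def)
    hence "coord i \<one>_{LA} : X.ops.fspan (?T 0)" using X.ops.fspan_superset by blast
    hence "x i \<odot>_{X} coord i \<one>_{LA} : X.ops.fspan (?T 0)"
     using sm Xc[OF x] unfolding submodule_iff by blast
    moreover have "x i \<odot>_{X} coord i \<one>_{LA} = coord i (x i)"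
     by(rule ext) (use Xc[OF x] in "simp add: Xs coord_def")
    ultimately show ?thesis by simp
   qed
   hence "(\<Oplus>_{X}i\<in>I. coord i (x i)) : X.ops.fspan (?T 0)"
    by(intro X.M.sub_finsum[OF X.ops.ksub_subgroup[OF X.ops.fsub_ksub[OF fs]]])
   thus "x : X.ops.fspan (?T 0)" using coord_sum[OF I, of x] x unfolding X_def by simp
  qed
 qed
qed

end

section \<open>Projective submodules\<close>

lemma (in left_module) smult_eqD:
 assumes "a : car R" "b : car R" "x : car M" "a \<odot>_{M} x = b \<odot>_{M} x"
 shows "(a \<ominus>_{R} b) \<odot>_{M} x = \<zero>_{M}"
 using assms smult_closed by(simp add: a_minus_def smult_l_distr smult_l_minus M.r_neg)

text \<open>The hypothesis \<open>inj\<close> makes y p -> y u an isomorphism from Rp onto the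
  submodule generated by u, and Rp is a retract of R because p is idempotent.\<close>

lemma cyclic_projective:
 fixes M :: "('r,'m) module"
 assumes "left_module R M" and u: "u : car M" and p: "p : car R" "p \<otimes>_{R} p = p" "p \<odot>_{M} u = u"
  and inj: "!!y. y : car R ==> y \<otimes>_{R} p = y ==> y \<odot>_{M} u = \<zero>_{M} ==> y = \<zero>_{R}"
 shows "submodule {y \<odot>_{M} u | y. y : car R} R M"
  "projective R (M(|carrier := {y \<odot>_{M} u | y. y : car R}|))"
proof -
 interpret left_module R M by fact
 let ?N = "{y \<odot>_{M} u | y. y : car R}"
 have NM: "?N <= car M" using u smult_closed by auto
 have sg: "subgroup ?N (add_monoid M)"
 proof (rule M.subgrpI[OF NM])
  show "\<zero>_{M} : ?N" using u by(auto intro!: exI[of _ "\<zero>_{R}"])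
  show "x \<oplus>_{M} y : ?N" if xy: "x : ?N" "y : ?N" for x y
  proof -
   obtain a b where "x = a \<odot>_{M} u" "y = b \<odot>_{M} u" "a : car R" "b : car R" using xy by blast
   hence "x \<oplus>_{M} y = (a \<oplus>_{R} b) \<odot>_{M} u" "a \<oplus>_{R} b : car R" using u by(auto simp: smult_l_distr)
   thus ?thesis by blast
  qed
  show "\<ominus>_{M} x : ?N" if xx: "x : ?N" for x
  proof -
   obtain a where "x = a \<odot>_{M} u" "a : car R" using xx by blast
   hence "\<ominus>_{M} x = (\<ominus>_{R} a) \<odot>_{M} u" "\<ominus>_{R} a : car R" using u by(auto simp: smult_l_minus)
   thus ?thesis by blast
  qed
 qed
 show sm: "submodule ?N R M" unfolding submodule_iff
 proof (intro conjI ballI sg)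
  fix a x assume a: "a : car R" "x : ?N"
  then obtain b where "x = b \<odot>_{M} u" "b : car R" by blast
  hence "a \<odot>_{M} x = (a \<otimes>_{R} b) \<odot>_{M} u" "a \<otimes>_{R} b : car R" using u a by(auto simp: smult_assoc)
  thus "a \<odot>_{M} x : ?N" by blast
 qed
 \<comment> \<open>The inverse isomorphism y u -> y p, defined by choosing some y; two choices
   differ by an annihilator of u, which \<open>inj\<close> turns into equality after multiplication
   by p.\<close>
 define c where "c n = (SOME y. y : car R & n = y \<odot>_{M} u) \<otimes>_{R} p" for n
 have c: "c (y \<odot>_{M} u) = y \<otimes>_{R} p" if y: "y : car R" for y
 proof -
  let ?y = "SOME z. z : car R & y \<odot>_{M} u = z \<odot>_{M} u"
  have s: "?y : car R & y \<odot>_{M} u = ?y \<odot>_{M} u" by(rule someI[of _ y]) (simp add: y)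
  let ?d = "(y \<ominus>_{R} ?y) \<otimes>_{R} p"
  have "?d \<odot>_{M} u = (y \<ominus>_{R} ?y) \<odot>_{M} u" using s y u p by(simp add: smult_assoc)
  also have "... = \<zero>_{M}" by(rule smult_eqD) (use s y u in auto)
  finally have "?d = \<zero>_{R}" using inj[of ?d] s y p by(simp add: R.m_assoc)
  hence "y \<otimes>_{R} p \<ominus>_{R} ?y \<otimes>_{R} p = \<zero>_{R}" using s y p by(simp add: a_minus_def R.l_distr R.l_minus)
  hence "y \<otimes>_{R} p = ?y \<otimes>_{R} p" using R.eq_if_minus_eq_zero s y p by blast
  thus ?thesis unfolding c_def by simp
 qed
 \<comment> \<open>A free module of rank one, with basis {u} because \<open>projective\<close> takes
   its basis from the element type of the module.\<close>
 let ?f = "%n i. if i = u then c n else \<zero>_{R}" and ?g = "%h. h u \<odot>_{M} u"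
 let ?NM = "M(|carrier := ?N|)"
 have "?f : module_hom R ?NM (free_module R {u})" unfolding module_hom_def hom_def
 proof (intro CollectI conjI ballI)
  show "?f : car (add_monoid ?NM) \<rightarrow> car (add_monoid (free_module R {u}))"
  proof
   fix n assume "n : car (add_monoid ?NM)"
   then obtain y where "n = y \<odot>_{M} u" "y : car R" by auto
   moreover have "finite {i. ?f n i ~= \<zero>_{R}}" by(rule finite_subset[of _ "{u}"]) auto
   ultimately show "?f n : car (add_monoid (free_module R {u}))" using c p by(auto simp: free_simps)
  qed
  fix n assume "n : car (add_monoid ?NM)"
  then obtain y where y: "n = y \<odot>_{M} u" "y : car R" by auto
  fix n' assume "n' : car (add_monoid ?NM)"
  then obtain y' where y': "n' = y' \<odot>_{M} u" "y' : car R" by auto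
  have "n \<oplus>_{M} n' = (y \<oplus>_{R} y') \<odot>_{M} u" using y y' u by(simp add: smult_l_distr)
  hence "c (n \<oplus>_{M} n') = c n \<oplus>_{R} c n'" using c y y' p by(simp add: R.l_distr)
  thus "?f (n \<otimes>_{add_monoid ?NM} n') = ?f n \<otimes>_{add_monoid (free_module R {u})} ?f n'"
   by(auto simp: free_simps fun_eq_iff)
 next
  fix a n assume a: "a : car R" and "n : car ?NM"
  then obtain y where y: "n = y \<odot>_{M} u" "y : car R" by auto
  have "a \<odot>_{M} n = (a \<otimes>_{R} y) \<odot>_{M} u" using y a u by(simp add: smult_assoc)
  hence "c (a \<odot>_{M} n) = a \<otimes>_{R} c n" using c y a p by(simp add: R.m_assoc)
  thus "?f (a \<odot>_{?NM} n) = a \<odot>_{free_module R {u}} ?f n" using a by(auto simp: free_simps fun_eq_iff)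
 qed
 moreover have "?g : module_hom R (free_module R {u}) ?NM" unfolding module_hom_def hom_def using u
  by(auto simp: free_simps smult_l_distr smult_assoc)
 moreover have "ALL x:car ?NM. ?g (?f x) = x" using c p u by(auto simp: smult_assoc)
 ultimately show "projective R ?NM" unfolding projective_def by blast
qed

context lpa_module
begin

definition sink_free :: bool where
 "sink_free <-> (ALL w x. ops.sink w --> x : car M --> vtM w x = \<zero>_{M})"

text \<open>The image of h is a finite-dimensional ghost-stable subspace of L(E) killed by the
  sinks, so it vanishes by \<open>fd_ghost_closed_zero\<close>. Real arrows do not enter, so the
  lemma applies to coordinates of L(E)-linear maps and, through the ghost embedding, to coordinates
  of maps that are linear over the ghost path algebra alone.\<close>

lemma fd_hom_to_leavitt_zero:
 assumes N: "ops.gsub N" "ops.fd N" "!!w x. ops.sink w ==> x : N ==> vtM w x = \<zero>_{M}"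
  and h: "!!x. x : N ==> h x : car (LA :: ('v,'e,'k) leavitt_ring)"
   "!!x y. x : N ==> y : N ==> h (x \<oplus>_{M} y) = h x \<oplus>_{LA} h y"
   "!!c x. x : N ==> h (scM c x) = semb c \<otimes>_{LA} h x"
   "!!v x. v : verts E ==> x : N ==> h (vtM v x) = lg (Vtx v) \<otimes>_{LA} h x"
   "!!e x. e : arcs E ==> x : N ==> h (ghM e x) = lg (Ghost e) \<otimes>_{LA} h x" and x: "x : N"
 shows "h x = \<zero>_{LA}"
proof -
 interpret L: lpa_module E "reg_module (LA :: ('v,'e,'k) leavitt_ring)" by(rule lpa_module_reg)
 interpret LF: ghost_filtration "reg_module (LA :: ('v,'e,'k) leavitt_ring)" L.scM E L.vtM L.arM L.ghM Cf
  by(rule ghost_filtration_reg)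
 note ND = ops.ksubD[OF ops.gsub_ksub[OF N(1)]]
 have h0: "h \<zero>_{M} = \<zero>_{LA}"
  using h(3)[OF ND(2), of 0] h(1)[OF ND(2)] ND(5)[OF ND(2)] L.ops.sc_zero_left[of "h \<zero>_{M}"] ops.sc_zero_right[of 0] by simp
 have kW: "L.ops.ksub (h ` N)"
 proof (rule L.ops.ksubI)
  show "h ` N <= car (reg_module (LA))" using h(1) by auto
  show "\<zero>_{reg_module (LA)} : h ` N" using h0 ND(2) by(metis imageI reg_module_simps(2))
  show "x \<oplus>_{reg_module (LA)} y : h ` N" if "x : h ` N" "y : h ` N" for x y
   using that ND(3) by(auto simp flip: h(2))
  show "L.scM c x : h ` N" if "x : h ` N" for c x using that ND(6) by(auto simp flip: h(3))
 qed
 have gW: "L.ops.gsub (h ` N)" unfolding L.ops.gsub_def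
 proof (intro conjI kW ballI)
  fix v y assume v: "v : verts E" and "y : h ` N"
  then obtain x where x: "x : N" "y = h x" by blast
  have "h (vtM v x) : h ` N" using N(1) v x(1) by(simp add: ops.gsub_def)
  thus "L.vtM v y : h ` N" using h(4)[OF v x(1)] x(2) by simp
 next
  fix e y assume e: "e : arcs E" and "y : h ` N"
  then obtain x where x: "x : N" "y = h x" by blast
  have "h (ghM e x) : h ` N" using N(1) e x(1) by(simp add: ops.gsub_def)
  thus "L.ghM e y : h ` N" using h(5)[OF e x(1)] x(2) by simp
 qed
 obtain S where S: "finite S" "N = ops.kspan S" using N(2) unfolding ops.fd_def by blast
 have SN: "S <= N" using ops.kspan_superset[of S] S by blast
 have hS: "h ` S <= car (reg_module (LA))" using SN h(1) by auto
 note KD = L.ops.ksubD[OF L.ops.ksub_kspan[OF hS]]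
 have "ops.ksub {x : N. h x : L.ops.kspan (h ` S)}"
  by(rule ops.ksubI) (use ND KD h h0 in \<open>auto simp del: reg_module_simps simp: reg_module_simps[symmetric, of "LA"]\<close>)
 hence "N <= {x : N. h x : L.ops.kspan (h ` S)}"
  using ops.kspan_minimal[of _ S] SN L.ops.kspan_superset[of "h ` S"] S(2) by blast
 hence "h ` N <= L.ops.kspan (h ` S)" by blast
 hence fW: "L.ops.fd (h ` N)"
  using L.ops.dimension_exists(2)[OF L.ops.fd_kspan[OF _ hS] kW] S(1) by blast
 have "h ` N <= {\<zero>_{reg_module (LA)}}"
 proof (rule LF.fd_ghost_closed_zero[OF gW fW])
  fix w y assume w: "L.ops.sink w" "y : h ` N"
  then obtain x where x: "x : N" "y = h x" by blast
  have w': "ops.sink w" "w : verts E" using w(1) unfolding L.ops.sink_def ops.sink_def by auto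
  show "L.vtM w y = \<zero>_{reg_module (LA)}"
   using h(4)[OF w'(2) x(1)] N(3)[OF w'(1) x(1)] h0 x(2) by simp
 qed
 thus ?thesis using x by auto
qed

text \<open>A retraction embeds N into a free module. On the trace of N on the lattice all
  coordinates of this embedding vanish, so the trace is zero, and a submodule with zero trace is
  zero.\<close>

lemma no_projective_submodule: assumes A: "ops.lattice A" and sf: sink_free
  and N: "submodule N (LA) M" "projective (LA) (M(|carrier := N|))" shows "N = {\<zero>_{M}}"
proof -
 have fN: "ops.fsub N" using N(1) submodule_iff_fsub by blast
 note ND = ops.ksubD[OF ops.fsub_ksub[OF fN]]
 obtain I f g where f: "f : module_hom (LA) (M(|carrier := N|)) (free_module (LA) (I :: 'm set))"
  and gf: "!!x. x : N ==> g (f x) = x" using N(2) unfolding projective_def by auto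
 have fc: "f x : car (free_module (LA) I)" if "x : N" for x
  using f that by(auto simp: module_hom_def hom_def)
 have f1: "f x i : car (LA)" if "x : N" for x i
  using fc[OF that] ring.ring_simprules(2)[OF ring_LA] by(cases "i : I") (auto simp: free_simps)
 have f2: "f (x \<oplus>_{M} y) i = f x i \<oplus>_{LA} f y i" if "x : N" "y : N" for x y i
  using f that by(auto simp: module_hom_def hom_def free_simps)
 have f3: "f (a \<odot>_{M} x) i = a \<otimes>_{LA} f x i" if "x : N" "a : car (LA)" for a x i
  using f that by(auto simp: module_hom_def free_simps)
 have gA: "ops.gsub A" "ops.fd A" using A by(auto simp: ops.lattice_def)
 have g: "ops.gsub (N Int A)" using fN gA ops.gsub_Int unfolding ops.fsub_def by blast
 have "f x i = \<zero>_{LA}" if "x : N Int A" for x i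
 proof (rule fd_hom_to_leavitt_zero[OF g _ _ _ _ _ _ _ that, of "%x. f x i"])
  show "ops.fd (N Int A)" using ops.dimension_exists(2)[OF gA(2) ops.gsub_ksub[OF g]] by blast
  show "vtM w x = \<zero>_{M}" if "ops.sink w" "x : N Int A" for w x
   using sf that ND(5) unfolding sink_free_def by blast
  show "f x i : car (LA)" if "x : N Int A" for x using f1 that by blast
  show "f (x \<oplus>_{M} y) i = f x i \<oplus>_{LA} f y i" if "x : N Int A" "y : N Int A" for x y
   using f2 that by blast
  show "f (scM c x) i = semb c \<otimes>_{LA} f x i" if "x : N Int A" for c x
   by(rule f3) (use that in auto)
  show "f (vtM v x) i = lg (Vtx v) \<otimes>_{LA} f x i" if "v : verts E" "x : N Int A" for v x
   by(rule f3) (use that in auto)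
  show "f (ghM e x) i = lg (Ghost e) \<otimes>_{LA} f x i" if "e : arcs E" "x : N Int A" for e x
   by(rule f3) (use that in auto)
 qed
 hence f0: "f x = (%i. \<zero>_{LA})" if "x : N Int A" for x using that by(intro ext)
 have z: "\<zero>_{M} : N Int A" by(rule ops.ksubD(2)[OF ops.gsub_ksub[OF g]])
 have "x = \<zero>_{M}" if x: "x : N Int A" for x
 proof -
  have "x = g (f x)" using gf[of x] x by simp
  also have "... = g (f \<zero>_{M})" unfolding f0[OF x] f0[OF z] ..
  also have "... = \<zero>_{M}" by(rule gf[OF ND(2)])
  finally show ?thesis .
 qed
 hence "N Int A <= {\<zero>_{M}}" by blast
 hence "N <= {\<zero>_{M}}" using ops.fsub_determined[OF A ops.fsub_zero fN] by blast
 thus ?thesis using ND(2) by blast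
qed

text \<open>Here N lies inside the lattice and is itself finite-dimensional. The coordinates take
  values in the ghost path algebra and are moved into L(E) by the injective embedding.\<close>

lemma no_projective_ghost_submodule:
 fixes M' :: "(('v,'e,'k) path_elem,'m) module"
 assumes A: "ops.lattice A" and sf: sink_free and NA: "N <= A" and gN: "ops.gsub N"
  and same: "!!x y. x \<oplus>_{M'} y = x \<oplus>_{M} y" "car M' = N"
   "!!a x. a : car PG ==> x : N ==> a \<odot>_{M'} x = gemb a \<odot>_{M} x"
  and pr: "projective (PG :: ('v,'e,'k) path_elem ring) M'" shows "N = {\<zero>_{M}}"
proof -
 interpret I: fin_digraph Gi by(rule inverse_fin)
 let ?P = "PG :: ('v,'e,'k) path_elem ring"
 note gE = ghost_embed_hom[where 'k = 'k]
 note ND = ops.ksubD[OF ops.gsub_ksub[OF gN]]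
 obtain I f g where f: "f : module_hom ?P M' (free_module ?P (I :: 'm set))"
  and gf: "!!x. x : N ==> g (f x) = x" using pr same(2) unfolding projective_def by auto
 have fc: "f x : car (free_module ?P I)" if "x : N" for x
  using f that same(2) by(auto simp: module_hom_def hom_def)
 have f1: "f x i : car ?P" if "x : N" for x i
  using fc[OF that] ring.ring_simprules(2)[OF I.ring_PA] by(cases "i : I") (auto simp: free_simps)
 have f2: "f (x \<oplus>_{M} y) i = f x i \<oplus>_{?P} f y i" if "x : N" "y : N" for x y i
  using f that same by(auto simp: module_hom_def hom_def free_simps)
 have f3: "f (gemb a \<odot>_{M} x) i = a \<otimes>_{?P} f x i" if "x : N" "a : car ?P" for a x i
 proof -
  have "f (a \<odot>_{M'} x) = a \<odot>_{free_module ?P I} f x"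
   using f that same(2) unfolding module_hom_def by blast
  thus ?thesis using same(3)[OF that(2,1)] by(simp add: free_simps)
 qed
 note gc = I.path_gens_closed[unfolded inverse_simps]
 have gm: "gemb (a \<otimes>_{?P} b) = gemb a \<otimes>_{LA} gemb b" if "a : car ?P" "b : car ?P" for a b
  using ring_hom_mult[OF gE(1) that] .
 have fA: "ops.fd A" "ops.gsub A" using A by(auto simp: ops.lattice_def)
 have "gemb (f x i) = \<zero>_{LA :: ('v,'e,'k) leavitt_ring}" if "x : N" for x i
 proof (rule fd_hom_to_leavitt_zero[OF gN _ _ _ _ _ _ _ that, of "%x. gemb (f x i)"])
  show "ops.fd N" using ops.dimension_exists(2)[OF fA(1) ops.gsub_ksub[OF gN] NA] .
  show "vtM w x = \<zero>_{M}" if "ops.sink w" "x : N" for w x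
   using sf that ND(5) unfolding sink_free_def by blast
  show "gemb (f x i) : car (LA)" if "x : N" for x using ring_hom_closed[OF gE(1) f1[OF that]] .
  show "gemb (f (x \<oplus>_{M} y) i) = gemb (f x i) \<oplus>_{LA} gemb (f y i)" if "x : N" "y : N" for x y
   using f2[OF that] ring_hom_add[OF gE(1) f1[OF that(1)] f1[OF that(2)]] by simp
  show "gemb (f (scM c x) i) = semb c \<otimes>_{LA} gemb (f x i)" if "x : N" for c x
   using f3[OF that gc(1)[of c], of i] gm[OF gc(1)[of c] f1[OF that, of i]] gE(2)[of c] by simp
  show "gemb (f (vtM v x) i) = lg (Vtx v) \<otimes>_{LA} gemb (f x i)" if "v : verts E" "x : N" for v x
   using f3[OF that(2) gc(2)[OF that(1)], of i] gm[OF gc(2)[OF that(1)] f1[OF that(2), of i]] gE(3)[OF that(1)] by simp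
  show "gemb (f (ghM e x) i) = lg (Ghost e) \<otimes>_{LA} gemb (f x i)" if "e : arcs E" "x : N" for e x
   using f3[OF that(2) gc(3)[OF that(1)], of i] gm[OF gc(3)[OF that(1)] f1[OF that(2), of i]] gE(4)[OF that(1)] by simp
 qed
 hence "f x i = 0" if "x : N" for x i
  by(intro ghost_embed_injective[of "f x i"]) (use f1[OF that, of i] that in "simp_all add: I.PA_simps")
 hence f0: "f x = (%i. 0)" if "x : N" for x using that by(intro ext)
 have "x = \<zero>_{M}" if x: "x : N" for x
  using gf[OF x] gf[OF ND(2)] unfolding f0[OF x] f0[OF ND(2)] by(rule trans[OF sym])
 thus ?thesis using ND(2) by blast
qed

end

section \<open>Finitely presented modules\<close>

context fin_digraph
begin

lemma lgen_vtx_nonzero: assumes "v : verts G"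
 shows "lg (Vtx v) ~= \<zero>_{LA :: ('a,'b,'k::field) leavitt_ring}"
proof
 interpret I: fin_digraph Gi by(rule inverse_fin)
 assume "lg (Vtx v) = \<zero>_{LA :: ('a,'b,'k) leavitt_ring}"
 with ghost_embed_hom(3)[OF assms, where 'k = 'k]
 have "gemb (path_vtx v) = \<zero>_{LA :: ('a,'b,'k) leavitt_ring}" by(rule trans)
 hence "path_vtx v = (0 :: ('a,'b,'k) path_elem)"
  by(intro ghost_embed_injective) (use I.path_gens_closed(2)[of v] assms in "simp_all add: I.PA_simps")
 hence "lookup (path_vtx v :: ('a,'b,'k) path_elem) (v, [], v) = 0" by simp
 thus False by(simp add: path_vtx_def)
qed

text \<open>Ghost length zero means a linear combination of vertices, and right multiplication by
  p_v leaves only the term at v.\<close>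

lemma Cf_zero_vtx: assumes "q : (Cf 0 :: ('a,'b,'k::field) leavitt_elem set)" "v : verts G"
 shows "EX c. q \<otimes>_{LA} lg (Vtx v) = semb c \<otimes>_{LA} lg (Vtx v)"
proof -
 interpret I: fin_digraph Gi by(rule inverse_fin)
 interpret L: ring "LA :: ('a,'b,'k) leavitt_ring" by(rule ring_LA)
 note gE = ghost_embed_hom[where 'k = 'k]
 obtain a where a: "q = gemb a" "keys a <= I.paths_le 0" using assms(1) unfolding Cf_def by blast
 have "EX c. gemb a \<otimes>_{LA} lg (Vtx v) = semb (c :: 'k) \<otimes>_{LA} lg (Vtx v)" using a(2)
 proof (induction a rule: span_induct)
  case zero
  show ?case by(rule exI[of _ 0]) (simp add: ghost_embed_zero scalar_embed_ring)
 next
  case (single p c)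
  then obtain w where w: "p = (w, [], w)" "w : verts G" by(auto simp: I.paths_le_def I.awalk_Nil_iff)
  have k: "keys (path_scalar Gi c) <= paths Gi"
   "keys (single p (1::'k)) <= paths Gi"
   using I.path_gens_closed(1)[of c] single I.paths_le_subset(1)[of 0] by(auto simp: I.PA_simps)
  have "single p c = bmul path_concat (path_scalar Gi c) (single p 1)"
   using I.path_scalar_single[of w "[]" w c 1] w by(simp add: I.paths_iff I.awalk_Nil_iff)
  hence "gemb (single p c) = semb c \<otimes>_{LA} lg (Vtx w)"
   using ghost_embed_bmul(1)[OF k] gE(2)[of c] gE(3)[OF w(2)] w(1) by(simp add: path_vtx_def)
  hence "gemb (single p c) \<otimes>_{LA} lg (Vtx v)
    = semb c \<otimes>_{LA} (lg (Vtx w) \<otimes>_{LA} lg (Vtx v))"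
   using w assms(2) by(simp add: L.m_assoc)
  also have "... = semb (if w = v then c else 0) \<otimes>_{LA} lg (Vtx v)"
   using leavitt_relation_simps(1)[OF w(2) assms(2), where 'k = 'k] assms(2) by(simp add: scalar_embed_ring)
  finally show ?case by blast
 next
  case (add a b)
  obtain c d where cd: "gemb a \<otimes>_{LA} lg (Vtx v) = semb (c :: 'k) \<otimes>_{LA} lg (Vtx v)"
   "gemb b \<otimes>_{LA} lg (Vtx v) = semb (d :: 'k) \<otimes>_{LA} lg (Vtx v)" using add.IH by blast
  have k: "keys a <= paths Gi" "keys b <= paths Gi"
   using add.hyps I.paths_le_subset(1)[of 0] by blast+
  have "gemb (a + b) \<otimes>_{LA} lg (Vtx v) = semb (c + d) \<otimes>_{LA} lg (Vtx v)"
   using ghost_embed_bmul(2)[OF k] ghost_embed_closed[OF k(1)] ghost_embed_closed[OF k(2)] assms(2) cd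
   by(simp add: L.l_distr scalar_embed_ring(1))
  thus ?case by blast
 qed
 thus ?thesis using a(1) by simp
qed

end

context lpa_module
begin

text \<open>A nonzero element u fixed by the vertex p of a sink generates a copy of L(E)p, which is
  projective. To see that nothing in L(E)p annihilates u, descent reduces to ghost elements; these
  are multiples c p, and c u = 0 forces c = 0.\<close>

lemma sink_free_if_no_projective:
 assumes np: "!!N. submodule N (LA) M ==> projective (LA) (M(|carrier := N|)) ==> N = {\<zero>_{M}}"
 shows sink_free unfolding sink_free_def
proof (intro allI impI)
 fix w x assume w: "ops.sink w" and x: "x : car M"
 let ?L = "LA :: ('v,'e,'k) leavitt_ring"
 interpret RL: lpa_module E "reg_module ?L" by(rule lpa_module_reg)
 interpret LF: ghost_filtration "reg_module ?L" RL.scM E RL.vtM RL.arM RL.ghM Cf by(rule ghost_filtration_reg)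
 have wv: "w : verts E" and wt: "!!e. e : arcs E ==> tail E e ~= w" using w unfolding ops.sink_def by auto
 define p where "p = (lg (Vtx w) :: ('v,'e,'k) leavitt_elem)"
 have p: "p : car ?L" "p \<otimes>_{?L} p = p" using wv leavitt_relation_simps(1)[OF wv wv, where 'k = 'k] by(auto simp: p_def)
 define u where "u = p \<odot>_{M} x"
 have u: "u : car M" "p \<odot>_{M} u = u" using p x smult_closed by(auto simp: u_def simp flip: smult_assoc)
 show "vtM w x = \<zero>_{M}"
 proof (rule ccontr)
  assume "vtM w x ~= \<zero>_{M}"
  hence u0: "u ~= \<zero>_{M}" by(simp add: u_def p_def)
  \<comment> \<open>Every ghost arrow is killed on the right by the vertex of a sink, since it can
    only be followed by the tail of its own arrow; so just the part of length zero survives.\<close>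
  have right: "EX c. q \<otimes>_{?L} p = semb c \<otimes>_{?L} p" if "q : Cf d" for q d using that
  proof (induction d arbitrary: q)
   case 0
   thus ?case using Cf_zero_vtx[OF 0 wv] by(simp add: p_def)
  next
   case (Suc d)
   obtain z y where zy: "z : Cf 0" "!!e. e : arcs E ==> y e : Cf d"
    "q = z \<oplus>_{reg_module ?L} (\<Oplus>_{reg_module ?L}e\<in>arcs E. RL.ghM e (y e))"
    using LF.F_decompose[OF Suc.prems] by blast
   have yc: "y e : car ?L" if "e : arcs E" for e using zy(2)[OF that] Cf_facts(1)[of d] by blast
   have zc: "z : car ?L" using zy(1) Cf_facts(1)[of 0] by blast
   have gz: "(lg (Ghost e) \<otimes>_{?L} y e) \<otimes>_{?L} p = \<zero>_{?L}" if e: "e : arcs E" for e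
   proof -
    obtain c where c: "y e \<otimes>_{?L} p = semb c \<otimes>_{?L} p" using Suc.IH[OF zy(2)[OF e]] by blast
    have "(lg (Ghost e) \<otimes>_{?L} y e) \<otimes>_{?L} p = lg (Ghost e) \<otimes>_{?L} (p \<otimes>_{?L} semb c)"
     using c yc[OF e] e p scalar_central[OF p(1), of c] by(simp add: R.m_assoc)
    also have "... = (lg (Ghost e) \<otimes>_{?L} p) \<otimes>_{?L} semb c" using e p by(simp add: R.m_assoc)
    also have "lg (Ghost e) \<otimes>_{?L} p = \<zero>_{?L}"
     using RL.ops.gh_vt[OF wv e, of "\<one>_{?L}"] wt[OF e] wv e by(auto simp: p_def)
    finally show ?thesis by simp
   qed
   have gc: "lg (Ghost e) \<otimes>_{?L} y e : car ?L" if "e : arcs E" for e using that yc by simp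
   have "(\<Oplus>_{reg_module ?L}e\<in>arcs E. RL.ghM e (y e)) = (\<Oplus>_{?L}e\<in>arcs E. lg (Ghost e) \<otimes>_{?L} y e)"
    using finsum_same[of "reg_module ?L" ?L] by simp
   hence "q \<otimes>_{?L} p = z \<otimes>_{?L} p \<oplus>_{?L} (\<Oplus>_{?L}e\<in>arcs E. lg (Ghost e) \<otimes>_{?L} y e) \<otimes>_{?L} p"
    using zy(3) zc p gc by(simp add: R.l_distr R.finsum_closed)
   also have "(\<Oplus>_{?L}e\<in>arcs E. lg (Ghost e) \<otimes>_{?L} y e) \<otimes>_{?L} p = (\<Oplus>_{?L}e\<in>arcs E. (lg (Ghost e) \<otimes>_{?L} y e) \<otimes>_{?L} p)"
    by(rule R.finsum_ldistr) (use p gc in auto)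
   also have "... = (\<Oplus>_{?L}e\<in>arcs E. \<zero>_{?L})" by(rule R.add.finprod_cong') (use gz in auto)
   finally have "q \<otimes>_{?L} p = z \<otimes>_{?L} p" using zc p by simp
   thus ?case using Cf_zero_vtx[OF zy(1) wv] by(simp add: p_def)
  qed
  have inj: "y = \<zero>_{?L}" if y: "y : car ?L" "y \<otimes>_{?L} p = y" "y \<odot>_{M} u = \<zero>_{M}" for y
  proof -
   let ?N = "{y : car ?L. y \<otimes>_{?L} p = y & y \<odot>_{M} u = \<zero>_{M}}"
   have NM: "?N <= car (reg_module ?L)" by auto
   have cl: "a \<otimes>_{?L} y : ?N" if "a : car ?L" "y : ?N" for a y
    using that p u by(auto simp: R.m_assoc smult_assoc)
   have "?N <= {\<zero>_{reg_module ?L}}"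
   proof (rule RL.ops.ghost_descent[OF LF.F_union_gsub order_trans[OF NM LF.F_union_generates] NM])
    show "RL.vtM v y : ?N" if "v : verts E" "y : ?N" for v y using cl[of "lg (Vtx v)" y] that by simp
    show "RL.ghM e y : ?N" if "e : arcs E" "y : ?N" for e y using cl[of "lg (Ghost e)" y] that by simp
    show "subgroup {\<zero>_{reg_module ?L}} (add_monoid (reg_module ?L))" by(rule RL.M.subgroup_zero)
    show "RL.arM e y : {\<zero>_{reg_module ?L}}" if "e : arcs E" "y : {\<zero>_{reg_module ?L}}" for e y using that by simp
    show "?N Int (\<Union>d. Cf d) <= {\<zero>_{reg_module ?L}}"
    proof
     fix q assume q: "q : ?N Int (\<Union>d. Cf d)"
     then obtain d c where c: "q \<otimes>_{?L} p = semb c \<otimes>_{?L} p" using right by blast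
     hence qc: "q = semb c \<otimes>_{?L} p" using q by auto
     hence "scM c u = \<zero>_{M}" using q p u by(auto simp: smult_assoc)
     have "c = 0"
     proof (rule ccontr)
      assume "c ~= 0"
      hence "u = scM (1 / c) (scM c u)" using u(1) by(simp flip: ops.sc_times)
      thus False using \<open>scM c u = \<zero>_{M}\<close> u0 by simp
     qed
     thus "q : {\<zero>_{reg_module ?L}}" using qc p by(simp add: scalar_embed_ring)
    qed
   qed
   thus ?thesis using y by auto
  qed
  note cp = cyclic_projective[OF left_module_axioms u(1) p u(2) inj]
  have "{y \<odot>_{M} u | y. y : car ?L} = {\<zero>_{M}}" using np[OF cp] .
  moreover have "p \<odot>_{M} u : {y \<odot>_{M} u | y. y : car ?L}" using p by blast
  ultimately show False using u(2) u0 by simp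
 qed
qed

end

lemma (in left_module) submodule_of_submodule: assumes K: "submodule K R M"
 shows "submodule N R (M(|carrier := K|)) <-> submodule N R M & N <= K"
proof -
 have eq: "add_monoid (M(|carrier := K|)) = (add_monoid M)(|carrier := K|)" by simp
 have sK: "subgroup K (add_monoid M)" using K by(simp add: submodule_iff)
 have "subgroup N (add_monoid (M(|carrier := K|))) <-> subgroup N (add_monoid M) & N <= K"
  unfolding eq using group.incl_subgroup[OF M.a_group sK] group.subgroup_incl[OF M.a_group _ sK]
   subgroup.subset[of N "(add_monoid M)(|carrier := K|)"] by(metis partial_object.select_convs(1) partial_object.update_convs(1))
 thus ?thesis by(auto simp: submodule_iff)
qed

context leavitt_ops
begin

lemma fsubI: assumes "ksub N" "!!v x. v : verts E ==> x : N ==> vt v x : N"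
  "!!e x. e : arcs E ==> x : N ==> ar e x : N" "!!e x. e : arcs E ==> x : N ==> gh e x : N"
 shows "fsub N" using assms by(simp add: fsub_def rsub_def gsub_def)

lemma fsubD: assumes "fsub N" "x : N"
 shows "v : verts E ==> vt v x : N" "e : arcs E ==> ar e x : N" "e : arcs E ==> gh e x : N"
 using assms by(simp_all add: fsub_def rsub_def gsub_def)

lemma fsub_Int: "fsub A ==> fsub B ==> fsub (A Int B)"
 by(rule fsubI) (auto simp: ksub_Int fsub_ksub fsubD)

lemma fsub_chain_union: assumes "!!d::nat. fsub (F d)" "!!m n. m <= n ==> F m <= F n"
 shows "fsub (\<Union>d. F d)"
proof (rule fsubI)
 note D = fsubD[OF assms(1)]
 have "gsub (\<Union>d. F d)"
 proof (rule gsub_chain_union)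
  show "gh e x : F (Suc d)" if "e : arcs E" "x : F d" for e x d
   using D(3)[OF that(2,1)] assms(2)[of d "Suc d"] by auto
 qed (simp_all add: fsub_ksub assms D)
 thus "ksub (\<Union>d. F d)" by(rule gsub_ksub)
 show "vt v x : (\<Union>d. F d)" if "v : verts E" "x : (\<Union>d. F d)" for v x
  using that D(1) by(meson UN_iff)
 show "ar v x : (\<Union>d. F d)" if "v : arcs E" "x : (\<Union>d. F d)" for v x
  using that D(2) by(meson UN_iff)
 show "gh v x : (\<Union>d. F d)" if "v : arcs E" "x : (\<Union>d. F d)" for v x
  using that D(3) by(meson UN_iff)
qed

end

context lpa_module
begin

text \<open>The module \<open>M\<close> plays the free module of a presentation and
  \<open>Ker\<close> its relations; the claim is that the class of u has no annihilator in L(E)p.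
  Independence of leading terms only treats ghost multipliers whose product with u is a ghost
  consequence of the short relations. Two descents remove these restrictions, one inside
  \<open>Ker\<close> and one inside L(E).\<close>

lemma leading_term_free: assumes F: "ghost_filtration M scM E vtM arM ghM F"
  and Ker: "ops.fsub Ker" "Ker <= ops.fspan (Ker Int F (Suc D))"
  and u: "u : F (Suc D)" "u ~: ops.ksum (F D) (Ker Int F (Suc D))" and v: "v : verts E" "vtM v u = u"
  and y: "y : car (LA)" "y \<otimes>_{LA} lg (Vtx v) = y" "y \<odot>_{M} u : Ker"
 shows "y = \<zero>_{LA}"
proof -
 let ?L = "LA :: ('v,'e,'k) leavitt_ring"
 let ?U = "Ker Int F (Suc D)"
 define p where "p = (lg (Vtx v) :: ('v,'e,'k) leavitt_elem)"
 interpret F: ghost_filtration M scM E vtM arM ghM F by(rule F)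
 interpret RL: lpa_module E "reg_module ?L" by(rule lpa_module_reg)
 interpret LF: ghost_filtration "reg_module ?L" RL.scM E RL.vtM RL.arM RL.ghM Cf by(rule ghost_filtration_reg)
 have p: "p : car ?L" "p \<otimes>_{?L} p = p" using v(1) leavitt_relation_simps(1)[OF v(1) v(1), where 'k = 'k] by(auto simp: p_def)
 have uc: "u : car M" "p \<odot>_{M} u = u" using u(1) ops.ksubD(1)[OF F.F_ksub] v(2) by(auto simp: p_def)
 \<comment> \<open>Multipliers are cut down to q = q p, because u is fixed by p and a multiplier can
   matter only through q p.\<close>
 define H where "H m = {q : Cf m. q \<otimes>_{?L} p = q}" for m
 define th where "th q = q \<odot>_{M} u" for q
 have fs: "finsum (reg_module ?L) f I = finsum ?L f I" for f and I :: "'e set" by(rule finsum_same) simp_all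
 have Hc: "q : car ?L" "q \<otimes>_{?L} p = q" if "q : H m" for q m using that Cf_facts(1)[of m] by(auto simp: H_def)
 have H0: "EX c. th q = scM c u & (c = 0 --> q = \<zero>_{?L})" if q: "q : H 0" for q
 proof -
  obtain c where "q \<otimes>_{?L} p = semb c \<otimes>_{?L} p" using Cf_zero_vtx[OF _ v(1)] q unfolding H_def p_def by blast
  hence c: "q = semb c \<otimes>_{?L} p" using Hc(2)[OF q] by simp
  show ?thesis unfolding th_def c by(rule exI[of _ c]) (use p uc in "simp add: smult_assoc scalar_embed_ring")
 qed
 have Cc: "x : car ?L" if "x : Cf m" for x m using that Cf_facts(1)[of m] by blast
 \<comment> \<open>The decomposition of q by leading ghost arrows is multiplied by p on the right.
   The last two clauses record that q drops in degree as soon as all coefficients do.\<close>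
 have Hdec: "EX z r. z : H 0 & (ALL e:arcs E. r e : H m & vtM (tail E e) (th (r e)) = th (r e))
    & th q = th z \<oplus>_{M} (\<Oplus>_{M}e\<in>arcs E. ghM e (th (r e)))
    & (ALL m'. (ALL e:arcs E. r e : H m') --> q : H (Suc m')) & ((ALL e:arcs E. r e = \<zero>_{?L}) --> q : H 0)"
  if q: "q : H (Suc m)" for q m
 proof -
  have qC: "q : Cf (Suc m)" using q by(simp add: H_def)
  obtain z y where zy: "z : Cf 0" "!!e. e : arcs E ==> y e : Cf m"
   "!!e. e : arcs E ==> lg (Vtx (tail E e)) \<otimes>_{?L} y e = y e"
   "q = z \<oplus>_{?L} (\<Oplus>_{?L}e\<in>arcs E. lg (Ghost e) \<otimes>_{?L} y e)"
   using LF.F_decompose[OF qC] unfolding fs reg_module_simps by blast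
  have yc: "y e : car ?L" if "e : arcs E" for e using Cc[OF zy(2)[OF that]] .
  have zc: "z : car ?L" using Cc[OF zy(1)] .
  define r where "r e = y e \<otimes>_{?L} p" for e
  have gc: "lg (Ghost e) \<otimes>_{?L} y e : car ?L" if "e : arcs E" for e using that yc by simp
  have rc: "r e : car ?L" "lg (Ghost e) \<otimes>_{?L} r e : car ?L" if "e : arcs E" for e using that yc p by(simp_all add: r_def)
  have "q = z \<otimes>_{?L} p \<oplus>_{?L} (\<Oplus>_{?L}e\<in>arcs E. lg (Ghost e) \<otimes>_{?L} y e) \<otimes>_{?L} p"
   using Hc(2)[OF q] zy(4) zc p gc by(metis (no_types, lifting) R.l_distr R.finsum_closed Pi_I)
  also have "(\<Oplus>_{?L}e\<in>arcs E. lg (Ghost e) \<otimes>_{?L} y e) \<otimes>_{?L} p = (\<Oplus>_{?L}e\<in>arcs E. (lg (Ghost e) \<otimes>_{?L} y e) \<otimes>_{?L} p)"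
   by(rule R.finsum_ldistr) (use p gc in auto)
  also have "... = (\<Oplus>_{?L}e\<in>arcs E. lg (Ghost e) \<otimes>_{?L} r e)"
   by(rule R.add.finprod_cong') (use p yc rc in "auto simp: r_def R.m_assoc")
  finally have q': "q = z \<otimes>_{?L} p \<oplus>_{?L} (\<Oplus>_{?L}e\<in>arcs E. lg (Ghost e) \<otimes>_{?L} r e)" .
  have pC: "p : Cf 0" using Cf_facts(6)[OF v(1)] by(simp add: p_def)
  have zH: "z \<otimes>_{?L} p : H 0" using Cf_facts(2)[OF zy(1) pC] zc p by(simp add: H_def R.m_assoc)
  have rH: "r e : H m" if "e : arcs E" for e
   using Cf_facts(2)[OF zy(2)[OF that] pC] yc[OF that] p by(simp add: H_def r_def R.m_assoc)
  have rt: "vtM (tail E e) (th (r e)) = th (r e)" if e: "e : arcs E" for e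
  proof -
   have "lg (Vtx (tail E e)) \<otimes>_{?L} r e = r e"
    using zy(3)[OF e] yc[OF e] p e by(simp add: r_def flip: R.m_assoc)
   thus ?thesis using rc(1)[OF e] uc(1) e by(simp add: th_def flip: smult_assoc)
  qed
  have "th q = th (z \<otimes>_{?L} p) \<oplus>_{M} (\<Oplus>_{?L}e\<in>arcs E. lg (Ghost e) \<otimes>_{?L} r e) \<odot>_{M} u"
   unfolding th_def by(subst q', rule smult_l_distr) (use zc p rc uc R.finsum_closed in auto)
  also have "(\<Oplus>_{?L}e\<in>arcs E. lg (Ghost e) \<otimes>_{?L} r e) \<odot>_{M} u = (\<Oplus>_{M}e\<in>arcs E. (lg (Ghost e) \<otimes>_{?L} r e) \<odot>_{M} u)"
   by(rule smult_finsum_l) (use uc rc in auto)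
  also have "... = (\<Oplus>_{M}e\<in>arcs E. ghM e (th (r e)))"
   by(rule M.add.finprod_cong') (use rc uc smult_assoc smult_closed in "auto simp: th_def")
  finally have thq: "th q = th (z \<otimes>_{?L} p) \<oplus>_{M} (\<Oplus>_{M}e\<in>arcs E. ghM e (th (r e)))" .
  have up: "q : H (Suc m')" if "ALL e:arcs E. r e : H m'" for m'
  proof -
   have ks: "subgroup (Cf (Suc m')) (add_monoid (reg_module ?L))" using LF.F_ksub[of "Suc m'"] unfolding RL.ops.ksub_def by simp
   have "(\<Oplus>_{reg_module ?L}e\<in>arcs E. lg (Ghost e) \<otimes>_{?L} r e) : Cf (Suc m')"
    by(rule RL.M.sub_finsum[OF ks]) (use that LF.F_gh in "auto simp: H_def")
   moreover have "z \<otimes>_{?L} p : Cf (Suc m')" using zH Cf_facts(8)[of 0 "Suc m'"] by(auto simp: H_def)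
   ultimately have "q : Cf (Suc m')" unfolding q' fs[symmetric] using Cf_facts(3) by blast
   thus ?thesis using Hc(2)[OF q] by(simp add: H_def)
  qed
  have "q : H 0" if "ALL e:arcs E. r e = \<zero>_{?L}"
  proof -
   have "(\<Oplus>_{?L}e\<in>arcs E. lg (Ghost e) \<otimes>_{?L} r e) = (\<Oplus>_{?L}e\<in>arcs E. \<zero>_{?L})"
    by(rule R.add.finprod_cong') (use that in auto)
   hence "q = z \<otimes>_{?L} p" using q' zc p by simp
   thus ?thesis using zH by simp
  qed
  thus ?thesis using zH rH rt thq up by blast
 qed
 have thF: "th q : F (Suc D + m)" if "q : H m" for q m using that
 proof (induction m arbitrary: q)
  case 0
  thus ?case using H0[OF 0] ops.ksubD(6)[OF F.F_ksub u(1)] by auto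
 next
  case (Suc m)
  obtain z r where zr: "z : H 0" "ALL e:arcs E. r e : H m"
   "th q = th z \<oplus>_{M} (\<Oplus>_{M}e\<in>arcs E. ghM e (th (r e)))" using Hdec[OF Suc.prems] by blast
  have ks: "subgroup (F (Suc D + Suc m)) (add_monoid M)" using F.F_ksub[of "Suc D + Suc m"] unfolding ops.ksub_def by simp
  have "(\<Oplus>_{M}e\<in>arcs E. ghM e (th (r e))) : F (Suc D + Suc m)"
   by(rule M.sub_finsum[OF ks]) (use zr(2) Suc.IH F.F_gh in auto)
  moreover have "th z : F (Suc D + Suc m)"
   using H0[OF zr(1)] ops.ksubD(6)[OF F.F_ksub u(1)] F.F_mono[of "Suc D" "Suc D + Suc m"] by auto
  ultimately show ?case unfolding zr(3) using ops.ksubD(3)[OF F.F_ksub] by blast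
 qed
 note indep = F.leading_term_independence[OF Ker(1) refl u, where H = H and th = th and ?o0.0 = "\<zero>_{?L}", OF H0 Hdec thF]
 \<comment> \<open>First descent: the levels over U form a ghost-stable subspace generating
   \<open>Ker\<close>, and a ghost multiple of u lying in some level is zero by
   \<open>indep\<close>. Hence every ghost multiple of u in \<open>Ker\<close> is zero.\<close>
 have Cz: "th q = \<zero>_{M}" if q: "q : H m" "th q : Ker" for q m
 proof -
  let ?N = "{th q | q m. q : H m & th q : Ker}"
  have gK: "ops.gsub Ker" using Ker(1) by(simp add: ops.fsub_def)
  note KD = ops.ksubD[OF ops.fsub_ksub[OF Ker(1)]]
  note Uk = F.U_ksub[OF Ker(1) refl, where D = D]
  note lv = ops.lev_ksub[OF Uk]
  have NM: "?N <= car M" using KD(1) by blast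
  have gC: "ops.gsub (\<Union>j. ops.lev ?U j)"
   by(rule ops.gsub_chain_union) (use lv F.lev_mono[OF Ker(1) refl] in auto)
  have "Ker <= ops.fspan (\<Union>j. ops.lev ?U j)"
  proof -
   have "?U <= (\<Union>j. ops.lev ?U j)" using UN_upper[of "0::nat" UNIV "ops.lev ?U"] by simp
   hence "ops.fspan ?U <= ops.fspan (\<Union>j. ops.lev ?U j)"
    using ops.fsub_fspan[OF ops.ksubD(1)[OF ops.gsub_ksub[OF gC]]] ops.fspan_superset[of "\<Union>j. ops.lev ?U j"]
    by(intro ops.fspan_minimal) (assumption, rule order_trans)
   thus ?thesis using Ker(2) by blast
  qed
  hence gen: "?N <= ops.fspan (\<Union>j. ops.lev ?U j)" by blast
  have "?N <= {\<zero>_{M}}"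
  proof (rule ops.ghost_descent[OF gC gen NM])
   show "vtM w x : ?N" if w: "w : verts E" and x: "x : ?N" for w x
   proof -
    obtain q m where q: "x = th q" "q : H m" "th q : Ker" using x by blast
    have "lg (Vtx w) \<otimes>_{?L} q : H m"
     using Cf_facts(2)[OF Cf_facts(6)[OF w], of q m] q(2) Hc[OF q(2)] w p by(simp add: H_def R.m_assoc)
    moreover have "th (lg (Vtx w) \<otimes>_{?L} q) = vtM w x" using Hc[OF q(2)] uc w q(1) by(simp add: th_def smult_assoc)
    moreover have "vtM w x : Ker" using ops.gsubD(1)[OF gK q(3) w] q(1) by simp
    ultimately show ?thesis by(metis (mono_tags, lifting) mem_Collect_eq)
   qed
   show "ghM e x : ?N" if e: "e : arcs E" and x: "x : ?N" for e x
   proof -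
    obtain q m where q: "x = th q" "q : H m" "th q : Ker" using x by blast
    have "lg (Ghost e) \<otimes>_{?L} q : H (Suc m)"
     using Cf_facts(2)[OF Cf_facts(7)[OF e], of q m] q(2) Hc[OF q(2)] e p by(simp add: H_def R.m_assoc)
    moreover have "th (lg (Ghost e) \<otimes>_{?L} q) = ghM e x" using Hc[OF q(2)] uc e q(1) by(simp add: th_def smult_assoc)
    moreover have "ghM e x : Ker" using ops.gsubD(2)[OF gK q(3) e] q(1) by simp
    ultimately show ?thesis by(metis (mono_tags, lifting) mem_Collect_eq)
   qed
   show "subgroup {\<zero>_{M}} (add_monoid M)" by(rule M.subgroup_zero)
   show "arM e x : {\<zero>_{M}}" if "e : arcs E" "x : {\<zero>_{M}}" for e x using that by simp
   show "?N Int (\<Union>j. ops.lev ?U j) <= {\<zero>_{M}}"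
   proof
    fix x assume "x : ?N Int (\<Union>j. ops.lev ?U j)"
    then obtain q m j where q: "x = th q" "q : H m" "th q : ops.lev ?U j" by blast
    hence "q = \<zero>_{?L}" by(intro indep)
    thus "x : {\<zero>_{M}}" using uc q(1) by(simp add: th_def smult_l_null)
   qed
  qed
  thus ?thesis using q by blast
 qed
 \<comment> \<open>Second descent, inside L(E): the multipliers sending u into \<open>Ker\<close>
   form a ghost-stable set. Its ghost elements send u to zero by \<open>Cz\<close>, hence into level
   0, and vanish by \<open>indep\<close>.\<close>
 let ?N = "{y : car ?L. y \<otimes>_{?L} p = y & y \<odot>_{M} u : Ker}"
 have NM: "?N <= car (reg_module ?L)" by auto
 have Ks: "submodule Ker ?L M" using Ker(1) submodule_iff_fsub by blast
 have cl: "a \<otimes>_{?L} y : ?N" if "a : car ?L" "y : ?N" for a y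
  using that p uc Ks unfolding submodule_iff by(auto simp: R.m_assoc smult_assoc)
 have "?N <= {\<zero>_{reg_module ?L}}"
 proof (rule RL.ops.ghost_descent[OF LF.F_union_gsub order_trans[OF NM LF.F_union_generates] NM])
  show "RL.vtM v y : ?N" if "v : verts E" "y : ?N" for v y using cl[of "lg (Vtx v)" y] that by simp
  show "RL.ghM e y : ?N" if "e : arcs E" "y : ?N" for e y using cl[of "lg (Ghost e)" y] that by simp
  show "subgroup {\<zero>_{reg_module ?L}} (add_monoid (reg_module ?L))" by(rule RL.M.subgroup_zero)
  show "RL.arM e y : {\<zero>_{reg_module ?L}}" if "e : arcs E" "y : {\<zero>_{reg_module ?L}}" for e y using that by simp
  show "?N Int (\<Union>d. Cf d) <= {\<zero>_{reg_module ?L}}"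
  proof
   fix q assume q: "q : ?N Int (\<Union>d. Cf d)"
   then obtain m where m: "q : H m" by(auto simp: H_def)
   have "th q = \<zero>_{M}" by(rule Cz[OF m]) (use q in "simp add: th_def")
   hence "th q : ops.lev ?U 0" using ops.ksubD(2)[OF F.U_ksub(1)[OF Ker(1) refl]] by simp
   hence "q = \<zero>_{?L}" using m by(intro indep)
   thus "q : {\<zero>_{reg_module ?L}}" by simp
  qed
 qed
 thus ?thesis using y by(auto simp: p_def)
qed

text \<open>Either every element of length D + 1 can be shortened modulo relations, and then the
  image of the piece of length D is stable under ghost arrows and is a lattice; or some element
  cannot, and then it generates a projective submodule by \<open>leading_term_free\<close>.\<close>

lemma lattice_if_no_projective:
 fixes X :: "(('v,'e,'k) leavitt_elem, 'x) module"
 assumes np: "!!N. submodule N (LA) M ==> projective (LA) (M(|carrier := N|)) ==> N = {\<zero>_{M}}"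
  and X: "lpa_module E X"
  and F: "ghost_filtration X (lpa_module.scM E X) E (lpa_module.vtM E X) (lpa_module.arM E X) (lpa_module.ghM E X) F"
  and phi: "phi : module_hom (LA) X M" "phi ` car X = car M"
  and fg: "finitely_generated (LA) (X(|carrier := a_kernel X M phi|))" shows "EX A. ops.lattice A"
proof -
 let ?L = "LA :: ('v,'e,'k) leavitt_ring"
 interpret X: lpa_module E X by(rule X)
 interpret F: ghost_filtration X X.scM E X.vtM X.arM X.ghM F by(rule F)
 have ph: "phi x : car M" "phi (x \<oplus>_{X} y) = phi x \<oplus>_{M} phi y" "a : car ?L ==> phi (a \<odot>_{X} x) = a \<odot>_{M} phi x"
  if "x : car X" "y : car X" for x y a using phi(1) that by(auto simp: module_hom_def hom_def)
 have ph0: "phi \<zero>_{X} = \<zero>_{M}" using ph(3)[of "\<zero>_{X}" "\<zero>_{X}" "\<zero>_{?L}"] ph(1)[of "\<zero>_{X}" "\<zero>_{X}"] by(simp add: X.smult_l_null smult_l_null)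
 define Ker where "Ker = {x : car X. phi x = \<zero>_{M}}"
 have ker: "a_kernel X M phi = Ker" by(auto simp: Ker_def a_kernel_def kernel_def)
 have kK: "X.ops.ksub Ker" by(rule X.ops.ksubI) (use ph ph0 in "auto simp: Ker_def")
 have fK: "X.ops.fsub Ker" by(rule X.ops.fsubI[OF kK]) (use ph in "auto simp: Ker_def")
 note KD = X.ops.ksubD[OF kK]
 obtain S where S: "finite S" "S <= Ker" "submodule_generated ?L (X(|carrier := Ker|)) S = Ker"
  using fg unfolding finitely_generated_def ker by auto
 have KerS: "Ker <= N" if N: "X.ops.fsub N" "S <= N" for N
 proof -
  have "X.ops.fsub (N Int Ker)" using X.ops.fsub_Int[OF N(1) fK] .
  hence "submodule (N Int Ker) ?L (X(|carrier := Ker|))"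
   using X.submodule_of_submodule[OF fK[folded X.submodule_iff_fsub]] X.submodule_iff_fsub by auto
  hence "submodule_generated ?L (X(|carrier := Ker|)) S <= N Int Ker"
   using N S(2) unfolding submodule_generated_def by blast
  thus ?thesis using S(3) by simp
 qed
 \<comment> \<open>Relations of bounded length generate all relations when the bound may vary. The
   finitely many generators of the kernel fit under one bound, which is enlarged by one to have the
   form D + 1.\<close>
 obtain D where D: "Ker <= X.ops.fspan (Ker Int F (Suc D))"
 proof -
  let ?G = "%d. X.ops.fspan (Ker Int F d)"
  have Gs: "X.ops.fsub (?G d)" for d by(rule X.ops.fsub_fspan) (use KD(1) in blast)
  have Gm: "?G m <= ?G n" if "m <= n" for m n
   by(rule X.ops.fspan_minimal[OF Gs]) (use F.F_mono[OF that] X.ops.fspan_superset[of "Ker Int F n"] in blast)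
  have g: "X.ops.fsub (\<Union>d. ?G d)" using Gs Gm by(rule X.ops.fsub_chain_union)
  have "Ker <= (\<Union>d. ?G d)"
  proof (rule X.ops.ghost_descent[OF F.F_union_gsub order_trans[OF KD(1) F.F_union_generates] KD(1)])
   show "X.vtM v x : Ker" if "v : verts E" "x : Ker" for v x using X.ops.fsubD[OF fK] that by blast
   show "X.ghM v x : Ker" if "v : arcs E" "x : Ker" for v x using X.ops.fsubD[OF fK] that by blast
   show "subgroup (\<Union>d. ?G d) (add_monoid X)" using X.ops.fsub_ksub[OF g] by(simp add: X.ops.ksub_def)
   show "X.arM e x : (\<Union>d. ?G d)" if "e : arcs E" "x : (\<Union>d. ?G d)" for e x
    by(rule X.ops.fsubD(2)[OF g that(2,1)])
   show "Ker Int (\<Union>d. F d) <= (\<Union>d. ?G d)"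
    unfolding Int_UN_distrib by(rule UN_mono[OF order_refl X.ops.fspan_superset])
  qed
  hence "S <= (\<Union>d. ?G d)" using S(2) by blast
  then obtain m where "S <= ?G m" using finite_subset_chain[OF S(1), of ?G] Gm by blast
  hence "S <= ?G (Suc m)" using Gm[of m "Suc m"] by auto
  thus ?thesis using KerS[OF Gs] that[of m] by blast
 qed
 let ?U = "Ker Int F (Suc D)"
 have kU: "X.ops.ksub ?U" using kK F.F_ksub X.ops.ksub_Int by blast
 show ?thesis
 proof (cases "F (Suc D) <= X.ops.ksum (F D) ?U")
  case True
  let ?A = "phi ` F D"
  have FX: "F d <= car X" for d using X.ops.ksubD(1)[OF F.F_ksub] .
  have fdA: "ops.fd ?A"
   by(rule fd_image[OF X.ops.kspace_axioms ops.kspace_axioms]) (use ph F.F_fd in auto)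
  \<comment> \<open>A ghost arrow leads from \<open>F D\<close> into \<open>F (Suc D)\<close>, and
    by the case assumption back into \<open>F D\<close> up to a relation, which \<open>phi\<close>
    does not see.\<close>
  have gA: "ops.gsub ?A" unfolding ops.gsub_def
  proof (intro conjI ballI)
   show "ops.ksub ?A" using fdA ops.fd_ksub by blast
   show "vtM v x : ?A" if that: "v : verts E" and x: "x : ?A" for v x
   proof -
    obtain y where y: "y : F D" "x = phi y" using x by blast
    have "y : car X" using y(1) FX by blast
    hence "phi (X.vtM v y) = vtM v x" using ph(3)[of y y] that y(2) by simp
    thus ?thesis using F.F_vt[OF that y(1)] by(metis imageI)
   qed
   show "ghM e x : ?A" if that: "e : arcs E" and x: "x : ?A" for e x
   proof -
    obtain y where y: "y : F D" "x = phi y" using x by blast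
    have "y : car X" using y(1) FX by blast
    hence h: "phi (X.ghM e y) = ghM e x" using ph(3)[of y y] that y(2) by simp
    have "X.ghM e y : X.ops.ksum (F D) ?U" using F.F_gh[OF that y(1)] True by blast
    then obtain a b where ab: "X.ghM e y = a \<oplus>_{X} b" "a : F D" "b : ?U" unfolding X.ops.ksum_def by blast
    have abc: "a : car X" "b : car X" using ab FX by blast+
    hence "phi (a \<oplus>_{X} b) = phi a" using ph(2)[of a b] ph(1)[of a a] ab(3) by(simp add: Ker_def)
    thus ?thesis using h ab by(metis imageI)
   qed
  qed
  have AM: "?A <= car M" using ops.ksubD(1)[OF ops.gsub_ksub[OF gA]] .
  have "car M <= ops.fspan ?A"
  proof -
   note sp = ops.fsub_fspan[OF AM]
   note spD = ops.ksubD[OF ops.fsub_ksub[OF sp]]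
   let ?P = "{x : car X. phi x : ops.fspan ?A}"
   have "X.ops.ksub ?P" by(rule X.ops.ksubI) (use ph ph0 spD in auto)
   hence "X.ops.fsub ?P" by(rule X.ops.fsubI) (use ph(3) ops.fsubD[OF sp] in auto)
   moreover have "F 0 <= ?P" using FX[of 0] F.F_mono[of 0 D] ops.fspan_superset[of ?A] by auto
   ultimately have "car X <= ?P" using order_trans[OF F.F_generates X.ops.fspan_minimal] by blast
   thus ?thesis unfolding phi(2)[symmetric] by blast
  qed
  hence "ops.rspan ?A = car M" by(rule ops.rspan_eq_carrier_if_fspan[OF gA])
  thus ?thesis using fdA gA unfolding ops.lattice_def by blast
 next
  case False
  then obtain x where x: "x : F (Suc D)" "x ~: X.ops.ksum (F D) ?U" by blast
  have kS: "X.ops.ksub (X.ops.ksum (F D) ?U)" using X.ops.ksub_ksum[OF F.F_ksub kU] .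
  have xc: "x : car X" using x(1) X.ops.ksubD(1)[OF F.F_ksub] by blast
  \<comment> \<open>x is the sum of its vertex components and the reducible elements form a
    subspace, so some component is irreducible. Passing to it provides the vertex that fixes
    u.\<close>
  have "EX v:verts E. X.vtM v x ~: X.ops.ksum (F D) ?U"
  proof (rule ccontr)
   assume "~ ?thesis"
   hence "(\<Oplus>_{X}v\<in>verts E. X.vtM v x) : X.ops.ksum (F D) ?U"
    using kS unfolding X.ops.ksub_def by(intro X.M.sub_finsum) auto
   thus False using X.ops.vt_sum[OF xc] x(2) by simp
  qed
  then obtain v where v: "v : verts E" "X.vtM v x ~: X.ops.ksum (F D) ?U" by blast
  define u where "u = X.vtM v x"
  have u: "u : F (Suc D)" "u ~: X.ops.ksum (F D) ?U" "X.vtM v u = u" "u : car X"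
   using F.F_vt[OF v(1) x(1)] v xc X.ops.vt_vt[OF v(1) v(1) xc] by(auto simp: u_def)
  let ?p = "lg (Vtx v) :: ('v,'e,'k) leavitt_elem"
  have p: "?p : car ?L" "?p \<otimes>_{?L} ?p = ?p" using v(1) leavitt_relation_simps(1)[OF v(1) v(1), where 'k = 'k] by auto
  have w: "phi u : car M" "?p \<odot>_{M} phi u = phi u" using ph(1)[OF u(4) u(4)] ph(3)[OF u(4) u(4) p(1)] u(3) by auto
  have inj: "y = \<zero>_{?L}" if y: "y : car ?L" "y \<otimes>_{?L} ?p = y" "y \<odot>_{M} phi u = \<zero>_{M}" for y
   by(rule X.leading_term_free[OF F fK D u(1,2) v(1) u(3) y(1,2)])
    (use y u(4) ph(3)[OF u(4) u(4) y(1)] X.smult_closed in "simp add: Ker_def")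
  \<comment> \<open>The submodule generated by the image of u is projective, hence zero by
    assumption. Then p kills this image although p = p p, so \<open>inj\<close> gives p = 0, which
    is false.\<close>
  note cp = cyclic_projective[OF left_module_axioms w(1) p w(2) inj]
  have "{y \<odot>_{M} phi u | y. y : car ?L} = {\<zero>_{M}}" using np[OF cp] .
  hence "?p \<odot>_{M} phi u = \<zero>_{M}" using p(1) by blast
  thus ?thesis using inj[OF p] lgen_vtx_nonzero[OF v(1), where 'k = 'k] by blast
 qed
qed

end

section \<open>From a lattice to finite length and finite presentation\<close>

lemma a_kernel_eq: "a_kernel M N f = {x : car M. f x = \<zero>_{N}}"
 by(simp add: a_kernel_def kernel_def)

lemma module_homI: assumes "!!x. x : car X ==> phi x : car M"
  "!!x y. x : car X ==> y : car X ==> phi (x \<oplus>_{X} y) = phi x \<oplus>_{M} phi y"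
  "!!a x. a : car R ==> x : car X ==> phi (a \<odot>_{X} x) = a \<odot>_{M} phi x"
 shows "phi : module_hom R X M" using assms by(auto simp: module_hom_def hom_def)

lemma module_homD: assumes "left_module R X" "left_module R M" "phi : module_hom R X M"
 shows "x : car X ==> phi x : car M"
  "x : car X ==> y : car X ==> phi (x \<oplus>_{X} y) = phi x \<oplus>_{M} phi y"
  "a : car R ==> x : car X ==> phi (a \<odot>_{X} x) = a \<odot>_{M} phi x"
  "phi \<zero>_{X} = \<zero>_{M}"
  "submodule (a_kernel X M phi) R X"
proof -
 interpret X: left_module R X by fact
 interpret M: left_module R M by fact
 show 1: "x : car X ==> phi x : car M" for x using assms(3) by(auto simp: module_hom_def hom_def)
 show 2: "x : car X ==> y : car X ==> phi (x \<oplus>_{X} y) = phi x \<oplus>_{M} phi y" for x y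
  using assms(3) by(auto simp: module_hom_def hom_def)
 show 3: "a : car R ==> x : car X ==> phi (a \<odot>_{X} x) = a \<odot>_{M} phi x" for a x
  using assms(3) by(auto simp: module_hom_def)
 show 4: "phi \<zero>_{X} = \<zero>_{M}"
  using 3[of "\<zero>_{R}" "\<zero>_{X}"] 1[of "\<zero>_{X}"] by(simp add: X.smult_l_null M.smult_l_null)
 have "phi (\<ominus>_{X} x) = \<zero>_{M}" if "x : car X" "phi x = \<zero>_{M}" for x
  using 2[of x "\<ominus>_{X} x"] that 1[of "\<ominus>_{X} x"] 4 by(simp add: X.M.r_neg)
 thus "submodule (a_kernel X M phi) R X" unfolding submodule_iff a_kernel_eq using 1 2 3 4
  by(intro conjI X.M.subgrpI) (auto simp: M.smult_r_null X.smult_closed)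
qed

context lpa_module
begin

lemma finite_length_if_lattice: assumes "ops.lattice A" shows "finite_length (LA) M"
 unfolding finite_length_def using ops.composition_series[OF assms ops.fsub_carrier] by(simp only: submodule_iff_fsub)

lemma ghost_embed_smult_gsub: assumes "ops.gsub A" "a : A" "c : Cf d" shows "c \<odot>_{M} a : A"
proof -
 interpret I: fin_digraph Gi by(rule inverse_fin)
 let ?P = "PG :: ('v,'e,'k) path_elem ring"
 have "submodule A ?P (restrict_scalars gemb M)"
  using assms(1) by(subst submodule_iff_gsub) simp_all
 moreover obtain x where "c = gemb x" "x : car ?P"
  using assms(3) I.paths_le_subset(1)[of d] by(auto simp: Cf_def I.PA_simps)
 ultimately show ?thesis using assms(2) by(simp add: submodule_iff)
qed

text \<open>Take one basis element for each vector of a spanning set of A, so that the elements of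
  ghost length 0 map onto A. As A is ghost-stable, a ghost arrow applied to such an element agrees
  with another such element up to a relation of length at most 1. These relations form a
  finite-dimensional space, and they generate all relations.\<close>

lemma finitely_presented_if_lattice: assumes A: "ops.lattice A" shows "finitely_presented (LA) M"
proof -
 let ?L = "LA :: ('v,'e,'k) leavitt_ring"
 obtain S where S: "finite S" "S <= car M" "A = ops.kspan S"
  using A unfolding ops.lattice_def ops.fd_def by blast
 obtain s and n :: nat where s: "S = s ` {..<n}"
  using finite_imp_nat_seg_image_inj_on[OF S(1)] lessThan_def by metis
 have sc: "s i : car M" if "i < n" for i using s S(2) that by auto
 let ?X = "free_module ?L {..<n}"
 interpret X: lpa_module E ?X by(rule lpa_module_free)
 interpret F: ghost_filtration ?X X.scM E X.vtM X.arM X.ghM "TF {..<n}"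
  by(rule ghost_filtration_free) simp
 have xc: "x i : car ?L" if "x : car ?X" for x i
  using that by(cases "i < n") (auto simp: free_simps)
 define phi where "phi x = (\<Oplus>_{M}i\<in>{..<n}. x i \<odot>_{M} s i)" for x
 have tc: "x i \<odot>_{M} s i : car M" if "x : car ?X" "i < n" for x i
  using xc[OF that(1)] sc[OF that(2)] smult_closed by blast
 have phi: "phi : module_hom ?L ?X M"
 proof (rule module_homI)
  show "phi x : car M" if "x : car ?X" for x
   unfolding phi_def using tc[OF that] by(intro M.finsum_closed) auto
  show "phi (x \<oplus>_{?X} y) = phi x \<oplus>_{M} phi y" if "x : car ?X" "y : car ?X" for x y
  proof -
   have "phi (x \<oplus>_{?X} y) = (\<Oplus>_{M}i\<in>{..<n}. x i \<odot>_{M} s i \<oplus>_{M} y i \<odot>_{M} s i)"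
    unfolding phi_def by(rule M.add.finprod_cong')
     (use tc that xc sc smult_l_distr in "auto simp: free_simps(3)")
   also have "... = phi x \<oplus>_{M} phi y"
    unfolding phi_def by(rule M.finsum_addf) (use tc that in auto)
   finally show ?thesis .
  qed
  show "phi (a \<odot>_{?X} x) = a \<odot>_{M} phi x" if "a : car ?L" "x : car ?X" for a x
  proof -
   have "a \<odot>_{M} phi x = (\<Oplus>_{M}i\<in>{..<n}. a \<odot>_{M} (x i \<odot>_{M} s i))"
    unfolding phi_def by(rule smult_finsum_r) (use tc that in auto)
   also have "... = phi (a \<odot>_{?X} x)" unfolding phi_def by(rule M.add.finprod_cong')
     (use tc that xc sc smult_assoc smult_closed in "auto simp: free_simps(4)")
   finally show ?thesis by simp
  qed
 qed
 note ph = module_homD[OF X.left_module_axioms left_module_axioms phi]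
 have coord: "coord i \<one>_{?L} : TF {..<n} 0" "phi (coord i \<one>_{?L}) = s i" if i: "i < n" for i
 proof -
  have "semb (1::'k) = \<one>_{?L}" by(simp add: scalar_embed_ring)
  hence o: "\<one>_{?L} : Cf 0" using Cf_facts(5)[of "1::'k"] by simp
  show "coord i \<one>_{?L} : TF {..<n} 0"
   unfolding TF_def using coord_closed[of i "{..<n}" "\<one>_{?L}"] i o Cf_facts(4) by(auto simp: coord_def)
  have "phi (coord i \<one>_{?L}) = (\<Oplus>_{M}j\<in>{..<n}. if i = j then s j else \<zero>_{M})"
   unfolding phi_def by(rule M.add.finprod_cong')
    (use sc in "auto simp: coord_def smult_one smult_l_null")
  also have "... = s i" by(rule M.add.finprod_singleton) (use i sc in auto)
  finally show "phi (coord i \<one>_{?L}) = s i" .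
 qed
 have gA: "ops.gsub A" using A by(simp add: ops.lattice_def)
 have SA: "S <= A" unfolding S(3) by(rule ops.kspan_superset)
 \<comment> \<open>Coordinates of length zero are combinations of vertices, which preserve A;
   conversely the image is a subspace containing the spanning set.\<close>
 have phiF: "phi ` TF {..<n} 0 = A"
 proof
  show "phi ` TF {..<n} 0 <= A"
  proof (intro image_subsetI)
   fix x assume x: "x : (TF {..<n} 0 :: (nat => ('v,'e,'k) leavitt_elem) set)"
   have "subgroup A (add_monoid M)" using ops.gsub_ksub[OF gA] by(simp add: ops.ksub_def)
   thus "phi x : A" unfolding phi_def
    by(rule M.sub_finsum, intro ghost_embed_smult_gsub[OF gA]) (use x SA s in "auto simp: TF_def")
  qed
  have "ops.fd (phi ` TF {..<n} 0)"
   by(rule fd_image[OF X.ops.kspace_axioms ops.kspace_axioms]) (use ph F.F_fd in auto)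
  hence "ops.kspan S <= phi ` TF {..<n} 0"
   using coord s by(intro ops.kspan_minimal ops.fd_ksub) (auto, metis imageI)
  thus "A <= phi ` TF {..<n} 0" using S(3) by simp
 qed
 have surj: "phi ` car ?X = car M"
 proof
  have "ops.ksub (phi ` car ?X)"
  proof (rule ops.ksubI)
   show "x \<oplus>_{M} y : phi ` car ?X" if "x : phi ` car ?X" "y : phi ` car ?X" for x y
    using that ph(2)[symmetric] by auto
   show "scM c x : phi ` car ?X" if "x : phi ` car ?X" for c x
    using that ph(3)[symmetric] X.smult_closed by auto
   show "\<zero>_{M} : phi ` car ?X" using image_eqI[of "\<zero>_{M}" phi "\<zero>_{?X}"] ph(4) by simp
  qed (use ph in auto)
  hence "ops.fsub (phi ` car ?X)" by(rule ops.fsubI) (use ph(3)[symmetric] X.smult_closed in auto)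
  moreover have "A <= phi ` car ?X" using phiF X.ops.ksubD(1)[OF F.F_ksub[of 0]] by blast
  ultimately show "car M <= phi ` car ?X"
   using order_trans[OF ops.lattice_generates[OF A] ops.fspan_minimal] by blast
 qed (use ph in auto)
 let ?Ker = "a_kernel ?X M phi"
 have fK: "X.ops.fsub ?Ker" using ph(5) X.submodule_iff_fsub by blast
 note KD = X.ops.ksubD[OF X.ops.fsub_ksub[OF fK]]
 let ?W = "TF {..<n} 1 Int ?Ker"
 have "X.ops.fd ?W"
  by(rule X.ops.dimension_exists(2)[OF F.F_fd[of 1]]) (use X.ops.ksub_Int F.F_ksub X.ops.fsub_ksub[OF fK] in auto)
 then obtain R0 where R0: "finite R0" "R0 <= car ?X" "?W = X.ops.kspan R0" unfolding X.ops.fd_def by blast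
 have R0K: "R0 <= ?Ker" using X.ops.kspan_superset[of R0] R0(3) by blast
 let ?K = "X.ops.fspan R0"
 have K: "X.ops.fsub ?K" by(rule X.ops.fsub_fspan[OF R0(2)])
 have WK: "?W <= ?K" unfolding R0(3) by(rule X.ops.kspan_minimal[OF X.ops.fsub_ksub[OF K] X.ops.fspan_superset])
 have KKer: "?K <= ?Ker" by(rule X.ops.fspan_minimal[OF fK R0K])
 \<comment> \<open>The elements of length zero together with the submodule generated by the short
   relations: ghost-stable, and generating the whole free module, so descent can start from
   it.\<close>
 let ?C = "X.ops.ksum (TF {..<n} 0) ?K"
 note kK = X.ops.fsub_ksub[OF K]
 have kC: "X.ops.ksub ?C" by(rule X.ops.ksub_ksum[OF F.F_ksub kK])
 have BC: "TF {..<n} 0 <= ?C" "?K <= ?C" using X.ops.ksum_left[OF F.F_ksub kK] X.ops.ksum_right[OF F.F_ksub kK] by auto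
 have gC: "X.ops.gsub ?C" unfolding X.ops.gsub_def
 proof (intro conjI ballI kC)
  show "X.vtM v x : ?C" if v: "v : verts E" and x: "x : ?C" for v x
  proof -
   obtain b k where bk: "x = b \<oplus>_{?X} k" "b : TF {..<n} 0" "k : ?K" using x unfolding X.ops.ksum_def by blast
   have "X.vtM v x = X.vtM v b \<oplus>_{?X} X.vtM v k"
    unfolding bk(1) by(rule X.ops.vt_add[OF v X.ops.ksubD(5)[OF F.F_ksub bk(2)] X.ops.ksubD(5)[OF kK bk(3)]])
   thus ?thesis unfolding X.ops.ksum_def using F.F_vt[OF v bk(2)] X.ops.fsubD(1)[OF K bk(3) v] by blast
  qed
  show "X.ghM e x : ?C" if e: "e : arcs E" and x: "x : ?C" for e x
  proof -
   obtain b k where bk: "x = b \<oplus>_{?X} k" "b : TF {..<n} 0" "k : ?K" using x unfolding X.ops.ksum_def by blast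
   have bc: "b : car ?X" by(rule X.ops.ksubD(5)[OF F.F_ksub bk(2)])
   have eq: "X.ghM e x = X.ghM e b \<oplus>_{?X} X.ghM e k"
    unfolding bk(1) by(rule X.ops.gh_add[OF e bc X.ops.ksubD(5)[OF kK bk(3)]])
   \<comment> \<open>The lift b' of the ghost image has length zero, so its difference from
     \<open>X.ghM e b\<close> is a relation of length at most 1.\<close>
   have "ghM e (phi b) : A" by(rule ops.gsubD(2)[OF gA _ e]) (use phiF bk(2) in blast)
   then obtain b' where b': "b' : TF {..<n} 0" "phi b' = ghM e (phi b)" unfolding phiF[symmetric] by force
   have b'c: "b' : car ?X" by(rule X.ops.ksubD(5)[OF F.F_ksub b'(1)])
   have gc: "X.ghM e b : car ?X" using e bc by simp
   have b1: "b' : TF {..<n} 1" using b'(1) F.F_Suc[of 0] by auto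
   have g1: "X.ghM e b : TF {..<n} 1" using F.F_gh[OF e bk(2)] by simp
   let ?d = "X.ghM e b \<ominus>_{?X} b'"
   have dd: "X.ghM e b = ?d \<oplus>_{?X} b'" using gc b'c by(simp add: X.M.minus_eq X.M.a_assoc X.M.l_neg)
   have dc: "?d : car ?X" using gc b'c by simp
   have "phi (X.ghM e b) = phi ?d \<oplus>_{M} phi b'" using ph(2)[OF dc b'c] dd by simp
   moreover have "phi (X.ghM e b) = phi b'" using ph(3)[OF _ bc] e b'(2) by simp
   ultimately have "phi ?d = \<zero>_{M}" using ph(1)[OF dc] ph(1)[OF b'c] by(metis M.add.l_cancel_one' M.a_comm)
   hence "?d : ?W" using X.ops.ksubD(7)[OF F.F_ksub g1 b1] dc by(simp add: a_kernel_eq)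
   hence "?d : ?C" using WK BC by blast
   hence "X.ghM e b : ?C" using X.ops.ksubD(3)[OF kC, of ?d b'] b'(1) BC dd by auto
   thus ?thesis unfolding eq using X.ops.ksubD(3)[OF kC] X.ops.fsubD(3)[OF K bk(3) e] BC by blast
  qed
 qed
 \<comment> \<open>A relation inside \<open>?C\<close> differs by an element of \<open>?K\<close>
   from a relation of length zero, and the latter lies in \<open>?W\<close>.\<close>
 have KerK: "?Ker <= ?K"
 proof (rule X.ops.ghost_descent[OF gC])
  have "TF {..<n} 0 <= X.ops.fspan ?C" using BC X.ops.fspan_superset by blast
  hence "X.ops.fspan (TF {..<n} 0) <= X.ops.fspan ?C"
   by(rule X.ops.fspan_minimal[OF X.ops.fsub_fspan[OF X.ops.ksubD(1)[OF kC]]])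
  thus "?Ker <= X.ops.fspan ?C" using KD(1) F.F_generates by blast
  show "?Ker <= car ?X" by(rule KD(1))
  show "X.vtM v x : ?Ker" if "v : verts E" "x : ?Ker" for v x by(rule X.ops.fsubD(1)[OF fK that(2,1)])
  show "X.ghM v x : ?Ker" if "v : arcs E" "x : ?Ker" for v x by(rule X.ops.fsubD(3)[OF fK that(2,1)])
  show "subgroup ?K (add_monoid ?X)" using kK by(simp add: X.ops.ksub_def)
  show "X.arM v x : ?K" if "v : arcs E" "x : ?K" for v x by(rule X.ops.fsubD(2)[OF K that(2,1)])
  show "?Ker Int ?C <= ?K"
  proof
   fix x assume x: "x : ?Ker Int ?C"
   then obtain b k where bk: "x = b \<oplus>_{?X} k" "b : TF {..<n} 0" "k : ?K" unfolding X.ops.ksum_def by blast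
   have bc: "b : car ?X" by(rule X.ops.ksubD(5)[OF F.F_ksub bk(2)])
   have kc: "k : car ?X" by(rule X.ops.ksubD(5)[OF kK bk(3)])
   have "k \<oplus>_{?X} b : ?Ker" using x bk(1) X.M.a_comm[OF bc kc] by simp
   hence "b : ?Ker"
    using X.M.subgroup_cancel[of ?Ker k b] X.ops.fsub_ksub[OF fK] KKer bk(3) bc by(auto simp: X.ops.ksub_def)
   hence "b : ?K" using WK bk(2) F.F_Suc[of 0] by auto
   thus "x : ?K" unfolding bk(1) using X.ops.ksubD(3)[OF kK _ bk(3)] by blast
  qed
 qed
 have "finitely_generated ?L (?X(|carrier := ?Ker|))" unfolding finitely_generated_def
 proof (intro exI conjI)
  show "finite R0" by(rule R0)
  show "R0 <= car (?X(|carrier := ?Ker|))" using R0K by simp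
  have sub: "submodule N ?L (?X(|carrier := ?Ker|)) <-> X.ops.fsub N & N <= ?Ker" for N
   using X.submodule_of_submodule[OF ph(5)] X.submodule_iff_fsub by simp
  have "?Ker <= N" if "X.ops.fsub N" "R0 <= N" for N using KerK X.ops.fspan_minimal[OF that] by blast
  thus "submodule_generated ?L (?X(|carrier := ?Ker|)) R0 = car (?X(|carrier := ?Ker|))"
   unfolding submodule_generated_def sub using fK R0K by auto
 qed
 thus ?thesis unfolding finitely_presented_def using phi surj by blast
qed

lemma finitely_presented_no_projective_iff:
 "(finitely_presented (LA) M & finite_length (LA) M
   & (ALL N. submodule N (LA) M & projective (LA) (M(|carrier := N|)) --> N = {\<zero>_{M}}))
  <-> sink_free & (EX A. ops.lattice A)"
proof (intro iffI conjI)
 let ?L = "LA :: ('v,'e,'k) leavitt_ring"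
 assume h: "finitely_presented ?L M & finite_length ?L M
   & (ALL N. submodule N ?L M & projective ?L (M(|carrier := N|)) --> N = {\<zero>_{M}})"
 hence np: "N = {\<zero>_{M}}" if "submodule N ?L M" "projective ?L (M(|carrier := N|))" for N using that by blast
 thus sink_free by(rule sink_free_if_no_projective)
 obtain n phi where f: "phi : module_hom ?L (free_module ?L {..<n::nat}) M"
  "phi ` car (free_module ?L {..<n}) = car M"
  "finitely_generated ?L ((free_module ?L {..<n})(|carrier := a_kernel (free_module ?L {..<n}) M phi|))"
  using h unfolding finitely_presented_def by blast
 show "EX A. ops.lattice A"
  by(rule lattice_if_no_projective[OF np lpa_module_free ghost_filtration_free f]) auto
next
 assume "sink_free & (EX A. ops.lattice A)"
 then obtain A where sf: sink_free and A: "ops.lattice A" by blast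
 show "finitely_presented (LA) M" using A by(rule finitely_presented_if_lattice)
 show "finite_length (LA) M" using A by(rule finite_length_if_lattice)
 show "ALL N. submodule N (LA) M & projective (LA) (M(|carrier := N|)) --> N = {\<zero>_{M}}"
  using no_projective_submodule[OF A sf] by blast
qed

end

section \<open>Tensor products\<close>

lemma op_ring_simps [simp]:
 "car (op_ring R) = car R" "x \<oplus>_{op_ring R} y = x \<oplus>_{R} y" "\<zero>_{op_ring R} = \<zero>_{R}"
 "\<one>_{op_ring R} = \<one>_{R}" "x \<otimes>_{op_ring R} y = y \<otimes>_{R} x"
 by(simp_all add: op_ring_def)

lemma ring_op_ring:
 fixes R (structure) assumes "ring R" shows "ring (op_ring R)"
proof -
 interpret ring R by fact
 show ?thesis
 proof (rule ringI)
  show "abelian_group (op_ring R)"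
   by(rule abelian_groupI) (auto simp: a_ac intro: bexI[of _ "\<ominus> x" for x] l_neg)
  show "monoid (op_ring R)" by(rule monoidI) (auto simp: m_assoc)
 qed (auto simp: l_distr r_distr)
qed

locale tensor_product = Y: left_module "op_ring R" Y + M: left_module R M
 for R :: "('r,'a) ring_scheme" and Y :: "('r,'x) module" and M :: "('r,'m) module"
begin

abbreviation FG :: "(('x \<times> 'm) \<Rightarrow>\<^sub>0 int) monoid" where "FG == free_Abelian_group (car Y \<times> car M)"
abbreviation T :: "('x,'m) tensor_elem monoid" where "T == tensor R Y M"
abbreviation pt :: "'x => 'm => ('x,'m) tensor_elem" where "pt == pure_tensor R Y M"
abbreviation cls :: "(('x \<times> 'm) \<Rightarrow>\<^sub>0 int) => ('x,'m) tensor_elem" where "cls c == tensor_null R Y M #>_{FG} c"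

sublocale FG: comm_group FG by(rule abelian_free_Abelian_group)

lemma relations_closed: "tensor_relations R Y M <= car FG"
proof -
 have d: "a - b : car FG" if "a : car FG" "b : car FG" for a b using that keys_diff[of a b] by auto
 have f: "frag_of (x, m) : car FG" if "x : car Y" "m : car M" for x m using that by simp
 show ?thesis
  unfolding tensor_relations_def using Y.smult_closed M.smult_closed Y.M.a_closed M.M.a_closed
  by(auto simp del: carrier_free_Abelian_group_iff intro!: d f)
qed

lemma null_subgroup: "subgroup (tensor_null R Y M) FG"
 unfolding tensor_null_def using relations_closed by(rule FG.generate_is_subgroup)

lemma null_normal: "tensor_null R Y M \<lhd> FG"
 using null_subgroup by(simp add: FG.normal_iff_subgroup)

sublocale T: comm_group T unfolding tensor_def by(rule FG.abelian_FactGroup[OF null_subgroup])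

lemma cls_hom: "cls : hom FG T" unfolding tensor_def by(rule normal.r_coset_hom_Mod[OF null_normal])

lemma cls_closed [simp]: "keys c <= car Y \<times> car M ==> cls c : car T"
 using cls_hom by(auto simp: hom_def)

lemma cls_add: "keys c <= car Y \<times> car M ==> keys d <= car Y \<times> car M
  ==> cls (c + d) = cls c \<otimes>_{T} cls d" using cls_hom by(auto simp: hom_def)

lemma cls_null: "c : tensor_null R Y M ==> cls c = \<one>_{T}"
 by(simp add: tensor_def subgroup.rcos_const[OF null_subgroup FG.is_group])

lemma pt_closed [simp]: "x : car Y ==> m : car M ==> pt x m : car T" by(simp add: pure_tensor_def)

lemma relationI:
 "x : car Y ==> x' : car Y ==> m : car M
  ==> frag_of (x \<oplus>_{Y} x', m) - (frag_of (x, m) + frag_of (x', m)) : tensor_relations R Y M"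
 "x : car Y ==> m : car M ==> m' : car M
  ==> frag_of (x, m \<oplus>_{M} m') - (frag_of (x, m) + frag_of (x, m')) : tensor_relations R Y M"
 "a : car R ==> x : car Y ==> m : car M
  ==> frag_of (a \<odot>_{Y} x, m) - frag_of (x, a \<odot>_{M} m) : tensor_relations R Y M"
 unfolding tensor_relations_def diff_diff_eq by blast+

lemma keys_frag_sum:
 "p : S ==> q : S ==> keys (frag_of p + frag_of q) <= S"
 using keys_add[of "frag_of p" "frag_of q"] by auto

lemma relation_eq: assumes "a - b : tensor_relations R Y M"
  "keys b <= car Y \<times> car M" shows "cls a = cls b"
proof -
 have n: "a - b : tensor_null R Y M" unfolding tensor_null_def by(rule generate.incl[OF assms(1)])
 have k: "keys (a - b) <= car Y \<times> car M" using subsetD[OF relations_closed assms(1)] by simp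
 have "cls a = cls (a - b) \<otimes>_{T} cls b" using cls_add[OF k assms(2)] by simp
 thus ?thesis using cls_null[OF n] assms(2) by simp
qed

lemma pt_add_left: assumes "x : car Y" "x' : car Y" "m : car M"
 shows "pt (x \<oplus>_{Y} x') m = pt x m \<otimes>_{T} pt x' m"
proof -
 have "cls (frag_of (x \<oplus>_{Y} x', m)) = cls (frag_of (x, m) + frag_of (x', m))"
  by(rule relation_eq[OF relationI(1) keys_frag_sum]) (use assms in auto)
 thus ?thesis using assms by(simp add: pure_tensor_def cls_add)
qed

lemma pt_add_right: assumes "x : car Y" "m : car M" "m' : car M"
 shows "pt x (m \<oplus>_{M} m') = pt x m \<otimes>_{T} pt x m'"
proof -
 have "cls (frag_of (x, m \<oplus>_{M} m')) = cls (frag_of (x, m) + frag_of (x, m'))"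
  by(rule relation_eq[OF relationI(2) keys_frag_sum]) (use assms in auto)
 thus ?thesis using assms by(simp add: pure_tensor_def cls_add)
qed

lemma pt_balanced: assumes "a : car R" "x : car Y" "m : car M"
 shows "pt (a \<odot>_{Y} x) m = pt x (a \<odot>_{M} m)" unfolding pure_tensor_def
 by(rule relation_eq[OF relationI(3)]) (use assms M.smult_closed in auto)

lemma pt_zero [simp]:
 "m : car M ==> pt \<zero>_{Y} m = \<one>_{T}" "x : car Y ==> pt x \<zero>_{M} = \<one>_{T}"
 using pt_add_left[of "\<zero>_{Y}" "\<zero>_{Y}" m] pt_add_right[of x "\<zero>_{M}" "\<zero>_{M}"]
  T.l_cancel_one'[of "pt \<zero>_{Y} m" "pt \<zero>_{Y} m"] T.l_cancel_one'[of "pt x \<zero>_{M}" "pt x \<zero>_{M}"] by simp_all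

lemma carrier_T: "car T = cls ` car FG" by(simp add: tensor_def carrier_FactGroup)

lemma tensor_subgroup_eq:
 assumes H: "subgroup H T" and pt: "!!x m. x : car Y ==> m : car M ==> pt x m : H" shows "H = car T"
proof
 show "car T <= H"
 proof
  fix t assume "t : car T"
  then obtain c where c: "t = cls c" "keys c <= car Y \<times> car M" by(auto simp: carrier_T)
  have "keys c <= car Y \<times> car M & cls c : H" using c(2)
  proof (induction c rule: frag_induction)
   case zero
   thus ?case using cls_null[of 0] subgroup.one_closed[OF null_subgroup] subgroup.one_closed[OF H] by simp
  next
   case (one p)
   thus ?case using pt by(auto simp: pure_tensor_def)
  next
   case (diff a b)
   have k: "keys (a - b) <= car Y \<times> car M" using diff keys_diff[of a b] by blast
   have "cls a = cls (a - b) \<otimes>_{T} cls b" using cls_add[OF k, of b] diff by simp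
   hence "cls (a - b) = cls a \<otimes>_{T} inv _{T} cls b" using k diff by(simp add: T.m_assoc)
   thus ?case using k diff subgroup.m_closed[OF H] subgroup.m_inv_closed[OF H] by simp
  qed
  thus "t : H" using c by simp
 qed
qed (rule subgroup.subset[OF H])

lemma hom_eq_on_pure: assumes "group G" "f : hom T G" "g : hom T G"
  and "!!x m. x : car Y ==> m : car M ==> f (pt x m) = g (pt x m)" and t: "t : car T"
 shows "f t = g t"
proof -
 interpret f: group_hom T G f using assms by(simp add: group_hom_def group_hom_axioms_def)
 interpret g: group_hom T G g using assms by(simp add: group_hom_def group_hom_axioms_def)
 have "subgroup {t : car T. f t = g t} T" by(rule T.subgroupI) auto
 hence "{t : car T. f t = g t} = car T" by(rule tensor_subgroup_eq) (use assms(4) in auto)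
 thus ?thesis using t by blast
qed

text \<open>The extension to the free abelian group sends the tensor relations to the identity,
  hence is constant on cosets; this gives the singleton image that \<open>the_elem\<close> in the
  definition asks for.\<close>

lemma tensor_lift:
 fixes G :: "('g,'c) monoid_scheme"
 assumes "comm_group G" and b: "!!x m. x : car Y ==> m : car M ==> b x m : car G"
  and bl: "!!x x' m. x : car Y ==> x' : car Y ==> m : car M ==> b (x \<oplus>_{Y} x') m = b x m \<otimes>_{G} b x' m"
  and br: "!!x m m'. x : car Y ==> m : car M ==> m' : car M ==> b x (m \<oplus>_{M} m') = b x m \<otimes>_{G} b x m'"
  and bb: "!!a x m. a : car R ==> x : car Y ==> m : car M ==> b (a \<odot>_{Y} x) m = b x (a \<odot>_{M} m)"
 shows "tensor_lift G b : hom T G"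
  "x : car Y ==> m : car M ==> tensor_lift G b (pt x m) = b x m"
proof -
 interpret G: comm_group G by fact
 define h :: "(('x \<times> 'm) \<Rightarrow>\<^sub>0 int) => 'g" where "h c = finprod G (%p. b (fst p) (snd p) [^]_{G} lookup c p) (keys c)" for c
 have bp: "b (fst p) (snd p) : car G" if "p : car Y \<times> car M" for p using b that by auto
 have hK: "h c = finprod G (%p. b (fst p) (snd p) [^]_{G} lookup c p) K"
  if "finite K" "keys c <= K" "K <= car Y \<times> car M" for c K
  unfolding h_def by(rule G.finprod_mono_neutral_cong_left)
   (use that bp in "auto simp: in_keys_iff subset_iff")
 have hc: "h c : car G" if "keys c <= car Y \<times> car M" for c
  unfolding h_def by(rule G.finprod_closed) (use that bp in blast)
 have hh: "h (c + d) = h c \<otimes>_{G} h d"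
  if cd: "keys c <= car Y \<times> car M" "keys d <= car Y \<times> car M" for c d
 proof -
  let ?K = "keys c Un keys d"
  have K: "finite ?K" "?K <= car Y \<times> car M" using cd by auto
  have "h (c + d) = finprod G (%p. b (fst p) (snd p) [^]_{G} lookup (c + d) p) ?K"
   by(rule hK[OF K(1) keys_add K(2)])
  also have "... = finprod G (%p. b (fst p) (snd p) [^]_{G} lookup c p
    \<otimes>_{G} b (fst p) (snd p) [^]_{G} lookup d p) ?K"
   by(rule G.finprod_cong') (use K(2) bp in "auto simp: lookup_add G.int_pow_mult")
  also have "... = h c \<otimes>_{G} h d"
   unfolding hK[OF K(1) Un_upper1 K(2)] hK[OF K(1) Un_upper2 K(2)]
   by(rule G.finprod_multf) (use K(2) bp in blast)+
  finally show ?thesis .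
 qed
 have hhom: "h : hom FG G" using hc hh by(auto simp: hom_def)
 interpret h: group_hom FG G h using hhom by(simp add: group_hom_def group_hom_axioms_def)
 have hd: "h (c - d) = \<one>_{G}" if "h c = h d" "keys c <= car Y \<times> car M"
  "keys d <= car Y \<times> car M" for c d
 proof -
  have k: "keys (c - d) <= car Y \<times> car M" using that keys_diff[of c d] by blast
  have "h (c - d) \<otimes>_{G} h d = h d" using hh[OF k that(3)] that(1) by simp
  thus ?thesis using hc[OF k] hc[OF that(3)] G.l_cancel_one by simp
 qed
 have hf: "h (frag_of (x, m)) = b x m" if "x : car Y" "m : car M" for x m
  using b[OF that] by(simp add: h_def G.int_pow_1)
 have "h c = \<one>_{G}" if "c : tensor_relations R Y M" for c
  using that unfolding tensor_relations_def diff_diff_eq by(elim UnE CollectE exE conjE; simp only:)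
   (rule hd; use keys_frag_sum[of _ "car Y \<times> car M"] hh hf bl br bb Y.smult_closed M.smult_closed in simp)+
 hence "tensor_relations R Y M <= kernel FG G h" unfolding kernel_def using relations_closed by blast
 hence null: "tensor_null R Y M <= kernel FG G h"
  unfolding tensor_null_def by(rule FG.generate_subgroup_incl[OF _ h.subgroup_kernel])
 have lift: "tensor_lift G b (cls c) = h c" if c: "keys c <= car Y \<times> car M" for c
 proof -
  have "h ` cls c = {h c}"
  proof
   show "h ` cls c <= {h c}" using null c hc by(auto simp: r_coset_def kernel_def hh)
   show "{h c} <= h ` cls c" using FG.rcos_self[OF _ null_subgroup, of c] c by(simp add: imageI)
  qed
  thus ?thesis unfolding tensor_lift_def h_def by simp
 qed
 show "tensor_lift G b : hom T G"
 proof (rule homI)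
  fix s t assume "s : car T" "t : car T"
  then obtain c d where cd: "s = cls c" "t = cls d" "keys c <= car Y \<times> car M" "keys d <= car Y \<times> car M"
   by(auto simp: carrier_T)
  show "tensor_lift G b s : car G" using cd lift hc by simp
  have "keys (c + d) <= car Y \<times> car M" using cd keys_add[of c d] by blast
  thus "tensor_lift G b (s \<otimes>_{T} t) = tensor_lift G b s \<otimes>_{G} tensor_lift G b t"
   using cd lift hh by(simp flip: cls_add)
 qed
 show "x : car Y ==> m : car M ==> tensor_lift G b (pt x m) = b x m"
  by(simp add: pure_tensor_def lift hf)
qed

end

section \<open>The natural map from the tensor product of L(E) and A to M\<close>

lemma (in left_module) left_module_submodule: assumes "submodule N R M"
 shows "left_module R (M(|carrier := N|))"
proof -
 have N: "subgroup N (add_monoid M)" "!!a x. a : car R ==> x : N ==> a \<odot>_{M} x : N"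
  using assms by(auto simp: submodule_iff)
 note D = M.subgrpD[OF N(1)]
 have "EX y:N. y \<oplus>_{M} x = \<zero>_{M}" if "x : N" for x using D(4)[OF that] D(5)[OF that] M.l_neg by blast
 hence "abelian_group (M(|carrier := N|))" by(intro abelian_groupI) (use D in "auto simp: M.a_ac")
 thus ?thesis by(intro left_module.intro left_module_axioms.intro R.ring_axioms)
   (use D(5) N(2) in "auto simp: smult_l_distr smult_r_distr smult_assoc smult_one")
qed

lemma (in fin_digraph) leavitt_right_module_simps [simp]:
 "car (leavitt_right_module G) = car (LA :: ('a,'b,'k::field) leavitt_ring)"
 "\<zero>_{leavitt_right_module G} = \<zero>_{LA :: ('a,'b,'k) leavitt_ring}"
 "x \<oplus>_{leavitt_right_module G} y = x \<oplus>_{LA :: ('a,'b,'k) leavitt_ring} y"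
 "a \<odot>_{leavitt_right_module G} x = x \<otimes>_{LA :: ('a,'b,'k) leavitt_ring} gemb a"
 by(simp_all add: leavitt_right_module_def)

lemma (in fin_digraph) left_module_leavitt_right_module:
 "left_module (op_ring PG)
  (leavitt_right_module G :: (('a,'b,'k::field) path_elem, ('a,'b,'k) leavitt_elem) module)"
proof -
 interpret I: fin_digraph Gi by(rule inverse_fin)
 interpret L: ring "LA :: ('a,'b,'k) leavitt_ring" by(rule ring_LA)
 note gE = ghost_embed_hom(1)[where 'k = 'k]
 note gc = ring_hom_closed[OF gE]
 have "abelian_group (leavitt_right_module G :: (('a,'b,'k) path_elem, ('a,'b,'k) leavitt_elem) module)"
  unfolding leavitt_right_module_def by(rule abelian_group_mk_module) (rule L.abelian_group_axioms)
 moreover have "ring (op_ring (PG :: ('a,'b,'k) path_elem ring))"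
  by(rule ring_op_ring) (rule I.ring_PA)
 ultimately show ?thesis by(intro left_module.intro left_module_axioms.intro)
   (use gc ring_hom_add[OF gE] ring_hom_mult[OF gE] ring_hom_one[OF gE] in "auto simp: L.l_distr L.r_distr L.m_assoc")
qed

context lpa_module
begin

text \<open>The natural map is injective for every ghost-stable A. Indeed the tensors 1 (x) a form a
  ghost-stable subspace that generates the tensor product over L(E), and the map is injective on it;
  descent then shows that the kernel is zero. The image is the L(E)-submodule generated by A, so
  only generation is at stake.\<close>

lemma natural_map_iso_iff: assumes gA: "ops.gsub A"
  and MA: "car MA = A" "!!x y. x \<oplus>_{MA} y = x \<oplus>_{M} y" "\<zero>_{MA} = \<zero>_{M}"
   "!!a x. a : car PG ==> x : A ==> a \<odot>_{MA} x = gemb a \<odot>_{M} x"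
  and LMA: "left_module (PG :: ('v,'e,'k) path_elem ring) MA"
 shows "tensor_lift (add_monoid M) (%x a. x \<odot>_{M} a)
   : iso (tensor PG (leavitt_right_module E) MA) (add_monoid M)
  <-> ops.rspan A = car M"
proof -
 let ?L = "LA :: ('v,'e,'k) leavitt_ring"
 let ?P = "PG :: ('v,'e,'k) path_elem ring"
 let ?Y = "leavitt_right_module E :: (('v,'e,'k) path_elem, ('v,'e,'k) leavitt_elem) module"
 interpret I: fin_digraph Gi by(rule inverse_fin)
 interpret T: tensor_product ?P ?Y MA
  by(intro tensor_product.intro left_module_leavitt_right_module LMA)
 note ge = ghost_embed_hom[where 'k = 'k]
 note gc = ring_hom_closed[OF ge(1)]
 have AM: "x : car M" if "x : A" for x using ops.ksubD(5)[OF ops.gsub_ksub[OF gA] that] .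
 define nat where "nat = tensor_lift (add_monoid M) (%x a. x \<odot>_{M} a)"
 have cg: "comm_group (add_monoid M)" by(rule M.a_comm_group)
 have nat: "nat : hom T.T (add_monoid M)" "!!x m. x : car ?L ==> m : A ==> nat (T.pt x m) = x \<odot>_{M} m"
  unfolding nat_def by(rule T.tensor_lift[OF cg];
   use AM gc MA smult_closed in "simp add: smult_l_distr smult_r_distr smult_assoc")+
 \<comment> \<open>Left multiplication on the first tensor factor, the L(E)-module structure of the
   tensor product.\<close>
 define s where "s a = tensor_lift T.T (%x m. T.pt (a \<otimes>_{?L} x) m)" for a
 have sh: "s a : hom T.T T.T" "!!x m. x : car ?L ==> m : A ==> s a (T.pt x m) = T.pt (a \<otimes>_{?L} x) m"
  if a: "a : car ?L" for a
 proof -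
  have *: "T.pt (a \<otimes>_{?L} (x \<oplus>_{?Y} x')) m = T.pt (a \<otimes>_{?L} x) m \<otimes>_{T.T} T.pt (a \<otimes>_{?L} x') m"
   if "x : car ?L" "x' : car ?L" "m : A" for x x' m
   using T.pt_add_left[of "a \<otimes>_{?L} x" "a \<otimes>_{?L} x'" m] a that MA(1) by(simp add: R.r_distr)
  have **: "T.pt (a \<otimes>_{?L} (b \<odot>_{?Y} x)) m = T.pt (a \<otimes>_{?L} x) (b \<odot>_{MA} m)"
   if "x : car ?L" "b : car ?P" "m : A" for x b m
   using T.pt_balanced[of b "a \<otimes>_{?L} x" m] a that MA(1) gc[OF that(2)] by(simp add: R.m_assoc)
  have ***: "T.pt (a \<otimes>_{?L} x) (m \<oplus>_{MA} m') = T.pt (a \<otimes>_{?L} x) m \<otimes>_{T.T} T.pt (a \<otimes>_{?L} x) m'"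
   if "x : car ?L" "m : A" "m' : A" for x m m'
   using T.pt_add_right[of "a \<otimes>_{?L} x" m m'] a that MA(1) by simp
  show "s a : hom T.T T.T" "!!x m. x : car ?L ==> m : A ==> s a (T.pt x m) = T.pt (a \<otimes>_{?L} x) m"
   unfolding s_def by(rule T.tensor_lift[OF T.T.comm_group_axioms];
    use * ** *** a MA(1) in "simp del: leavitt_right_module_simps(3,4)")+
 qed
 define X where "X = mk_module (car T.T) \<one>_{T.T} (%t u. t \<otimes>_{T.T} u) s"
 have X [simp]: "car X = car T.T" "\<zero>_{X} = \<one>_{T.T}" "t \<oplus>_{X} u = t \<otimes>_{T.T} u" "a \<odot>_{X} t = s a t" for t u a
  by(simp_all add: X_def)
 have sc: "s a t : car T.T" if "a : car ?L" "t : car T.T" for a t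
  using sh(1)[OF that(1)] that(2) by(auto simp: hom_def)
 have sm: "s a (t \<otimes>_{T.T} u) = s a t \<otimes>_{T.T} s a u" if "a : car ?L" "t : car T.T" "u : car T.T" for a t u
  using sh(1)[OF that(1)] that(2,3) by(auto simp: hom_def)
 have "left_module ?L X"
 proof (intro left_module.intro left_module_axioms.intro R.ring_axioms)
  show "abelian_group X"
   by(rule abelian_groupI) (auto simp: T.T.m_ac intro: bexI[of _ "inv _{T.T} x" for x])
  show "a \<odot>_{X} t : car X" if "a : car ?L" "t : car X" for a t using sc that by simp
  show "a \<odot>_{X} (t \<oplus>_{X} u) = a \<odot>_{X} t \<oplus>_{X} a \<odot>_{X} u"
   if "a : car ?L" "t : car X" "u : car X" for a t u using sm that by simp
  have eq: "f t = g t" if "f : hom T.T T.T" "g : hom T.T T.T" "t : car T.T"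
   "!!x m. x : car ?L ==> m : A ==> f (T.pt x m) = g (T.pt x m)" for f g t
   by(rule T.hom_eq_on_pure[OF T.T.is_group that(1,2) _ that(3)]) (use that(4) MA(1) in simp)
  show "(a \<oplus>_{?L} b) \<odot>_{X} t = a \<odot>_{X} t \<oplus>_{X} b \<odot>_{X} t" if ab: "a : car ?L" "b : car ?L" "t : car X" for a b t
  proof -
   have "s (a \<oplus>_{?L} b) t = (%t. s a t \<otimes>_{T.T} s b t) t"
   proof (rule eq[of "s (a \<oplus>_{?L} b)" "%t. s a t \<otimes>_{T.T} s b t"])
    show "(%t. s a t \<otimes>_{T.T} s b t) : hom T.T T.T"
     using ab sc sm by(intro homI) (auto simp: T.T.m_ac)
    show "s (a \<oplus>_{?L} b) (T.pt x m) = s a (T.pt x m) \<otimes>_{T.T} s b (T.pt x m)" if "x : car ?L" "m : A" for x m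
     using ab that sh T.pt_add_left[of "a \<otimes>_{?L} x" "b \<otimes>_{?L} x" m] MA(1) by(simp add: R.l_distr)
   qed (use ab sh in auto)
   thus ?thesis by simp
  qed
  show "(a \<otimes>_{?L} b) \<odot>_{X} t = a \<odot>_{X} (b \<odot>_{X} t)" if ab: "a : car ?L" "b : car ?L" "t : car X" for a b t
  proof -
   have "s (a \<otimes>_{?L} b) t = (%t. s a (s b t)) t"
    by(rule eq[of "s (a \<otimes>_{?L} b)" "%t. s a (s b t)"]) (use ab sc sm sh in "auto intro!: homI simp: R.m_assoc")
   thus ?thesis by simp
  qed
  show "\<one>_{?L} \<odot>_{X} t = t" if "t : car X" for t
  proof -
   have "s \<one>_{?L} t = (%t. t) t"
    by(rule eq[of "s \<one>_{?L}" "%t. t"]) (use that sh in "auto intro!: homI")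
   thus ?thesis by simp
  qed
 qed
 then interpret X: lpa_module E X by(intro lpa_module.intro fin_digraph_axioms)
 have nm: "nat : module_hom ?L X M"
 proof (rule module_homI)
  have nc: "nat t : car M" if "t : car T.T" for t using nat(1) that by(auto simp: hom_def)
  have na: "nat (t \<otimes>_{T.T} u) = nat t \<oplus>_{M} nat u" if "t : car T.T" "u : car T.T" for t u
   using nat(1) that by(auto simp: hom_def)
  show "nat t : car M" if "t : car X" for t using nc that by simp
  show "nat (t \<oplus>_{X} u) = nat t \<oplus>_{M} nat u" if "t : car X" "u : car X" for t u using na that by simp
  show "nat (a \<odot>_{X} t) = a \<odot>_{M} nat t" if a: "a : car ?L" and t: "t : car X" for a t
  proof -
   have "(%t. nat (s a t)) t = (%t. a \<odot>_{M} nat t) t"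
   proof (rule T.hom_eq_on_pure[where G = "add_monoid M"])
    show "group (add_monoid M)" by(rule M.a_group)
    show "(%t. nat (s a t)) : hom T.T (add_monoid M)" using a nc na sc sm by(intro homI) auto
    show "(%t. a \<odot>_{M} nat t) : hom T.T (add_monoid M)" using a nc na by(intro homI) (auto simp: smult_r_distr smult_closed)
    show "t : car T.T" using t by simp
    show "nat (s a (T.pt x m)) = a \<odot>_{M} nat (T.pt x m)" if "x : car ?Y" "m : car MA" for x m
     using that a sh nat(2) AM MA(1) by(simp add: smult_assoc)
   qed
   thus ?thesis by simp
  qed
 qed
 note nd = module_homD[OF X.left_module_axioms left_module_axioms nm]
 have pt1: "T.pt \<one>_{?L} m : car T.T" if "m : A" for m using that MA(1) by simp
 let ?C = "T.pt \<one>_{?L} ` A"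
 note AD = ops.ksubD[OF ops.gsub_ksub[OF gA]]
 have gact: "s (gemb a) (T.pt \<one>_{?L} m) : ?C" if a: "a : car ?P" and m: "m : A" for a m
 proof -
  have am: "gemb a \<odot>_{M} m : A" using T.M.smult_closed[of a m] MA a m by auto
  have "s (gemb a) (T.pt \<one>_{?L} m) = T.pt (a \<odot>_{?Y} \<one>_{?L}) m"
   using sh(2)[OF gc[OF a], of "\<one>_{?L}" m] gc[OF a] m by simp
  also have "... = T.pt \<one>_{?L} (gemb a \<odot>_{M} m)"
   using T.pt_balanced[OF a, of "\<one>_{?L}" m] MA a m by simp
  finally show ?thesis using am by simp
 qed
 note pgc = I.path_gens_closed[unfolded inverse_simps]
 have gC: "X.ops.gsub ?C" unfolding X.ops.gsub_def
 proof (intro conjI ballI)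
  show "X.ops.ksub ?C"
  proof (rule X.ops.ksubI)
   show "\<zero>_{X} : ?C" using T.pt_zero(2)[of "\<one>_{?L}"] MA(3) AD(2) by(metis X(2) R.one_closed imageI leavitt_right_module_simps(1))
   show "x \<oplus>_{X} y : ?C" if x: "x : ?C" and y: "y : ?C" for x y
   proof -
    obtain m m' where "m : A" "m' : A" "x = T.pt \<one>_{?L} m" "y = T.pt \<one>_{?L} m'" using x y by blast
    thus ?thesis using T.pt_add_right[of "\<one>_{?L}" m m', symmetric] MA AD(3)[of m m'] by simp
   qed
   show "X.scM c x : ?C" if "x : ?C" for c x using gact[OF pgc(1)[of c]] that ge(2)[of c] by auto
  qed (use pt1 in auto)
  show "X.vtM v x : ?C" if v: "v : verts E" and "x : ?C" for v x using gact[OF pgc(2)[OF v]] that(2) ge(3)[OF v] by auto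
  show "X.ghM v x : ?C" if v: "v : arcs E" and "x : ?C" for v x using gact[OF pgc(3)[OF v]] that(2) ge(4)[OF v] by auto
 qed
 note CD = X.ops.ksubD[OF X.ops.gsub_ksub[OF gC]]
 have genC: "car X <= X.ops.fspan ?C"
 proof -
  define SP where "SP = X.ops.fspan ?C"
  have sub: "submodule SP ?L X" using X.ops.fsub_fspan[OF CD(1)] X.submodule_iff_fsub unfolding SP_def by blast
  have "subgroup H T.T" if "subgroup H (add_monoid X)" for H
   using that by(simp add: subgroup_def m_inv_def)
  hence "subgroup SP T.T" using sub by(simp add: submodule_iff del: X)
  hence "SP = car T.T"
  proof (rule T.tensor_subgroup_eq)
   show "T.pt x m : SP" if "x : car ?Y" "m : car MA" for x m
   proof -
    have "T.pt \<one>_{?L} m : SP" using that MA(1) X.ops.fspan_superset[of ?C] unfolding SP_def by blast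
    hence "s x (T.pt \<one>_{?L} m) : SP" using sub that unfolding submodule_iff by simp
    thus ?thesis using sh(2)[of x "\<one>_{?L}" m] that MA(1) by simp
   qed
  qed
  thus ?thesis by(simp add: SP_def)
 qed
 \<comment> \<open>The kernel is stable under L(E), and a tensor 1 (x) m in it has m = 0; this is
   what descent from \<open>?C\<close> asks for.\<close>
 let ?Ker = "a_kernel X M nat"
 have fK: "X.ops.fsub ?Ker" using nd(5) X.submodule_iff_fsub by blast
 have "?Ker <= {\<zero>_{X}}"
 proof (rule X.ops.ghost_descent[OF gC])
  show "?Ker <= X.ops.fspan ?C" "?Ker <= car X" using genC by(auto simp: a_kernel_eq)
  show "X.vtM v x : ?Ker" if "v : verts E" "x : ?Ker" for v x by(rule X.ops.fsubD(1)[OF fK that(2,1)])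
  show "X.ghM v x : ?Ker" if "v : arcs E" "x : ?Ker" for v x by(rule X.ops.fsubD(3)[OF fK that(2,1)])
  show "subgroup {\<zero>_{X}} (add_monoid X)" by(rule X.M.subgroup_zero)
  show "X.arM v x : {\<zero>_{X}}" if "v : arcs E" "x : {\<zero>_{X}}" for v x
   using that X.ops.ar_zero by(simp del: X)
  show "?Ker Int ?C <= {\<zero>_{X}}"
  proof
   fix t assume t: "t : ?Ker Int ?C"
   then obtain m where m: "m : A" "t = T.pt \<one>_{?L} m" by blast
   have "nat t = m" using nat(2)[of "\<one>_{?L}" m] m AM[OF m(1)] by(simp add: smult_one)
   hence "m = \<zero>_{M}" using t by(simp add: a_kernel_eq)
   thus "t : {\<zero>_{X}}" using m(2) T.pt_zero(2)[of "\<one>_{?L}"] MA(3) by simp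
  qed
 qed
 hence ker: "t = \<one>_{T.T}" if "t : car T.T" "nat t = \<zero>_{M}" for t using that by(auto simp: a_kernel_eq)
 interpret N: group_hom T.T "add_monoid M" nat
  using nat(1) M.a_group T.T.is_group by(simp add: group_hom_def group_hom_axioms_def)
 have inj: "inj_on nat (car T.T)" by(rule N.inj_on_one_iff[THEN iffD2]) (use ker in auto)
 have im: "a \<odot>_{M} x : nat ` car T.T" if a: "a : car ?L" and x: "x : nat ` car T.T" for a x
 proof -
  obtain t where t: "t : car T.T" "x = nat t" using x by blast
  hence "a \<odot>_{M} x = nat (s a t)" using nd(3)[OF a, of t] by simp
  thus ?thesis using sc[OF a t(1)] by simp
 qed
 have img: "ops.fsub (nat ` car T.T)"
 proof (rule ops.fsubI)
  show "ops.ksub (nat ` car T.T)"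
  proof (rule ops.ksubI)
   show "\<zero>_{M} : nat ` car T.T" using nd(4) by(metis X(2) T.T.one_closed imageI)
   show "x \<oplus>_{M} y : nat ` car T.T" if xy: "x : nat ` car T.T" "y : nat ` car T.T" for x y
   proof -
    obtain t u where t: "t : car T.T" "x = nat t" "u : car T.T" "y = nat u" using xy by blast
    hence eq: "x \<oplus>_{M} y = nat (t \<otimes>_{T.T} u)" using nd(2)[of t u] by simp
    show ?thesis using T.T.m_closed[OF t(1,3)] unfolding eq by(rule imageI)
   qed
  qed (use im nd in auto)
 qed (use im in auto)
 have sub: "nat ` car T.T <= ops.fspan A"
 proof -
  note sp = ops.fsub_fspan[OF AD(1)]
  have sub: "submodule (ops.fspan A) ?L M" using sp submodule_iff_fsub by blast
  note SD = ops.ksubD[OF ops.fsub_ksub[OF sp]]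
  have "subgroup {t : car T.T. nat t : ops.fspan A} T.T"
   by(rule T.T.subgroupI) (use SD in "auto simp flip: a_inv_def")
  hence "{t : car T.T. nat t : ops.fspan A} = car T.T"
  proof (rule T.tensor_subgroup_eq)
   show "T.pt x m : {t : car T.T. nat t : ops.fspan A}" if "x : car ?Y" "m : car MA" for x m
    using that nat(2) MA(1) sub ops.fspan_superset[of A] unfolding submodule_iff by auto
  qed
  thus ?thesis by blast
 qed
 have "A <= nat ` car T.T"
 proof
  fix m assume m: "m : A"
  hence "nat (T.pt \<one>_{?L} m) = m" using nat(2)[of "\<one>_{?L}" m] AM[OF m] by(simp add: smult_one)
  thus "m : nat ` car T.T" using pt1[OF m] by(metis imageI)
 qed
 hence "ops.fspan A <= nat ` car T.T" by(rule ops.fspan_minimal[OF img])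
 hence "nat ` car T.T = ops.fspan A" using sub by blast
 moreover have "ops.rspan A = car M <-> ops.fspan A = car M"
  using ops.rspan_eq_carrier_if_fspan[OF gA] ops.rspan_le_fspan[of A] ops.fspan_minimal[OF ops.fsub_carrier AD(1)] by blast
 ultimately show ?thesis using inj nat(1) by(auto simp: iso_def bij_betw_def simp flip: nat_def)
qed

end

section \<open>Independence of the free resolution\<close>

definition unit_vector :: "('r,'a) ring_scheme => 'i => 'i => 'r" where
 "unit_vector R i = (%j. if j = i then \<one>_{R} else \<zero>_{R})"

lemma unit_vector_closed: assumes "ring R" "i : I" shows "unit_vector R i : car (free_module R I)"
proof -
 interpret ring R by fact
 have "{j. unit_vector R i j ~= \<zero>_{R}} <= {i}" by(auto simp: unit_vector_def)
 hence "finite {j. unit_vector R i j ~= \<zero>_{R}}" by(rule finite_subset) simp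
 thus ?thesis using assms(2) by(auto simp: free_simps unit_vector_def)
qed

lemma module_hom_expand:
 fixes R :: "('r,'a) ring_scheme" and X :: "('r,'x) module"
 assumes "left_module R X" and phi: "phi : module_hom R (free_module R I) X" and x: "x : car (free_module R I)"
 shows "phi x = (\<Oplus>_{X}i\<in>{i. x i ~= \<zero>_{R}}. x i \<odot>_{X} phi (unit_vector R i))"
proof -
 interpret X: left_module R X by fact
 interpret F: left_module R "free_module R I" by(rule left_module_free) (rule X.R.ring_axioms)
 note ph = module_homD[OF F.left_module_axioms X.left_module_axioms phi]
 let ?S = "{i. x i ~= \<zero>_{R}}"
 have S: "finite ?S" "?S <= I" using x by(auto simp: free_simps)
 have xc: "x i : car R" for i using x X.R.zero_closed by(cases "i : I") (auto simp: free_simps)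
 have u: "unit_vector R i : car (free_module R I)" if "i : ?S" for i
  by(rule unit_vector_closed[OF X.R.ring_axioms subsetD[OF S(2) that]])
 have su: "x i \<odot>_{free_module R I} unit_vector R i : car (free_module R I)" if "i : ?S" for i
  using F.smult_closed[OF xc u[OF that]] .
 have "x = (\<Oplus>_{free_module R I}i\<in>?S. x i \<odot>_{free_module R I} unit_vector R i)"
 proof
  fix j
  have "(\<Oplus>_{free_module R I}i\<in>?S. x i \<odot>_{free_module R I} unit_vector R i) j
    = (\<Oplus>_{R}i\<in>?S. (x i \<odot>_{free_module R I} unit_vector R i) j)"
   by(rule finsum_free_module[OF X.R.ring_axioms su])
  also have "... = (\<Oplus>_{R}i\<in>?S. if j = i then x i else \<zero>_{R})"
   by(rule X.R.add.finprod_cong') (use xc in "auto simp: free_simps(4) unit_vector_def")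
  also have "... = x j"
  proof (cases "j : ?S")
   case True
   thus ?thesis using S(1) xc by(intro X.R.add.finprod_singleton) auto
  next
   case False
   hence "(\<Oplus>_{R}i\<in>?S. if j = i then x i else \<zero>_{R}) = (\<Oplus>_{R}i\<in>?S. \<zero>_{R})"
    by(intro X.R.add.finprod_cong') auto
   thus ?thesis using False by simp
  qed
  finally show "x j = (\<Oplus>_{free_module R I}i\<in>?S. x i \<odot>_{free_module R I} unit_vector R i) j" by simp
 qed
 hence "phi x = phi (\<Oplus>_{free_module R I}i\<in>?S. x i \<odot>_{free_module R I} unit_vector R i)" by simp
 also have "... = (\<Oplus>_{X}i\<in>?S. phi (x i \<odot>_{free_module R I} unit_vector R i))"
  by(rule additive_finsum[OF F.M.abelian_group_axioms X.M.abelian_group_axioms]) (use ph su in auto)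
 also have "... = (\<Oplus>_{X}i\<in>?S. x i \<odot>_{X} phi (unit_vector R i))"
  by(rule X.M.add.finprod_cong') (use ph(1,3) u xc X.smult_closed in auto)
 finally show ?thesis .
qed

lemma free_lift:
 fixes R :: "('r,'a) ring_scheme" and X :: "('r,'x) module"
 assumes "left_module R X" and g: "!!i. i : I ==> g i : car X"
 shows "EX phi:module_hom R (free_module R I) X. ALL i:I. phi (unit_vector R i) = g i"
proof -
 interpret X: left_module R X by fact
 interpret F: left_module R "free_module R I" by(rule left_module_free) (rule X.R.ring_axioms)
 define phi where "phi x = (\<Oplus>_{X}i\<in>{i. x i ~= \<zero>_{R}}. x i \<odot>_{X} g i)" for x
 have xc: "x i : car R" if "x : car (free_module R I)" for x i
  using that X.R.zero_closed by(cases "i : I") (auto simp: free_simps)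
 have xg: "x i \<odot>_{X} g i : car X" if "x : car (free_module R I)" "i : I" for x i
  using X.smult_closed[OF xc[OF that(1)] g[OF that(2)]] .
 have fS: "finite {i. x i ~= \<zero>_{R}}" "{i. x i ~= \<zero>_{R}} <= I" if "x : car (free_module R I)" for x
  using that by(auto simp: free_simps)
 have ph: "phi x = (\<Oplus>_{X}i\<in>S. x i \<odot>_{X} g i)"
  if "x : car (free_module R I)" "finite S" "{i. x i ~= \<zero>_{R}} <= S" "S <= I" for x S
  unfolding phi_def by(rule X.M.add.finprod_mono_neutral_cong_left)
   (use that xg[OF that(1)] g in "auto simp: X.smult_l_null subset_iff")
 have "phi : module_hom R (free_module R I) X"
 proof (rule module_homI)
  show "phi x : car X" if x: "x : car (free_module R I)" for x
   unfolding phi_def using xg[OF x] fS[OF x] by(intro X.M.finsum_closed) auto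
  show "phi (x \<oplus>_{free_module R I} y) = phi x \<oplus>_{X} phi y"
   if xy: "x : car (free_module R I)" "y : car (free_module R I)" for x y
  proof -
   let ?S = "{i. x i ~= \<zero>_{R}} Un {i. y i ~= \<zero>_{R}}"
   have S: "finite ?S" "?S <= I" using fS[OF xy(1)] fS[OF xy(2)] by auto
   have "phi (x \<oplus>_{free_module R I} y) = (\<Oplus>_{X}i\<in>?S. (x \<oplus>_{free_module R I} y) i \<odot>_{X} g i)"
    by(rule ph[OF F.M.a_closed[OF xy] S(1) _ S(2)]) (auto simp: free_simps(3))
   also have "... = (\<Oplus>_{X}i\<in>?S. x i \<odot>_{X} g i \<oplus>_{X} y i \<odot>_{X} g i)"
    by(rule X.M.add.finprod_cong')
     (use xg[OF xy(1)] xg[OF xy(2)] xc[OF xy(1)] xc[OF xy(2)] g S(2) X.smult_l_distr in "auto simp: free_simps(3)")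
   also have "... = phi x \<oplus>_{X} phi y"
    unfolding ph[OF xy(1) S(1) Un_upper1 S(2)] ph[OF xy(2) S(1) Un_upper2 S(2)]
    by(rule X.M.finsum_addf) (use xg[OF xy(1)] xg[OF xy(2)] S(2) in auto)
   finally show ?thesis .
  qed
  show "phi (a \<odot>_{free_module R I} x) = a \<odot>_{X} phi x" if a: "a : car R" and x: "x : car (free_module R I)" for a x
  proof -
   have "phi (a \<odot>_{free_module R I} x) = (\<Oplus>_{X}i\<in>{i. x i ~= \<zero>_{R}}. (a \<odot>_{free_module R I} x) i \<odot>_{X} g i)"
    by(rule ph[OF F.smult_closed[OF a x] fS(1)[OF x] _ fS(2)[OF x]]) (use a in "auto simp: free_simps(4)")
   also have "... = (\<Oplus>_{X}i\<in>{i. x i ~= \<zero>_{R}}. a \<odot>_{X} (x i \<odot>_{X} g i))"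
    by(rule X.M.add.finprod_cong')
     (use a xg[OF x] xc[OF x] g fS(2)[OF x] X.smult_assoc X.smult_closed in "auto simp: free_simps(4)")
   also have "... = a \<odot>_{X} phi x"
    unfolding phi_def by(rule X.smult_finsum_r[symmetric]) (use a xg[OF x] fS(2)[OF x] in auto)
   finally show ?thesis .
  qed
 qed
 moreover have "phi (unit_vector R i) = g i" if i: "i : I" for i
 proof -
  have "phi (unit_vector R i) = (\<Oplus>_{X}j\<in>{i}. unit_vector R i j \<odot>_{X} g j)"
   by(rule ph[OF unit_vector_closed[OF X.R.ring_axioms i]]) (use i in "auto simp: unit_vector_def")
  thus ?thesis using g[OF i] by(simp add: unit_vector_def X.smult_one)
 qed
 ultimately show ?thesis by blast
qed

lemma free_projective:
 fixes R :: "('r,'a) ring_scheme" and X :: "('r,'x) module" and Y :: "('r,'y) module"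
 assumes X: "left_module R X" and Y: "left_module R Y" and phi: "phi : module_hom R (free_module R I) X"
  and \<psi>: "\<psi> : module_hom R Y X" and im: "phi ` car (free_module R I) <= \<psi> ` car Y"
 shows "EX \<chi>:module_hom R (free_module R I) Y. ALL x:car (free_module R I). \<psi> (\<chi> x) = phi x"
proof -
 interpret X: left_module R X by fact
 interpret Y: left_module R Y by fact
 interpret F: left_module R "free_module R I" by(rule left_module_free) (rule X.R.ring_axioms)
 note u = unit_vector_closed[OF X.R.ring_axioms]
 have "EX y. y : car Y & \<psi> y = phi (unit_vector R i)" if "i : I" for i
 proof -
  have "phi (unit_vector R i) : \<psi> ` car Y" using im u[OF that] by blast
  thus ?thesis by force
 qed
 then obtain g where g: "!!i. i : I ==> g i : car Y" "!!i. i : I ==> \<psi> (g i) = phi (unit_vector R i)" by metis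
 obtain \<chi> where \<chi>: "\<chi> : module_hom R (free_module R I) Y" "!!i. i : I ==> \<chi> (unit_vector R i) = g i"
  using free_lift[OF Y, of I g] g(1) by blast
 note cD = module_homD[OF F.left_module_axioms Y \<chi>(1)] and pD = module_homD[OF Y X \<psi>]
 have comp: "(%x. \<psi> (\<chi> x)) : module_hom R (free_module R I) X"
  by(rule module_homI) (use cD pD in simp_all)
 have "\<psi> (\<chi> x) = phi x" if x: "x : car (free_module R I)" for x
 proof -
  have S: "{i. x i ~= \<zero>_{R}} <= I" "!!i. i : I ==> x i : car R" using x by(auto simp: free_simps)
  show ?thesis unfolding module_hom_expand[OF X comp x] module_hom_expand[OF X phi x]
   by(rule X.M.add.finprod_cong')
    (use S \<chi>(2) g module_homD(1)[OF F.left_module_axioms X phi u] X.smult_closed in auto)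
 qed
 thus ?thesis using \<chi>(1) by blast
qed

text \<open>Spelled like the differential inside \<open>Tor\<close>, which thereby becomes the map
  induced by the differential of the resolution.\<close>

definition tensor_map ::
 "('r,'a) ring_scheme => ('r,'y) module => ('r,'m) module => ('x => 'y)
  => ('x,'m) tensor_elem => ('y,'m) tensor_elem" where
 "tensor_map R Y M u = tensor_lift (tensor R Y M) (%x m. pure_tensor R Y M (u x) m)"

lemma tensor_map:
 assumes "tensor_product R X M" "tensor_product R Y M" and u: "u : module_hom (op_ring R) X Y"
 shows "tensor_map R Y M u : hom (tensor R X M) (tensor R Y M)"
  "x : car X ==> m : car M ==> tensor_map R Y M u (pure_tensor R X M x m) = pure_tensor R Y M (u x) m"
proof -
 interpret X: tensor_product R X M by fact
 interpret Y: tensor_product R Y M by fact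
 note uD = module_homD[OF X.Y.left_module_axioms Y.Y.left_module_axioms u]
 show "tensor_map R Y M u : hom (tensor R X M) (tensor R Y M)"
  "x : car X ==> m : car M ==> tensor_map R Y M u (pure_tensor R X M x m) = pure_tensor R Y M (u x) m"
  unfolding tensor_map_def by(rule X.tensor_lift[OF Y.T.comm_group_axioms];
   use uD Y.pt_add_left Y.pt_add_right Y.pt_balanced in simp)+
qed

locale resolution_tensor = M: left_module R M + N: left_module "op_ring R" N
 for R :: "('r,'a) ring_scheme" and M :: "('r,'m) module" and N :: "('r,'n) module" +
 fixes I :: "nat => 'i set" and d ep assumes res: "free_resolution (op_ring R) N I d ep"
begin

abbreviation F :: "nat => ('r,'i => 'r) module" where "F n == free_module (op_ring R) (I n)"
abbreviation T :: "nat => ('i => 'r,'m) tensor_elem monoid" where "T n == tensor R (F n) M"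
abbreviation D :: "nat => ('i => 'r,'m) tensor_elem => ('i => 'r,'m) tensor_elem"
 where "D n == tensor_map R (F n) M (d n)"

lemma F_module: "left_module (op_ring R) (F n)" by(rule left_module_free) (rule N.R.ring_axioms)

sublocale TP: tensor_product R "F n" M for n
 by(intro tensor_product.intro F_module M.left_module_axioms)

lemma d_hom: "d n : module_hom (op_ring R) (F (Suc n)) (F n)"
 and ep_hom: "ep : module_hom (op_ring R) (F 0) N" and ep_surj: "ep ` car (F 0) = car N"
 and d0_image: "d 0 ` car (F (Suc 0)) = a_kernel (F 0) N ep"
 and d_image: "d (Suc n) ` car (F (Suc (Suc n))) = a_kernel (F (Suc n)) (F n) (d n)"
 using res by(auto simp: free_resolution_def)

lemmas dD = module_homD[OF F_module F_module d_hom]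
lemmas epD = module_homD[OF F_module N.left_module_axioms ep_hom]

lemma d_d: "x : car (F (Suc (Suc n))) ==> d n (d (Suc n) x) = \<zero>_{F n}"
 using d_image[of n] by(auto simp: a_kernel_eq)

lemma ep_d: "x : car (F (Suc 0)) ==> ep (d 0 x) = \<zero>_{N}"
 using d0_image by(auto simp: a_kernel_eq)

lemmas D_hom = tensor_map[OF TP.tensor_product_axioms TP.tensor_product_axioms d_hom]

lemma D_group_hom: "group_hom (T (Suc n)) (T n) (D n)"
 using D_hom(1) TP.T.is_group by(simp add: group_hom_def group_hom_axioms_def)

lemma D_D: assumes "t : car (T (Suc (Suc n)))" shows "D n (D (Suc n) t) = \<one>_{T n}"
proof -
 have "(%t. D n (D (Suc n) t)) t = (%t. \<one>_{T n}) t"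
 proof (rule TP.hom_eq_on_pure[OF TP.T.is_group _ _ _ assms])
  show "(%t. D n (D (Suc n) t)) : hom (T (Suc (Suc n))) (T n)"
   using hom_compose[OF D_hom(1)[of "Suc n"] D_hom(1)[of n]] by(simp add: comp_def)
  show "(%t. \<one>_{T n}) : hom (T (Suc (Suc n))) (T n)" by(rule homI) simp_all
  show "D n (D (Suc n) (pure_tensor R (F (Suc (Suc n))) M x m)) = \<one>_{T n}"
   if "x : car (F (Suc (Suc n)))" "m : car M" for x m using that D_hom(2) dD(1) d_d by simp
 qed
 thus ?thesis by simp
qed

text \<open>In degree 0 every element counts as a cycle, in agreement with the case distinction in
  \<open>Tor\<close>.\<close>

definition exact_at :: "nat => bool" where
 "exact_at q <-> (ALL z:car (T q). (q = 0 | D (q - 1) z = \<one>_{T (q - 1)}) --> (EX w:car (T (Suc q)). D q w = z))"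

lemma trivial_homology_iff:
 "trivial_group ((T q)(|carrier := (if q = 0 then car (T 0) else kernel (T q) (T (q - 1)) (D (q - 1)))|)
  Mod (D q ` car (T (Suc q)))) <-> exact_at q"
proof -
 define Z where "Z = (if q = 0 then car (T 0) else kernel (T q) (T (q - 1)) (D (q - 1)))"
 interpret Dq: group_hom "T (Suc q)" "T q" "D q" by(rule D_group_hom)
 have Z: "subgroup Z (T q)"
 proof (cases q)
  case (Suc n)
  interpret group_hom "T (Suc n)" "T n" "D n" by(rule D_group_hom)
  show ?thesis unfolding Z_def Suc using subgroup_kernel by simp
 qed (simp add: Z_def TP.T.subgroup_self)
 let ?B = "D q ` car (T (Suc q))"
 have B: "subgroup ?B (T q)" by(rule Dq.img_is_subgroup)
 have BZ: "?B <= Z"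
 proof (cases q)
  case 0
  thus ?thesis using Dq.hom_closed by(auto simp: Z_def)
 next
  case (Suc n)
  thus ?thesis using Dq.hom_closed D_D[of _ n] by(auto simp: Z_def kernel_def)
 qed
 interpret Zg: comm_group "(T q)(|carrier := Z|)"
  by(rule group.group_comm_groupI[OF subgroup.subgroup_is_group[OF Z TP.T.is_group]])
   (simp, rule TP.T.m_comm; use subgroup.subset[OF Z] in auto)
 have BZg: "subgroup ?B ((T q)(|carrier := Z|))" by(rule TP.T.subgroup_incl[OF B Z BZ])
 have "trivial_group ((T q)(|carrier := Z|) Mod ?B) <-> Z <= ?B"
 proof
  assume tr: "trivial_group ((T q)(|carrier := Z|) Mod ?B)"
  show "Z <= ?B"
  proof
   fix z assume z: "z : Z"
   have "?B #>_{(T q)(|carrier := Z|)} z : car ((T q)(|carrier := Z|) Mod ?B)"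
    using z by(simp add: carrier_FactGroup)
   hence "?B #>_{(T q)(|carrier := Z|)} z = ?B" using tr by(auto simp: trivial_group_def)
   thus "z : ?B" using Zg.rcos_self[OF _ BZg, of z] z by simp
  qed
 next
  assume ZB: "Z <= ?B"
  have "?B #>_{(T q)(|carrier := Z|)} z = ?B" if "z : Z" for z
   by(rule subgroup.rcos_const[OF BZg Zg.is_group subsetD[OF ZB that]])
  hence "car ((T q)(|carrier := Z|) Mod ?B) = {?B}"
   using Zg.one_closed by(auto simp: carrier_FactGroup)
  thus "trivial_group ((T q)(|carrier := Z|) Mod ?B)"
   using Zg.abelian_FactGroup[OF BZg] by(simp add: trivial_group_def comm_group.axioms(2))
 qed
 also have "Z <= ?B <-> exact_at q" unfolding Z_def exact_at_def kernel_def by(cases q) force+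
 finally show ?thesis unfolding Z_def .
qed

end


section \<open>Chain maps, homotopies and the comparison theorem\<close>

lemma module_hom_compose:
 assumes "left_module R X" "left_module R Y" "left_module R Z" "f : module_hom R X Y" "g : module_hom R Y Z"
 shows "(%x. g (f x)) : module_hom R X Z"
 by(rule module_homI) (use module_homD[OF assms(1,2,4)] module_homD[OF assms(2,3,5)] in simp_all)

lemma module_hom_diff:
 fixes R :: "('r,'a) ring_scheme" and X :: "('r,'x) module" and Y :: "('r,'y) module"
 assumes "left_module R X" "left_module R Y" "f : module_hom R X Y" "g : module_hom R X Y"
 shows "(%x. f x \<ominus>_{Y} g x) : module_hom R X Y"
proof -
 interpret Y: left_module R Y by fact
 note fD = module_homD[OF assms(1,2,3)] and gD = module_homD[OF assms(1,2,4)]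
 have m: "a \<odot>_{Y} (\<ominus>_{Y} y) = \<ominus>_{Y} (a \<odot>_{Y} y)" if "a : car R" "y : car Y" for a y
 proof -
  have "a \<odot>_{Y} (\<ominus>_{Y} y) \<oplus>_{Y} a \<odot>_{Y} y = \<zero>_{Y}"
   using that by(simp add: Y.M.l_neg Y.smult_r_null flip: Y.smult_r_distr)
  thus ?thesis using that Y.smult_closed by(intro Y.M.minus_equality[symmetric]) auto
 qed
 show ?thesis
 proof (rule module_homI)
  show "f (x \<oplus>_{X} y) \<ominus>_{Y} g (x \<oplus>_{X} y) = (f x \<ominus>_{Y} g x) \<oplus>_{Y} (f y \<ominus>_{Y} g y)"
   if "x : car X" "y : car X" for x y
   using that fD gD by(simp add: Y.M.minus_eq Y.M.minus_add Y.M.a_ac)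
  show "f (a \<odot>_{X} x) \<ominus>_{Y} g (a \<odot>_{X} x) = a \<odot>_{Y} (f x \<ominus>_{Y} g x)"
   if "a : car R" "x : car X" for a x using that fD gD m by(simp add: Y.M.minus_eq Y.smult_r_distr)
 qed (use fD gD in simp)
qed

lemma (in abelian_group) minus_zero_right: "x : car G ==> x \<ominus> \<zero> = x"
 by(simp add: minus_eq)

lemma (in abelian_group) add_left_cancel:
 assumes "x \<oplus> y = x \<oplus> z" "x : car G" "y : car G" "z : car G" shows "y = z"
 using r_neg1[OF assms(2,3)] r_neg1[OF assms(2,4)] unfolding assms(1) by(rule trans[OF sym])

lemma (in abelian_group) add_minus_cancel: "x : car G ==> y : car G ==> x \<oplus> (y \<ominus> x) = y"
 using a_lcomm[of x y "\<ominus> x"] by(simp add: minus_eq r_neg)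

text \<open>The maps are lifted degree by degree: the map already built sends boundaries to
  boundaries of the other resolution, and a free module lifts through a surjection onto
  these.\<close>

lemma chain_map_exists:
 assumes "resolution_tensor R M N I d ep" "resolution_tensor R M N J e \<eta>"
 shows "EX f. (ALL n. f n : module_hom (op_ring R) (free_module (op_ring R) (I n)) (free_module (op_ring R) (J n)))
  & (ALL x:car (free_module (op_ring R) (I 0)). \<eta> (f 0 x) = ep x)
  & (ALL n. ALL x:car (free_module (op_ring R) (I (Suc n))). e n (f (Suc n) x) = f n (d n x))"
proof -
 interpret A: resolution_tensor R M N I d ep by fact
 interpret B: resolution_tensor R M N J e \<eta> by fact
 \<comment> \<open>The second conjunct is what makes the next lift possible, so the recursion has to
   hand it on with each map.\<close>
 define P where "P n f <-> f : module_hom (op_ring R) (A.F n) (B.F n)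
  & (ALL x:car (A.F (Suc n)). f (d n x) : e n ` car (B.F (Suc n)))
  & (n = 0 --> (ALL x:car (A.F 0). \<eta> (f x) = ep x))" for n f
 have "EX f. ALL n. P n (f n) & (ALL x:car (A.F (Suc n)). e n (f (Suc n) x) = f n (d n x))"
 proof (rule dependent_nat_choice)
  obtain f where f: "f : module_hom (op_ring R) (A.F 0) (B.F 0)" "ALL x:car (A.F 0). \<eta> (f x) = ep x"
   using free_projective[OF A.N.left_module_axioms B.F_module A.ep_hom B.ep_hom] A.ep_surj B.ep_surj by auto
  have "f (d 0 x) : e 0 ` car (B.F (Suc 0))" if "x : car (A.F (Suc 0))" for x
   unfolding B.d0_image a_kernel_eq
   using f(2) A.dD(1)[OF that] A.ep_d[OF that] module_homD(1)[OF A.F_module B.F_module f(1)] by simp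
  thus "EX f. P 0 f" unfolding P_def using f by blast
 next
  fix f n assume P: "P n f"
  hence f: "f : module_hom (op_ring R) (A.F n) (B.F n)"
   and im: "(%x. f (d n x)) ` car (A.F (Suc n)) <= e n ` car (B.F (Suc n))" unfolding P_def by blast+
  obtain g where g: "g : module_hom (op_ring R) (A.F (Suc n)) (B.F (Suc n))"
   "ALL x:car (A.F (Suc n)). e n (g x) = f (d n x)"
   using free_projective[OF B.F_module B.F_module module_hom_compose[OF A.F_module A.F_module B.F_module A.d_hom f] B.d_hom im]
   by blast
  have "g (d (Suc n) x) : e (Suc n) ` car (B.F (Suc (Suc n)))" if "x : car (A.F (Suc (Suc n)))" for x
   unfolding B.d_image a_kernel_eq
   using g(2) A.dD(1)[OF that] A.d_d[OF that] module_homD(1)[OF A.F_module B.F_module g(1)] module_homD(4)[OF A.F_module B.F_module f] by simp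
  thus "EX g. P (Suc n) g & (ALL x:car (A.F (Suc n)). e n (g x) = f (d n x))"
   unfolding P_def using g by blast
 qed
 then obtain f where f: "!!n. P n (f n)" "!!n. ALL x:car (A.F (Suc n)). e n (f (Suc n) x) = f n (d n x)" by metis
 thus ?thesis by(intro exI[of _ f]) (simp add: P_def)
qed

text \<open>The next component lifts \<open>k - h d\<close>. This is a cycle because of the middle
  conjunct of \<open>P\<close>, which says that \<open>d h\<close> and \<open>k\<close> agree on
  boundaries.\<close>

lemma (in resolution_tensor) homotopy_exists:
 assumes k: "!!n. k n : module_hom (op_ring R) (F n) (F n)" "!!x. x : car (F 0) ==> ep (k 0 x) = \<zero>_{N}"
  "!!n x. x : car (F (Suc n)) ==> d n (k (Suc n) x) = k n (d n x)"
 shows "EX h. (ALL n. h n : module_hom (op_ring R) (F n) (F (Suc n))) & (ALL x:car (F 0). d 0 (h 0 x) = k 0 x)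
  & (ALL n. ALL x:car (F (Suc n)). d (Suc n) (h (Suc n) x) = k (Suc n) x \<ominus>_{F (Suc n)} h n (d n x))"
proof -
 define P where "P n h <-> h : module_hom (op_ring R) (F n) (F (Suc n))
  & (ALL x:car (F (Suc n)). d n (h (d n x)) = k n (d n x)) & (n = 0 --> (ALL x:car (F 0). d 0 (h x) = k 0 x))" for n h
 note kD = module_homD[OF F_module F_module k(1)]
 have "EX h. ALL n. P n (h n) & (ALL x:car (F (Suc n)). d (Suc n) (h (Suc n) x) = k (Suc n) x \<ominus>_{F (Suc n)} h n (d n x))"
 proof (rule dependent_nat_choice)
  have "k 0 ` car (F 0) <= d 0 ` car (F (Suc 0))"
   unfolding d0_image a_kernel_eq using k(2) kD(1) by auto
  then obtain h where "h : module_hom (op_ring R) (F 0) (F (Suc 0))" "ALL x:car (F 0). d 0 (h x) = k 0 x"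
   using free_projective[OF F_module F_module k(1) d_hom] by blast
  thus "EX h. P 0 h" unfolding P_def using dD(1) by blast
 next
  fix h n assume P: "P n h"
  hence h: "h : module_hom (op_ring R) (F n) (F (Suc n))"
   and hd: "!!x. x : car (F (Suc n)) ==> d n (h (d n x)) = k n (d n x)" unfolding P_def by blast+
  note hD = module_homD[OF F_module F_module h]
  let ?phi = "%x. k (Suc n) x \<ominus>_{F (Suc n)} h (d n x)"
  have phi: "?phi : module_hom (op_ring R) (F (Suc n)) (F (Suc n))"
   by(rule module_hom_diff[OF F_module F_module k(1) module_hom_compose[OF F_module F_module F_module d_hom h]])
  have "?phi x : d (Suc n) ` car (F (Suc (Suc n)))" if x: "x : car (F (Suc n))" for x
  proof -
   have c: "k (Suc n) x : car (F (Suc n))" "h (d n x) : car (F (Suc n))" "?phi x : car (F (Suc n))"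
    using kD(1)[OF x] hD(1)[OF dD(1)[OF x]] TP.Y.M.minus_closed by auto
   have "d n (h (d n x) \<oplus>_{F (Suc n)} ?phi x) = d n (k (Suc n) x)"
    using TP.Y.M.add_minus_cancel[OF c(2,1)] by simp
   hence "d n (h (d n x)) \<oplus>_{F n} d n (?phi x) = d n (h (d n x))"
    using dD(2)[OF c(2,3)] k(3)[OF x] hd[OF x] by simp
   hence "d n (h (d n x)) \<oplus>_{F n} d n (?phi x) = d n (h (d n x)) \<oplus>_{F n} \<zero>_{F n}"
    using dD(1)[OF c(2)] TP.Y.M.r_zero by simp
   hence "d n (?phi x) = \<zero>_{F n}"
    by(rule TP.Y.M.add_left_cancel[OF _ dD(1)[OF c(2)] dD(1)[OF c(3)] TP.Y.M.zero_closed])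
   thus ?thesis unfolding d_image a_kernel_eq using c(3) by simp
  qed
  then obtain g where g: "g : module_hom (op_ring R) (F (Suc n)) (F (Suc (Suc n)))"
   "ALL x:car (F (Suc n)). d (Suc n) (g x) = ?phi x"
   using free_projective[OF F_module F_module phi d_hom] by blast
  have "d (Suc n) (g (d (Suc n) x)) = k (Suc n) (d (Suc n) x)" if x: "x : car (F (Suc (Suc n)))" for x
   using g(2) dD(1)[OF x] d_d[OF x] hD(4) kD(1)[OF dD(1)[OF x]] TP.Y.M.minus_zero_right by simp
  thus "EX g. P (Suc n) g & (ALL x:car (F (Suc n)). d (Suc n) (g x) = k (Suc n) x \<ominus>_{F (Suc n)} h (d n x))"
   unfolding P_def using g by blast
 qed
 then obtain h where h: "!!n. P n (h n)"
  "!!n. ALL x:car (F (Suc n)). d (Suc n) (h (Suc n) x) = k (Suc n) x \<ominus>_{F (Suc n)} h n (d n x)" by metis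
 thus ?thesis by(intro exI[of _ h]) (simp add: P_def)
qed

text \<open>Let g and f be comparison maps in both directions. A cycle z over the second resolution
  gives the cycle g z over the first, which is a boundary by assumption; so f g z is a boundary, and
  it differs from z by a boundary since f g is homotopic to the identity.\<close>

lemma exact_at_independent:
 assumes "resolution_tensor R M N I d ep" "resolution_tensor R M N J e \<eta>"
  and ex: "resolution_tensor.exact_at R M I d q" shows "resolution_tensor.exact_at R M J e q"
proof -
 interpret A: resolution_tensor R M N I d ep by fact
 interpret B: resolution_tensor R M N J e \<eta> by fact
 obtain f where f: "!!n. f n : module_hom (op_ring R) (A.F n) (B.F n)"
  "!!x. x : car (A.F 0) ==> \<eta> (f 0 x) = ep x"
  "!!n x. x : car (A.F (Suc n)) ==> e n (f (Suc n) x) = f n (d n x)"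
  using chain_map_exists[OF assms(1,2)] by blast
 obtain g where g: "!!n. g n : module_hom (op_ring R) (B.F n) (A.F n)"
  "!!x. x : car (B.F 0) ==> ep (g 0 x) = \<eta> x"
  "!!n x. x : car (B.F (Suc n)) ==> d n (g (Suc n) x) = g n (e n x)"
  using chain_map_exists[OF assms(2,1)] by blast
 note fD = module_homD[OF A.F_module B.F_module f(1)] and gD = module_homD[OF B.F_module A.F_module g(1)]
 have idh: "(%x. x) : module_hom (op_ring R) (B.F n) (B.F n)" for n by(rule module_homI) simp_all
 \<comment> \<open>The difference of f g and the identity lies over the zero map of N. Its homotopy
   is found on the free modules and carried over to the tensor products below.\<close>
 define k where "k n x = f n (g n x) \<ominus>_{B.F n} x" for n x
 have fg: "f n (g n x) = x \<oplus>_{B.F n} k n x" if "x : car (B.F n)" for n x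
  unfolding k_def using B.TP.Y.M.add_minus_cancel[OF that] fD(1)[OF gD(1)[OF that]] by simp
 have k1: "k n : module_hom (op_ring R) (B.F n) (B.F n)" for n
  unfolding k_def by(rule module_hom_diff[OF B.F_module B.F_module module_hom_compose[OF B.F_module A.F_module B.F_module g(1) f(1)] idh])
 note kD = module_homD[OF B.F_module B.F_module k1]
 have k2: "\<eta> (k 0 x) = \<zero>_{N}" if x: "x : car (B.F 0)" for x
 proof -
  have "\<eta> x \<oplus>_{N} \<eta> (k 0 x) = \<eta> x \<oplus>_{N} \<zero>_{N}"
   using A.N.M.r_zero[OF B.epD(1)[OF x]] fg[OF x] f(2)[OF gD(1)[OF x]] g(2)[OF x] B.epD(2)[OF x kD(1)[OF x]] by simp
  thus ?thesis
   by(rule A.N.M.add_left_cancel[OF _ B.epD(1)[OF x] B.epD(1)[OF kD(1)[OF x]] A.N.M.zero_closed])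
 qed
 have k3: "e n (k (Suc n) x) = k n (e n x)" if x: "x : car (B.F (Suc n))" for n x
 proof -
  have ex: "e n x : car (B.F n)" using B.dD(1)[OF x] .
  have "e n (f (Suc n) (g (Suc n) x)) = f n (g n (e n x))" using f(3)[OF gD(1)[OF x]] g(3)[OF x] by simp
  hence "e n x \<oplus>_{B.F n} e n (k (Suc n) x) = e n x \<oplus>_{B.F n} k n (e n x)"
   using fg[OF x] fg[OF ex] B.dD(2)[OF x kD(1)[OF x]] by simp
  thus ?thesis by(rule B.TP.Y.M.add_left_cancel[OF _ ex B.dD(1)[OF kD(1)[OF x]] kD(1)[OF ex]])
 qed
 obtain h where h: "!!n. h n : module_hom (op_ring R) (B.F n) (B.F (Suc n))"
  "!!x. x : car (B.F 0) ==> e 0 (h 0 x) = k 0 x"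
  "!!n x. x : car (B.F (Suc n)) ==> e (Suc n) (h (Suc n) x) = k (Suc n) x \<ominus>_{B.F (Suc n)} h n (e n x)"
  using B.homotopy_exists[OF k1 k2 k3] by blast
 note hD = module_homD[OF B.F_module B.F_module h(1)]
 let ?f = "%n. tensor_map R (B.F n) M (f n)" and ?g = "%n. tensor_map R (A.F n) M (g n)"
  and ?h = "%n. tensor_map R (B.F (Suc n)) M (h n)"
 note Tf = tensor_map[OF A.TP.tensor_product_axioms B.TP.tensor_product_axioms f(1)]
 note Tg = tensor_map[OF B.TP.tensor_product_axioms A.TP.tensor_product_axioms g(1)]
 note Th = tensor_map[OF B.TP.tensor_product_axioms B.TP.tensor_product_axioms h(1)]
 have gd: "A.D n (?g (Suc n) z) = ?g n (B.D n z)" if z: "z : car (B.T (Suc n))" for n z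
 proof -
  have "(%z. A.D n (?g (Suc n) z)) z = (%z. ?g n (B.D n z)) z"
  proof (rule B.TP.hom_eq_on_pure[OF A.TP.T.is_group _ _ _ z])
   show "(%z. A.D n (?g (Suc n) z)) : hom (B.T (Suc n)) (A.T n)"
    using hom_compose[OF Tg(1) A.D_hom(1)] by(simp add: comp_def)
   show "(%z. ?g n (B.D n z)) : hom (B.T (Suc n)) (A.T n)"
    using hom_compose[OF B.D_hom(1) Tg(1)] by(simp add: comp_def)
  qed (use Tg(2) A.D_hom(2) B.D_hom(2) gD(1) B.dD(1) g(3) in simp)
  thus ?thesis by simp
 qed
 have fd: "B.D n (?f (Suc n) z) = ?f n (A.D n z)" if z: "z : car (A.T (Suc n))" for n z
 proof -
  have "(%z. B.D n (?f (Suc n) z)) z = (%z. ?f n (A.D n z)) z"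
  proof (rule A.TP.hom_eq_on_pure[OF B.TP.T.is_group _ _ _ z])
   show "(%z. B.D n (?f (Suc n) z)) : hom (A.T (Suc n)) (B.T n)"
    using hom_compose[OF Tf(1) B.D_hom(1)] by(simp add: comp_def)
   show "(%z. ?f n (A.D n z)) : hom (A.T (Suc n)) (B.T n)"
    using hom_compose[OF A.D_hom(1) Tf(1)] by(simp add: comp_def)
  qed (use Tf(2) A.D_hom(2) B.D_hom(2) fD(1) A.dD(1) f(3) in simp)
  thus ?thesis by simp
 qed
 have closed: "?f n z : car (B.T n)" if "z : car (A.T n)" for n z using Tf(1) that by(auto simp: hom_def)
 have gclosed: "?g n z : car (A.T n)" if "z : car (B.T n)" for n z using Tg(1) that by(auto simp: hom_def)
 have hclosed: "?h n z : car (B.T (Suc n))" if "z : car (B.T n)" for n z using Th(1) that by(auto simp: hom_def)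
 have Dclosed: "B.D n z : car (B.T n)" if "z : car (B.T (Suc n))" for n z using B.D_hom(1) that by(auto simp: hom_def)
 \<comment> \<open>The case distinction omits the summand h d in degree 0, where no differential
   leaves the complex.\<close>
 have homot: "?f n (?g n z) = z \<otimes>_{B.T n} (B.D n (?h n z) \<otimes>_{B.T n} (case n of 0 => \<one>_{B.T n} | Suc m => ?h m (B.D m z)))"
  if z: "z : car (B.T n)" for n z
 proof -
  let ?r = "%z. case n of 0 => \<one>_{B.T n} | Suc m => ?h m (B.D m z)"
  have r: "?r : hom (B.T n) (B.T n)"
  proof (cases n)
   case 0
   thus ?thesis by(auto intro!: homI)
  next
   case (Suc m)
   show ?thesis using hom_compose[OF B.D_hom(1)[of m] Th(1)[of m]] unfolding Suc by(simp add: comp_def)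
  qed
  have u: "(%z. B.D n (?h n z)) : hom (B.T n) (B.T n)"
   using hom_compose[OF Th(1) B.D_hom(1)] by(simp add: comp_def)
  have mult: "(%z. a z \<otimes>_{B.T n} b z) : hom (B.T n) (B.T n)"
   if "a : hom (B.T n) (B.T n)" "b : hom (B.T n) (B.T n)" for a b
   using that by(intro homI) (auto simp: hom_def B.TP.T.m_ac Pi_def)
  have "(%z. ?f n (?g n z)) z = (%z. z \<otimes>_{B.T n} (B.D n (?h n z) \<otimes>_{B.T n} ?r z)) z"
  proof (rule B.TP.hom_eq_on_pure[OF B.TP.T.is_group _ _ _ z])
   show "(%z. ?f n (?g n z)) : hom (B.T n) (B.T n)"
    using hom_compose[OF Tg(1) Tf(1)] by(simp add: comp_def)
   show "(%z. z \<otimes>_{B.T n} (B.D n (?h n z) \<otimes>_{B.T n} ?r z)) : hom (B.T n) (B.T n)"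
    by(rule mult[OF _ mult[OF u r]]) (auto intro!: homI)
   fix x m assume x: "x : car (B.F n)" and m: "m : car M"
   have ehx: "e n (h n x) : car (B.F n)" using B.dD(1)[OF hD(1)[OF x]] .
   have l: "?f n (?g n (B.TP.pt n x m)) = B.TP.pt n (f n (g n x)) m"
    using Tf(2)[OF gD(1)[OF x] m] Tg(2)[OF x m] by simp
   have e: "B.D n (?h n (B.TP.pt n x m)) = B.TP.pt n (e n (h n x)) m"
    using B.D_hom(2)[OF hD(1)[OF x] m] Th(2)[OF x m] by simp
   show "?f n (?g n (B.TP.pt n x m)) = B.TP.pt n x m \<otimes>_{B.T n} (B.D n (?h n (B.TP.pt n x m)) \<otimes>_{B.T n} ?r (B.TP.pt n x m))"
   proof (cases n)
    case 0
    have "f n (g n x) = x \<oplus>_{B.F n} e n (h n x)" using fg[OF x] h(2) x unfolding 0 by simp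
    thus ?thesis unfolding l e using B.TP.pt_add_left[OF x ehx m] B.TP.pt_closed[OF ehx m] 0 by simp
   next
    case (Suc p)
    have x': "x : car (B.F (Suc p))" using x Suc by simp
    have hd: "h p (e p x) : car (B.F n)" unfolding Suc using hD(1)[OF B.dD(1)[OF x']] .
    have "k n x = h p (e p x) \<oplus>_{B.F n} e n (h n x)"
     unfolding Suc h(3)[OF x'] using B.TP.Y.M.add_minus_cancel[OF hd[unfolded Suc] kD(1)[OF x']] by simp
    hence "f n (g n x) = x \<oplus>_{B.F n} (e n (h n x) \<oplus>_{B.F n} h p (e p x))"
     using fg[OF x] B.TP.Y.M.a_comm[OF hd ehx] by simp
    moreover have "?r (B.TP.pt n x m) = B.TP.pt n (h p (e p x)) m"
     unfolding Suc using B.D_hom(2)[OF x' m] Th(2)[OF B.dD(1)[OF x'] m] by simp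
    ultimately show ?thesis unfolding l e
     using B.TP.pt_add_left[OF x B.TP.Y.M.a_closed[OF ehx hd] m] B.TP.pt_add_left[OF ehx hd m] by simp
   qed
  qed
  thus ?thesis by simp
 qed
 show ?thesis unfolding B.exact_at_def
 proof (intro ballI impI)
  fix z assume z: "z : car (B.T q)" and Dz: "q = 0 | B.D (q - 1) z = \<one>_{B.T (q - 1)}"
  have one: "?g n \<one>_{B.T n} = \<one>_{A.T n}" "?h n \<one>_{B.T n} = \<one>_{B.T (Suc n)}" for n
   using hom_one[OF Tg(1)] hom_one[OF Th(1)] B.TP.T.is_group A.TP.T.is_group by auto
  have "q = 0 | A.D (q - 1) (?g q z) = \<one>_{A.T (q - 1)}"
   using Dz gd[of z "q - 1"] z one by(cases q) auto
  then obtain w where w: "w : car (A.T (Suc q))" "A.D q w = ?g q z"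
   using ex gclosed[OF z] unfolding A.exact_at_def by blast
  have r: "(case q of 0 => \<one>_{B.T q} | Suc m => ?h m (B.D m z)) = \<one>_{B.T q}"
   using Dz one by(cases q) auto
  interpret Dq: group_hom "B.T (Suc q)" "B.T q" "B.D q" by(rule B.D_group_hom)
  have eq: "B.D q (?f (Suc q) w) = z \<otimes>_{B.T q} B.D q (?h q z)"
   using homot[OF z] fd[OF w(1)] w(2) r Dclosed[OF hclosed[OF z]] by simp
  \<comment> \<open>In additive notation: on a cycle, f g z = z + d h z, and f g z = d f w; so z is
    the boundary of f w - h z.\<close>
  let ?w = "?f (Suc q) w \<otimes>_{B.T (Suc q)} inv _{B.T (Suc q)} (?h q z)"
  have "B.D q ?w = z"
   using closed[OF w(1)] hclosed[OF z] eq z Dclosed[OF hclosed[OF z]] by(simp add: B.TP.T.m_assoc)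
  thus "EX w:car (B.T (Suc q)). B.D q w = z"
   using closed[OF w(1)] hclosed[OF z] by(intro bexI[of _ ?w]) auto
 qed
qed

section \<open>The periodic resolution of the augmentation module\<close>

definition tensor_coord :: "('r,'a) ring_scheme => ('r,'m) module => 'i => ('i => 'r,'m) tensor_elem => 'm" where
 "tensor_coord R M i = tensor_lift (add_monoid M) (%x m. x i \<odot>_{M} m)"

text \<open>Tensoring a finite free module with M gives a power of M. The four facts express this
  through the coordinates: additivity, values on pure tensors, joint injectivity and joint
  surjectivity.\<close>

lemma tensor_coord:
 fixes R :: "('r,'a) ring_scheme" and M :: "('r,'m) module" and I :: "'i set"
 defines "X == free_module (op_ring R) I" assumes M: "left_module R M" and I: "finite I"
 shows "i : I ==> tensor_coord R M i : hom (tensor R X M) (add_monoid M)"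
  "i : I ==> x : car X ==> m : car M ==> tensor_coord R M i (pure_tensor R X M x m) = x i \<odot>_{M} m"
  "t : car (tensor R X M) ==> t' : car (tensor R X M)
   ==> (!!i. i : I ==> tensor_coord R M i t = tensor_coord R M i t') ==> t = t'"
  "(!!i. i : I ==> f i : car M) ==> EX t:car (tensor R X M). ALL i:I. tensor_coord R M i t = f i"
proof -
 interpret M: left_module R M by fact
 have rS: "ring (op_ring R)" by(rule ring_op_ring) (rule M.R.ring_axioms)
 have XM: "left_module (op_ring R) X" unfolding X_def by(rule left_module_free[OF rS])
 interpret T: tensor_product R X M by(intro tensor_product.intro XM M)
 have xc: "x i : car R" if "x : car X" for x i
  using that M.R.zero_closed by(cases "i : I") (auto simp: X_def free_simps)
 have cg: "comm_group (add_monoid M)" by(rule M.M.a_comm_group)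
 have hom: "tensor_coord R M i : hom T.T (add_monoid M)"
  "!!x m. x : car X ==> m : car M ==> tensor_coord R M i (T.pt x m) = x i \<odot>_{M} m" for i
  unfolding tensor_coord_def by(rule T.tensor_lift[OF cg];
   use xc M.smult_closed M.smult_l_distr M.smult_r_distr M.smult_assoc in "simp add: X_def free_simps(3,4)")+
 show "i : I ==> tensor_coord R M i : hom T.T (add_monoid M)"
  "i : I ==> x : car X ==> m : car M ==> tensor_coord R M i (T.pt x m) = x i \<odot>_{M} m" for i x m
  using hom by auto
 have cc: "tensor_coord R M i t : car M" if "t : car T.T" for i t using hom(1)[of i] that by(auto simp: hom_def)
 let ?u = "unit_vector (op_ring R)"
 have u: "?u i : car X" if "i : I" for i unfolding X_def by(rule unit_vector_closed[OF rS that])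
 have pt_sum: "T.pt (\<Oplus>_{X}j\<in>J. g j) m = finprod T.T (%j. T.pt (g j) m) J"
  if "finite J" "!!j. j : J ==> g j : car X" "m : car M" for J and g :: "'i => 'i => 'r" and m
  using that
 proof (induction J rule: finite_induct)
  case (insert j J)
  have g: "g : J \<rightarrow> car X" "g j : car X" using insert.prems by auto
  hence "(%j. T.pt (g j) m) : J \<rightarrow> car T.T" "T.pt (g j) m : car T.T" using insert.prems by auto
  thus ?case using insert g T.pt_add_left[OF g(2) T.Y.M.finsum_closed[OF g(1)] insert.prems(2)] by simp
 qed simp
 \<comment> \<open>Rebuilds a tensor from its coordinates along the unit vectors. It is the identity
   on pure tensors, hence everywhere, which gives joint injectivity.\<close>
 define rc where "rc t = finprod T.T (%i. T.pt (?u i) (tensor_coord R M i t)) I" for t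
 have uc: "T.pt (?u i) (tensor_coord R M i t) : car T.T" if "i : I" "t : car T.T" for i t
  using u cc that by simp
 have rch: "rc : hom T.T T.T"
 proof (rule homI)
  show "rc t : car T.T" if "t : car T.T" for t unfolding rc_def by(rule T.T.finprod_closed) (use uc that in auto)
  show "rc (s \<otimes>_{T.T} t) = rc s \<otimes>_{T.T} rc t" if st: "s : car T.T" "t : car T.T" for s t
  proof -
   have "rc (s \<otimes>_{T.T} t) = finprod T.T (%i. T.pt (?u i) (tensor_coord R M i s) \<otimes>_{T.T} T.pt (?u i) (tensor_coord R M i t)) I"
    unfolding rc_def
   proof (rule T.T.finprod_cong')
    show "T.pt (?u i) (tensor_coord R M i (s \<otimes>_{T.T} t)) = T.pt (?u i) (tensor_coord R M i s) \<otimes>_{T.T} T.pt (?u i) (tensor_coord R M i t)"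
     if "i : I" for i
     using hom_mult[OF hom(1) st, of i] T.pt_add_right[OF u[OF that] cc[OF st(1)] cc[OF st(2)]] by simp
   qed (use uc st in auto)
   also have "... = rc s \<otimes>_{T.T} rc t" unfolding rc_def by(rule T.T.finprod_multf) (use uc st in auto)
   finally show ?thesis .
  qed
 qed
 have rc: "rc t = t" if "t : car T.T" for t
 proof -
  have "rc t = (%t. t) t"
  proof (rule T.hom_eq_on_pure[OF T.T.is_group rch _ _ that])
   show "(%t. t) : hom T.T T.T" by(rule homI) auto
   fix x m assume x: "x : car X" and m: "m : car M"
   let ?S = "{i. x i ~= \<zero>_{op_ring R}}"
   have S: "finite ?S" "?S <= I" using x by(auto simp: X_def free_simps)
   have xu: "x i \<odot>_{X} ?u i : car X" if "i : I" for i using T.Y.smult_closed[of "x i", OF _ u[OF that]] xc[OF x] by simp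
   have pe: "T.pt (?u i) (x i \<odot>_{M} m) = T.pt (x i \<odot>_{X} ?u i) m" if "i : I" for i
    using T.pt_balanced[OF xc[OF x] u[OF that] m] by simp
   have "T.pt x m = T.pt (\<Oplus>_{X}i\<in>?S. x i \<odot>_{X} ?u i) m"
   proof -
    have "(%x. x) : module_hom (op_ring R) (free_module (op_ring R) I) X" by(rule module_homI) (simp_all add: X_def)
    from module_hom_expand[OF XM this x[unfolded X_def]] show ?thesis by(rule arg_cong[where f = "%x. T.pt x m"])
   qed
   also have "... = finprod T.T (%i. T.pt (x i \<odot>_{X} ?u i) m) ?S" by(rule pt_sum) (use S xu m in auto)
   also have "... = finprod T.T (%i. T.pt (x i \<odot>_{X} ?u i) m) I"
   proof (rule T.T.finprod_mono_neutral_cong_left[OF I S(2)])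
    show "T.pt (x i \<odot>_{X} ?u i) m = \<one>_{T.T}" if "i : I - ?S" for i
     using that pe[of i] m u by(simp add: M.smult_l_null)
   qed (use xu m in auto)
   also have "... = rc (T.pt x m)" unfolding rc_def
    by(rule T.T.finprod_cong') (use pe u xu xc[OF x] M.smult_closed m hom(2)[OF x m] in auto)
   finally show "rc (T.pt x m) = T.pt x m" by simp
  qed
  thus ?thesis by simp
 qed
 show "t = t'" if t: "t : car T.T" "t' : car T.T" and eq: "!!i. i : I ==> tensor_coord R M i t = tensor_coord R M i t'"
 proof -
  have "rc t = rc t'" unfolding rc_def by(rule T.T.finprod_cong') (use eq uc t in auto)
  thus ?thesis using rc t by simp
 qed
 show "EX t:car T.T. ALL i:I. tensor_coord R M i t = f i" if f: "!!i. i : I ==> f i : car M"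
 proof (intro bexI ballI)
  let ?t = "finprod T.T (%i. T.pt (?u i) (f i)) I"
  have fc: "T.pt (?u i) (f i) : car T.T" if "i : I" for i using u f that by simp
  show "?t : car T.T" by(rule T.T.finprod_closed) (use fc in auto)
  fix i assume i: "i : I"
  have "tensor_coord R M i (finprod T.T (%i. T.pt (?u i) (f i)) J) = (\<Oplus>_{M}j\<in>J. ?u j i \<odot>_{M} f j)"
   if "finite J" "J <= I" for J using that
  proof (induction J rule: finite_induct)
   case empty
   show ?case using hom_one[OF hom(1)[of i] T.T.is_group M.M.a_group] by simp
  next
   case (insert j J)
   have h: "(%i. T.pt (?u i) (f i)) : J \<rightarrow> car T.T" "T.pt (?u j) (f j) : car T.T" using insert.prems fc by auto
   have c: "?u j' i \<odot>_{M} f j' : car M" if "j' : I" for j' using M.smult_closed[OF xc[OF u[OF that]] f[OF that]] .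
   have c': "(%j. ?u j i \<odot>_{M} f j) : J \<rightarrow> car M" "?u j i \<odot>_{M} f j : car M" using c insert.prems by auto
   have "tensor_coord R M i (finprod T.T (%i. T.pt (?u i) (f i)) (insert j J))
     = tensor_coord R M i (T.pt (?u j) (f j)) \<oplus>_{M} tensor_coord R M i (finprod T.T (%i. T.pt (?u i) (f i)) J)"
    using hom_mult[OF hom(1)[of i] h(2) T.T.finprod_closed[OF h(1)]] T.T.finprod_insert[OF insert.hyps(1,2) h] by simp
   thus ?case using insert c' hom(2)[OF u f, of j j i] M.M.finsum_insert[OF insert.hyps(1,2) c'] by simp
  qed
  hence "tensor_coord R M i ?t = (\<Oplus>_{M}j\<in>I. ?u j i \<odot>_{M} f j)" using I by blast
  also have "... = (\<Oplus>_{M}j\<in>I. if i = j then f j else \<zero>_{M})"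
   by(rule M.M.add.finprod_cong') (use f in "auto simp: unit_vector_def M.smult_one M.smult_l_null")
  also have "... = f i" by(rule M.M.add.finprod_singleton) (use i f I in auto)
  finally show "tensor_coord R M i ?t = f i" .
 qed
qed

section \<open>The resolution over the path algebra\<close>

context fin_digraph
begin

abbreviation "arrow_sum M m == (\<Oplus>_{M}e\<in>arcs G. path_arr G e \<odot>_{M} m e)"
abbreviation "path_comb y == (\<Oplus>_{PA}e\<in>arcs G. path_arr G e \<otimes>_{PA} y e)"

abbreviation aug_row :: "('a,'b,'k::field) path_elem => 'a => 'k" where
 "aug_row x == (%v. lookup x (v, [], v))"

text \<open>A concatenation of paths is trivial only if both paths are.\<close>

lemma aug_row_mult: assumes "x : car PA" "y : car (PA :: ('a,'b,'k::field) path_elem ring)"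
 shows "aug_row (x \<otimes>_{PA} y) v = aug_row x v * aug_row y v"
proof -
 have x: "keys x <= paths G" and y: "keys y <= paths G" using assms by(auto simp: PA_simps)
 have s: "aug_row (bterm path_concat (u, p, w) (u', q, w') c c') v
   = aug_row (single (u, p, w) c) v * aug_row (single (u', q, w') c') v"
  if "(u, p, w) : paths G" "(u', q, w') : paths G" for u p w u' q w' and c c' :: 'k
  using that by(auto simp: bterm_def path_concat_def lookup_single when_def paths_iff awalk_Nil_iff)
 have "aug_row (bmul path_concat x y) v = aug_row x v * aug_row y v" using x
 proof (induction x rule: span_induct)
  case (single p c)
  show ?case using y
  proof (induction y rule: span_induct)
   case (single q d)
   thus ?case using s[of "fst p" "fst (snd p)" "snd (snd p)" "fst q" "fst (snd q)" "snd (snd q)" c d] \<open>p : paths G\<close>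
    by(simp add: bmul_single)
  qed (simp_all add: bmul_add_right lookup_add distrib_left)
 qed (simp_all add: bmul_add_left lookup_add distrib_right)
 thus ?thesis by(simp add: PA_simps)
qed

lemma left_module_augmentation:
 "left_module (op_ring PA) (augmentation_module G :: (('a,'b,'k::field) path_elem, 'a => 'k) module)"
proof -
 have "abelian_group (augmentation_module G :: (('a,'b,'k) path_elem,'a => 'k) module)"
 proof (rule abelian_groupI)
  show "EX y:car (augmentation_module G). y \<oplus>_{augmentation_module G} x = \<zero>_{augmentation_module G}"
   if "x : car (augmentation_module G :: (('a,'b,'k) path_elem,'a => 'k) module)" for x
   by(rule bexI[of _ "%v. - x v"]) (use that in "auto simp: augmentation_module_def")
 qed (auto simp: augmentation_module_def algebra_simps)
 moreover have "aug_row (\<one>_{PA} :: ('a,'b,'k) path_elem) v = 1" if "v : verts G" for v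
  using that by(simp add: PA_simps path_scalar_def lookup_sum lookup_single when_def)
 ultimately show ?thesis by(intro left_module.intro left_module_axioms.intro ring_op_ring ring_PA)
   (auto simp: augmentation_module_def PA_simps(5) aug_row_mult lookup_add fun_eq_iff algebra_simps)
qed

lemma pderiv_facts:
 fixes x :: "('a,'b,'k::field) path_elem" shows "x : car PA ==> pderiv e x : car PA"
  "path_vtx (head G e) \<otimes>_{PA} pderiv e x = pderiv e x"
  "x : car PA ==> (!!v. aug_row x v = 0) ==> x = (path_comb (%e. pderiv e x))"
  "(!!e. e : arcs G ==> y e : car PA) ==> e : arcs G ==>
   pderiv e (path_comb y) = path_vtx (head G e) \<otimes>_{PA} (y e :: ('a,'b,'k) path_elem)"
proof -
 interpret P: ring "PA :: ('a,'b,'k) path_elem ring" by(rule ring_PA)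
 have fs: "(\<Oplus>_{PA}i\<in>I. f i) = (\<Sum>i\<in>I. f i)" if "finite I" "!!i. i : I ==> f i : car PA"
  for f :: "'b => ('a,'b,'k) path_elem" and I
  using that by(induction I rule: finite_induct) (auto simp: PA_simps(4,5))
 show c: "x : car PA ==> pderiv e x : car PA" for x :: "('a,'b,'k) path_elem" and e using keys_pderiv by(auto simp: PA_simps)
 show "path_vtx (head G e) \<otimes>_{PA} pderiv e x = pderiv e x" by(simp add: PA_simps vtx_pderiv)
 show "x = (path_comb (%e. pderiv e x))" if x: "x : car PA" "!!v. aug_row x v = 0"
 proof -
  have k: "keys x <= paths G" using x(1) by(simp add: PA_simps)
  have "(path_comb (%e. pderiv e x)) = (\<Sum>e\<in>arcs G. path_arr G e \<otimes>_{PA} pderiv e x)"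
   by(rule fs) (use c[OF x(1)] in auto)
  thus ?thesis using path_decompose[OF k] lookup_ptriv[OF k] x(2) by(simp add: PA_simps(2))
 qed
 show "pderiv e (path_comb y) = path_vtx (head G e) \<otimes>_{PA} y e"
  if y: "!!e. e : arcs G ==> y e : car PA" and e: "e : arcs G"
 proof -
  have "(path_comb y) = (\<Sum>e\<in>arcs G. path_arr G e \<otimes>_{PA} y e)"
   by(rule fs) (use y in auto)
  hence "pderiv e (path_comb y) = (\<Sum>e'\<in>arcs G. pderiv e (path_arr G e' \<otimes>_{PA} y e'))"
   by(simp add: pderiv_sum)
  also have "... = (\<Sum>e'\<in>arcs G. if e = e' then path_vtx (head G e) \<otimes>_{PA} y e' else 0)"
   by(rule sum.cong) (use y in "auto simp: PA_simps pderiv_arr_mult")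
  also have "... = path_vtx (head G e) \<otimes>_{PA} y e" using e by simp
  finally show ?thesis .
 qed
qed

text \<open>
 \<open>P(E)p\<close> with \<open>p = path_vtx (head G e)\<close> is a summand of the free module \<open>P(E)\<close>, not free itself; the
 free resolution continues it by multiplying alternately with \<open>1 - p\<close> and \<open>p\<close>.
\<close>

definition res_basis :: "'i => ('b => 'i) => nat => 'i set" where
 "res_basis i0 ix n = (if n = 0 then {i0} else ix ` arcs G)"

text \<open>The parity starts with 1 - p because the first differential, the sum of e x_e, has as
  kernel the families with p x_e = 0, where p is the head of e.\<close>

definition res_factor :: "nat => 'b => ('a,'b,'k::field) path_elem" where
 "res_factor n e = (if even n then \<one>_{PA} \<ominus>_{PA} path_vtx (head G e) else path_vtx (head G e))"

text \<open>The injection \<open>ix\<close> transports the basis indexed by arrows to an arbitrary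
  index type, since \<open>chosen_resolution\<close> prescribes lists as indices; \<open>i0\<close>
  indexes the one basis vector in degree 0.\<close>

definition res_map :: "'i => ('b => 'i) => nat => ('i => ('a,'b,'k::field) path_elem) => 'i => ('a,'b,'k) path_elem" where
 "res_map i0 ix n x = (case n of
  0 => (%i. if i = i0 then \<Oplus>_{PA}e\<in>arcs G. path_arr G e \<otimes>_{PA} x (ix e) else \<zero>_{PA})
 | Suc m => (%i. if i : ix ` arcs G then res_factor m (the_inv_into (arcs G) ix i) \<otimes>_{PA} x i else \<zero>_{PA}))"

lemma res_factor: assumes "e : arcs G"
 shows "(res_factor n e :: ('a,'b,'k::field) path_elem) : car PA"
  "res_factor n e \<otimes>_{PA} res_factor (Suc n) e = (\<zero>_{PA} :: ('a,'b,'k) path_elem)"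
  "res_factor n e \<oplus>_{PA} res_factor (Suc n) e = (\<one>_{PA} :: ('a,'b,'k) path_elem)"
  "res_factor 0 e \<otimes>_{PA} path_vtx (head G e) = (\<zero>_{PA} :: ('a,'b,'k) path_elem)"
  "path_vtx (head G e) \<otimes>_{PA} res_factor 0 e = (\<zero>_{PA} :: ('a,'b,'k) path_elem)"
  "path_arr G e \<otimes>_{PA} res_factor 0 e = (\<zero>_{PA} :: ('a,'b,'k) path_elem)"
proof -
 interpret P: ring "PA :: ('a,'b,'k) path_elem ring" by(rule ring_PA)
 have h: "head G e : verts G" using assms by simp
 have p: "path_vtx (head G e) : car (PA :: ('a,'b,'k) path_elem ring)" using h by simp
 have pp: "path_vtx (head G e) \<otimes>_{PA} path_vtx (head G e) = (path_vtx (head G e) :: ('a,'b,'k) path_elem)"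
  by(simp add: PA_simps) (simp add: path_vtx_def bmul_single bterm_def path_concat_def)
 have ap: "path_arr G e \<otimes>_{PA} path_vtx (head G e) = (path_arr G e :: ('a,'b,'k) path_elem)"
  by(simp add: PA_simps) (simp add: path_vtx_def path_arr_def bmul_single bterm_def path_concat_def)
 have a: "path_arr G e : car (PA :: ('a,'b,'k) path_elem ring)" using assms by simp
 show "(res_factor n e :: ('a,'b,'k) path_elem) : car PA" using p by(simp add: res_factor_def)
 show "res_factor 0 e \<otimes>_{PA} path_vtx (head G e) = (\<zero>_{PA} :: ('a,'b,'k) path_elem)"
  "path_vtx (head G e) \<otimes>_{PA} res_factor 0 e = (\<zero>_{PA} :: ('a,'b,'k) path_elem)"
  "path_arr G e \<otimes>_{PA} res_factor 0 e = (\<zero>_{PA} :: ('a,'b,'k) path_elem)"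
  using p pp a ap by(simp_all add: res_factor_def P.minus_eq P.l_distr P.r_distr P.l_minus P.r_minus P.r_neg)
 show "res_factor n e \<otimes>_{PA} res_factor (Suc n) e = (\<zero>_{PA} :: ('a,'b,'k) path_elem)"
  using p pp by(simp add: res_factor_def P.minus_eq P.l_distr P.r_distr P.l_minus P.r_minus P.r_neg)
 show "res_factor n e \<oplus>_{PA} res_factor (Suc n) e = (\<one>_{PA} :: ('a,'b,'k) path_elem)"
  using p P.add_minus_cancel[of "path_vtx (head G e)" "\<one>_{PA}"] P.a_comm[of "path_vtx (head G e)" "\<one>_{PA} \<ominus>_{PA} path_vtx (head G e)"]
  by(auto simp: res_factor_def)
qed

context
 fixes i0 :: 'i and ix :: "'b => 'i" assumes ix: "inj_on ix (arcs G)"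
begin

abbreviation RF :: "nat => (('a,'b,'k::field) path_elem, 'i => ('a,'b,'k) path_elem) module" where
 "RF n == free_module (op_ring PA) (res_basis i0 ix n)"

lemma RF_simps:
 "x : car (RF 0 :: (('a,'b,'k::field) path_elem, 'i => ('a,'b,'k) path_elem) module)
  <-> (ALL i. x i : car (PA :: ('a,'b,'k) path_elem ring)) & (ALL i. i ~= i0 --> x i = \<zero>_{PA})"
 "x : car (RF (Suc n) :: (('a,'b,'k::field) path_elem, 'i => ('a,'b,'k) path_elem) module)
  <-> (ALL i. x i : car (PA :: ('a,'b,'k) path_elem ring)) & (ALL i. i ~: ix ` arcs G --> x i = \<zero>_{PA})"
proof -
 interpret P: ring "PA :: ('a,'b,'k) path_elem ring" by(rule ring_PA)
 have *: "x : car (free_module (op_ring PA) J) <-> (ALL i. x i : car PA) & (ALL i. i ~: J --> x i = \<zero>_{PA})"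
  if "finite J" for J :: "'i set" and x :: "'i => ('a,'b,'k) path_elem"
 proof -
  have "finite {i. x i ~= \<zero>_{PA}}" if "ALL i. i ~: J --> x i = \<zero>_{PA}"
   by(rule finite_subset[OF _ \<open>finite J\<close>]) (use that in auto)
  thus ?thesis using P.zero_closed by(auto simp: free_simps)
 qed
 show "x : car (RF 0) <-> (ALL i. x i : car PA) & (ALL i. i ~= i0 --> x i = \<zero>_{PA})" for x :: "'i => ('a,'b,'k) path_elem"
  using *[of "{i0}" x] by(simp add: res_basis_def)
 show "x : car (RF (Suc n)) <-> (ALL i. x i : car PA) & (ALL i. i ~: ix ` arcs G --> x i = \<zero>_{PA})" for x :: "'i => ('a,'b,'k) path_elem"
  using *[of "ix ` arcs G" x] by(simp add: res_basis_def)
qed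

lemma res_map_simps:
 "res_map i0 ix 0 x = (%i. if i = i0 then \<Oplus>_{PA}e\<in>arcs G. path_arr G e \<otimes>_{PA} x (ix e) else \<zero>_{PA})"
 "e : arcs G ==> res_map i0 ix (Suc n) x (ix e) = res_factor n e \<otimes>_{PA} x (ix e)"
 "i ~: ix ` arcs G ==> res_map i0 ix (Suc n) x i = \<zero>_{PA}"
 by(auto simp: res_map_def the_inv_into_f_f[OF ix])

lemma res_map_hom:
 "res_map i0 ix n : module_hom (op_ring PA) (RF (Suc n)) (RF n :: (('a,'b,'k::field) path_elem, 'i => ('a,'b,'k) path_elem) module)"
proof -
 interpret P: ring "PA :: ('a,'b,'k) path_elem ring" by(rule ring_PA)
 show ?thesis
 proof (cases n)
  case 0
  have ac: "path_arr G e \<otimes>_{PA} x (ix e) : car (PA :: ('a,'b,'k) path_elem ring)" if "x : car (RF (Suc 0))" "e : arcs G" for x e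
   using that unfolding RF_simps by simp
  show ?thesis unfolding 0
  proof (rule module_homI)
   fix x assume x: "x : car (RF (Suc 0) :: (('a,'b,'k) path_elem,'i => ('a,'b,'k) path_elem) module)"
   show "res_map i0 ix 0 x : car (RF 0)"
    unfolding RF_simps(1) res_map_simps using ac[OF x] by(auto intro!: P.finsum_closed)
   fix y assume y: "y : car (RF (Suc 0) :: (('a,'b,'k) path_elem,'i => ('a,'b,'k) path_elem) module)"
   have "(\<Oplus>_{PA}e\<in>arcs G. path_arr G e \<otimes>_{PA} (x (ix e) \<oplus>_{PA} y (ix e)))
     = (\<Oplus>_{PA}e\<in>arcs G. path_arr G e \<otimes>_{PA} x (ix e) \<oplus>_{PA} path_arr G e \<otimes>_{PA} y (ix e))"
    by(rule P.add.finprod_cong') (use x y ac in "auto simp: RF_simps P.r_distr")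
   also have "... = (path_comb (%e. x (ix e))) \<oplus>_{PA} (path_comb (%e. y (ix e)))"
    by(rule P.finsum_addf) (use x y ac in auto)
   finally show "res_map i0 ix 0 (x \<oplus>_{RF (Suc 0)} y) = res_map i0 ix 0 x \<oplus>_{RF 0} res_map i0 ix 0 y"
    by(auto simp: res_map_simps free_simps(3))
  next
   fix a x assume a: "a : car (op_ring (PA :: ('a,'b,'k) path_elem ring))"
    and x: "x : car (RF (Suc 0) :: (('a,'b,'k) path_elem,'i => ('a,'b,'k) path_elem) module)"
   have "(path_comb (%e. x (ix e))) \<otimes>_{PA} a = (\<Oplus>_{PA}e\<in>arcs G. (path_arr G e \<otimes>_{PA} x (ix e)) \<otimes>_{PA} a)"
    by(rule P.finsum_ldistr) (use a x ac in auto)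
   also have "... = (\<Oplus>_{PA}e\<in>arcs G. path_arr G e \<otimes>_{PA} (x (ix e) \<otimes>_{PA} a))"
    by(rule P.add.finprod_cong') (use a x in "auto simp: RF_simps P.m_assoc")
   finally show "res_map i0 ix 0 (a \<odot>_{RF (Suc 0)} x) = a \<odot>_{RF 0} res_map i0 ix 0 x"
    using a by(auto simp: res_map_simps free_simps(4))
  qed
 next
  case (Suc m)
  have val: "res_map i0 ix (Suc m) x i = (if i : ix ` arcs G then res_factor m (the_inv_into (arcs G) ix i) \<otimes>_{PA} x i else \<zero>_{PA})"
   for x :: "'i => ('a,'b,'k) path_elem" and i by(simp add: res_map_def)
  have rf: "res_factor m (the_inv_into (arcs G) ix i) : car (PA :: ('a,'b,'k) path_elem ring)" if "i : ix ` arcs G" for i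
   by(rule res_factor(1)) (use the_inv_into_into[OF ix that subset_refl] in simp)
  show ?thesis unfolding Suc by(rule module_homI)
    (use rf in "auto simp: RF_simps val free_simps(3,4) P.r_distr P.m_assoc fun_eq_iff")
 qed
qed

text \<open>An element without trivial part is the sum of e times its derivative along e, which
  settles the image of the first differential; the derivatives also determine its kernel. Beyond
  that the two factors at an arrow are complementary orthogonal idempotents, so the kernel of
  multiplying by one is the image of multiplying by the other.\<close>

lemma periodic_resolution:
 "free_resolution (op_ring PA) (augmentation_module G :: (('a,'b,'k::field) path_elem, 'a => 'k) module)
  (res_basis i0 ix) (res_map i0 ix) (%x. aug_row (x i0))"
proof -
 interpret P: ring "PA :: ('a,'b,'k) path_elem ring" by(rule ring_PA)
 note rf = res_factor[where 'k = 'k]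
 let ?N = "augmentation_module G :: (('a,'b,'k) path_elem,'a => 'k) module"
 let ?R = "%n. RF n :: (('a,'b,'k) path_elem,'i => ('a,'b,'k) path_elem) module"
 have out: "aug_row x v = 0" if "x : car (PA :: ('a,'b,'k) path_elem ring)" "v ~: verts G" for x v
  using that by(auto simp: PA_simps paths_iff in_keys_iff awalk_Nil_iff subset_iff)
 have mc: "res_map i0 ix n x : car (?R n)" if "x : car (?R (Suc n))" for n x
  using res_map_hom[of n, where 'k = 'k] that by(auto simp: module_hom_def hom_def)
 have eps: "(%x. aug_row (x i0)) : module_hom (op_ring PA) (?R 0) ?N"
  by(rule module_homI) (auto simp: RF_simps free_simps(3,4) augmentation_module_def PA_simps(5) lookup_add out aug_row_mult)
 have surj: "(%x. aug_row (x i0)) ` car (?R 0) = car ?N"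
 proof
  show "(%x. aug_row (x i0)) ` car (?R 0) <= car ?N" using eps by(auto simp: module_hom_def hom_def)
  show "car ?N <= (%x. aug_row (x i0)) ` car (?R 0)"
  proof
   fix c assume c: "c : car ?N"
   define a :: "('a,'b,'k) path_elem" where "a = (\<Sum>v\<in>verts G. single (v, [], v) (c v))"
   have a: "a : car PA"
    unfolding PA_simps a_def by(rule CollectI, rule order_trans[OF keys_sum], rule UN_least) (auto simp: paths_iff awalk_Nil_iff)
   have ac: "aug_row a = c"
    using c by(auto simp: a_def lookup_sum lookup_single when_def augmentation_module_def)
   have "(%i. if i = i0 then a else \<zero>_{PA}) : car (?R 0)" unfolding RF_simps(1) using a by auto
   thus "c : (%x. aug_row (x i0)) ` car (?R 0)" by(rule rev_image_eqI) (simp add: ac)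
  qed
 qed
 have ker0: "a_kernel (?R 0) ?N (%x. aug_row (x i0)) = {x : car (?R 0). ALL v. aug_row (x i0) v = 0}"
  by(auto simp: a_kernel_eq augmentation_module_def fun_eq_iff)
 have d0: "res_map i0 ix 0 ` car (?R (Suc 0)) = a_kernel (?R 0) ?N (%x. aug_row (x i0))"
  unfolding ker0
 proof
  show "res_map i0 ix 0 ` car (?R (Suc 0)) <= {x : car (?R 0). ALL v. aug_row (x i0) v = 0}"
  proof (intro image_subsetI CollectI conjI allI)
   fix x v assume x: "x : car (?R (Suc 0))"
   thus "res_map i0 ix 0 x : car (?R 0)" by(rule mc)
   have xc: "x i : car PA" for i using x by(simp add: RF_simps)
   have sg: "subgroup {y : car PA. aug_row y v = 0} (add_monoid (PA :: ('a,'b,'k) path_elem ring))"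
   proof (rule P.subgrpI)
    show "\<ominus>_{PA} y : {y : car PA. aug_row y v = 0}" if "y : {y : car PA. aug_row y v = 0}" for y :: "('a,'b,'k) path_elem"
    proof -
     have y: "y : car PA" "aug_row y v = 0" using that by auto
     have "y \<oplus>_{PA} (\<ominus>_{PA} y) = \<zero>_{PA}" using y by(simp add: P.r_neg)
     hence "aug_row y v + aug_row (\<ominus>_{PA} y) v = 0" unfolding PA_simps(4,5) by(simp flip: lookup_add)
     thus ?thesis using y by simp
    qed
    show "\<zero>_{PA} : {y : car (PA :: ('a,'b,'k) path_elem ring). aug_row y v = 0}" using P.zero_closed by(simp add: PA_simps(4))
    show "y \<oplus>_{PA} z : {y : car PA. aug_row y v = 0}"
     if "y : {y : car PA. aug_row y v = 0}" "z : {y : car PA. aug_row y v = 0}" for y z :: "('a,'b,'k) path_elem"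
     using that P.a_closed[of y z] by(simp add: PA_simps(5) lookup_add)
   qed blast
   have "path_arr G e \<otimes>_{PA} x (ix e) : {y : car PA. aug_row y v = 0}" if "e : arcs G" for e
   proof -
    have "aug_row (path_arr G e :: ('a,'b,'k) path_elem) v = 0" by(simp add: path_arr_def lookup_single when_def)
    thus ?thesis using that xc[of "ix e"] aug_row_mult[of "path_arr G e" "x (ix e)" v] by simp
   qed
   hence "(path_comb (%e. x (ix e))) : {y : car PA. aug_row y v = 0}" by(rule P.sub_finsum[OF sg])
   thus "aug_row (res_map i0 ix 0 x i0) v = 0" by(simp add: res_map_simps)
  qed
  show "{x : car (?R 0). ALL v. aug_row (x i0) v = 0} <= res_map i0 ix 0 ` car (?R (Suc 0))"
  proof
   fix x assume "x : {x : car (?R 0). ALL v. aug_row (x i0) v = 0}"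
   hence x: "x i0 : car PA" "!!v. aug_row (x i0) v = 0" "!!i. i ~= i0 ==> x i = \<zero>_{PA}" by(auto simp: RF_simps)
   define y where "y i = (if i : ix ` arcs G then pderiv (the_inv_into (arcs G) ix i) (x i0) else \<zero>_{PA})" for i
   have ye: "y (ix e) = pderiv e (x i0)" if "e : arcs G" for e using that by(simp add: y_def the_inv_into_f_f[OF ix])
   have yc: "y : car (?R (Suc 0))" unfolding RF_simps(2) using pderiv_facts(1)[OF x(1)] by(auto simp: y_def)
   have "(path_comb (%e. y (ix e))) = (path_comb (%e. pderiv e (x i0)))"
    by(rule P.add.finprod_cong') (use ye pderiv_facts(1)[OF x(1)] in auto)
   hence "(path_comb (%e. y (ix e))) = x i0" using pderiv_facts(3)[OF x(1,2)] by simp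
   hence "res_map i0 ix 0 y = x" using x(3) by(auto simp: res_map_simps fun_eq_iff)
   thus "x : res_map i0 ix 0 ` car (?R (Suc 0))" using yc by blast
  qed
 qed
 have zR: "\<zero>_{?R n} = (%i. \<zero>_{PA})" for n by(simp add: free_simps)
 have ds: "res_map i0 ix (Suc n) ` car (?R (Suc (Suc n))) = a_kernel (?R (Suc n)) (?R n) (res_map i0 ix n)" for n
 proof
  show "res_map i0 ix (Suc n) ` car (?R (Suc (Suc n))) <= a_kernel (?R (Suc n)) (?R n) (res_map i0 ix n)"
  proof (intro image_subsetI)
   fix y assume y: "y : car (?R (Suc (Suc n)))"
   let ?x = "res_map i0 ix (Suc n) y"
   have yc: "y i : car PA" for i using y by(simp add: RF_simps)
   have xe: "?x (ix e) = res_factor n e \<otimes>_{PA} y (ix e)" if "e : arcs G" for e using res_map_simps(2)[OF that] .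
   have "res_map i0 ix n ?x = (%i. \<zero>_{PA})"
   proof (cases n)
    case 0
    have "(path_comb (%e. ?x (ix e))) = (\<Oplus>_{PA}e\<in>arcs G. \<zero>_{PA :: ('a,'b,'k) path_elem ring})"
    proof (rule P.add.finprod_cong')
     fix e assume e: "e : arcs G"
     have "path_arr G e \<otimes>_{PA} ?x (ix e) = (path_arr G e \<otimes>_{PA} res_factor 0 e) \<otimes>_{PA} y (ix e)"
      using xe[OF e] e yc rf(1)[OF e] 0 by(simp add: P.m_assoc)
     thus "path_arr G e \<otimes>_{PA} ?x (ix e) = \<zero>_{PA}" using rf(6)[OF e] yc by simp
    qed auto
    thus ?thesis unfolding 0 by(simp add: res_map_simps(1) fun_eq_iff)
   next
    case (Suc m)
    show ?thesis
    proof
     fix i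
     show "res_map i0 ix n ?x i = \<zero>_{PA}"
     proof (cases "i : ix ` arcs G")
      case True
      then obtain e where e: "e : arcs G" "i = ix e" by blast
      have "res_map i0 ix n ?x i = (res_factor m e \<otimes>_{PA} res_factor (Suc m) e) \<otimes>_{PA} y (ix e)"
       using xe[OF e(1)] e yc rf(1)[OF e(1)] Suc by(simp add: res_map_simps P.m_assoc)
      thus ?thesis using rf(2)[OF e(1), of m] yc by simp
     qed (simp add: Suc res_map_simps)
    qed
   qed
   thus "?x : a_kernel (?R (Suc n)) (?R n) (res_map i0 ix n)"
    using mc[OF y] by(simp add: a_kernel_eq zR)
  qed
  show "a_kernel (?R (Suc n)) (?R n) (res_map i0 ix n) <= res_map i0 ix (Suc n) ` car (?R (Suc (Suc n)))"
  proof
   fix x assume "x : a_kernel (?R (Suc n)) (?R n) (res_map i0 ix n)"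
   hence x: "x : car (?R (Suc n))" "res_map i0 ix n x = (%i. \<zero>_{PA})" by(auto simp: a_kernel_eq zR)
   have xc: "x i : car PA" "i ~: ix ` arcs G ==> x i = \<zero>_{PA}" for i using x(1) by(auto simp: RF_simps)
   \<comment> \<open>A cycle is fixed by the next factor and is therefore its own preimage: for n =
     0 since differentiating the vanishing sum gives p x = 0, later since the complementary factor
     kills it.\<close>
   have fx: "res_factor n e \<otimes>_{PA} x (ix e) = x (ix e)" if e: "e : arcs G" for e
   proof (cases n)
    case 0
    have "(path_comb (%e. x (ix e))) = \<zero>_{PA}"
     using fun_cong[OF x(2), of i0] 0 by(simp add: res_map_simps)
    hence "path_vtx (head G e) \<otimes>_{PA} x (ix e) = \<zero>_{PA}"
     using pderiv_facts(4)[of "%e. x (ix e)", OF xc(1) e] by(simp add: PA_simps(4))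
    thus ?thesis using xc(1)[of "ix e"] e 0 by(simp add: res_factor_def P.minus_eq P.l_distr P.l_minus)
   next
    case (Suc m)
    have "res_factor m e \<otimes>_{PA} x (ix e) = \<zero>_{PA}"
     using fun_cong[OF x(2), of "ix e"] Suc e by(simp add: res_map_simps)
    moreover have "(res_factor m e \<oplus>_{PA} res_factor (Suc m) e) \<otimes>_{PA} x (ix e) = x (ix e)"
     using rf(3)[OF e, of m] xc(1) by simp
    ultimately show ?thesis
     using P.l_distr[OF rf(1)[OF e, of m] rf(1)[OF e, of "Suc m"] xc(1)[of "ix e"]] rf(1)[OF e, of "Suc m"] xc(1)[of "ix e"] Suc by simp
   qed
   have "res_map i0 ix (Suc n) x i = x i" for i
    by(cases "i : ix ` arcs G") (use fx xc(2)[of i] in "auto simp: res_map_simps")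
   hence "x = res_map i0 ix (Suc n) x" by(intro ext) simp
   moreover have "x : car (?R (Suc (Suc n)))" using xc by(auto simp: RF_simps)
   ultimately show "x : res_map i0 ix (Suc n) ` car (?R (Suc (Suc n)))" by(rule image_eqI)
  qed
 qed
 show ?thesis unfolding free_resolution_def using eps surj res_map_hom d0 ds by blast
qed

end

end

section \<open>Tor of the augmentation module\<close>

context fin_digraph
begin

text \<open>In coordinates the complex is M, followed by one copy of M per arrow in each higher
  degree. Exactness in degree 0 is surjectivity of the arrow sum; in degree 1 it says that a family
  with zero arrow sum has components of the form (1 - p) m; above that it is automatic from the
  idempotents.\<close>

lemma periodic_exact_iff:
 fixes M :: "(('a,'b,'k::field) path_elem, 'm) module" and i0 :: 'i
 assumes M: "left_module PA M" and ix: "inj_on ix (arcs G)"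
 defines "ex == resolution_tensor.exact_at PA M (res_basis i0 ix) (res_map i0 ix)"
 shows "ex 0 <-> (ALL x:car M. EX m. (ALL e:arcs G. m e : car M) & x = (arrow_sum M m))"
  "ex 1 <-> (ALL m. (ALL e:arcs G. m e : car M) & (arrow_sum M m) = \<zero>_{M}
   --> (ALL e:arcs G. path_vtx (head G e) \<odot>_{M} m e = \<zero>_{M}))"
  "ex (Suc (Suc n))"
proof -
 interpret M: left_module PA M by fact
 let ?N = "augmentation_module G :: (('a,'b,'k) path_elem,'a => 'k) module"
 interpret N: left_module "op_ring PA" ?N by(rule left_module_augmentation)
 interpret X: resolution_tensor PA M ?N "res_basis i0 ix" "res_map i0 ix" "%x. aug_row (x i0)"
  by unfold_locales (rule periodic_resolution[OF ix])
 let ?B = "res_basis i0 ix"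
 have fB: "finite (?B n)" for n by(simp add: res_basis_def)
 have B: "i0 : ?B 0" "e : arcs G ==> ix e : ?B (Suc n)" for e n by(simp_all add: res_basis_def)
 note tc = tensor_coord[OF M fB]
 note rf = res_factor[where 'k = 'k]
 define c where "c e = tensor_coord PA M (ix e)" for e
 define c0 where "c0 = tensor_coord PA M i0"
 have c_closed: "c e z : car M" if "e : arcs G" "z : car (X.T (Suc n))" for e z n
  using tc(1)[OF B(2)[OF that(1)], of n] that(2) unfolding c_def by(auto simp: hom_def)
 have c0_closed: "c0 z : car M" if "z : car (X.T 0)" for z
  using tc(1)[OF B(1)] that unfolding c0_def by(auto simp: hom_def)
 have c_eq: "z = w" if "z : car (X.T (Suc n))" "w : car (X.T (Suc n))" "!!e. e : arcs G ==> c e z = c e w" for z w n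
  by(rule tc(3)[OF that(1,2)]) (use that(3) in "auto simp: res_basis_def c_def")
 have c0_eq: "z = w" if "z : car (X.T 0)" "w : car (X.T 0)" "c0 z = c0 w" for z w
  by(rule tc(3)[OF that(1,2)]) (use that(3) in "auto simp: res_basis_def c0_def")
 have c_ex: "EX z:car (X.T (Suc n)). ALL e:arcs G. c e z = m e" if m: "!!e. e : arcs G ==> m e : car M" for m n
 proof -
  have "EX z:car (X.T (Suc n)). ALL i:?B (Suc n). tensor_coord PA M i z = m (the_inv_into (arcs G) ix i)"
   by(rule tc(4)) (use m the_inv_into_f_f[OF ix] in "auto simp: res_basis_def")
  thus ?thesis using the_inv_into_f_f[OF ix] by(auto simp: res_basis_def c_def)
 qed
 have c0_ex: "EX z:car (X.T 0). c0 z = x" if "x : car M" for x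
  using tc(4)[of 0 "%_. x"] that B(1) unfolding c0_def by blast
 have xc: "x i : car PA" if "x : car (X.F n)" for x i n
  using that by(cases n) (auto simp: RF_simps[OF ix] simp del: One_nat_def)
 have ac: "path_arr G e \<odot>_{M} m : car M" if "e : arcs G" "m : car M" for e m
  using M.smult_closed that by simp
 \<comment> \<open>The differentials in coordinates, here the arrow sum and in \<open>DS\<close>
   multiplication by a factor; both are additive, so pure tensors decide.\<close>
 have D0: "c0 (X.D 0 z) = (arrow_sum M (%e. c e z))" if z: "z : car (X.T (Suc 0))" for z
 proof -
  have "(%z. c0 (X.D 0 z)) z = (%z. \<Oplus>_{M}e\<in>arcs G. path_arr G e \<odot>_{M} c e z) z"
  proof (rule X.TP.hom_eq_on_pure[OF M.M.a_group _ _ _ z])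
   show "(%z. c0 (X.D 0 z)) : hom (X.T (Suc 0)) (add_monoid M)"
    using hom_compose[OF X.D_hom(1)[of 0] tc(1)[OF B(1)]] by(simp add: comp_def c0_def)
   show "(%z. \<Oplus>_{M}e\<in>arcs G. path_arr G e \<odot>_{M} c e z) : hom (X.T (Suc 0)) (add_monoid M)"
   proof (rule homI)
    show "(arrow_sum M (%e. c e z)) : car (add_monoid M)" if "z : car (X.T (Suc 0))" for z
     using ac c_closed that by(auto intro!: M.M.finsum_closed)
    fix z w assume z: "z : car (X.T (Suc 0))" and w: "w : car (X.T (Suc 0))"
    have "(\<Oplus>_{M}e\<in>arcs G. path_arr G e \<odot>_{M} c e (z \<otimes>_{X.T (Suc 0)} w))
      = (\<Oplus>_{M}e\<in>arcs G. path_arr G e \<odot>_{M} c e z \<oplus>_{M} path_arr G e \<odot>_{M} c e w)"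
    proof (rule M.M.add.finprod_cong')
     fix e assume e: "e : arcs G"
     have "c e (z \<otimes>_{X.T (Suc 0)} w) = c e z \<oplus>_{M} c e w" using hom_mult[OF tc(1)[OF B(2)[OF e]] z w] by(simp add: c_def)
     thus "path_arr G e \<odot>_{M} c e (z \<otimes>_{X.T (Suc 0)} w) = path_arr G e \<odot>_{M} c e z \<oplus>_{M} path_arr G e \<odot>_{M} c e w"
      using M.smult_r_distr[of "path_arr G e"] e c_closed[OF e z] c_closed[OF e w] by simp
    qed (use ac c_closed[OF _ z] c_closed[OF _ w] in auto)
    also have "... = (arrow_sum M (%e. c e z)) \<oplus>_{M} (arrow_sum M (%e. c e w))"
     by(rule M.M.finsum_addf) (use ac c_closed[OF _ z] c_closed[OF _ w] in auto)
    finally show "(\<Oplus>_{M}e\<in>arcs G. path_arr G e \<odot>_{M} c e (z \<otimes>_{X.T (Suc 0)} w))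
      = (arrow_sum M (%e. c e z)) \<otimes>_{add_monoid M} (arrow_sum M (%e. c e w))" by simp
   qed
   fix x m assume x: "x : car (X.F (Suc 0))" and m: "m : car M"
   have pc: "path_arr G e \<otimes>_{PA} x (ix e) : car PA" if "e : arcs G" for e using xc[OF x] that by simp
   have "c0 (X.D 0 (pure_tensor PA (X.F (Suc 0)) M x m)) = res_map i0 ix 0 x i0 \<odot>_{M} m"
    using X.D_hom(2)[OF x m] tc(2)[OF B(1) X.dD(1)[OF x] m] by(simp add: c0_def)
   also have "... = (\<Oplus>_{M}e\<in>arcs G. (path_arr G e \<otimes>_{PA} x (ix e)) \<odot>_{M} m)"
    using M.smult_finsum_l[OF m pc] by(simp add: res_map_simps[OF ix])
   also have "... = (\<Oplus>_{M}e\<in>arcs G. path_arr G e \<odot>_{M} c e (pure_tensor PA (X.F (Suc 0)) M x m))"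
   proof (rule M.M.add.finprod_cong')
    fix e assume e: "e : arcs G"
    have "c e (pure_tensor PA (X.F (Suc 0)) M x m) = x (ix e) \<odot>_{M} m" using tc(2)[OF B(2)[OF e] x m] by(simp add: c_def)
    thus "(path_arr G e \<otimes>_{PA} x (ix e)) \<odot>_{M} m = path_arr G e \<odot>_{M} c e (pure_tensor PA (X.F (Suc 0)) M x m)"
     using M.smult_assoc[of "path_arr G e" "x (ix e)" m] xc[OF x] e m by simp
   qed (use ac c_closed[OF _ X.TP.pt_closed[OF x m]] in auto)
   finally show "c0 (X.D 0 (pure_tensor PA (X.F (Suc 0)) M x m)) = (\<Oplus>_{M}e\<in>arcs G. path_arr G e \<odot>_{M} c e (pure_tensor PA (X.F (Suc 0)) M x m))" .
  qed
  thus ?thesis by simp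
 qed
 have DS: "c e (X.D (Suc n) z) = res_factor n e \<odot>_{M} c e z" if e: "e : arcs G" and z: "z : car (X.T (Suc (Suc n)))" for e z n
 proof -
  have "(%z. c e (X.D (Suc n) z)) z = (%z. res_factor n e \<odot>_{M} c e z) z"
  proof (rule X.TP.hom_eq_on_pure[OF M.M.a_group _ _ _ z])
   show "(%z. c e (X.D (Suc n) z)) : hom (X.T (Suc (Suc n))) (add_monoid M)"
    using hom_compose[OF X.D_hom(1)[of "Suc n"] tc(1)[OF B(2)[OF e]]] by(simp add: comp_def c_def)
   show "(%z. res_factor n e \<odot>_{M} c e z) : hom (X.T (Suc (Suc n))) (add_monoid M)"
    using tc(1)[OF B(2)[OF e], of "Suc n"] c_closed[OF e, of _ "Suc n"] rf(1)[OF e] M.smult_closed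
    by(intro homI) (auto simp: c_def hom_def M.smult_r_distr)
   fix x m assume x: "x : car (X.F (Suc (Suc n)))" and m: "m : car M"
   show "c e (X.D (Suc n) (pure_tensor PA (X.F (Suc (Suc n))) M x m)) = res_factor n e \<odot>_{M} c e (pure_tensor PA (X.F (Suc (Suc n))) M x m)"
    using X.D_hom(2)[OF x m] tc(2)[OF B(2)[OF e] X.dD(1)[OF x] m] tc(2)[OF B(2)[OF e] x m] res_map_simps(2)[OF ix e, where n = n and x = x]
     M.smult_assoc[OF rf(1)[OF e] xc[OF x] m, of n "ix e"] by(simp add: c_def)
  qed
  thus ?thesis by simp
 qed
 have Dc: "X.D n z : car (X.T n)" if "z : car (X.T (Suc n))" for n z using X.D_hom(1)[of n] that by(auto simp: hom_def)
 have c_one: "c e \<one>_{X.T (Suc n)} = \<zero>_{M}" "c0 \<one>_{X.T 0} = \<zero>_{M}" if "e : arcs G" for e n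
  using hom_one[OF tc(1)[OF B(2)[OF that]] X.TP.T.is_group M.M.a_group, of n] hom_one[OF tc(1)[OF B(1)] X.TP.T.is_group M.M.a_group]
  by(simp_all add: c_def c0_def)
 have c0_one: "c0 \<one>_{X.T 0} = \<zero>_{M}"
  using hom_one[OF tc(1)[OF B(1)] X.TP.T.is_group M.M.a_group] by(simp add: c0_def)
 show "ex 0 <-> (ALL x:car M. EX m. (ALL e:arcs G. m e : car M) & x = (arrow_sum M m))"
 proof
  assume "ex 0"
  hence ex: "EX w:car (X.T (Suc 0)). X.D 0 w = z" if "z : car (X.T 0)" for z
   using that unfolding ex_def X.exact_at_def by simp
  show "ALL x:car M. EX m. (ALL e:arcs G. m e : car M) & x = arrow_sum M m"
  proof
   fix x assume "x : car M"
   then obtain z where z: "z : car (X.T 0)" "c0 z = x" using c0_ex by blast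
   obtain w where w: "w : car (X.T (Suc 0))" "X.D 0 w = z" using ex[OF z(1)] by blast
   thus "EX m. (ALL e:arcs G. m e : car M) & x = arrow_sum M m"
    using D0[OF w(1)] z c_closed[OF _ w(1)] by(intro exI[of _ "%e. c e w"]) auto
  qed
 next
  assume r: "ALL x:car M. EX m. (ALL e:arcs G. m e : car M) & x = arrow_sum M m"
  have "EX w:car (X.T (Suc 0)). X.D 0 w = z" if z: "z : car (X.T 0)" for z
  proof -
   from r[rule_format, OF c0_closed[OF z]] obtain m where
    m: "ALL e:arcs G. m e : car M" "c0 z = arrow_sum M m" by blast
   from c_ex[of m 0] m(1) obtain w where w: "w : car (X.T (Suc 0))" "ALL e:arcs G. c e w = m e" by blast
   have "(arrow_sum M (%e. c e w)) = arrow_sum M m"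
    by(rule M.M.add.finprod_cong') (use w ac m in auto)
   hence "X.D 0 w = z" using c0_eq[OF Dc[OF w(1)] z] D0[OF w(1)] m(2) by simp
   thus ?thesis using w(1) by blast
  qed
  thus "ex 0" unfolding ex_def X.exact_at_def by simp
 qed
 show "ex 1 <-> (ALL m. (ALL e:arcs G. m e : car M) & (arrow_sum M m) = \<zero>_{M}
   --> (ALL e:arcs G. path_vtx (head G e) \<odot>_{M} m e = \<zero>_{M}))"
 proof
  assume "ex 1"
  hence ex: "EX w:car (X.T (Suc (Suc 0))). X.D (Suc 0) w = z" if "z : car (X.T (Suc 0))" "X.D 0 z = \<one>_{X.T 0}" for z
   using that unfolding ex_def X.exact_at_def by simp
  show "ALL m. (ALL e:arcs G. m e : car M) & (arrow_sum M m) = \<zero>_{M}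
   --> (ALL e:arcs G. path_vtx (head G e) \<odot>_{M} m e = \<zero>_{M})"
  proof (intro allI impI ballI, elim conjE)
   fix m e assume m: "ALL e:arcs G. m e : car M" and s: "(arrow_sum M m) = \<zero>_{M}" and e: "e : arcs G"
   from c_ex[of m 0] m obtain z where z: "z : car (X.T (Suc 0))" "!!e. e : arcs G ==> c e z = m e" by blast
   have "(arrow_sum M (%e. c e z)) = arrow_sum M m"
    by(rule M.M.add.finprod_cong') (use z ac m in auto)
   hence "X.D 0 z = \<one>_{X.T 0}" using c0_eq[OF Dc[OF z(1)] X.TP.T.one_closed] D0[OF z(1)] s c0_one by simp
   then obtain w where w: "w : car (X.T (Suc (Suc 0)))" "X.D (Suc 0) w = z" using ex z(1) by blast
   have "m e = res_factor 0 e \<odot>_{M} c e w" using DS[OF e w(1)] w(2) z(2)[OF e] by simp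
   hence "path_vtx (head G e) \<odot>_{M} m e = (path_vtx (head G e) \<otimes>_{PA} res_factor 0 e) \<odot>_{M} c e w"
    using M.smult_assoc[of "path_vtx (head G e)" "res_factor 0 e" "c e w"] rf(1)[OF e] c_closed[OF e w(1)] e by simp
   thus "path_vtx (head G e) \<odot>_{M} m e = \<zero>_{M}"
    using rf(5)[OF e] c_closed[OF e w(1)] by(simp add: M.smult_l_null)
  qed
 next
  assume r: "ALL m. (ALL e:arcs G. m e : car M) & (arrow_sum M m) = \<zero>_{M}
   --> (ALL e:arcs G. path_vtx (head G e) \<odot>_{M} m e = \<zero>_{M})"
  have "EX w:car (X.T (Suc (Suc 0))). X.D (Suc 0) w = z" if z: "z : car (X.T (Suc 0))" "X.D 0 z = \<one>_{X.T 0}" for z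
  proof -
   have "(arrow_sum M (%e. c e z)) = \<zero>_{M}" using D0[OF z(1)] z(2) c0_one by simp
   hence p: "path_vtx (head G e) \<odot>_{M} c e z = \<zero>_{M}" if "e : arcs G" for e
    using r[rule_format, of "%e. c e z"] c_closed[OF _ z(1)] that by blast
   obtain w where w: "w : car (X.T (Suc (Suc 0)))" "!!e. e : arcs G ==> c e w = c e z"
    using c_ex[of "%e. c e z"] c_closed[OF _ z(1)] by blast
   have "c e (X.D (Suc 0) w) = c e z" if e: "e : arcs G" for e
   proof -
    have "res_factor 0 e \<odot>_{M} c e z = c e z \<oplus>_{M} (\<ominus>_{PA} path_vtx (head G e)) \<odot>_{M} c e z"
     using M.smult_l_distr[of "\<one>_{PA}" "\<ominus>_{PA} path_vtx (head G e)" "c e z"] c_closed[OF e z(1)] e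
     by(simp add: res_factor_def M.R.minus_eq M.smult_one)
    thus ?thesis using p[OF e] DS[OF e w(1)] w(2)[OF e] c_closed[OF e z(1)] e by(simp add: M.smult_l_minus)
   qed
   hence "X.D (Suc 0) w = z" using c_eq[OF Dc[OF w(1)] z(1)] by blast
   thus ?thesis using w(1) by blast
  qed
  thus "ex 1" unfolding ex_def X.exact_at_def by simp
 qed
 show "ex (Suc (Suc n))" unfolding ex_def X.exact_at_def
 proof (intro ballI impI)
  fix z assume z: "z : car (X.T (Suc (Suc n)))"
   and "Suc (Suc n) = 0 | X.D (Suc (Suc n) - 1) z = \<one>_{X.T (Suc (Suc n) - 1)}"
  hence D: "X.D (Suc n) z = \<one>_{X.T (Suc n)}" by simp
  obtain w where w: "w : car (X.T (Suc (Suc (Suc n))))" "!!e. e : arcs G ==> c e w = c e z"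
   using c_ex[of "%e. c e z"] c_closed[OF _ z] by blast
  have "c e (X.D (Suc (Suc n)) w) = c e z" if e: "e : arcs G" for e
  proof -
   have "res_factor n e \<odot>_{M} c e z = \<zero>_{M}" using DS[OF e z] D c_one[OF e] by simp
   moreover have "(res_factor n e \<oplus>_{PA} res_factor (Suc n) e) \<odot>_{M} c e z = c e z"
    using rf(3)[OF e, of n] c_closed[OF e z] by(simp add: M.smult_one)
   ultimately have "res_factor (Suc n) e \<odot>_{M} c e z = c e z"
    using M.smult_l_distr[OF rf(1)[OF e, of n] rf(1)[OF e, of "Suc n"] c_closed[OF e z]]
     M.smult_closed[OF rf(1)[OF e, of "Suc n"] c_closed[OF e z]] by simp
   thus ?thesis using DS[OF e w(1)] w(2)[OF e] by simp
  qed
  hence "X.D (Suc (Suc n)) w = z" using c_eq[OF Dc[OF w(1)] z] by blast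
  thus "EX w:car (X.T (Suc (Suc (Suc n)))). X.D (Suc (Suc n)) w = z" using w(1) by blast
 qed
qed

text \<open>Exactness does not depend on the resolution, so the one chosen inside \<open>Tor\<close>
  may be exchanged for the periodic one, of which only the degrees 0 and 1 impose
  conditions.\<close>

lemma blanchfield_iff:
 fixes M :: "(('a,'b,'k::field) path_elem, 'm) module" shows "blanchfield G M <-> left_module PA M
  & (ALL x:car M. EX m. (ALL e:arcs G. m e : car M) & x = (arrow_sum M m))
  & (ALL m. (ALL e:arcs G. m e : car M) & (arrow_sum M m) = \<zero>_{M}
   --> (ALL e:arcs G. path_vtx (head G e) \<odot>_{M} m e = \<zero>_{M}))"
proof (cases "left_module PA M")
 case False
 thus ?thesis by(simp add: blanchfield_def)
next
 case True
 interpret M: left_module PA M by(rule True)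
 let ?N = "augmentation_module G :: (('a,'b,'k) path_elem,'a => 'k) module"
 interpret N: left_module "op_ring PA" ?N by(rule left_module_augmentation)
 \<comment> \<open>Some injection of the arrows into the index type of
   \<open>chosen_resolution\<close>: singleton lists that contain the arrow as a path-algebra
   element, told apart by their supports. The empty list is the index in degree 0.\<close>
 define ix :: "'b => (('a => 'k) \<times> ('a,'b,'k) path_elem) list" where "ix e = [((%_. 0), path_arr G e)]" for e
 have ix: "inj_on ix (arcs G)"
 proof (rule inj_onI)
  fix e e' assume "ix e = ix e'"
  hence "keys (path_arr G e :: ('a,'b,'k) path_elem) = keys (path_arr G e' :: ('a,'b,'k) path_elem)"
   by(simp add: ix_def)
  thus "e = e'" by(simp add: path_arr_def)
 qed
 note per = periodic_resolution[OF ix, of "[]", where 'k = 'k]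
 obtain I d where cr: "chosen_resolution (op_ring PA) ?N = (I, d)" by(cases "chosen_resolution (op_ring PA) ?N")
 \<comment> \<open>The periodic resolution also shows that a free resolution with these indices
   exists, so the choice in \<open>chosen_resolution\<close> really is a resolution.\<close>
 have "EX p. (%(I, d). EX ep. free_resolution (op_ring PA) ?N I d ep) (p :: (nat => (('a => 'k) \<times> ('a,'b,'k) path_elem) list set) \<times> _)"
  using per by blast
 hence "(%(I, d). EX ep. free_resolution (op_ring PA) ?N I d ep) (chosen_resolution (op_ring PA) ?N)"
  unfolding chosen_resolution_def by(rule someI_ex)
 then obtain ep where res: "free_resolution (op_ring PA) ?N I d ep" unfolding cr by auto
 interpret A: resolution_tensor PA M ?N I d ep by unfold_locales (rule res)
 interpret B: resolution_tensor PA M ?N "res_basis [] ix" "res_map [] ix" "%x. aug_row (x [])"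
  by unfold_locales (rule per)
 have "trivial_group (Tor PA ?N M q) <-> A.exact_at q" for q
  unfolding A.trivial_homology_iff[symmetric] by(simp add: Tor_def cr tensor_map_def Let_def)
 also have "A.exact_at q <-> B.exact_at q" for q
  using exact_at_independent[OF A.resolution_tensor_axioms B.resolution_tensor_axioms]
   exact_at_independent[OF B.resolution_tensor_axioms A.resolution_tensor_axioms] by blast
 finally have tor: "trivial_group (Tor PA ?N M q) <-> B.exact_at q" for q .
 have "(ALL q. B.exact_at q) <-> B.exact_at 0 & B.exact_at 1"
  using periodic_exact_iff(3)[OF True ix, of "[]"] by(metis One_nat_def not0_implies_Suc)
 thus ?thesis
  unfolding blanchfield_def tor using True periodic_exact_iff(1,2)[OF True ix, of "[]"] by simp
qed

end

section \<open>Blanchfield modules as modules over the Leavitt path algebra\<close>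

context fin_digraph
begin

lemma path_ring_relations:
 fixes c d :: "'k::field" and x :: "('a,'b,'k) path_elem"
 shows "path_scalar G (c + d) = path_scalar G c \<oplus>_{PA} path_scalar G d"
  "path_scalar G (c * d) = path_scalar G c \<otimes>_{PA} path_scalar G d"
  "path_scalar G 1 = \<one>_{PA :: ('a,'b,'k) path_elem ring}"
  "x : car PA ==> x \<otimes>_{PA} path_scalar G c = path_scalar G c \<otimes>_{PA} x"
  "path_vtx v \<otimes>_{PA} path_vtx w = (if v = w then path_vtx v else \<zero>_{PA :: ('a,'b,'k) path_elem ring})"
  "(\<Oplus>_{PA}v\<in>verts G. path_vtx v) = \<one>_{PA :: ('a,'b,'k) path_elem ring}"
  "path_vtx v \<otimes>_{PA} path_arr G e = (if v = tail G e then path_arr G e else \<zero>_{PA :: ('a,'b,'k) path_elem ring})"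
  "path_arr G e \<otimes>_{PA} path_vtx (head G e) = (path_arr G e :: ('a,'b,'k) path_elem)"
proof -
 interpret P: ring "PA :: ('a,'b,'k) path_elem ring" by(rule ring_PA)
 show "path_scalar G (c + d) = path_scalar G c \<oplus>_{PA} path_scalar G d"
  by(simp add: PA_simps path_scalar_def single_add sum.distrib)
 show "path_scalar G (c * d) = path_scalar G c \<otimes>_{PA} path_scalar G d"
  unfolding PA_simps by(subst (2) path_scalar_def, simp add: bmul_sum_right)
   (auto simp: path_scalar_def[of G "c * d"] intro!: sum.cong path_scalar_single[symmetric] simp: paths_iff awalk_Nil_iff)
 show "path_scalar G 1 = \<one>_{PA :: ('a,'b,'k) path_elem ring}" by(simp add: PA_simps)
 have r: "bmul path_concat (single (u, p, v) a) (path_scalar G c) = single (u, p, v) (c * a)"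
  if "(u, p, v) : paths G" for u p v and a :: 'k
 proof -
  have "v : verts G" using that by(auto simp: paths_iff)
  have "bmul path_concat (single (u, p, v) a) (path_scalar G c)
    = (\<Sum>w\<in>verts G. bterm path_concat (u, p, v) (w, [], w) a c)"
   unfolding path_scalar_def by(simp add: bmul_sum_right bmul_single)
  also have "... = (\<Sum>w\<in>verts G. if v = w then single (u, p, v) (c * a) else 0)"
   by(rule sum.cong) (auto simp: bterm_def path_concat_def mult.commute)
  finally show ?thesis using \<open>v : verts G\<close> by simp
 qed
 show "x \<otimes>_{PA} path_scalar G c = path_scalar G c \<otimes>_{PA} x" if x: "x : car PA"
 proof -
  have "keys x <= paths G" using x by(simp add: PA_simps)
  hence "bmul path_concat x (path_scalar G c) = bmul path_concat (path_scalar G c) x"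
  proof (induction x rule: span_induct)
   case (single p a)
   thus ?case using r by(cases p) (auto simp: path_scalar_single)
  qed (simp_all add: bmul_add_left bmul_add_right)
  thus ?thesis by(simp add: PA_simps)
 qed
 show "path_vtx v \<otimes>_{PA} path_vtx w = (if v = w then path_vtx v else \<zero>_{PA :: ('a,'b,'k) path_elem ring})"
  by(simp add: PA_simps) (simp add: path_vtx_def bmul_single bterm_def path_concat_def)
 show "path_vtx v \<otimes>_{PA} path_arr G e = (if v = tail G e then path_arr G e else \<zero>_{PA :: ('a,'b,'k) path_elem ring})"
  "path_arr G e \<otimes>_{PA} path_vtx (head G e) = (path_arr G e :: ('a,'b,'k) path_elem)"
  by(simp_all add: PA_simps) (simp_all add: path_vtx_def path_arr_def bmul_single bterm_def path_concat_def)
 have "(\<Oplus>_{PA}v\<in>V. path_vtx v) = (\<Sum>v\<in>V. path_vtx v :: ('a,'b,'k) path_elem)" if "finite V" "V <= verts G" for V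
  using that
 proof (induction V rule: finite_induct)
  case (insert v V)
  have "path_vtx : V \<rightarrow> car (PA :: ('a,'b,'k) path_elem ring)" using insert.prems by auto
  thus ?case using insert by(simp add: PA_simps(5))
 qed (simp add: PA_simps(4))
 thus "(\<Oplus>_{PA}v\<in>verts G. path_vtx v) = \<one>_{PA :: ('a,'b,'k) path_elem ring}"
  by(simp add: PA_simps(3) path_scalar_def path_vtx_def)
qed

text \<open>Write x as a sum of e m_e; the ghost of e has to send x to p m_e, where p is the head of
  e. The injectivity hypothesis makes this independent of the decomposition, and the relations
  follow by decomposing suitably.\<close>

lemma leavitt_ops_of_path_module:
 fixes M :: "(('a,'b,'k::field) path_elem, 'm) module" assumes M: "left_module PA M"
  and surj: "ALL x:car M. EX m. (ALL e:arcs G. m e : car M) & x = arrow_sum M m"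
  and inj: "ALL m. (ALL e:arcs G. m e : car M) & (arrow_sum M m) = \<zero>_{M}
   --> (ALL e:arcs G. path_vtx (head G e) \<odot>_{M} m e = \<zero>_{M})"
 shows "EX gh. leavitt_ops M (%c x. path_scalar G c \<odot>_{M} x) G (%v x. path_vtx v \<odot>_{M} x) (%e x. path_arr G e \<odot>_{M} x) gh"
proof -
 interpret M: left_module PA M by(rule M)
 note rl = path_ring_relations[where 'k = 'k]
 note gc = path_gens_closed
 have act: "a \<odot>_{M} (b \<odot>_{M} x) = (a \<otimes>_{PA} b) \<odot>_{M} x" if "a : car PA" "b : car PA" "x : car M" for a b x
  using M.smult_assoc that by simp
 have ac: "path_arr G e \<odot>_{M} x : car M" if "e : arcs G" "x : car M" for e x using M.smult_closed that by simp
 have pc: "path_vtx v \<odot>_{M} x : car M" if "v : verts G" "x : car M" for v x using M.smult_closed that by simp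
 have ap: "path_arr G e \<odot>_{M} (path_vtx (head G e) \<odot>_{M} x) = path_arr G e \<odot>_{M} x" if "e : arcs G" "x : car M" for e x
  using act[of "path_arr G e" "path_vtx (head G e)" x] that rl(8) by simp
 define su where "su m = arrow_sum M m" for m
 define ok where "ok m <-> (ALL e:arcs G. m e : car M)" for m :: "'b => 'm"
 have suc: "su m : car M" if "ok m" for m unfolding su_def by(rule M.M.finsum_closed) (use that ac in "auto simp: ok_def")
 have su_cong: "su m = su m'" if "ok m'" "!!e. e : arcs G ==> path_arr G e \<odot>_{M} m e = path_arr G e \<odot>_{M} m' e" for m m'
  unfolding su_def by(rule M.M.add.finprod_cong') (use that ac in "auto simp: ok_def")
 have su_add: "su (%e. m e \<oplus>_{M} m' e) = su m \<oplus>_{M} su m'" if m: "ok m" "ok m'" for m m'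
 proof -
  have "su (%e. m e \<oplus>_{M} m' e) = (\<Oplus>_{M}e\<in>arcs G. path_arr G e \<odot>_{M} m e \<oplus>_{M} path_arr G e \<odot>_{M} m' e)"
   unfolding su_def by(rule M.M.add.finprod_cong') (use m ac M.smult_r_distr in "auto simp: ok_def")
  also have "... = su m \<oplus>_{M} su m'" unfolding su_def by(rule M.M.finsum_addf) (use m ac in "auto simp: ok_def")
  finally show ?thesis .
 qed
 have su_act: "a \<odot>_{M} su m = (\<Oplus>_{M}e\<in>arcs G. (a \<otimes>_{PA} path_arr G e) \<odot>_{M} m e)" if a: "a : car PA" and m: "ok m" for a m
 proof -
  have "a \<odot>_{M} su m = (\<Oplus>_{M}e\<in>arcs G. a \<odot>_{M} (path_arr G e \<odot>_{M} m e))"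
   unfolding su_def by(rule M.smult_finsum_r) (use a m ac in "auto simp: ok_def")
  also have "... = (\<Oplus>_{M}e\<in>arcs G. (a \<otimes>_{PA} path_arr G e) \<odot>_{M} m e)"
   by(rule M.M.add.finprod_cong') (use a m act M.smult_closed in "auto simp: ok_def")
  finally show ?thesis .
 qed
 obtain D where D: "!!x. x : car M ==> ok (D x)" "!!x. x : car M ==> x = su (D x)"
  using bchoice[OF surj] unfolding ok_def su_def by blast
 define gh where "gh e x = path_vtx (head G e) \<odot>_{M} D x e" for e x
 have gh: "gh e (su m) = path_vtx (head G e) \<odot>_{M} m e" if m: "ok m" and e: "e : arcs G" for m e
 proof -
  \<comment> \<open>Difference between the given and the chosen decomposition of the same element:
    its arrow sum is zero, so \<open>inj\<close> kills its head components.\<close>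
  define k where "k e = m e \<ominus>_{M} D (su m) e" for e
  have okD: "ok (D (su m))" using D(1) suc m by blast
  have k: "ok k" using m okD by(auto simp: ok_def k_def)
  have mk: "D (su m) e \<oplus>_{M} k e = m e" if "e : arcs G" for e
   unfolding k_def by(rule M.M.add_minus_cancel) (use that m okD in "auto simp: ok_def")
  have "su m = su (%e. D (su m) e \<oplus>_{M} k e)"
   by(rule su_cong) (use mk m okD k in "auto simp: ok_def")
  hence "su m \<oplus>_{M} su k = su m \<oplus>_{M} \<zero>_{M}"
   using su_add[OF okD k] D(2)[OF suc[OF m]] suc[OF m] by simp
  hence "su k = \<zero>_{M}" by(rule M.M.add_left_cancel) (use suc m k in auto)
  hence "path_vtx (head G e) \<odot>_{M} k e = \<zero>_{M}" using inj k e unfolding ok_def su_def by blast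
  moreover have "path_vtx (head G e) \<odot>_{M} m e = path_vtx (head G e) \<odot>_{M} D (su m) e \<oplus>_{M} path_vtx (head G e) \<odot>_{M} k e"
   using M.smult_r_distr[of "path_vtx (head G e)" "D (su m) e" "k e"] mk[OF e] e okD k by(simp add: ok_def)
  ultimately show ?thesis using pc[of "head G e" "D (su m) e"] e okD by(simp add: gh_def ok_def)
 qed
 have ghc: "gh e x : car M" if "e : arcs G" "x : car M" for e x
  unfolding gh_def by(rule pc) (use D(1) that in "auto simp: ok_def")
 have vsu: "path_vtx v \<odot>_{M} su m = su (%e. if tail G e = v then m e else \<zero>_{M})" if v: "v : verts G" and m: "ok m" for v m
  unfolding su_act[OF gc(2)[OF v] m] unfolding su_def
  by(rule M.M.add.finprod_cong') (use m ac in "auto simp: ok_def rl(7) M.smult_l_null M.smult_r_null")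
 have ssu: "path_scalar G c \<odot>_{M} su m = su (%e. path_scalar G c \<odot>_{M} m e)" if m: "ok m" for c m
  unfolding su_act[OF gc(1) m] unfolding su_def
 proof (rule M.M.add.finprod_cong')
  fix e assume e: "e : arcs G"
  show "(path_scalar G c \<otimes>_{PA} path_arr G e) \<odot>_{M} m e = path_arr G e \<odot>_{M} (path_scalar G c \<odot>_{M} m e)"
   using act[of "path_arr G e" "path_scalar G c" "m e"] rl(4)[OF gc(3)[OF e], of c] m e by(simp add: ok_def)
 qed (use m ac M.smult_closed in "auto simp: ok_def")
 have comm: "b \<odot>_{M} (path_scalar G c \<odot>_{M} x) = path_scalar G c \<odot>_{M} (b \<odot>_{M} x)" if "b : car PA" "x : car M" for b c x
  using act that rl(4)[OF that(1)] by simp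
 have k: "kspace M (%c x. path_scalar G (c :: 'k) \<odot>_{M} x)"
  by unfold_locales (auto simp: M.smult_closed M.smult_r_distr M.smult_l_distr M.smult_one rl(1,2,3) act)
 have vv: "path_vtx v \<odot>_{M} (path_vtx w \<odot>_{M} x) = (if v = w then path_vtx v \<odot>_{M} x else \<zero>_{M})"
  if "v : verts G" "w : verts G" "x : car M" for v w x
  using act[of "path_vtx v" "path_vtx w" x] that rl(5)[of v w] by(simp add: M.smult_l_null)
 have vs: "(\<Oplus>_{M}v\<in>verts G. path_vtx v \<odot>_{M} x) = x" if "x : car M" for x
  using M.smult_finsum_l[of x "verts G" path_vtx] that rl(6) by(simp add: M.smult_one)
 have "leavitt_ops M (%c x. path_scalar G (c :: 'k) \<odot>_{M} x) G (%v x. path_vtx v \<odot>_{M} x) (%e x. path_arr G e \<odot>_{M} x) gh"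
 proof (rule leavitt_ops.intro[OF k fin_digraph_axioms leavitt_ops_axioms.intro])
  fix e x y assume e: "e : arcs G" and x: "x : car M" and y: "y : car M"
  have "x \<oplus>_{M} y = su (%e. D x e \<oplus>_{M} D y e)" using su_add[OF D(1)[OF x] D(1)[OF y]] D(2)[OF x] D(2)[OF y] by simp
  thus "gh e (x \<oplus>_{M} y) = gh e x \<oplus>_{M} gh e y"
   using gh[of "%e. D x e \<oplus>_{M} D y e" e] D(1)[OF x] D(1)[OF y] e by(simp add: ok_def gh_def M.smult_r_distr)
 next
  fix e x c assume e: "e : arcs G" and x: "x : car M"
  have "path_scalar G c \<odot>_{M} x = su (%e. path_scalar G c \<odot>_{M} D x e)" using ssu[OF D(1)[OF x]] D(2)[OF x] by simp
  thus "gh e (path_scalar G c \<odot>_{M} x) = path_scalar G c \<odot>_{M} gh e x"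
   using gh[of "%e. path_scalar G c \<odot>_{M} D x e" e] D(1)[OF x] e by(simp add: ok_def gh_def M.smult_closed comm)
 next
  fix e x assume e: "e : arcs G" and x: "x : car M"
  show "path_vtx (head G e) \<odot>_{M} gh e x = gh e x" using vv e D(1)[OF x] by(simp add: gh_def ok_def)
  have "path_vtx (tail G e) \<odot>_{M} x = su (%e'. if tail G e' = tail G e then D x e' else \<zero>_{M})"
   using vsu[OF _ D(1)[OF x]] e D(2)[OF x] by simp
  thus "gh e (path_vtx (tail G e) \<odot>_{M} x) = gh e x"
   using gh[of "%e'. if tail G e' = tail G e then D x e' else \<zero>_{M}" e] D(1)[OF x] e by(simp add: ok_def gh_def)
  show "path_arr G e \<odot>_{M} (path_vtx (head G e) \<odot>_{M} x) = path_arr G e \<odot>_{M} x" using ap[OF e x] .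
  show "path_vtx (tail G e) \<odot>_{M} (path_arr G e \<odot>_{M} x) = path_arr G e \<odot>_{M} x"
   using act[of "path_vtx (tail G e)" "path_arr G e" x] e x rl(7) by simp
 next
  fix e e' x assume e: "e : arcs G" "e' : arcs G" and x: "x : car M"
  have o: "ok (%e. if e' = e then x else \<zero>_{M})" using x by(simp add: ok_def)
  have "su (%e. if e' = e then x else \<zero>_{M}) = (\<Oplus>_{M}e\<in>arcs G. if e' = e then path_arr G e \<odot>_{M} x else \<zero>_{M})"
   unfolding su_def by(rule M.M.add.finprod_cong') (use x ac in "auto simp: M.smult_r_null")
  also have "... = path_arr G e' \<odot>_{M} x" by(rule M.M.add.finprod_singleton) (use e x ac in auto)
  finally have "gh e (path_arr G e' \<odot>_{M} x) = path_vtx (head G e) \<odot>_{M} (if e' = e then x else \<zero>_{M})" using gh[OF o e(1)] by simp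
  thus "gh e (path_arr G e' \<odot>_{M} x) = (if e = e' then path_vtx (head G e) \<odot>_{M} x else \<zero>_{M})"
   using e by(auto simp: M.smult_r_null)
 next
  fix v x assume v: "v : verts G" and x: "x : car M"
  have "path_vtx v \<odot>_{M} x = (arrow_sum M (%e. (if tail G e = v then D x e else \<zero>_{M})))"
   using vsu[OF v D(1)[OF x]] D(2)[OF x] by(simp add: su_def)
  also have "... = (\<Oplus>_{M}e\<in>{e : arcs G. tail G e = v}. path_arr G e \<odot>_{M} gh e x)"
   by(rule M.M.add.finprod_mono_neutral_cong_right)
    (use D(1)[OF x] ap ac ghc x in "auto simp: ok_def gh_def M.smult_r_null")
  finally show "path_vtx v \<odot>_{M} x = (\<Oplus>_{M}e\<in>{e : arcs G. tail G e = v}. path_arr G e \<odot>_{M} gh e x)" .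
 qed (use ac pc ghc comm vv vs in "simp_all add: M.smult_r_distr")
 thus ?thesis by blast
qed

text \<open>\<open>leavitt_module\<close> chooses a structure extending that of P(E). Such a
  structure exists: the one built from the ghost operators agrees with P(E) on generators, hence
  everywhere.\<close>

lemma leavitt_module_exists:
 fixes M :: "(('a,'b,'k::field) path_elem, 'm) module" assumes B: "blanchfield G M"
 shows "left_module (LA :: ('a,'b,'k) leavitt_ring) (leavitt_module G M)"
  "car (leavitt_module G M) = car M" "\<zero>_{leavitt_module G M} = \<zero>_{M}"
  "x \<oplus>_{leavitt_module G M} y = x \<oplus>_{M} y"
  "a : car PA ==> x : car M ==> real_embed G a \<odot>_{leavitt_module G M} x = a \<odot>_{M} x"
proof -
 note b = B[unfolded blanchfield_iff]
 interpret M: left_module PA M using b by blast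
 obtain gh where ops: "leavitt_ops M (%c x. path_scalar G (c :: 'k) \<odot>_{M} x) G (%v x. path_vtx v \<odot>_{M} x) (%e x. path_arr G e \<odot>_{M} x) gh"
  using leavitt_ops_of_path_module[of M] b by blast
 let ?LM = "mk_module (car M) \<zero>_{M} (%x y. x \<oplus>_{M} y)"
 obtain s where s: "left_module (LA :: ('a,'b,'k) leavitt_ring) (?LM s)"
  "!!x c. x : car M ==> s (semb c) x = path_scalar G c \<odot>_{M} x"
  "!!x v. x : car M ==> v : verts G ==> s (lg (Vtx v)) x = path_vtx v \<odot>_{M} x"
  "!!x e. x : car M ==> e : arcs G ==> s (lg (Arr e)) x = path_arr G e \<odot>_{M} x"
  using leavitt_module_of_ops[OF ops] by blast
 interpret S: left_module "LA :: ('a,'b,'k) leavitt_ring" "?LM s" by(rule s(1))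
 note re = real_embed_hom[where 'k = 'k]
 note rc = ring_hom_closed[OF re(1)]
 have "s (real_embed G a) x = a \<odot>_{M} x" if "a : car PA" "x : car M" for a x using that
 proof (induction a arbitrary: x rule: path_induct)
  case (add a b)
  thus ?case using S.smult_l_distr[OF rc rc, of a b x] ring_hom_add[OF re(1), of a b] M.smult_l_distr by simp
 next
  case (mult a b)
  thus ?case using S.smult_assoc[OF rc rc, of a b x] ring_hom_mult[OF re(1), of a b] M.smult_assoc M.smult_closed by simp
 qed (simp_all add: re(2,3,4) s(2,3,4))
 hence "EX s. left_module (LA :: ('a,'b,'k) leavitt_ring) (?LM s) & (ALL a:car PA. ALL x:car M. s (real_embed G a) x = a \<odot>_{M} x)"
  using s(1) by blast
 note ex = someI_ex[OF this]
 have eq: "leavitt_module G M = ?LM (SOME s. left_module (LA :: ('a,'b,'k) leavitt_ring) (?LM s)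
   & (ALL a:car PA. ALL x:car M. s (real_embed G a) x = a \<odot>_{M} x))"
  by(simp add: leavitt_module_def Let_def)
 show "left_module (LA :: ('a,'b,'k) leavitt_ring) (leavitt_module G M)"
  "car (leavitt_module G M) = car M" "\<zero>_{leavitt_module G M} = \<zero>_{M}"
  "x \<oplus>_{leavitt_module G M} y = x \<oplus>_{M} y"
  "a : car PA ==> x : car M ==> real_embed G a \<odot>_{leavitt_module G M} x = a \<odot>_{M} x"
  unfolding eq using ex by auto
qed

end

section \<open>Translation between P(E)-modules, L(E)-modules and stable subspaces\<close>

lemma tensor_lift_cong:
 fixes G :: "('g,'c) monoid_scheme" and H :: "('g,'d) monoid_scheme"
 assumes "car G = car H" "monoid.mult G = monoid.mult H" "\<one>_{G} = \<one>_{H}"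
 shows "tensor_lift G b = tensor_lift H b"
proof -
 have p: "x [^]_{G} z = x [^]_{H} z" for x and z :: int
  unfolding int_pow_def nat_pow_def m_inv_def Let_def assms ..
 have f: "finprod G f A = finprod H f A" for f and A :: "('x \<times> 'm) set"
  unfolding finprod_def using assms by simp
 show ?thesis unfolding tensor_lift_def p f ..
qed

context lpa_module
begin

text \<open>A sink is the tail of no arrow, so its vertex kills every
  \<open>arM e (m e)\<close>.\<close>

lemma sink_free_if_generated:
 assumes "!!x. x : car M ==> EX m. (ALL e:arcs E. m e : car M) & x = (\<Oplus>_{M}e\<in>arcs E. arM e (m e))"
 shows sink_free unfolding sink_free_def
proof (intro allI impI)
 fix w x assume w: "ops.sink w" and "x : car M"
 then obtain m where m: "ALL e:arcs E. m e : car M" "x = (\<Oplus>_{M}e\<in>arcs E. arM e (m e))" using assms by blast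
 have wv: "w : verts E" "!!e. e : arcs E ==> tail E e ~= w" using w by(auto simp: ops.sink_def)
 have "vtM w x = (\<Oplus>_{M}e\<in>arcs E. vtM w (arM e (m e)))"
  unfolding m(2) by(rule ops.op_finsum(1)) (use m(1) wv(1) in auto)
 also have "... = (\<Oplus>_{M}e\<in>arcs E. \<zero>_{M})"
 proof (rule M.add.finprod_cong')
  fix e assume e: "e : arcs E"
  show "vtM w (arM e (m e)) = \<zero>_{M}" using ops.vt_ar[OF wv(1) e, of "m e"] m(1) e wv(2)[OF e] by auto
 qed auto
 finally show "vtM w x = \<zero>_{M}" by simp
qed

text \<open>The arrow sums form a subspace containing every \<open>arM e (ghM e x)\<close>, so
  \<open>reconstruct\<close> applies once the sink components vanish.\<close>

lemma generated_if_sink_free: assumes sf: sink_free and x: "x : car M"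
 shows "EX m. (ALL e:arcs E. m e : car M) & x = (\<Oplus>_{M}e\<in>arcs E. arM e (m e))"
proof -
 let ?K = "{y. EX m. (ALL e:arcs E. m e : car M) & y = (\<Oplus>_{M}e\<in>arcs E. arM e (m e))}"
 have "ops.ksub ?K"
 proof (rule ops.ksubI)
  show "?K <= car M" by(auto intro!: M.finsum_closed)
  have "(\<Oplus>_{M}e\<in>arcs E. arM e \<zero>_{M}) = (\<Oplus>_{M}e\<in>arcs E. \<zero>_{M})" by(rule M.add.finprod_cong') auto
  thus "\<zero>_{M} : ?K" by(intro CollectI exI[of _ "%_. \<zero>_{M}"]) simp
  show "y \<oplus>_{M} z : ?K" if "y : ?K" "z : ?K" for y z
  proof -
   obtain m n where m: "ALL e:arcs E. m e : car M" "y = (\<Oplus>_{M}e\<in>arcs E. arM e (m e))"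
    and n: "ALL e:arcs E. n e : car M" "z = (\<Oplus>_{M}e\<in>arcs E. arM e (n e))" using \<open>y : ?K\<close> \<open>z : ?K\<close> by blast
   have "(\<Oplus>_{M}e\<in>arcs E. arM e (m e \<oplus>_{M} n e)) = (\<Oplus>_{M}e\<in>arcs E. arM e (m e) \<oplus>_{M} arM e (n e))"
    by(rule M.add.finprod_cong') (use m(1) n(1) ops.ar_add in auto)
   also have "... = y \<oplus>_{M} z" unfolding m(2) n(2) by(rule M.finsum_addf) (use m(1) n(1) in auto)
   finally show ?thesis using m(1) n(1) by(intro CollectI exI[of _ "%e. m e \<oplus>_{M} n e"]) simp
  qed
  show "scM c y : ?K" if "y : ?K" for c y
  proof -
   obtain m where m: "ALL e:arcs E. m e : car M" "y = (\<Oplus>_{M}e\<in>arcs E. arM e (m e))" using \<open>y : ?K\<close> by blast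
   have "scM c y = (\<Oplus>_{M}e\<in>arcs E. scM c (arM e (m e)))" unfolding m(2) by(rule ops.op_finsum(3)) (use m(1) in auto)
   also have "... = (\<Oplus>_{M}e\<in>arcs E. arM e (scM c (m e)))"
    by(rule M.add.finprod_cong') (use m(1) ops.ar_sc in auto)
   finally show ?thesis using m(1) by(intro CollectI exI[of _ "%e. scM c (m e)"]) simp
  qed
 qed
 hence K: "subgroup ?K (add_monoid M)" by(simp add: ops.ksub_def)
 have "x : ?K"
 proof (rule ops.reconstruct[OF K x])
  show "vtM w x : ?K" if "ops.sink w" for w
   using sf that x M.subgrpD(2)[OF K] by(simp add: sink_free_def)
  show "arM e (ghM e x) : ?K" if e: "e : arcs E" for e
  proof -
   let ?m = "%e'. if e = e' then ghM e x else \<zero>_{M}"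
   have "(\<Oplus>_{M}e'\<in>arcs E. arM e' (?m e')) = (\<Oplus>_{M}e'\<in>arcs E. if e = e' then arM e' (ghM e' x) else \<zero>_{M})"
    by(rule M.add.finprod_cong') (use x in auto)
   also have "... = arM e (ghM e x)" by(rule M.add.finprod_singleton) (use e x in auto)
   finally show ?thesis using e x by(intro CollectI exI[of _ ?m]) simp
  qed
 qed
 thus ?thesis by blast
qed

text \<open>Applying the ghost of e to the sum isolates the summand of e.\<close>

lemma arrow_sum_zeroD:
 assumes m: "ALL e:arcs E. m e : car M" "(\<Oplus>_{M}e\<in>arcs E. arM e (m e)) = \<zero>_{M}" and e: "e : arcs E"
 shows "vtM (head E e) (m e) = \<zero>_{M}"
proof -
 have "ghM e (\<Oplus>_{M}e\<in>arcs E. arM e (m e)) = (\<Oplus>_{M}e'\<in>arcs E. ghM e (arM e' (m e')))"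
  by(rule ops.op_finsum(2)) (use m(1) e in auto)
 also have "... = (\<Oplus>_{M}e'\<in>arcs E. if e = e' then vtM (head E e') (m e') else \<zero>_{M})"
  by(rule M.add.finprod_cong') (use m(1) e ops.gh_ar in auto)
 also have "... = vtM (head E e) (m e)" by(rule M.add.finprod_singleton) (use e m(1) in auto)
 finally show ?thesis using m(2) e by simp
qed

lemma finite_dimensional_iff: assumes "ops.ksub A"
 shows "finitely_generated (ring_of_field :: 'k ring) (restrict_scalars semb (M(|carrier := A|))) <-> ops.fd A"
proof -
 let ?F = "ring_of_field :: 'k ring" and ?M = "restrict_scalars (semb :: 'k => _) M"
 interpret F: ring ?F
 proof (rule ringI)
  show "abelian_group ?F"
   by(rule abelian_groupI) (auto simp: ring_of_field_def algebra_simps intro: exI[of _ "- x" for x])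
  show "monoid ?F" by(rule monoidI) (auto simp: ring_of_field_def)
 qed (auto simp: ring_of_field_def algebra_simps)
 have hom: "semb : ring_hom ?F (LA :: ('v,'e,'k) leavitt_ring)"
  by(rule ring_hom_memI) (auto simp: ring_of_field_def scalar_embed_ring)
 interpret FM: left_module ?F ?M by(rule restrict_scalars_module[OF left_module_axioms F.ring_axioms hom])
 have sub: "submodule N ?F ?M <-> ops.ksub N" for N
  using submodule_via_hom[of ?M ?F "semb" N] by(simp add: ops.ksub_def ring_of_field_def)
 have A: "submodule A ?F ?M" using sub assms by blast
 have eq: "restrict_scalars (semb :: 'k => _) (M(|carrier := A|)) = ?M(|carrier := A|)"
  by(simp add: restrict_scalars_def mk_module_def)
 have gen: "submodule_generated ?F (?M(|carrier := A|)) S = ops.kspan S" if "S <= A" for S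
 proof -
  have "S <= car M" using that ops.ksubD(1)[OF assms] by blast
  hence k: "ops.ksub (ops.kspan S)" "ops.kspan S <= A"
   using ops.ksub_kspan ops.kspan_minimal[OF assms that] by auto
  show ?thesis unfolding submodule_generated_def FM.submodule_of_submodule[OF A] sub
  proof
   show "\<Inter> {N. (ops.ksub N & N <= A) & S <= N} <= ops.kspan S"
    by(rule Inter_lower) (use k ops.kspan_superset[of S] in simp)
   show "ops.kspan S <= \<Inter> {N. (ops.ksub N & N <= A) & S <= N}"
    by(rule Inter_greatest, rule ops.kspan_minimal) simp_all
  qed
 qed
 show ?thesis
 proof
  assume "finitely_generated ?F (restrict_scalars semb (M(|carrier := A|)))"
  then obtain S where S: "finite S" "S <= A" "ops.kspan S = A" unfolding finitely_generated_def eq using gen by auto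
  have "S <= car M" using S(2) ops.ksubD(1)[OF assms] by blast
  thus "ops.fd A" unfolding ops.fd_def using S by blast
 next
  assume "ops.fd A"
  then obtain S where S: "finite S" "A = ops.kspan S" unfolding ops.fd_def by blast
  hence "S <= A" using ops.kspan_superset by blast
  thus "finitely_generated ?F (restrict_scalars semb (M(|carrier := A|)))"
   unfolding finitely_generated_def eq using gen S by(intro exI[of _ S]) simp
 qed
qed

text \<open>For the second part, finitely many generators yield a lattice by
  \<open>lattice_exists\<close>; conversely a finite spanning set of a lattice over k generates over
  P(E) all that the lattice generates.\<close>

lemma real_submodule_generated:
 assumes same: "car M' = car M" "!!x y. x \<oplus>_{M'} y = x \<oplus>_{M} y" "\<zero>_{M'} = \<zero>_{M}"
   "!!a x. a : car (PA :: ('v,'e,'k) path_elem ring) ==> x : car M ==> a \<odot>_{M'} x = real_embed E a \<odot>_{M} x"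
 shows "submodule_generated (PA :: ('v,'e,'k) path_elem ring) M' S = ops.rspan S"
  "finitely_generated (PA :: ('v,'e,'k) path_elem ring) M' <-> (EX A. ops.lattice A)"
proof -
 let ?P = "PA :: ('v,'e,'k) path_elem ring"
 show gen: "submodule_generated ?P M' S = ops.rspan S" for S
  unfolding submodule_generated_def ops.rspan_def by(subst submodule_iff_rsub[OF same]) auto
 show "finitely_generated ?P M' <-> (EX A. ops.lattice A)"
 proof
  assume "finitely_generated ?P M'"
  thus "EX A. ops.lattice A"
   unfolding finitely_generated_def gen same(1) using ops.lattice_exists by blast
 next
  assume "EX A. ops.lattice A"
  then obtain A S where A: "ops.rspan A = car M" and S: "finite S" "S <= car M" "A = ops.kspan S"
   unfolding ops.lattice_def ops.fd_def by blast
  have r: "ops.rsub (ops.rspan S)" by(rule ops.rsub_rspan[OF S(2)])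
  have "A <= ops.rspan S"
   unfolding S(3) by(rule ops.kspan_minimal[OF ops.rsub_ksub[OF r] ops.rspan_superset])
  hence "ops.rspan A <= ops.rspan S" by(rule ops.rspan_minimal[OF r])
  hence "ops.rspan S = car M" using A ops.ksubD(1)[OF ops.rsub_ksub[OF r]] by auto
  thus "finitely_generated ?P M'" unfolding finitely_generated_def gen same(1) using S by blast
 qed
qed

text \<open>In an L(E)-module the injectivity half of the Blanchfield condition always holds by
  \<open>arrow_sum_zeroD\<close>, and the surjectivity half says that the sinks kill the
  module.\<close>

lemma fg_blanchfield_restrict_iff:
 "fg_blanchfield E (restrict_scalars (real_embed E) M) <-> sink_free & (EX A. ops.lattice A)"
proof -
 let ?M = "restrict_scalars (real_embed E) M :: (('v,'e,'k) path_elem,'m) module"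
 note re = real_embed_hom[where 'k = 'k]
 have fs: "(\<Oplus>_{?M}e\<in>arcs E. f e) = (\<Oplus>_{M}e\<in>arcs E. f e)" for f by(rule finsum_same) simp_all
 have ar: "(\<Oplus>_{M}e\<in>arcs E. real_embed E (path_arr E e :: ('v,'e,'k) path_elem) \<odot>_{M} m e) = (\<Oplus>_{M}e\<in>arcs E. arM e (m e))"
  if "ALL e:arcs E. m e : car M" for m by(rule M.add.finprod_cong') (use that re(4) in auto)
 have lm: "left_module (PA) ?M" by(rule restrict_scalars_module[OF left_module_axioms ring_PA re(1)])
 have "blanchfield E ?M <-> sink_free"
 proof
  assume "blanchfield E ?M"
  hence "ALL x:car M. EX m. (ALL e:arcs E. m e : car M)
    & x = (\<Oplus>_{M}e\<in>arcs E. real_embed E (path_arr E e :: ('v,'e,'k) path_elem) \<odot>_{M} m e)"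
   unfolding blanchfield_iff fs by simp
  hence "EX m. (ALL e:arcs E. m e : car M) & x = (\<Oplus>_{M}e\<in>arcs E. arM e (m e))" if "x : car M" for x
   using that ar by(elim ballE[of _ _ x] exE conjE) auto
  thus sink_free by(rule sink_free_if_generated)
 next
  assume sf: sink_free
  show "blanchfield E ?M" unfolding blanchfield_iff fs restrict_scalars_simps
  proof (intro conjI lm ballI allI impI)
   show "EX m. (ALL e:arcs E. m e : car M) & x = (\<Oplus>_{M}e\<in>arcs E. real_embed E (path_arr E e :: ('v,'e,'k) path_elem) \<odot>_{M} m e)"
    if "x : car M" for x using generated_if_sink_free[OF sf that] ar by(elim exE conjE) auto
   show "real_embed E (path_vtx (head E e) :: ('v,'e,'k) path_elem) \<odot>_{M} m e = \<zero>_{M}"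
    if "(ALL e:arcs E. m e : car M) & (\<Oplus>_{M}e\<in>arcs E. real_embed E (path_arr E e :: ('v,'e,'k) path_elem) \<odot>_{M} m e) = \<zero>_{M}"
     "e : arcs E" for m e using arrow_sum_zeroD[of m e] that ar[of m] re(3)[of "head E e"] by simp
  qed
 qed
 thus ?thesis unfolding fg_blanchfield_def by(subst real_submodule_generated(2)) simp_all
qed

end

section \<open>Lattices in a finitely generated Blanchfield module\<close>

locale fg_blanchfield_module = fin_digraph E
 for E :: "('v,'e) pre_digraph" and M' :: "(('v,'e,'k::field) path_elem, 'm) module" +
 assumes fg_blanchfield: "fg_blanchfield E M'"
begin

abbreviation "LM == leavitt_module E M'"

lemma blanchfield: "blanchfield E M'" using fg_blanchfield by(simp add: fg_blanchfield_def)

lemmas LM = leavitt_module_exists[OF blanchfield]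

sublocale LM: lpa_module E LM by(intro lpa_module.intro fin_digraph_axioms LM(1))

lemma ghost_module_simps [simp]:
 "car (ghost_module E M') = car LM" "x \<oplus>_{ghost_module E M'} y = x \<oplus>_{LM} y" "\<zero>_{ghost_module E M'} = \<zero>_{LM}"
 "a \<odot>_{ghost_module E M'} x = gemb a \<odot>_{LM} x" by(simp_all add: ghost_module_def)

lemma sink_free: "LM.sink_free"
proof (rule LM.sink_free_if_generated)
 note re = real_embed_hom[where 'k = 'k]
 fix x assume "x : car LM"
 then obtain m where m: "ALL e:arcs E. m e : car M'" "x = (\<Oplus>_{M'}e\<in>arcs E. path_arr E e \<odot>_{M'} m e)"
  using blanchfield unfolding blanchfield_iff LM(2) by blast
 have "(\<Oplus>_{M'}e\<in>arcs E. path_arr E e \<odot>_{M'} m e) = (\<Oplus>_{LM}e\<in>arcs E. path_arr E e \<odot>_{M'} m e)"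
  by(rule finsum_same) (simp_all add: LM(2,3,4))
 also have "... = (\<Oplus>_{LM}e\<in>arcs E. LM.arM e (m e))"
 proof (rule LM.M.add.finprod_cong')
  fix e assume e: "e : arcs E"
  show "path_arr E e \<odot>_{M'} m e = LM.arM e (m e)"
   using LM(5)[OF path_gens_closed(3)[OF e], of "m e"] re(4)[OF e] m(1) e by simp
 qed (use m(1) in "auto simp flip: LM(2)")
 finally show "EX m. (ALL e:arcs E. m e : car LM) & x = (\<Oplus>_{LM}e\<in>arcs E. LM.arM e (m e))"
  using m LM(2) by auto
qed

lemma ghost_submodule_iff: "ghost_submodule E M' A <-> LM.ops.gsub A"
 by(rule LM.submodule_iff_gsub) simp_all

lemmas real_generated = LM.real_submodule_generated[OF LM(2)[symmetric] LM(4)[symmetric] LM(3)[symmetric]]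

lemma lattice_in_iff: "lattice_in E M' A <-> LM.ops.lattice A"
proof -
 have "submodule_generated (PA) M' A = LM.ops.rspan A"
  by(rule real_generated(1)) (simp add: LM(2,5))
 thus ?thesis unfolding lattice_in_def ghost_submodule_iff LM.ops.lattice_def finite_dimensional_def
  using LM.finite_dimensional_iff[OF LM.ops.gsub_ksub] LM(2) by auto
qed

lemma natural_map_is_iso_iff: assumes "LM.ops.gsub A"
 shows "natural_map_is_iso E M' A <-> LM.ops.rspan A = car LM"
proof -
 let ?P = "PG :: ('v,'e,'k) path_elem ring"
 interpret I: fin_digraph Gi by(rule inverse_fin)
 have lift: "tensor_lift (add_monoid M') b = tensor_lift (add_monoid LM) b" for b :: "('v,'e,'k) leavitt_elem => 'm => 'm"
  by(rule tensor_lift_cong) (simp_all add: LM(2,3,4) fun_eq_iff)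
 have iso: "iso T (add_monoid M') = iso T (add_monoid LM)" for T :: "((('v,'e,'k) leavitt_elem \<times> 'm) \<Rightarrow>\<^sub>0 int) set monoid"
  by(simp add: iso_def hom_def LM(2,4))
 have "left_module ?P (ghost_module E M')"
  unfolding ghost_module_def by(rule restrict_scalars_module[OF LM(1) I.ring_PA ghost_embed_hom(1)])
 hence "left_module ?P ((ghost_module E M')(|carrier := A|))"
  by(rule left_module.left_module_submodule) (use assms ghost_submodule_iff in blast)
 thus ?thesis unfolding natural_map_is_iso_def natural_map_def lift iso
  by(intro LM.natural_map_iso_iff[OF assms]) simp_all
qed

end

theorem proposition7p2:
 fixes E :: "('v, 'e) pre_digraph"
 assumes "fin_digraph E"
 shows
  "(\<forall>M :: (('v, 'e, 'k::field) leavitt_elem, 'm) module. left_module (leavitt_algebra E) M \<longrightarrow>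
    (fg_blanchfield E (restrict_scalars (real_embed E) M) \<longleftrightarrow>
     finitely_presented (leavitt_algebra E) M \<and> finite_length (leavitt_algebra E) M
     \<and> (\<forall>N. submodule N (leavitt_algebra E) M
          \<and> projective (leavitt_algebra E) (M\<lparr>carrier := N\<rparr>) \<longrightarrow> N = {\<zero>\<^bsub>M\<^esub>})))
  \<and> (\<forall>M :: (('v, 'e) path \<Rightarrow>\<^sub>0 'k, 'm) module. fg_blanchfield E M \<longrightarrow>
    (\<exists>A. lattice_in E M A)
    \<and> (\<forall>A. ghost_submodule E M A \<longrightarrow>
      (lattice_in E M A \<longleftrightarrow> finite_dimensional E M A \<and> natural_map_is_iso E M A))
    \<and> (\<forall>A N. lattice_in E M A \<and> ghost_submodule E M N \<and> N \<subseteq> A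
      \<and> projective (path_algebra (inverse_quiver E) :: (('v, 'e) path \<Rightarrow>\<^sub>0 'k) ring)
        ((ghost_module E M)\<lparr>carrier := N\<rparr>) \<longrightarrow> N = {\<zero>\<^bsub>M\<^esub>}))
  \<and> (\<forall>M :: (('v, 'e) path \<Rightarrow>\<^sub>0 'k, 'm) module. fg_blanchfield E M \<longrightarrow>
    (\<exists>A. lattice_in E M A \<and> (\<forall>B. lattice_in E M B \<longrightarrow> A \<subseteq> B)))"
proof (intro conjI allI impI)
 interpret fin_digraph E by fact
 show "fg_blanchfield E (restrict_scalars (real_embed E) M) \<longleftrightarrow>
     finitely_presented (leavitt_algebra E) M & finite_length (leavitt_algebra E) M
     & (ALL N. submodule N (leavitt_algebra E) M
          & projective (leavitt_algebra E) (M(|carrier := N|)) --> N = {\<zero>\<^bsub>M\<^esub>})"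
  if "left_module (leavitt_algebra E) M" for M :: "(('v, 'e, 'k) leavitt_elem, 'm) module"
 proof -
  interpret lpa_module E M using that by(intro lpa_module.intro fin_digraph_axioms)
  \<comment> \<open>Both sides say that the sinks kill the module and that it has a lattice.\<close>
  show ?thesis unfolding fg_blanchfield_restrict_iff finitely_presented_no_projective_iff ..
 qed
 fix M :: "(('v, 'e) path \<Rightarrow>\<^sub>0 'k, 'm) module"
 assume "fg_blanchfield E M"
 then interpret B: fg_blanchfield_module E M by unfold_locales
 have "finitely_generated (path_algebra E) M" using B.fg_blanchfield by(simp add: fg_blanchfield_def)
 hence ex: "EX A. B.LM.ops.lattice A" by(subst (asm) B.real_generated(2)) (simp_all add: B.LM(2,5))
 thus "EX A. lattice_in E M A" unfolding B.lattice_in_iff .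
 show "EX A. lattice_in E M A & (ALL B. lattice_in E M B --> A <= B)"
  unfolding B.lattice_in_iff using ex B.LM.ops.smallest_lattice by blast
 show "lattice_in E M A \<longleftrightarrow> finite_dimensional E M A & natural_map_is_iso E M A" if "ghost_submodule E M A" for A
 proof -
  have A: "B.LM.ops.gsub A" using that B.ghost_submodule_iff by blast
  show ?thesis
   unfolding B.lattice_in_iff B.LM.ops.lattice_def finite_dimensional_def B.natural_map_is_iso_iff[OF A]
    B.LM.finite_dimensional_iff[OF B.LM.ops.gsub_ksub[OF A]] using A by blast
 qed
 fix A N assume h: "lattice_in E M A & ghost_submodule E M N & N <= A
  & projective (path_algebra (inverse_quiver E) :: (('v, 'e) path \<Rightarrow>\<^sub>0 'k) ring) ((ghost_module E M)(|carrier := N|))"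
 hence hs: "B.LM.ops.lattice A" "B.LM.ops.gsub N" "N <= A"
  using B.lattice_in_iff B.ghost_submodule_iff by blast+
 have "N = {\<zero>\<^bsub>B.LM\<^esub>}"
  by(rule B.LM.no_projective_ghost_submodule[OF hs(1) B.sink_free hs(3,2), of "(ghost_module E M)(|carrier := N|)"])
   (use h in simp_all)
 thus "N = {\<zero>\<^bsub>M\<^esub>}" by(simp add: B.LM(3))
qed

end
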